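(* Let $q\in[1,\infty)$ and $r\in(0,1)$. Let $u\in B^r_{q,\infty}(\mathbb{R}^N,\mathbb{R}^d)$, let $E\subset\mathbb{R}^N$ be an $\mathcal{L}^N$-measurable set and let $\eta\in W^{1,1}(\mathbb{R}^N)$. For each $\varepsilon\in(0,\infty)$ put $u_\varepsilon(x):=\int_{\mathbb{R}^N}\eta(z)u(x-\varepsilon z)\,dz$. Then $$\left|\int_{\mathbb{R}^N}\eta(z)dz\right|^q\liminf_{\varepsilon\to 0^+}\int_{S^{N-1}}\int_E\chi_{E}(x+\varepsilon n)\frac{|u(x+\varepsilon n)-u(x)|^q}{\varepsilon^{rq}}\,dx\,d\mathcal{H}^{N-1}(n)\leq\liminf_{\varepsilon\to 0^+}\frac{1}{|\ln\varepsilon|}\left[u_\varepsilon\right]^q_{W^{r,q}(E,\mathbb{R}^d)}$$ $$\leq\limsup_{\varepsilon\to 0^+}\frac{1}{|\ln\varepsilon|}\left[u_\varepsilon\right]^q_{W^{r,q}(E,\mathbb{R}^d)}\leq\left|\int_{\mathbb{R}^N}\eta(z)dz\right|^q\limsup_{\varepsilon\to 0^+}\int_{S^{N-1}}\int_E\chi_{E}(x+\varepsilon n)\frac{|u(x+\varepsilon n)-u(x)|^q}{\varepsilon^{rq}}\,dx\,d\mathcal{H}^{N-1}(n).$$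
   Context: $N,d$ are natural numbers ($\geq1$). $\mathcal{L}^N$ is Lebesgue measure on $\mathbb{R}^N$, $\mathcal{H}^{N-1}$ is $(N-1)$-dimensional Hausdorff measure, $S^{N-1}$ is the unit sphere in $\mathbb{R}^N$, $\chi_E$ is the characteristic function of $E$. For $1\leq q<\infty$, $r\in(0,1)$, the Besov space is $$B^r_{q,\infty}(\mathbb{R}^N,\mathbb{R}^d):=\Big\{u\in L^q(\mathbb{R}^N,\mathbb{R}^d):\sup_{h\in\mathbb{R}^N\setminus\{0\}}\int_{\mathbb{R}^N}\frac{|u(x+h)-u(x)|^q}{|h|^{rq}}dx<\infty\Big\}.$$ The Gagliardo seminorm on a measurable set $E\subset\mathbb{R}^N$ is $\left[u\right]_{W^{r,q}(E,\mathbb{R}^d)}:=\left(\int_{E}\int_{E}\frac{|u(x)-u(y)|^q}{|x-y|^{N+rq}}dx\,dy\right)^{1/q}$. $W^{1,1}(\mathbb{R}^N)$ is the usual Sobolev space of real-valued functions. *)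

theory Defs
  imports "HOL-Analysis.Analysis"
begin

section \<open>Hausdorff measure\<close>

text \<open>
  Contribution of one covering set to the \<open>k\<close>-dimensional Hausdorff measure.  The constant
  is the volume of the \<open>k\<close>-dimensional unit ball, i.e. the normalisation for which
  \<open>k\<close>-dimensional Hausdorff measure on \<open>k\<close>-space is Lebesgue measure.
  As \<open>0 ^ 0 = 1\<close>, for \<open>k = 0\<close> every nonempty set contributes \<open>1\<close>
  (so the \<open>0\<close>-dimensional measure is counting measure); the empty set contributes \<open>0\<close>.
\<close>

definition hausdorff_weight :: "nat \<Rightarrow> 'a::metric_space set \<Rightarrow> ennreal" where
  "hausdorff_weight k C =
     (if C = {} then 0 else ennreal (unit_ball_vol (real k) * (diameter C / 2) ^ k))"

text \<open>Boundedness is required because \<^const>\<open>diameter\<close> is meaningful for bounded sets only.\<close>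

definition hausdorff_covers :: "real \<Rightarrow> 'a::metric_space set \<Rightarrow> (nat \<Rightarrow> 'a set) set" where
  "hausdorff_covers \<delta> A =
     {C. A \<subseteq> (\<Union>i. C i) \<and> (\<forall>i. bounded (C i) \<and> diameter (C i) \<le> \<delta>)}"

definition hausdorff_content :: "nat \<Rightarrow> real \<Rightarrow> 'a::metric_space set \<Rightarrow> ennreal" where
  "hausdorff_content k \<delta> A = (INF C\<in>hausdorff_covers \<delta> A. \<Sum>i. hausdorff_weight k (C i))"

definition hausdorff_outer :: "nat \<Rightarrow> 'a::metric_space set \<Rightarrow> ennreal" where
  "hausdorff_outer k A = (SUP \<delta>\<in>{0<..}. hausdorff_content k \<delta> A)"

text \<open>The measure lives on the sets that are measurable in the sense of Caratheodory.\<close>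

definition hausdorff_measure :: "nat \<Rightarrow> 'a::metric_space measure" where
  "hausdorff_measure k =
     measure_of UNIV (lambda_system UNIV UNIV (hausdorff_outer k)) (hausdorff_outer k)"

lemma hausdorff_covers_mono: "A \<subseteq> B \<Longrightarrow> hausdorff_covers \<delta> B \<subseteq> hausdorff_covers \<delta> A"
  by (auto simp: hausdorff_covers_def)

lemma hausdorff_content_mono: "A \<subseteq> B \<Longrightarrow> hausdorff_content k \<delta> A \<le> hausdorff_content k \<delta> B"
  unfolding hausdorff_content_def by (intro INF_superset_mono hausdorff_covers_mono order_refl)

lemma hausdorff_content_empty:
  assumes "\<delta> > 0" shows "hausdorff_content k \<delta> ({}::'a::metric_space set) = 0"
proof -
  have "(\<lambda>_. {}) \<in> hausdorff_covers \<delta> ({}::'a set)"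
    using assms by (simp add: hausdorff_covers_def diameter_def)
  then have "hausdorff_content k \<delta> ({}::'a set) \<le> (\<Sum>i::nat. hausdorff_weight k ({}::'a set))"
    unfolding hausdorff_content_def by (rule INF_lower2) simp
  then show ?thesis by (simp add: hausdorff_weight_def)
qed

lemma hausdorff_content_subadditive:
  fixes A :: "nat \<Rightarrow> 'a::metric_space set"
  shows "hausdorff_content k \<delta> (\<Union>i. A i) \<le> (\<Sum>i. hausdorff_content k \<delta> (A i))"
proof (cases "(\<Sum>i. hausdorff_content k \<delta> (A i)) = top")
  case False
  show ?thesis
  proof (rule ennreal_le_epsilon)
    fix e :: real assume e: "0 < e"
    have fin: "hausdorff_content k \<delta> (A i) < top" for i
      using False ennreal_suminf_lessD less_top by blast
    have "\<exists>C\<in>hausdorff_covers \<delta> (A i). (\<Sum>j. hausdorff_weight k (C j))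
              < hausdorff_content k \<delta> (A i) + ennreal (e * (1/2) ^ Suc i)" for i
    proof -
      have "hausdorff_content k \<delta> (A i) < hausdorff_content k \<delta> (A i) + ennreal (e * (1/2) ^ Suc i)"
        using fin[of i] e by (simp add: ennreal_add_left_cancel_less[where b = 0, simplified] less_top)
      then show ?thesis
        by (subst (asm) (1) hausdorff_content_def) (simp add: INF_less_iff)
    qed
    then obtain C where C: "\<And>i. C i \<in> hausdorff_covers \<delta> (A i)"
      and le: "\<And>i. (\<Sum>j. hausdorff_weight k (C i j))
              < hausdorff_content k \<delta> (A i) + ennreal (e * (1/2) ^ Suc i)"
      by metis
    define D where "D n = (case prod_decode n of (i, j) \<Rightarrow> C i j)" for n
    have "D \<in> hausdorff_covers \<delta> (\<Union>i. A i)"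
    proof -
      have "x \<in> (\<Union>n. D n)" if "x \<in> A i" for x i
      proof -
        from that C[of i] obtain j where "x \<in> C i j" by (auto simp: hausdorff_covers_def)
        then have "x \<in> D (prod_encode (i, j))" by (simp add: D_def)
        then show ?thesis by blast
      qed
      moreover have "bounded (D n) \<and> diameter (D n) \<le> \<delta>" for n
        using C by (auto simp: D_def hausdorff_covers_def split: prod.split)
      ultimately show ?thesis unfolding hausdorff_covers_def by blast
    qed
    then have "hausdorff_content k \<delta> (\<Union>i. A i) \<le> (\<Sum>n. hausdorff_weight k (D n))"
      unfolding hausdorff_content_def by (rule INF_lower)
    also have "\<dots> = (\<Sum>i. \<Sum>j. hausdorff_weight k (C i j))"
      using suminf_ennreal_2dimen[of "\<lambda>i. \<Sum>j. hausdorff_weight k (C i j)"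
          "\<lambda>(i, j). hausdorff_weight k (C i j)"]
      by (simp add: D_def comp_def case_prod_beta)
    also have "\<dots> \<le> (\<Sum>i. hausdorff_content k \<delta> (A i) + ennreal (e * (1/2) ^ Suc i))"
      by (intro suminf_le less_imp_le[OF le]) auto
    also have "\<dots> = (\<Sum>i. hausdorff_content k \<delta> (A i)) + (\<Sum>i. ennreal (e * (1/2) ^ Suc i))"
      by (intro suminf_add[symmetric]) auto
    also have "(\<Sum>i. ennreal (e * (1/2) ^ Suc i)) = ennreal e"
      using sums_mult[OF power_half_series, of e] e
      by (intro suminf_ennreal_eq) auto
    finally show "hausdorff_content k \<delta> (\<Union>i. A i)
        \<le> (\<Sum>i. hausdorff_content k \<delta> (A i)) + ennreal e" .
  qed
qed simp

lemma outer_measure_space_hausdorff: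
  "outer_measure_space UNIV (hausdorff_outer k :: 'a::metric_space set \<Rightarrow> ennreal)"
  unfolding outer_measure_space_def
proof (intro conjI)
  show "positive UNIV (hausdorff_outer k :: 'a set \<Rightarrow> ennreal)"
    by (auto simp: positive_def hausdorff_outer_def hausdorff_content_empty
        intro!: antisym SUP_least)
  show "increasing UNIV (hausdorff_outer k :: 'a set \<Rightarrow> ennreal)"
    unfolding increasing_def hausdorff_outer_def
    by (auto intro!: SUP_mono' hausdorff_content_mono)
  show "countably_subadditive UNIV (hausdorff_outer k :: 'a set \<Rightarrow> ennreal)"
    unfolding countably_subadditive_def
  proof (intro allI impI)
    fix A :: "nat \<Rightarrow> 'a set"
    show "hausdorff_outer k (\<Union>i. A i) \<le> (\<Sum>i. hausdorff_outer k (A i))"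
      unfolding hausdorff_outer_def[of k "\<Union>i. A i"]
    proof (rule SUP_least)
      fix \<delta> :: real assume d: "\<delta> \<in> {0<..}"
      have "hausdorff_content k \<delta> (\<Union>i. A i) \<le> (\<Sum>i. hausdorff_content k \<delta> (A i))"
        by (rule hausdorff_content_subadditive)
      also have "\<dots> \<le> (\<Sum>i. hausdorff_outer k (A i))"
        by (intro suminf_le) (auto simp: hausdorff_outer_def intro!: SUP_upper d)
      finally show "hausdorff_content k \<delta> (\<Union>i. A i) \<le> (\<Sum>i. hausdorff_outer k (A i))" .
    qed
  qed
qed

lemma measure_space_hausdorff:
  "measure_space UNIV (lambda_system UNIV UNIV (hausdorff_outer k))
     (hausdorff_outer k :: 'a::metric_space set \<Rightarrow> ennreal)"
proof -
  interpret sigma_algebra UNIV "UNIV :: 'a set set"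
    using sigma_algebra_Pow[of UNIV] by simp
  show ?thesis
    using outer_measure_space_hausdorff by (rule caratheodory_lemma)
qed

lemma space_hausdorff_measure [simp]: "space (hausdorff_measure k) = UNIV"
  by (simp add: hausdorff_measure_def)

lemma sets_hausdorff_measure:
  "sets (hausdorff_measure k :: 'a::metric_space measure)
     = lambda_system UNIV UNIV (hausdorff_outer k)"
  unfolding hausdorff_measure_def
  using measure_space_hausdorff[of k, where 'a = 'a]
  by (intro sigma_algebra.sets_measure_of_eq) (simp add: measure_space_def)

lemma emeasure_hausdorff_measure:
  fixes A :: "'a::metric_space set"
  assumes "A \<in> sets (hausdorff_measure k)"
  shows "emeasure (hausdorff_measure k) A = hausdorff_outer k A"
proof -
  have "measure_space UNIV (lambda_system UNIV UNIV (hausdorff_outer k))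
      (hausdorff_outer k :: 'a set \<Rightarrow> ennreal)"
    by (rule measure_space_hausdorff)
  then show ?thesis
    using assms unfolding sets_hausdorff_measure unfolding hausdorff_measure_def measure_space_def
    by (intro emeasure_measure_of_sigma) auto
qed


section \<open>Function spaces\<close>

text \<open>
  Elements of function spaces are represented by everywhere defined, Lebesgue measurable
  functions; all conditions are invariant under changes on null sets.
\<close>

definition Lq_space :: "real \<Rightarrow> ('a::euclidean_space \<Rightarrow> 'b::euclidean_space) set" where
  "Lq_space q = {u \<in> borel_measurable lebesgue.
      (\<integral>\<^sup>+x. ennreal (norm (u x) powr q) \<partial>lebesgue) < \<infinity>}"

definition besov_inf_space :: "real \<Rightarrow> real \<Rightarrow> ('a::euclidean_space \<Rightarrow> 'b::euclidean_space) set" where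
  "besov_inf_space r q = {u \<in> Lq_space q.
      (SUP h\<in>UNIV - {0}.
         \<integral>\<^sup>+x. ennreal (norm (u (x + h) - u x) powr q / norm h powr (r * q)) \<partial>lebesgue) < \<infinity>}"

primrec C_k :: "nat \<Rightarrow> ('a::euclidean_space \<Rightarrow> real) \<Rightarrow> bool" where
  "C_k 0 f \<longleftrightarrow> continuous_on UNIV f"
| "C_k (Suc k) f \<longleftrightarrow> (\<forall>x. f differentiable (at x)) \<and>
      (\<forall>v. C_k k (\<lambda>x. frechet_derivative f (at x) v))"

definition test_function :: "('a::euclidean_space \<Rightarrow> real) \<Rightarrow> bool" where
  "test_function \<phi> \<longleftrightarrow> (\<forall>k. C_k k \<phi>) \<and> compact (closure {x. \<phi> x \<noteq> 0})"

definition weak_gradient :: "('a::euclidean_space \<Rightarrow> real) \<Rightarrow> ('a \<Rightarrow> 'a) \<Rightarrow> bool" where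
  "weak_gradient f g \<longleftrightarrow> (\<forall>\<phi>. test_function \<phi> \<longrightarrow> (\<forall>i\<in>Basis.
      (LINT x|lebesgue. f x * frechet_derivative \<phi> (at x) i)
        = - (LINT x|lebesgue. (g x \<bullet> i) * \<phi> x)))"

definition W11_space :: "('a::euclidean_space \<Rightarrow> real) set" where
  "W11_space = {f. integrable lebesgue f \<and> (\<exists>g. integrable lebesgue g \<and> weak_gradient f g)}"


section \<open>Gagliardo seminorm and mollification\<close>

text \<open>Powers of extended nonnegative reals with a positive real exponent.\<close>

definition ennreal_powr :: "ennreal \<Rightarrow> real \<Rightarrow> ennreal" where
  "ennreal_powr a p = (if a = \<infinity> then \<infinity> else ennreal (enn2real a powr p))"

definition gagliardo_seminorm ::
    "real \<Rightarrow> real \<Rightarrow> 'a::euclidean_space set \<Rightarrow> ('a \<Rightarrow> 'b::euclidean_space) \<Rightarrow> ennreal" where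
  "gagliardo_seminorm r q E u = ennreal_powr
     (\<integral>\<^sup>+y\<in>E. (\<integral>\<^sup>+x\<in>E. ennreal (norm (u x - u y) powr q /
          norm (x - y) powr (real DIM('a) + r * q)) \<partial>lebesgue) \<partial>lebesgue) (1 / q)"

text \<open>
  For integrable \<open>\<eta>\<close> and \<open>u\<close> in some \<open>L\<^sup>q\<close> the integral exists for almost
  every \<open>x\<close>; on the exceptional null set the Bochner integral has the value \<open>0\<close>.
\<close>

definition mollify ::
    "('a::euclidean_space \<Rightarrow> real) \<Rightarrow> ('a \<Rightarrow> 'b::euclidean_space) \<Rightarrow> real \<Rightarrow> 'a \<Rightarrow> 'b" where
  "mollify \<eta> u \<epsilon> x = (LINT z|lebesgue. \<eta> z *\<^sub>R u (x - \<epsilon> *\<^sub>R z))"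

definition sphere_difference ::
    "real \<Rightarrow> real \<Rightarrow> 'a::euclidean_space set \<Rightarrow> ('a \<Rightarrow> 'b::euclidean_space) \<Rightarrow> real \<Rightarrow> ennreal" where
  "sphere_difference r q E u \<epsilon> =
     (\<integral>\<^sup>+n\<in>sphere 0 1.
        (\<integral>\<^sup>+x\<in>E. indicator E (x + \<epsilon> *\<^sub>R n) *
            ennreal (norm (u (x + \<epsilon> *\<^sub>R n) - u x) powr q / \<epsilon> powr (r * q)) \<partial>lebesgue)
        \<partial>hausdorff_measure (DIM('a) - 1))"

end

theory Submission
  imports Defs
begin

text \<open>
  Polar coordinates turn the Gagliardo energy into the integral over \<open>\<rho> > 0\<close> of \<open>1 / \<rho>\<close> times the
  sphere difference at scale \<open>\<rho>\<close>.  For \<open>u\<^sub>\<epsilon>\<close> the scales \<open>\<rho> > 1\<close> contribute \<open>O(1)\<close>.  For compactly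
  supported \<open>\<eta>\<close> so do the scales \<open>\<rho> \<le> \<epsilon>\<close>, as translations of \<open>\<eta>\<close> are Lipschitz in \<open>L\<^sup>1\<close>, and on
  \<open>\<epsilon> < \<rho> \<le> 1\<close> the difference of \<open>u\<^sub>\<epsilon>\<close> and \<open>(\<integral>\<eta>) u\<close> is of order \<open>\<epsilon>\<^sup>r\<close> in \<open>L\<^sup>q\<close>, hence again
  contributes \<open>O(1)\<close>.  What remains is \<open>|\<integral>\<eta>|\<^sup>q\<close> times a logarithmic average of the sphere differences
  of \<open>u\<close>.  A general \<open>\<eta>\<close> is cut off; a kernel with small \<open>L\<^sup>1\<close> norm \<open>F\<close> contributes at most
  \<open>C F\<^sup>q |ln \<epsilon>| + O(1)\<close>, where the scales below \<open>\<epsilon>\<close> to the power \<open>1 / (1 - r)\<close> are handled by the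
  Lipschitz bound.

  The normalised Hausdorff measure enters through its equality with the cone measure on the sphere:
  the lower bound is the isodiametric inequality applied in tangent hyperplanes, the upper bound
  a Vitali covering by caps.
\<close>

section \<open>Metric outer measures\<close>

text \<open>The two outer bounds carry the same constant, so no step may lose a factor: the
  Hausdorff measure must be identified exactly, and \<open>q\<close>-th powers of sums are split
  with leading coefficient \<open>1 + d\<close>. The obstacle is that \<open>u\<close> is only Besov
  regular: its own Gagliardo energy may diverge logarithmically, so a remainder kernel cannot be
  discarded but only be made small relative to the logarithm. By the Lipschitz bound the increments
  of the mollified function are of order \<open>norm h / \<epsilon>\<close> in the
  \<open>q\<close>-th mean; against the Gagliardo weight, the range \<open>norm h \<le> a\<close>
  contributes \<open>\<epsilon> powr (- q) * a powr (q * (1 - r))\<close>, which is bounded for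
  \<open>a = \<epsilon> powr (1 / (1 - r))\<close>: this is the origin of the exponent. For a
  compactly supported kernel the difference of two translates has integral zero and bounded support,
  so \<open>u\<close> may be replaced by increments of size \<open>\<epsilon> powr r\<close>; this
  raises the admissible scale to \<open>\<epsilon>\<close>. Finally, any fixed range of scales has
  bounded mass under \<open>1 / \<rho>\<close>, so only the lower and upper limits at 0 survive the
  logarithmic average.\<close>

lemma metric_outer_measure_closed:
  fixes \<mu> :: "'a::metric_space set \<Rightarrow> ennreal"
  assumes om: "outer_measure_space UNIV \<mu>"
    and add: "\<And>A B d. 0 < d \<Longrightarrow> (\<And>a b. a \<in> A \<Longrightarrow> b \<in> B \<Longrightarrow> d \<le> dist a b) \<Longrightarrow> \<mu> A + \<mu> B \<le> \<mu> (A \<union> B)"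
    and F: "closed F"
  shows "F \<in> lambda_system UNIV UNIV \<mu>"
proof -
  have mono: "\<mu> A \<le> \<mu> B" if "A \<subseteq> B" for A B
    using om that by (auto simp: outer_measure_space_def increasing_def)
  \<comment> \<open>\<open>countably_subadditive\<close> speaks of disjoint families only, hence the
    detour through \<open>disjointed\<close>.\<close>
  have csub: "\<mu> (\<Union>i. A i) \<le> (\<Sum>i. \<mu> (A i))" for A :: "nat \<Rightarrow> 'a set"
  proof -
    have "\<mu> (\<Union>i. disjointed A i) \<le> (\<Sum>i. \<mu> (disjointed A i))"
      using om disjoint_family_disjointed[of A]
      unfolding outer_measure_space_def countably_subadditive_def by blast
    also have "\<dots> \<le> (\<Sum>i. \<mu> (A i))"
      by (intro suminf_le mono disjointed_subset) auto
    finally show ?thesis by (simp add: UN_disjointed_eq)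
  qed
  have mu0: "\<mu> {} = 0"
    using om by (auto simp: outer_measure_space_def positive_def)
  have sub2: "\<mu> (A \<union> B) \<le> \<mu> A + \<mu> B" for A B
  proof -
    have "\<mu> (A \<union> B) = \<mu> (\<Union>i. (if i = 0 then A else if i = Suc 0 then B else {}))"
      by (rule arg_cong[where f = \<mu>]) (auto split: if_splits)
    also have "\<dots> \<le> (\<Sum>i. \<mu> (if i = 0 then A else if i = Suc 0 then B else {}))"
      by (rule csub)
    also have "\<dots> = (\<Sum>i\<in>{0,Suc 0}. \<mu> (if i = 0 then A else if i = Suc 0 then B else {}))"
      by (rule suminf_finite) (auto simp: mu0)
    finally show ?thesis by simp
  qed
  \<comment> \<open>The nontrivial half of the Caratheodory condition. \<open>A - F\<close> is
    exhausted by the sets \<open>S n\<close>, which have positive distance from \<open>F\<close>, so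
    that additivity applies to \<open>A \<inter> F\<close> and \<open>S n\<close>; what is lost lies
    in the shells \<open>R m\<close> with \<open>m \<ge> n\<close>, and their measures form a
    convergent series.\<close>
  have main: "\<mu> (A \<inter> F) + \<mu> (A - F) \<le> \<mu> A" if "F \<noteq> {}" and fin: "\<mu> A < \<infinity>" for A
  proof -
    define S where "S n = {x\<in>A. 1 / real (Suc n) \<le> infdist x F}" for n
    define R where "R n = S (Suc n) - S n" for n
    have Smono: "S m \<subseteq> S n" if "m \<le> n" for m n
    proof -
      have "1 / real (Suc n) \<le> 1 / real (Suc m)"
        using that by (intro divide_left_mono) auto
      then show ?thesis by (auto simp: S_def)
    qed
    \<comment> \<open>As \<open>F\<close> is closed, a point outside it has positive distance from
      \<open>F\<close>. If \<open>k\<close> is the first index with \<open>x \<in> S k\<close> and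
      \<open>k > n\<close>, then \<open>x\<close> lies in the shell
      \<open>R (k - 1)\<close>.\<close>
    have dec: "A - F \<subseteq> S n \<union> (\<Union>m. R (m + n))" for n
    proof
      fix x assume x: "x \<in> A - F"
      then have "infdist x F > 0"
        using F \<open>F \<noteq> {}\<close> by (metis DiffD2 in_closed_iff_infdist_zero infdist_nonneg less_eq_real_def)
      then obtain N where "1 / real (Suc N) < infdist x F"
        using nat_approx_posE by blast
      then have N: "x \<in> S N" using x by (auto simp: S_def)
      define k where "k = (LEAST k. x \<in> S k)"
      have k: "x \<in> S k" "\<And>j. j < k \<Longrightarrow> x \<notin> S j"
        unfolding k_def using N by (auto intro: LeastI dest: not_less_Least)
      show "x \<in> S n \<union> (\<Union>m. R (m + n))"
      proof (cases "k \<le> n")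
        case True then show ?thesis using k Smono by blast
      next
        case False
        then have "x \<in> R ((k - 1 - n) + n)"
          using k by (auto simp: R_def)
        then show ?thesis by blast
      qed
    qed
    \<comment> \<open>Shells that are not adjacent are separated: points of \<open>S (k - 1)\<close>
      have distance at least \<open>1 / k\<close> from \<open>F\<close>, points of
      \<open>R k\<close> less than \<open>1 / (k + 1)\<close>.\<close>
    have gap: "\<mu> P + \<mu> (R k) \<le> \<mu> (P \<union> R k)" if P: "k > 0 \<longrightarrow> P \<subseteq> S (k - 1)" "k = 0 \<longrightarrow> P = {}" for P k
    proof (cases "k = 0")
      case True then show ?thesis using P by (simp add: mu0)
    next
      case False
      show ?thesis
      proof (rule add)
        show "0 < 1 / real k - 1 / real (Suc k)" using False frac_less2[of 1 1 "real k" "real (Suc k)"] by simp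
        fix a b assume a: "a \<in> P" and b: "b \<in> R k"
        from a P False have "1 / real k \<le> infdist a F" by (auto simp: S_def)
        moreover from b have "infdist b F < 1 / real (Suc k)" by (auto simp: R_def S_def)
        moreover have "infdist a F \<le> infdist b F + dist a b"
          by (rule infdist_triangle)
        ultimately show "1 / real k - 1 / real (Suc k) \<le> dist a b" by linarith
      qed
    qed
    have RA: "R n \<subseteq> A" for n by (auto simp: R_def S_def)
    \<comment> \<open>Steps of length two leave a whole shell between consecutive members, so
      additivity applies. The offset \<open>p\<close> selects even or odd shells; adding both sums
      produces the bound \<open>2 * \<mu> A\<close>.\<close>
    have fins: "(\<Sum>m<n. \<mu> (R (2 * m + p))) \<le> \<mu> (\<Union>m<n. R (2 * m + p))" for n p
    proof (induction n)
      case 0 then show ?case by simp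
    next
      case (Suc n)
      have "(\<Sum>m<Suc n. \<mu> (R (2 * m + p))) \<le> \<mu> (\<Union>m<n. R (2 * m + p)) + \<mu> (R (2 * n + p))"
        using Suc by (simp add: add_right_mono)
      also have "\<dots> \<le> \<mu> ((\<Union>m<n. R (2 * m + p)) \<union> R (2 * n + p))"
      proof (rule gap)
        show "0 < 2 * n + p \<longrightarrow> (\<Union>m<n. R (2 * m + p)) \<subseteq> S (2 * n + p - 1)"
        proof (intro impI UN_least)
          fix m assume "m \<in> {..<n}"
          then have "Suc (2 * m + p) \<le> 2 * n + p - 1" by simp
          from Smono[OF this] show "R (2 * m + p) \<subseteq> S (2 * n + p - 1)" by (auto simp: R_def)
        qed
      qed auto
      also have "(\<Union>m<n. R (2 * m + p)) \<union> R (2 * n + p) = (\<Union>m<Suc n. R (2 * m + p))"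
        by (auto simp: less_Suc_eq)
      finally show ?case .
    qed
    have fins': "(\<Sum>m<n. \<mu> (R (2 * m + p))) \<le> \<mu> A" for n p
      using fins[of p n] mono[of "\<Union>m<n. R (2 * m + p)" A] RA by (meson UN_least order_trans)
    have "(\<Sum>m<n. \<mu> (R m)) \<le> 2 * \<mu> A" for n
    proof -
      have "(\<Sum>m<n. \<mu> (R m)) \<le> (\<Sum>m<2 * n. \<mu> (R m))"
        by (intro sum_mono2) auto
      also have "\<dots> = (\<Sum>m<n. \<mu> (R (2 * m + 0))) + (\<Sum>m<n. \<mu> (R (2 * m + 1)))"
        by (induction n) (auto simp: algebra_simps)
      also have "\<dots> \<le> \<mu> A + \<mu> A" by (intro add_mono fins')
      finally show ?thesis by (simp add: mult_2)
    qed
    then have "(\<Sum>m. \<mu> (R m)) \<le> 2 * \<mu> A"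
      by (simp add: suminf_eq_SUP SUP_least)
    also have "\<dots> < \<infinity>" using fin by (simp add: ennreal_mult_less_top)
    finally have sumfin: "(\<Sum>m. \<mu> (R m)) < \<infinity>" .
    have "(\<lambda>n. \<Sum>m. \<mu> (R (m + n))) \<longlonglongrightarrow> 0"
    proof -
      define f where "f m = enn2real (\<mu> (R m))" for m
      have Rf: "\<mu> (R m) = ennreal (f m)" for m
        using ennreal_suminf_lessD[OF sumfin, of m] by (simp add: f_def less_top)
      have "summable f"
        using sumfin unfolding Rf by (intro summable_suminf_not_top) (auto simp: f_def)
      have "(\<Sum>m. \<mu> (R (m + n))) = ennreal (\<Sum>m. f (m + n))" for n
        unfolding Rf
      proof (rule suminf_ennreal2)
        show "summable (\<lambda>m. f (m + n))"
          using \<open>summable f\<close> by (rule summable_ignore_initial_segment)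
      qed (simp add: f_def)
      moreover have "(\<lambda>n. \<Sum>m. f (m + n)) \<longlonglongrightarrow> 0"
        using \<open>summable f\<close> by (rule suminf_exist_split2)
      ultimately show ?thesis using tendsto_ennrealI[of "\<lambda>n. \<Sum>m. f (m + n)" 0] by simp
    qed
    then have "(\<lambda>n. \<mu> A + (\<Sum>m. \<mu> (R (m + n)))) \<longlonglongrightarrow> \<mu> A + 0"
      by (intro tendsto_add tendsto_const)
    moreover have "\<mu> (A \<inter> F) + \<mu> (A - F) \<le> \<mu> A + (\<Sum>m. \<mu> (R (m + n)))" for n
    proof -
      have "\<mu> (A - F) \<le> \<mu> (S n \<union> (\<Union>m. R (m + n)))" by (rule mono[OF dec])
      also have "\<dots> \<le> \<mu> (S n) + (\<Sum>m. \<mu> (R (m + n)))"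
        by (rule order_trans[OF sub2 add_left_mono[OF csub]])
      finally have 1: "\<mu> (A \<inter> F) + \<mu> (A - F) \<le> (\<mu> (A \<inter> F) + \<mu> (S n)) + (\<Sum>m. \<mu> (R (m + n)))"
        by (simp add: add_left_mono add.assoc)
      have "\<mu> (A \<inter> F) + \<mu> (S n) \<le> \<mu> (A \<inter> F \<union> S n)"
      proof (rule add)
        show "0 < 1 / real (Suc n)" by simp
        fix a b assume "a \<in> A \<inter> F" "b \<in> S n"
        then show "1 / real (Suc n) \<le> dist a b"
          using infdist_le[of a F b] by (auto simp: S_def dist_commute)
      qed
      also have "\<dots> \<le> \<mu> A" by (rule mono) (auto simp: S_def)
      finally show ?thesis using 1 by (meson add_right_mono order_trans)
    qed
    ultimately show ?thesis
      by (intro LIMSEQ_le_const[where X = "\<lambda>n. \<mu> A + (\<Sum>m. \<mu> (R (m + n)))"]) auto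
  qed
  have "\<mu> (F \<inter> A) + \<mu> ((UNIV - F) \<inter> A) = \<mu> A" for A
  proof (rule antisym)
    show "\<mu> (F \<inter> A) + \<mu> ((UNIV - F) \<inter> A) \<le> \<mu> A"
    proof (cases "F = {} \<or> \<mu> A = \<infinity>")
      case False
      then have "\<mu> (A \<inter> F) + \<mu> (A - F) \<le> \<mu> A" by (intro main) (auto simp: less_top)
      moreover have "(UNIV - F) \<inter> A = A - F" by auto
      ultimately show ?thesis by (simp add: Int_commute)
    qed (auto simp: mu0)
    show "\<mu> A \<le> \<mu> (F \<inter> A) + \<mu> ((UNIV - F) \<inter> A)"
      by (rule order_trans[OF mono sub2]) auto
  qed
  then show ?thesis by (auto simp: lambda_system_def)
qed

lemma hausdorff_content_antimono: "\<delta> \<le> \<delta>' \<Longrightarrow> hausdorff_content k \<delta>' A \<le> hausdorff_content k \<delta> A"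
  unfolding hausdorff_content_def
  by (intro INF_superset_mono) (auto simp: hausdorff_covers_def intro: order_trans)

text \<open>A covering set of diameter at most \<open>\<delta>\<close> cannot meet both parts, so
  every cover of the union splits into covers of the parts without counting a weight twice.\<close>

lemma hausdorff_content_separated:
  fixes A B :: "'a::metric_space set"
  assumes "\<And>a b. a \<in> A \<Longrightarrow> b \<in> B \<Longrightarrow> d \<le> dist a b" and d: "\<delta> < d" "0 < \<delta>"
  shows "hausdorff_content k \<delta> A + hausdorff_content k \<delta> B \<le> hausdorff_content k \<delta> (A \<union> B)"
  unfolding hausdorff_content_def[of k \<delta> "A \<union> B"]
proof (rule INF_greatest)
  fix C assume C: "C \<in> hausdorff_covers \<delta> (A \<union> B)"
  \<comment> \<open>Members that miss \<open>D\<close> are replaced by the empty set, whose weight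
    is 0 even for \<open>k = 0\<close>.\<close>
  define P where "P D i = (if C i \<inter> D = {} then {} else C i)" for D i
  have P: "P D \<in> hausdorff_covers \<delta> D" if "D \<subseteq> A \<union> B" for D
  proof -
    have "x \<in> (\<Union>i. P D i)" if x: "x \<in> D" for x
    proof -
      obtain i where "x \<in> C i" using C \<open>D \<subseteq> A \<union> B\<close> x unfolding hausdorff_covers_def by blast
      then have "x \<in> P D i" using x by (auto simp: P_def)
      then show ?thesis by blast
    qed
    moreover have "bounded (P D i) \<and> diameter (P D i) \<le> \<delta>" for i
      using C d by (simp add: hausdorff_covers_def P_def)
    ultimately show ?thesis unfolding hausdorff_covers_def by blast
  qed
  have "hausdorff_weight k (P A i) + hausdorff_weight k (P B i) \<le> hausdorff_weight k (C i)" for i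
  proof (cases "C i \<inter> A = {} \<or> C i \<inter> B = {}")
    case True then show ?thesis by (auto simp: P_def hausdorff_weight_def)
  next
    case False
    then obtain a b where ab: "a \<in> C i" "a \<in> A" "b \<in> C i" "b \<in> B" by auto
    then have "dist a b \<le> diameter (C i)"
      using C by (intro diameter_bounded_bound) (auto simp: hausdorff_covers_def)
    moreover have "diameter (C i) \<le> \<delta>" using C by (auto simp: hausdorff_covers_def)
    moreover have "d \<le> dist a b" using assms(1) ab by auto
    ultimately show ?thesis using d by auto
  qed
  then have "(\<Sum>i. hausdorff_weight k (P A i) + hausdorff_weight k (P B i)) \<le> (\<Sum>i. hausdorff_weight k (C i))"
    by (intro suminf_le) auto
  moreover have "(\<Sum>i. hausdorff_weight k (P A i) + hausdorff_weight k (P B i))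
      = (\<Sum>i. hausdorff_weight k (P A i)) + (\<Sum>i. hausdorff_weight k (P B i))"
    by (intro suminf_add[symmetric]) auto
  moreover have "hausdorff_content k \<delta> D \<le> (\<Sum>i. hausdorff_weight k (P D i))" if "D \<subseteq> A \<union> B" for D
    unfolding hausdorff_content_def by (rule INF_lower[OF P[OF that]])
  ultimately show "hausdorff_content k \<delta> A + hausdorff_content k \<delta> B \<le> (\<Sum>i. hausdorff_weight k (C i))"
    using add_mono[of "hausdorff_content k \<delta> A" "\<Sum>i. hausdorff_weight k (P A i)"
        "hausdorff_content k \<delta> B" "\<Sum>i. hausdorff_weight k (P B i)"] by simp
qed

text \<open>The content grows as \<open>\<delta>\<close> shrinks, so the supremum may be taken over
  \<open>\<delta>\<close> below the gap \<open>d\<close>, where contents of the two parts add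
  up.\<close>

lemma hausdorff_outer_separated:
  fixes A B :: "'a::metric_space set"
  assumes "0 < d" "\<And>a b. a \<in> A \<Longrightarrow> b \<in> B \<Longrightarrow> d \<le> dist a b"
  shows "hausdorff_outer k A + hausdorff_outer k B \<le> hausdorff_outer k (A \<union> B)"
proof -
  have "hausdorff_outer k A + hausdorff_outer k B
      = (SUP \<delta>\<in>{0<..}. hausdorff_content k \<delta> A + hausdorff_content k \<delta> B)"
    unfolding hausdorff_outer_def
  proof (rule SUP_add_directed_ennreal[symmetric])
    fix i j :: real assume "i \<in> {0<..}" "j \<in> {0<..}"
    then show "\<exists>l\<in>{0<..}. hausdorff_content k i A + hausdorff_content k j B
        \<le> hausdorff_content k l A + hausdorff_content k l B"
      by (intro bexI[of _ "min i j"] add_mono hausdorff_content_antimono) auto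
  qed
  also have "\<dots> \<le> hausdorff_outer k (A \<union> B)"
  proof (rule SUP_least)
    fix \<delta> :: real assume \<delta>: "\<delta> \<in> {0<..}"
    define \<delta>' where "\<delta>' = min \<delta> (d / 2)"
    have \<delta>': "0 < \<delta>'" "\<delta>' < d" "\<delta>' \<le> \<delta>" using \<delta> assms by (auto simp: \<delta>'_def)
    have "hausdorff_content k \<delta> A + hausdorff_content k \<delta> B \<le> hausdorff_content k \<delta>' A + hausdorff_content k \<delta>' B"
      by (intro add_mono hausdorff_content_antimono \<delta>')
    also have "\<dots> \<le> hausdorff_content k \<delta>' (A \<union> B)"
      using assms \<delta>' by (intro hausdorff_content_separated[where d = d]) auto
    also have "\<dots> \<le> hausdorff_outer k (A \<union> B)"
      unfolding hausdorff_outer_def using \<delta>' by (intro SUP_upper) auto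
    finally show "hausdorff_content k \<delta> A + hausdorff_content k \<delta> B \<le> hausdorff_outer k (A \<union> B)" .
  qed
  finally show ?thesis .
qed

text \<open>Caratheodory measurability of Borel sets is what makes the measure additive on Borel
  pieces of the sphere and Borel integrands on it measurable.\<close>

lemma sets_borel_subset_hausdorff_measure:
  "sets (borel :: 'a::metric_space measure) \<subseteq> sets (hausdorff_measure k)"
proof -
  have "F \<in> sets (hausdorff_measure k)" if "closed F" for F :: "'a set"
    unfolding sets_hausdorff_measure using outer_measure_space_hausdorff hausdorff_outer_separated that
    by (rule metric_outer_measure_closed)
  then have "sets (sigma UNIV (Collect closed :: 'a set set)) \<subseteq> sets (hausdorff_measure k)"
    by (subst sets_measure_of) (auto intro!: sets.sigma_sets_subset[of _ "hausdorff_measure k", simplified])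
  then show ?thesis by (simp add: borel_eq_closed)
qed

section \<open>The isodiametric inequality\<close>

lemma emeasure_lborel_real_affine_vimage:
  assumes [measurable]: "A \<in> sets borel" and "c \<noteq> 0"
  shows "emeasure lborel A = ennreal \<bar>c\<bar> * emeasure lborel {x. t + c * x \<in> A}"
proof -
  have "emeasure lborel A = (\<integral>\<^sup>+x. indicator A x \<partial>lborel)" by simp
  also have "\<dots> = ennreal \<bar>c\<bar> * (\<integral>\<^sup>+x. indicator A (t + c * x) \<partial>lborel)"
    using \<open>c \<noteq> 0\<close> by (intro nn_integral_real_affine) auto
  also have "(\<integral>\<^sup>+x. indicator A (t + c * x) \<partial>lborel) = (\<integral>\<^sup>+x. indicator {x. t + c * x \<in> A} x \<partial>lborel)"
    by (intro nn_integral_cong) (auto simp: indicator_def)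
  also have "\<dots> = emeasure lborel {x. t + c * x \<in> A}"
    by (rule nn_integral_indicator) measurable
  finally show ?thesis .
qed

text \<open>If \<open>a\<close>, \<open>b\<close> are close to the suprema of \<open>A\<close>, \<open>B\<close>, then the subsets \<open>(A - b) / 2\<close> and
  \<open>(a - B) / 2\<close> of \<open>M\<close> are nearly disjoint.\<close>

lemma half_difference_measure_bounded:
  fixes A B M :: "real set"
  assumes [measurable]: "A \<in> sets borel" "B \<in> sets borel" "M \<in> sets borel"
    and ne: "A \<noteq> {}" "B \<noteq> {}" and bdd: "bdd_above A" "bdd_above B"
    and M: "\<And>x y. x \<in> A \<Longrightarrow> y \<in> B \<Longrightarrow> (x - y) / 2 \<in> M"
  shows "emeasure lborel A + emeasure lborel B \<le> 2 * emeasure lborel M"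
proof (rule ennreal_le_epsilon)
  fix e :: real assume e: "0 < e"
  obtain a where a: "a \<in> A" "Sup A - e / 2 < a"
    using less_cSupD[OF ne(1), of "Sup A - e / 2"] e by auto
  obtain b where b: "b \<in> B" "Sup B - e / 2 < b"
    using less_cSupD[OF ne(2), of "Sup B - e / 2"] e by auto
  define P where "P = {m. b + 2 * m \<in> A}"
  define Q where "Q = {m. a + (- 2) * m \<in> B}"
  have [measurable]: "P \<in> sets borel" "Q \<in> sets borel"
    unfolding P_def Q_def by measurable
  have PM: "P \<union> Q \<subseteq> M"
  proof
    fix m assume "m \<in> P \<union> Q"
    then show "m \<in> M"
      using M[of "b + 2 * m" b] M[of a "a + (- 2) * m"] a b by (auto simp: P_def Q_def)
  qed
  \<comment> \<open>The overlap lies in an interval of length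
    \<open>((Sup A - a) + (Sup B - b)) / 2\<close>, which is below \<open>e / 2\<close> because
    \<open>a\<close> and \<open>b\<close> are within \<open>e / 2\<close> of the suprema.\<close>
  have "P \<inter> Q \<subseteq> {(a - Sup B) / 2 .. (Sup A - b) / 2}"
  proof
    fix m assume "m \<in> P \<inter> Q"
    then have "b + 2 * m \<le> Sup A" "a + (- 2) * m \<le> Sup B"
      using bdd by (auto simp: P_def Q_def intro: cSup_upper)
    then show "m \<in> {(a - Sup B) / 2 .. (Sup A - b) / 2}" by auto
  qed
  then have "emeasure lborel (P \<inter> Q) \<le> emeasure lborel {(a - Sup B) / 2 .. (Sup A - b) / 2}"
    by (intro emeasure_mono) auto
  also have "\<dots> \<le> ennreal (e / 2)"
    using a b e by (cases "(a - Sup B) / 2 \<le> (Sup A - b) / 2") (auto intro!: ennreal_leI simp: field_simps)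
  finally have PQ: "emeasure lborel (P \<inter> Q) \<le> ennreal (e / 2)" .
  have "emeasure lborel A + emeasure lborel B = 2 * (emeasure lborel P + emeasure lborel Q)"
    using emeasure_lborel_real_affine_vimage[of A 2 b] emeasure_lborel_real_affine_vimage[of B "-2" a]
    by (simp add: P_def Q_def distrib_left)
  also have "emeasure lborel P + emeasure lborel Q = emeasure lborel (P \<union> Q) + emeasure lborel (P \<inter> Q)"
    by (rule emeasure_Un_Int) auto
  also have "2 * \<dots> \<le> 2 * (emeasure lborel M + ennreal (e / 2))"
    using PM PQ by (intro mult_left_mono add_mono emeasure_mono) auto
  also have "\<dots> = 2 * emeasure lborel M + ennreal e"
    using e by (simp add: distrib_left ennreal_mult'[symmetric] flip: ennreal_numeral)
  finally show "emeasure lborel A + emeasure lborel B \<le> 2 * emeasure lborel M + ennreal e" .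
qed

text \<open>Truncation from above reduces to sets with suprema. The cut at \<open>max a n\<close>
  instead of \<open>n\<close> keeps the point \<open>a\<close> in every truncation, so that none is
  empty.\<close>

lemma half_difference_measure:
  fixes A B M :: "real set"
  assumes [measurable]: "A \<in> sets borel" "B \<in> sets borel" "M \<in> sets borel"
    and ne: "A \<noteq> {}" "B \<noteq> {}"
    and M: "\<And>x y. x \<in> A \<Longrightarrow> y \<in> B \<Longrightarrow> (x - y) / 2 \<in> M"
  shows "emeasure lborel A + emeasure lborel B \<le> 2 * emeasure lborel M"
proof -
  obtain a b where ab: "a \<in> A" "b \<in> B" using ne by auto
  define An where "An n = A \<inter> {..max a (real n)}" for n
  define Bn where "Bn n = B \<inter> {..max b (real n)}" for n
  have [measurable]: "An n \<in> sets borel" "Bn n \<in> sets borel" for n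
    by (auto simp: An_def Bn_def)
  have "emeasure lborel (An n) + emeasure lborel (Bn n) \<le> 2 * emeasure lborel M" for n
  proof (rule half_difference_measure_bounded)
    show "An n \<noteq> {}" using ab by (auto simp: An_def)
    show "Bn n \<noteq> {}" using ab by (auto simp: Bn_def)
    show "bdd_above (An n)" "bdd_above (Bn n)" by (auto simp: An_def Bn_def)
  qed (auto simp: An_def Bn_def M)
  moreover have "(\<lambda>n. emeasure lborel (An n)) \<longlonglongrightarrow> emeasure lborel (\<Union>n. An n)"
    by (rule Lim_emeasure_incseq) (auto simp: incseq_def An_def)
  moreover have "(\<lambda>n. emeasure lborel (Bn n)) \<longlonglongrightarrow> emeasure lborel (\<Union>n. Bn n)"
    by (rule Lim_emeasure_incseq) (auto simp: incseq_def Bn_def)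
  moreover have "(\<Union>n. An n) = A"
    using real_arch_simple by (fastforce simp: An_def le_max_iff_disj)
  moreover have "(\<Union>n. Bn n) = B"
    using real_arch_simple by (fastforce simp: Bn_def le_max_iff_disj)
  ultimately show ?thesis
    using tendsto_add[of "\<lambda>n. emeasure lborel (An n)" _ _ "\<lambda>n. emeasure lborel (Bn n)"]
    by (intro LIMSEQ_le_const2[of "\<lambda>n. emeasure lborel (An n) + emeasure lborel (Bn n)"]) auto
qed

section \<open>Level sets and the Prekopa-Leindler inequality\<close>

text \<open>Layer cake formula with heights measured relative to the upper bound \<open>a\<close>.
  Relative heights allow levels of functions with different suprema to be compared at the same
  parameter \<open>s\<close>.\<close>

lemma nn_integral_layers:
  fixes f :: "real \<Rightarrow> real"
  assumes [measurable]: "f \<in> borel_measurable borel"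
    and f: "\<And>x. 0 \<le> f x" "\<And>x. f x \<le> a" and a: "0 < a"
  shows "(\<integral>\<^sup>+s. indicator {0<..<1} s * emeasure lborel {x. s * a < f x} \<partial>lborel)
      = (\<integral>\<^sup>+x. ennreal (f x / a) \<partial>lborel)"
proof -
  have "(\<integral>\<^sup>+s. indicator {0<..<1} s * emeasure lborel {x. s * a < f x} \<partial>lborel)
      = (\<integral>\<^sup>+s. \<integral>\<^sup>+x. indicator {0<..<1} s * indicator {x. s * a < f x} x \<partial>lborel \<partial>(lborel :: real measure))"
    by (intro nn_integral_cong) (subst nn_integral_cmult, auto)
  also have "\<dots> = (\<integral>\<^sup>+x. \<integral>\<^sup>+s. indicator {0<..<1} s * indicator {x. s * a < f x} x \<partial>lborel \<partial>lborel)"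
    by (rule lborel_pair.Fubini') measurable
  also have "\<dots> = (\<integral>\<^sup>+x. ennreal (f x / a) \<partial>lborel)"
  proof (intro nn_integral_cong)
    fix x
    have "(\<integral>\<^sup>+s. indicator {0<..<1} s * indicator {x. s * a < f x} x \<partial>lborel)
        = (\<integral>\<^sup>+s. indicator {0<..<f x / a} s \<partial>lborel)"
    proof (intro nn_integral_cong)
      fix s
      have "s < 1" if "s * a < f x"
      proof -
        have "s * a < 1 * a" using that f(2)[of x] by simp
        then show ?thesis using a by (simp only: mult_less_cancel_right_pos)
      qed
      then show "indicator {0<..<1} s * indicator {x. s * a < f x} x = (indicator {0<..<f x / a} s :: ennreal)"
        using a by (auto simp: indicator_def pos_less_divide_eq)
    qed
    then show "(\<integral>\<^sup>+s. indicator {0<..<1} s * indicator {x. s * a < f x} x \<partial>lborel) = ennreal (f x / a)"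
      using a f[of x] by simp
  qed
  finally show ?thesis .
qed

text \<open>Only the levels below \<open>c\<close> are counted, so the left side is the integral of
  the minimum of \<open>h\<close> and \<open>c\<close>; hence an inequality, valid also for
  unbounded \<open>h\<close>.\<close>

lemma nn_integral_layers_le:
  fixes h :: "real \<Rightarrow> ennreal"
  assumes [measurable]: "h \<in> borel_measurable borel" and c: "0 < c"
  shows "ennreal c * (\<integral>\<^sup>+s. indicator {0<..<1} s * emeasure lborel {x. ennreal (s * c) < h x} \<partial>lborel)
      \<le> (\<integral>\<^sup>+x. h x \<partial>lborel)"
proof -
  have "ennreal c * (\<integral>\<^sup>+s. indicator {0<..<1} s * emeasure lborel {x. ennreal (s * c) < h x} \<partial>lborel)
      = ennreal c * (\<integral>\<^sup>+s. \<integral>\<^sup>+x. indicator {0<..<1} s * indicator {x. ennreal (s * c) < h x} x \<partial>lborel \<partial>(lborel :: real measure))"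
    by (intro arg_cong2[where f = "(*)"] refl nn_integral_cong) (subst nn_integral_cmult, auto)
  also have "\<dots> = ennreal c * (\<integral>\<^sup>+x. \<integral>\<^sup>+s. indicator {0<..<1} s * indicator {x. ennreal (s * c) < h x} x \<partial>lborel \<partial>lborel)"
    by (subst lborel_pair.Fubini') measurable
  also have "\<dots> = (\<integral>\<^sup>+x. ennreal c * (\<integral>\<^sup>+s. indicator {0<..<1} s * indicator {x. ennreal (s * c) < h x} x \<partial>lborel) \<partial>lborel)"
    by (subst nn_integral_cmult) measurable
  also have "\<dots> \<le> (\<integral>\<^sup>+x. h x \<partial>lborel)"
  proof (intro nn_integral_mono)
    fix x
    show "ennreal c * (\<integral>\<^sup>+s. indicator {0<..<1} s * indicator {x. ennreal (s * c) < h x} x \<partial>lborel) \<le> h x"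
    proof (cases "h x")
      case (real y)
      have "(\<integral>\<^sup>+s. indicator {0<..<1} s * indicator {x. ennreal (s * c) < h x} x \<partial>lborel)
          \<le> (\<integral>\<^sup>+s. indicator {0<..<y / c} s \<partial>lborel)"
        using c real
        by (intro nn_integral_mono) (auto simp: indicator_def field_simps ennreal_less_iff)
      also have "\<dots> = ennreal (y / c)" using c real by simp
      finally have "ennreal c * (\<integral>\<^sup>+s. indicator {0<..<1} s * indicator {x. ennreal (s * c) < h x} x \<partial>lborel)
          \<le> ennreal c * ennreal (y / c)" by (intro mult_left_mono) auto
      also have "\<dots> = h x" using c real by (simp add: ennreal_mult'[symmetric])
      finally show ?thesis .
    qed simp
  qed
  finally show ?thesis .
qed

text \<open>Converts the additive inequality between level sets into the multiplicative one between
  integrals.\<close>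

lemma ennreal_amgm: "4 * (F * G) \<le> (F + G)\<^sup>2" for F G :: ennreal
proof (cases F; cases G)
  fix x y assume xy: "F = ennreal x" "0 \<le> x" "G = ennreal y" "0 \<le> y"
  have "4 * (x * y) \<le> (x + y)\<^sup>2"
    using zero_le_power2[of "x - y"] by (simp add: power2_eq_square algebra_simps)
  then have "ennreal (4 * (x * y)) \<le> ennreal ((x + y)\<^sup>2)" by (rule ennreal_leI)
  then show ?thesis using xy
    by (simp add: ennreal_mult' ennreal_power[symmetric])
qed (auto simp: power2_eq_square ennreal_top_mult)

text \<open>The levels \<open>s * a\<close> of \<open>f\<close>, \<open>s * b\<close> of
  \<open>g\<close> and \<open>s * c\<close> of \<open>h\<close> match when
  \<open>c = sqrt (a * b)\<close>: half differences of points above the first two levels lie above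
  the third. The inequality for sets, integrated over \<open>s\<close>, gives
  \<open>c * (F / a + G / b) \<le> 2 * H\<close>, and the arithmetic-geometric mean inequality
  removes \<open>a\<close>, \<open>b\<close> and \<open>c\<close>.\<close>

lemma prekopa_leindler_1d_bounded:
  fixes f g :: "real \<Rightarrow> real" and h :: "real \<Rightarrow> ennreal"
  assumes [measurable]: "f \<in> borel_measurable borel" "g \<in> borel_measurable borel" "h \<in> borel_measurable borel"
    and f: "\<And>x. 0 \<le> f x" "bdd_above (range f)" and g: "\<And>x. 0 \<le> g x" "bdd_above (range g)"
    and h: "\<And>x y. ennreal (f x * g y) \<le> (h ((x - y) / 2))\<^sup>2"
  shows "(\<integral>\<^sup>+x. f x \<partial>lborel) * (\<integral>\<^sup>+x. g x \<partial>lborel) \<le> (\<integral>\<^sup>+x. h x \<partial>lborel)\<^sup>2"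
proof -
  define a where "a = (SUP x. f x)"
  define b where "b = (SUP x. g x)"
  have fa: "f x \<le> a" and gb: "g x \<le> b" for x
    using f g by (auto simp: a_def b_def intro: cSUP_upper)
  show ?thesis
  proof (cases "a > 0 \<and> b > 0")
    case False
    then have "a \<le> 0 \<or> b \<le> 0" by auto
    then have "(\<forall>x. f x = 0) \<or> (\<forall>x. g x = 0)"
      using f(1) g(1) fa gb by (meson order_antisym order_trans)
    then show ?thesis by auto
  next
    case True
    define c where "c = sqrt (a * b)"
    have a: "0 < a" and b: "0 < b" and c: "0 < c" and c2: "c * c = a * b"
      using True by (auto simp: c_def)
    define F where "F = (\<integral>\<^sup>+x. f x \<partial>lborel)"
    define G where "G = (\<integral>\<^sup>+x. g x \<partial>lborel)"
    define H where "H = (\<integral>\<^sup>+x. h x \<partial>lborel)"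
    have lev: "emeasure lborel {x. s * a < f x} + emeasure lborel {x. s * b < g x}
        \<le> 2 * emeasure lborel {x. ennreal (s * c) < h x}" if s: "0 < s" "s < 1" for s
    proof (rule half_difference_measure)
      \<comment> \<open>This is why \<open>a\<close> and \<open>b\<close> are suprema: for
        \<open>s < 1\<close> the superlevel sets are nonempty, without which the inequality for sets
        is false.\<close>
      show "{x. s * a < f x} \<noteq> {}"
        using less_cSUP_iff[of UNIV f "s * a"] f s a by (auto simp: a_def)
      show "{x. s * b < g x} \<noteq> {}"
        using less_cSUP_iff[of UNIV g "s * b"] g s b by (auto simp: b_def)
      fix x y assume xy: "x \<in> {x. s * a < f x}" "y \<in> {x. s * b < g x}"
      have "(s * c) * (s * c) = (s * a) * (s * b)" using c2 by (simp add: algebra_simps)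
      also have "\<dots> < f x * g y"
      proof (rule mult_strict_mono)
        have "0 < s * a" using s a by simp
        then show "0 < f x" using xy by simp
      qed (use xy b s in auto)
      finally have *: "ennreal ((s * c) * (s * c)) < ennreal (f x * g y)"
        by (intro ennreal_lessI le_less_trans[OF zero_le_square[of "s * c"]])
      show "(x - y) / 2 \<in> {x. ennreal (s * c) < h x}"
      proof (rule ccontr)
        assume "(x - y) / 2 \<notin> {x. ennreal (s * c) < h x}"
        then have "(h ((x - y) / 2))\<^sup>2 \<le> (ennreal (s * c))\<^sup>2" by (intro power_mono) auto
        also have "\<dots> = ennreal ((s * c) * (s * c))"
          using s c by (simp add: power2_eq_square ennreal_mult)
        finally show False using * h[of x y] by auto
      qed
    qed measurable
    let ?LA = "\<lambda>s. indicator {0<..<1} s * emeasure lborel {x. s * a < f x}"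
    let ?LB = "\<lambda>s. indicator {0<..<1} s * emeasure lborel {x. s * b < g x}"
    let ?LH = "\<lambda>s. indicator {0<..<1} s * emeasure lborel {x. ennreal (s * c) < h x}"
    have [measurable]: "?LA \<in> borel_measurable borel" "?LB \<in> borel_measurable borel"
      "?LH \<in> borel_measurable borel"
      by measurable
    have "(\<integral>\<^sup>+x. ennreal (f x / a) \<partial>lborel) + (\<integral>\<^sup>+x. ennreal (g x / b) \<partial>lborel)
        = (\<integral>\<^sup>+s. ?LA s \<partial>lborel) + (\<integral>\<^sup>+s. ?LB s \<partial>lborel)"
      using f g fa gb a b by (subst (1 2) nn_integral_layers) auto
    also have "\<dots> = (\<integral>\<^sup>+s. ?LA s + ?LB s \<partial>lborel)" by (rule nn_integral_add[symmetric]) auto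
    also have "\<dots> \<le> (\<integral>\<^sup>+s. 2 * ?LH s \<partial>lborel)"
      using lev by (intro nn_integral_mono) (auto simp: indicator_def)
    also have "\<dots> = 2 * (\<integral>\<^sup>+s. ?LH s \<partial>lborel)" by (rule nn_integral_cmult) auto
    finally have "c * ((\<integral>\<^sup>+x. ennreal (f x / a) \<partial>lborel) + (\<integral>\<^sup>+x. ennreal (g x / b) \<partial>lborel))
        \<le> c * (2 * (\<integral>\<^sup>+s. ?LH s \<partial>lborel))" by (rule mult_left_mono) simp
    also have "\<dots> = 2 * (c * (\<integral>\<^sup>+s. ?LH s \<partial>lborel))" by (simp add: mult_ac)
    also have "\<dots> \<le> 2 * H"
      unfolding H_def using c by (intro mult_left_mono nn_integral_layers_le) auto
    also have "(\<integral>\<^sup>+x. ennreal (f x / a) \<partial>lborel) = F * ennreal (1 / a)"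
      unfolding F_def using f a by (subst nn_integral_multc[symmetric]) (auto simp: ennreal_mult[symmetric])
    also have "(\<integral>\<^sup>+x. ennreal (g x / b) \<partial>lborel) = G * ennreal (1 / b)"
      unfolding G_def using g b by (subst nn_integral_multc[symmetric]) (auto simp: ennreal_mult[symmetric])
    finally have 1: "ennreal c * (F * ennreal (1 / a) + G * ennreal (1 / b)) \<le> 2 * H" .
    have "4 * ((ennreal c * (F * ennreal (1 / a))) * (ennreal c * (G * ennreal (1 / b))))
       \<le> (ennreal c * (F * ennreal (1 / a)) + ennreal c * (G * ennreal (1 / b)))\<^sup>2"
      by (rule ennreal_amgm)
    also have "\<dots> \<le> (2 * H)\<^sup>2" using 1 by (intro power_mono) (auto simp: distrib_left)
    also have "\<dots> = 4 * H\<^sup>2" by (simp add: power_mult_distrib)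
    also have "(ennreal c * (F * ennreal (1 / a))) * (ennreal c * (G * ennreal (1 / b)))
        = (ennreal c * ennreal c * ennreal (1 / a) * ennreal (1 / b)) * (F * G)"
      by (simp add: mult_ac)
    also have "ennreal c * ennreal c * ennreal (1 / a) * ennreal (1 / b) = 1"
      using a b c c2 by (simp add: ennreal_mult[symmetric])
    finally show ?thesis
      unfolding F_def[symmetric] G_def[symmetric] H_def[symmetric]
      by (subst (asm) ennreal_mult_le_mult_iff) auto
  qed
qed

text \<open>Truncation at heights \<open>n\<close> and \<open>m\<close> makes \<open>f\<close> and
  \<open>g\<close> real valued and bounded. The two heights are independent, so that the suprema can
  be pulled out of the product one after the other.\<close>

lemma prekopa_leindler_1d:
  fixes f g h :: "real \<Rightarrow> ennreal"
  assumes [measurable]: "f \<in> borel_measurable borel" "g \<in> borel_measurable borel" "h \<in> borel_measurable borel"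
    and h: "\<And>x y. f x * g y \<le> (h ((x - y) / 2))\<^sup>2"
  shows "(\<integral>\<^sup>+x. f x \<partial>lborel) * (\<integral>\<^sup>+x. g x \<partial>lborel) \<le> (\<integral>\<^sup>+x. h x \<partial>lborel)\<^sup>2"
proof -
  define T where "T f n x = enn2real (min (f x) (of_nat n))" for f :: "real \<Rightarrow> ennreal" and n :: nat and x
  have T: "ennreal (T f n x) = min (f x) (of_nat n)" for f n x
    by (simp add: T_def min.strict_coboundedI2 of_nat_less_top)
  have T0: "0 \<le> T f n x" for f n x by (simp add: T_def)
  have Tb: "bdd_above (range (T f n))" for f n
  proof (rule bdd_aboveI)
    fix y assume "y \<in> range (T f n)"
    then obtain x where y: "y = T f n x" by auto
    have "ennreal y \<le> ennreal (real n)" using T[of f n x] by (simp add: y ennreal_of_nat_eq_real_of_nat)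
    then show "y \<le> real n" by (simp add: ennreal_le_iff)
  qed
  have TI: "(\<integral>\<^sup>+x. f x \<partial>lborel) = (SUP n. \<integral>\<^sup>+x. T f n x \<partial>lborel)"
    if [measurable]: "f \<in> borel_measurable borel" for f
  proof -
    have "(\<integral>\<^sup>+x. f x \<partial>lborel) = (\<integral>\<^sup>+x. (SUP n. ennreal (T f n x)) \<partial>lborel)"
    proof (intro nn_integral_cong)
      fix x
      have "(SUP n. min (f x) (of_nat n)) = min (f x) (SUP n. of_nat n)"
        by (simp add: inf_min[symmetric] inf_SUP)
      then show "f x = (SUP n. ennreal (T f n x))"
        by (simp add: T ennreal_SUP_of_nat_eq_top)
    qed
    also have "\<dots> = (SUP n. \<integral>\<^sup>+x. T f n x \<partial>lborel)"
    proof (rule nn_integral_monotone_convergence_SUP)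
      show "incseq (\<lambda>n x. ennreal (T f n x))"
        unfolding T incseq_def le_fun_def by (intro allI impI min.mono order_refl of_nat_mono)
      show "(\<lambda>x. ennreal (T f n x)) \<in> borel_measurable lborel" for n
        unfolding T by measurable
    qed
    finally show ?thesis .
  qed
  have Tm: "T f n \<in> borel_measurable borel" if [measurable]: "f \<in> borel_measurable borel" for f n
    unfolding T_def[abs_def] by measurable
  have "(\<integral>\<^sup>+x. T f n x \<partial>lborel) * (\<integral>\<^sup>+x. T g m x \<partial>lborel) \<le> (\<integral>\<^sup>+x. h x \<partial>lborel)\<^sup>2" for n m
  proof (rule prekopa_leindler_1d_bounded)
    fix x y
    have "ennreal (T f n x * T g m y) \<le> f x * g y"
      using T0 by (simp add: ennreal_mult T mult_mono)
    then show "ennreal (T f n x * T g m y) \<le> (h ((x - y) / 2))\<^sup>2" using h order_trans by blast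
  qed (auto intro: Tm T0 Tb)
  then show ?thesis
    unfolding TI[OF assms(1)] TI[OF assms(2)] SUP_mult_left_ennreal SUP_mult_right_ennreal
    by (intro SUP_least)
qed

text \<open>Stated with \<open>(x - y) / 2\<close> instead of the usual midpoint, so that the isodiametric inequality
  follows without reflecting a set.\<close>

lemma prekopa_leindler:
  fixes f g h :: "('i \<Rightarrow> real) \<Rightarrow> ennreal"
  assumes "finite I"
    and "f \<in> borel_measurable (\<Pi>\<^sub>M i\<in>I. lborel)" "g \<in> borel_measurable (\<Pi>\<^sub>M i\<in>I. lborel)"
      "h \<in> borel_measurable (\<Pi>\<^sub>M i\<in>I. lborel)"
    and "\<And>x y. x \<in> extensional I \<Longrightarrow> y \<in> extensional I \<Longrightarrow> f x * g y \<le> (h (\<lambda>i\<in>I. (x i - y i) / 2))\<^sup>2"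
  shows "(\<integral>\<^sup>+x. f x \<partial>(\<Pi>\<^sub>M i\<in>I. lborel)) * (\<integral>\<^sup>+x. g x \<partial>(\<Pi>\<^sub>M i\<in>I. lborel))
      \<le> (\<integral>\<^sup>+x. h x \<partial>(\<Pi>\<^sub>M i\<in>I. lborel))\<^sup>2"
  using assms
proof (induction I arbitrary: f g h rule: finite_induct)
  case empty
  interpret product_sigma_finite "\<lambda>_. lborel :: real measure" by standard
  \<comment> \<open>Over the empty index set the product measure is a point mass, and the hypothesis
    at that point is the claim.\<close>
  show ?case
    using empty(4)[of "\<lambda>_. undefined" "\<lambda>_. undefined"]
    by (simp add: PiM_empty nn_integral_count_space_finite power2_eq_square restrict_def)
next
  case (insert i I)
  interpret product_sigma_finite "\<lambda>_. lborel :: real measure" by standard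
  note [measurable] = insert.prems(1-3)
  have [measurable]: "(\<lambda>(t, x). k (x(i := t))) \<in> borel_measurable (lborel \<Otimes>\<^sub>M (\<Pi>\<^sub>M i\<in>I. lborel))"
    if [measurable]: "k \<in> borel_measurable (\<Pi>\<^sub>M i\<in>insert i I. lborel)" for k :: "('i \<Rightarrow> real) \<Rightarrow> ennreal"
    by measurable
  interpret I: finite_product_sigma_finite "\<lambda>_. lborel :: real measure" I by standard (rule insert.hyps)
  let ?L = "\<lambda>k t. \<integral>\<^sup>+x. k (x(i := t)) \<partial>(\<Pi>\<^sub>M i\<in>I. lborel)"
  have meas: "?L k \<in> borel_measurable borel"
    if [measurable]: "k \<in> borel_measurable (\<Pi>\<^sub>M i\<in>insert i I. lborel)" for k :: "('i \<Rightarrow> real) \<Rightarrow> ennreal"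
  proof -
    have "?L k \<in> borel_measurable lborel"
      by (rule I.borel_measurable_nn_integral) (use that in measurable)
    then show ?thesis by simp
  qed
  \<comment> \<open>Integrating out all coordinates except \<open>i\<close> leaves functions of one
    variable. The induction hypothesis, applied to the slices at \<open>s\<close>, \<open>t\<close>
    and \<open>(s - t) / 2\<close>, is exactly what the one-dimensional inequality asks of
    them.\<close>
  have "(\<integral>\<^sup>+t. ?L f t \<partial>lborel) * (\<integral>\<^sup>+t. ?L g t \<partial>lborel) \<le> (\<integral>\<^sup>+t. ?L h t \<partial>lborel)\<^sup>2"
  proof (rule prekopa_leindler_1d)
    fix s t :: real
    show "?L f s * ?L g t \<le> (?L h ((s - t) / 2))\<^sup>2"
    proof (rule insert.IH)
      have sub: "(\<lambda>x. k (x(i := t))) \<in> borel_measurable (\<Pi>\<^sub>M i\<in>I. lborel)"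
        if [measurable]: "k \<in> borel_measurable (\<Pi>\<^sub>M i\<in>insert i I. lborel)" for k :: "('i \<Rightarrow> real) \<Rightarrow> ennreal" and t
        by measurable
      show "(\<lambda>x. f (x(i := s))) \<in> borel_measurable (\<Pi>\<^sub>M i\<in>I. lborel)"
        "(\<lambda>x. g (x(i := t))) \<in> borel_measurable (\<Pi>\<^sub>M i\<in>I. lborel)"
        "(\<lambda>x. h (x(i := (s - t) / 2))) \<in> borel_measurable (\<Pi>\<^sub>M i\<in>I. lborel)"
        by (rule sub, fact)+
      fix x y :: "'i \<Rightarrow> real" assume xy: "x \<in> extensional I" "y \<in> extensional I"
      have "f (x(i := s)) * g (y(i := t)) \<le> (h (\<lambda>j\<in>insert i I. ((x(i := s)) j - (y(i := t)) j) / 2))\<^sup>2"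
        using xy by (intro insert.prems(4)) (auto simp: extensional_def)
      also have "(\<lambda>j\<in>insert i I. ((x(i := s)) j - (y(i := t)) j) / 2) = (\<lambda>j\<in>I. (x j - y j) / 2)(i := (s - t) / 2)"
        using insert.hyps by (auto simp: fun_eq_iff restrict_def)
      finally show "f (x(i := s)) * g (y(i := t)) \<le> (h ((\<lambda>j\<in>I. (x j - y j) / 2)(i := (s - t) / 2)))\<^sup>2" .
    qed
  qed (intro meas; fact)+
  then show ?case
    using insert.hyps insert.prems(1-3) by (simp add: product_nn_integral_insert_rev)
qed

section \<open>The isodiametric inequality in coordinates\<close>

text \<open>Half the difference of two points of \<open>C\<close> lies in the ball of radius
  \<open>d / 2\<close>. So the functional inequality applies with the indicator of \<open>C\<close>
  in both factors and the indicator of this ball, and yields the square of the claim.\<close>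

lemma isodiametric_PiM_pos:
  assumes I: "finite I" and C: "C \<in> sets (\<Pi>\<^sub>M i\<in>I. lborel)" and d: "0 < d"
    and diam: "\<And>x y. x \<in> C \<Longrightarrow> y \<in> C \<Longrightarrow> (\<Sum>i\<in>I. (x i - y i)\<^sup>2) \<le> d\<^sup>2"
  shows "emeasure (\<Pi>\<^sub>M i\<in>I. lborel) C \<le> ennreal (unit_ball_vol (real (card I)) * (d / 2) ^ card I)"
proof -
  let ?B = "{f. sqrt (\<Sum>i\<in>I. (f i)\<^sup>2) \<le> d / 2} \<inter> space (\<Pi>\<^sub>M i\<in>I. lborel)"
  have B: "?B \<in> sets (\<Pi>\<^sub>M i\<in>I. lborel)" using I by measurable
  have "(emeasure (\<Pi>\<^sub>M i\<in>I. lborel) C)\<^sup>2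
      = (\<integral>\<^sup>+x. indicator C x \<partial>(\<Pi>\<^sub>M i\<in>I. lborel)) * (\<integral>\<^sup>+x. indicator C x \<partial>(\<Pi>\<^sub>M i\<in>I. lborel))"
    using C by (simp add: power2_eq_square)
  also have "\<dots> \<le> (\<integral>\<^sup>+x. indicator ?B x \<partial>(\<Pi>\<^sub>M i\<in>I. lborel))\<^sup>2"
  proof (rule prekopa_leindler[OF I])
    fix x y :: "'a \<Rightarrow> real"
    have "(\<lambda>i\<in>I. (x i - y i) / 2) \<in> ?B" if "x \<in> C" "y \<in> C"
    proof -
      have "(\<Sum>i\<in>I. ((x i - y i) / 2)\<^sup>2) = (\<Sum>i\<in>I. (x i - y i)\<^sup>2) / 4"
        by (simp add: power_divide sum_divide_distrib)
      also have "\<dots> \<le> (d / 2)\<^sup>2" using diam[OF that] by (simp add: power_divide)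
      finally have "sqrt (\<Sum>i\<in>I. ((x i - y i) / 2)\<^sup>2) \<le> d / 2"
        using d by (intro real_le_lsqrt) auto
      moreover have "(\<Sum>i\<in>I. ((\<lambda>i\<in>I. (x i - y i) / 2) i)\<^sup>2) = (\<Sum>i\<in>I. ((x i - y i) / 2)\<^sup>2)"
        by (intro sum.cong) auto
      ultimately show ?thesis by (auto simp: space_PiM)
    qed
    then show "indicator C x * indicator C y \<le> (indicator ?B (\<lambda>i\<in>I. (x i - y i) / 2) :: ennreal)\<^sup>2"
      by (auto simp: indicator_def simp del: Int_iff)
  qed (use B C in auto)
  also have "\<dots> = (emeasure (\<Pi>\<^sub>M i\<in>I. lborel) ?B)\<^sup>2" using B by simp
  also have "emeasure (\<Pi>\<^sub>M i\<in>I. lborel) ?B = ennreal (unit_ball_vol (real (card I)) * (d / 2) ^ card I)"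
    using I d by (intro emeasure_cball_aux) auto
  finally have le: "(emeasure (\<Pi>\<^sub>M i\<in>I. lborel) C)\<^sup>2 \<le> (ennreal (unit_ball_vol (real (card I)) * (d / 2) ^ card I))\<^sup>2" .
  have w: "0 \<le> unit_ball_vol (real (card I)) * (d / 2) ^ card I" using d by simp
  show ?thesis
  proof (cases "emeasure (\<Pi>\<^sub>M i\<in>I. lborel) C")
    case (real c)
    then have "c\<^sup>2 \<le> (unit_ball_vol (real (card I)) * (d / 2) ^ card I)\<^sup>2"
      using le w by (simp add: ennreal_power)
    then show ?thesis using w real by (auto intro: ennreal_leI power2_le_imp_le)
  next
    case top
    then show ?thesis using le w by (simp add: ennreal_power power2_eq_square ennreal_mult_top top_unique flip: ennreal_mult)
  qed
qed

text \<open>Letting the bound decrease to \<open>d\<close> admits \<open>d = 0\<close>, as needed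
  for covering sets that are single points.\<close>

lemma isodiametric_PiM:
  assumes I: "finite I" and C: "C \<in> sets (\<Pi>\<^sub>M i\<in>I. lborel)" and d: "0 \<le> d"
    and diam: "\<And>x y. x \<in> C \<Longrightarrow> y \<in> C \<Longrightarrow> (\<Sum>i\<in>I. (x i - y i)\<^sup>2) \<le> d\<^sup>2"
  shows "emeasure (\<Pi>\<^sub>M i\<in>I. lborel) C \<le> ennreal (unit_ball_vol (real (card I)) * (d / 2) ^ card I)"
proof -
  have "emeasure (\<Pi>\<^sub>M i\<in>I. lborel) C \<le> ennreal (unit_ball_vol (real (card I)) * (c / 2) ^ card I)" if "d < c" for c
  proof (rule isodiametric_PiM_pos[OF I C])
    show "0 < c" using d that by simp
    fix x y assume "x \<in> C" "y \<in> C"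
    moreover have "d\<^sup>2 \<le> c\<^sup>2" using d that by (intro power_mono) auto
    ultimately show "(\<Sum>i\<in>I. (x i - y i)\<^sup>2) \<le> c\<^sup>2" using diam order_trans by blast
  qed
  then have ev: "\<forall>\<^sub>F c in at_right d. emeasure (\<Pi>\<^sub>M i\<in>I. lborel) C
      \<le> ennreal (unit_ball_vol (real (card I)) * (c / 2) ^ card I)"
    by (intro eventually_mono[OF eventually_at_right_less[of d]])
  have "((\<lambda>c. ennreal (unit_ball_vol (real (card I)) * (c / 2) ^ card I)) \<longlongrightarrow>
      ennreal (unit_ball_vol (real (card I)) * (d / 2) ^ card I)) (at_right d)"
    by (intro tendsto_ennrealI tendsto_mult tendsto_const tendsto_power tendsto_divide tendsto_ident_at) simp
  then show ?thesis
    by (rule tendsto_lowerbound[OF _ ev]) simp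
qed

section \<open>Cone measure and polar coordinates\<close>

lemma nn_integral_lborel_affine:
  fixes f :: "'a::euclidean_space \<Rightarrow> ennreal"
  assumes [measurable]: "f \<in> borel_measurable borel" and c: "c \<noteq> 0"
  shows "(\<integral>\<^sup>+x. f x \<partial>lborel) = ennreal (\<bar>c\<bar> ^ DIM('a)) * (\<integral>\<^sup>+x. f (t + c *\<^sub>R x) \<partial>lborel)"
  by (subst lborel_affine[OF c, of t])
    (simp add: nn_integral_density nn_integral_distr nn_integral_cmult)

lemma AE_lborel_affine:
  fixes P :: "'a::euclidean_space \<Rightarrow> bool"
  assumes "AE x in lborel. P x" and c: "c \<noteq> 0"
  shows "AE z in lborel. P (t + c *\<^sub>R z)"
proof -
  obtain N where N: "{x. \<not> P x} \<subseteq> N" "N \<in> null_sets lborel" using assms by (auto simp: eventually_ae_filter)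
  then have [measurable]: "N \<in> sets borel" by auto
  have "ennreal (\<bar>c\<bar> ^ DIM('a)) * (\<integral>\<^sup>+z. indicator N (t + c *\<^sub>R z) \<partial>lborel) = (\<integral>\<^sup>+x. indicator N x \<partial>lborel)"
    by (rule nn_integral_lborel_affine[symmetric, OF _ c]) measurable
  also have "\<dots> = 0" using N by auto
  finally have "(\<integral>\<^sup>+z. indicator N (t + c *\<^sub>R z) \<partial>lborel) = 0" using c by simp
  then have "AE z in lborel. indicator N (t + c *\<^sub>R z) = (0 :: ennreal)"
    by (subst (asm) nn_integral_0_iff_AE) auto
  then show ?thesis
    by eventually_elim (use N in \<open>auto simp: indicator_def split: if_splits\<close>)
qed

text \<open>The mass of \<open>A\<close> is \<open>N\<close> times the volume of the part of the unit ball that lies on rays through \<open>A\<close>.\<close>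

definition cone_measure :: "'a::euclidean_space measure" where
  "cone_measure = distr (density lborel (\<lambda>x. ennreal (real DIM('a)) * indicator (cball 0 1 - {0}) x)) borel sgn"

lemma borel_measurable_sgn_vector [measurable]: "sgn \<in> borel_measurable (borel :: 'a::euclidean_space measure)"
  unfolding sgn_div_norm[abs_def] by measurable

lemma sets_cone_measure [measurable_cong, simp]: "sets cone_measure = sets borel"
  by (simp add: cone_measure_def)

lemma space_cone_measure [simp]: "space cone_measure = UNIV"
  by (simp add: cone_measure_def)

lemma nn_integral_cone_measure:
  fixes f :: "'a::euclidean_space \<Rightarrow> ennreal"
  assumes [measurable]: "f \<in> borel_measurable borel"
  shows "(\<integral>\<^sup>+n. f n \<partial>cone_measure)
    = (\<integral>\<^sup>+x. ennreal (real DIM('a)) * indicator (cball 0 1 - {0}) x * f (sgn x) \<partial>lborel)"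
proof -
  have [measurable]: "(indicator (cball 0 1 - {0}) :: 'a \<Rightarrow> ennreal) \<in> borel_measurable lborel"
    by (rule borel_measurable_indicator) auto
  show ?thesis
    unfolding cone_measure_def by (subst nn_integral_distr, measurable, subst nn_integral_density) measurable
qed

lemma emeasure_cone_measure:
  fixes A :: "'a::euclidean_space set"
  assumes [measurable]: "A \<in> sets borel"
  shows "emeasure cone_measure A
    = ennreal (real DIM('a)) * emeasure lborel {x \<in> cball 0 1 - {0}. sgn x \<in> A}"
proof -
  have "emeasure cone_measure A = (\<integral>\<^sup>+n. indicator A n \<partial>cone_measure)" by simp
  also have "\<dots> = (\<integral>\<^sup>+x. ennreal (real DIM('a)) * indicator {x \<in> cball 0 1 - {0}. sgn x \<in> A} x \<partial>lborel)"
    by (subst nn_integral_cone_measure) (auto intro!: nn_integral_cong simp: indicator_def)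
  also have "\<dots> = ennreal (real DIM('a)) * emeasure lborel {x \<in> cball 0 1 - {0}. sgn x \<in> A}"
    by (subst nn_integral_cmult) (auto simp flip: nn_integral_indicator)
  finally show ?thesis .
qed

lemma emeasure_cone_measure_finite: "emeasure (cone_measure :: 'a::euclidean_space measure) A < \<infinity>"
proof -
  have "emeasure (cone_measure :: 'a measure) A \<le> emeasure (cone_measure :: 'a measure) UNIV"
    by (rule order_trans[OF emeasure_space]) simp
  also have "\<dots> \<le> ennreal (real DIM('a)) * emeasure lborel (cball 0 1 :: 'a set)"
    by (subst emeasure_cone_measure) (auto intro!: mult_left_mono emeasure_mono)
  also have "\<dots> < \<infinity>"
    using emeasure_bounded_finite[of "cball 0 1 :: 'a set"] by (simp add: ennreal_mult_less_top)
  finally show ?thesis .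
qed

lemma finite_measure_cone_measure: "finite_measure cone_measure"
  using emeasure_cone_measure_finite by (intro finite_measureI) (simp add: less_top)

lemma AE_cone_measure_sphere: "AE n in cone_measure. n \<in> sphere (0 :: 'a::euclidean_space) 1"
proof (rule AE_I)
  have *: "{x \<in> cball 0 1 - {0}. sgn x \<in> - sphere (0::'a) 1} = {}"
    by (auto simp: norm_sgn)
  show "emeasure cone_measure (- sphere (0::'a) 1) = 0"
    using emeasure_cone_measure[of "- sphere (0::'a) 1"] unfolding * by simp
qed auto

section \<open>Integration in polar coordinates\<close>

text \<open>The density through which the auxiliary radius of the polar coordinate formula is
  integrated out, with \<open>a = norm y\<close>.\<close>

lemma nn_integral_inverse_power:
  fixes a :: real
  assumes "0 < a" "0 < N"
  shows "(\<integral>\<^sup>+s. ennreal (real N * a ^ N / s ^ Suc N) * indicator {a..} s \<partial>lborel) = 1"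
proof -
  have "((\<lambda>s. - (a ^ N / s ^ N)) \<longlongrightarrow> - 0) at_top"
    using assms
    by (intro tendsto_minus real_tendsto_divide_at_top[OF tendsto_const] filterlim_pow_at_top filterlim_ident)
  moreover have "((\<lambda>s. - (a ^ N / s ^ N)) has_real_derivative real N * a ^ N / x ^ Suc N) (at x)"
    if "a \<le> x" for x
  proof -
    have "x \<noteq> 0" "x ^ (N - Suc 0) * x = x ^ N"
      using that assms by (auto simp flip: power_Suc2)
    then show ?thesis
      by (auto intro!: derivative_eq_intros simp: divide_simps mult_ac)
  qed
  ultimately have "(\<integral>\<^sup>+s. ennreal (real N * a ^ N / s ^ Suc N) * indicator {a..} s \<partial>lborel)
      = - 0 - (- (a ^ N / a ^ N))"
    using assms by (intro nn_integral_FTC_atLeast) auto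
  then show ?thesis using assms by simp
qed

text \<open>The cone measure is itself a volume integral over the unit ball, so the right side is an
  integral over a radius and a point \<open>x\<close> of the ball. Substituting
  \<open>\<rho> = norm x * s\<close> for fixed \<open>x\<close> and then
  \<open>y = s *\<^sub>R x\<close> for fixed \<open>s\<close> turns it into the integral of
  \<open>f y\<close> times a probability density in \<open>s\<close>.\<close>

lemma nn_integral_polar:
  fixes f :: "'a::euclidean_space \<Rightarrow> ennreal"
  assumes [measurable]: "f \<in> borel_measurable borel"
  shows "(\<integral>\<^sup>+x. f x \<partial>lborel) =
    (\<integral>\<^sup>+\<rho>. indicator {0<..} \<rho> * (ennreal (\<rho> ^ (DIM('a) - 1)) * (\<integral>\<^sup>+n. f (\<rho> *\<^sub>R n) \<partial>cone_measure)) \<partial>lborel)"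
proof -
  define N where "N = DIM('a)"
  have N: "0 < N" by (simp add: N_def)
  let ?i = "indicator (cball 0 1 - {0}) :: 'a \<Rightarrow> ennreal"
  let ?p = "indicator {0<..} :: real \<Rightarrow> ennreal"
  have [measurable]: "?i \<in> borel_measurable borel"
    by (rule borel_measurable_indicator) auto
  have [measurable]: "(\<lambda>y::'a. indicator {norm y..} s :: ennreal) \<in> borel_measurable borel"
    "(\<lambda>y::'a. indicator {norm (0 + s *\<^sub>R y)..} s :: ennreal) \<in> borel_measurable borel" for s
    unfolding indicator_def atLeast_iff by measurable
  have [measurable]: "(indicator (- {0}) :: 'a \<Rightarrow> ennreal) \<in> borel_measurable borel"
    by (rule borel_measurable_indicator) auto
  have [measurable]: "(\<lambda>x. f (c *\<^sub>R sgn x)) \<in> borel_measurable borel" for c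
    by measurable
  have "(\<integral>\<^sup>+\<rho>. ?p \<rho> * (ennreal (\<rho> ^ (N - 1)) * (\<integral>\<^sup>+n. f (\<rho> *\<^sub>R n) \<partial>cone_measure)) \<partial>lborel)
      = (\<integral>\<^sup>+\<rho>. (\<integral>\<^sup>+x. ?p \<rho> * (ennreal (\<rho> ^ (N - 1)) * (ennreal (real N) * ?i x * f (\<rho> *\<^sub>R sgn x))) \<partial>lborel) \<partial>lborel)"
  proof (rule nn_integral_cong)
    fix \<rho> :: real
    have "(\<integral>\<^sup>+x. ?p \<rho> * (ennreal (\<rho> ^ (N - 1)) * (ennreal (real N) * ?i x * f (\<rho> *\<^sub>R sgn x))) \<partial>lborel)
        = ?p \<rho> * (\<integral>\<^sup>+x. ennreal (\<rho> ^ (N - 1)) * (ennreal (real N) * ?i x * f (\<rho> *\<^sub>R sgn x)) \<partial>lborel)"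
      by (rule nn_integral_cmult) measurable
    also have "(\<integral>\<^sup>+x. ennreal (\<rho> ^ (N - 1)) * (ennreal (real N) * ?i x * f (\<rho> *\<^sub>R sgn x)) \<partial>lborel)
        = ennreal (\<rho> ^ (N - 1)) * (\<integral>\<^sup>+x. ennreal (real N) * ?i x * f (\<rho> *\<^sub>R sgn x) \<partial>lborel)"
      by (rule nn_integral_cmult) measurable
    also have "(\<integral>\<^sup>+x. ennreal (real N) * ?i x * f (\<rho> *\<^sub>R sgn x) \<partial>lborel) = (\<integral>\<^sup>+n. f (\<rho> *\<^sub>R n) \<partial>cone_measure)"
      unfolding N_def by (rule nn_integral_cone_measure[symmetric]) measurable
    finally show "?p \<rho> * (ennreal (\<rho> ^ (N - 1)) * (\<integral>\<^sup>+n. f (\<rho> *\<^sub>R n) \<partial>cone_measure))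
        = (\<integral>\<^sup>+x. ?p \<rho> * (ennreal (\<rho> ^ (N - 1)) * (ennreal (real N) * ?i x * f (\<rho> *\<^sub>R sgn x))) \<partial>lborel)" ..
  qed
  also have "\<dots> = (\<integral>\<^sup>+x. (\<integral>\<^sup>+\<rho>. ?p \<rho> * (ennreal (\<rho> ^ (N - 1)) * (ennreal (real N) * ?i x * f (\<rho> *\<^sub>R sgn x))) \<partial>lborel) \<partial>lborel)"
    by (rule lborel_pair.Fubini') measurable
  \<comment> \<open>The substitution \<open>\<rho> = norm x * s\<close> turns
    \<open>\<rho> *\<^sub>R sgn x\<close> into \<open>s *\<^sub>R x\<close>; its Jacobian completes
    \<open>norm x ^ (N - 1)\<close> to \<open>norm x ^ N\<close>.\<close>
  also have "\<dots> = (\<integral>\<^sup>+x. (\<integral>\<^sup>+s. ?p s * (ennreal (s ^ (N - 1)) * (ennreal (real N * norm x ^ N) * ?i x * f (s *\<^sub>R x))) \<partial>lborel) \<partial>lborel)"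
  proof (rule nn_integral_cong)
    fix x :: 'a
    show "(\<integral>\<^sup>+\<rho>. ?p \<rho> * (ennreal (\<rho> ^ (N - 1)) * (ennreal (real N) * ?i x * f (\<rho> *\<^sub>R sgn x))) \<partial>lborel)
        = (\<integral>\<^sup>+s. ?p s * (ennreal (s ^ (N - 1)) * (ennreal (real N * norm x ^ N) * ?i x * f (s *\<^sub>R x))) \<partial>lborel)"
    proof (cases "x = 0")
      case False
      have pw: "norm x * norm x ^ (N - 1) = norm x ^ N"
        using N by (simp flip: power_Suc)
      have "(\<integral>\<^sup>+\<rho>. ?p \<rho> * (ennreal (\<rho> ^ (N - 1)) * (ennreal (real N) * ?i x * f (\<rho> *\<^sub>R sgn x))) \<partial>lborel)
        = ennreal \<bar>norm x\<bar> * (\<integral>\<^sup>+s. ?p (0 + norm x * s) * (ennreal ((0 + norm x * s) ^ (N - 1)) * (ennreal (real N) * ?i x * f ((0 + norm x * s) *\<^sub>R sgn x))) \<partial>lborel)"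
        using False by (intro nn_integral_real_affine) auto
      also have "\<dots> = (\<integral>\<^sup>+s. ennreal \<bar>norm x\<bar> * (?p (0 + norm x * s) * (ennreal ((0 + norm x * s) ^ (N - 1)) * (ennreal (real N) * ?i x * f ((0 + norm x * s) *\<^sub>R sgn x)))) \<partial>lborel)"
        by (rule nn_integral_cmult[symmetric]) measurable
      also have "\<dots> = (\<integral>\<^sup>+s. ?p s * (ennreal (s ^ (N - 1)) * (ennreal (real N * norm x ^ N) * ?i x * f (s *\<^sub>R x))) \<partial>lborel)"
      proof (rule nn_integral_cong)
        fix s :: real
        have "ennreal (norm x) * (ennreal ((norm x * s) ^ (N - 1)) * ennreal (real N))
            = ennreal (s ^ (N - 1)) * ennreal (real N * norm x ^ N)" if "0 < s"
          using that by (simp add: ennreal_mult[symmetric] power_mult_distrib pw[symmetric] mult_ac)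
        moreover have "(norm x * s) *\<^sub>R sgn x = s *\<^sub>R x"
          using False by (simp add: sgn_div_norm)
        ultimately show "ennreal \<bar>norm x\<bar> * (?p (0 + norm x * s) * (ennreal ((0 + norm x * s) ^ (N - 1)) * (ennreal (real N) * ?i x * f ((0 + norm x * s) *\<^sub>R sgn x))))
          = ?p s * (ennreal (s ^ (N - 1)) * (ennreal (real N * norm x ^ N) * ?i x * f (s *\<^sub>R x)))"
          using False by (cases "0 < s") (auto simp: zero_less_mult_iff mult.assoc[symmetric])
      qed
      finally show ?thesis .
    qed simp
  qed
  also have "\<dots> = (\<integral>\<^sup>+s. (\<integral>\<^sup>+x. ?p s * (ennreal (s ^ (N - 1)) * (ennreal (real N * norm x ^ N) * ?i x * f (s *\<^sub>R x))) \<partial>lborel) \<partial>lborel)"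
    by (rule lborel_pair.Fubini') measurable
  \<comment> \<open>The substitution \<open>y = s *\<^sub>R x\<close> turns the restriction to the
    unit ball into \<open>norm y \<le> s\<close>.\<close>
  also have "\<dots> = (\<integral>\<^sup>+s. (\<integral>\<^sup>+y. ennreal (real N * norm y ^ N / s ^ Suc N) * indicator {norm y..} s * (indicator (- {0}) y * f y) \<partial>lborel) \<partial>lborel)"
  proof (rule nn_integral_cong)
    fix s :: real
    show "(\<integral>\<^sup>+x. ?p s * (ennreal (s ^ (N - 1)) * (ennreal (real N * norm x ^ N) * ?i x * f (s *\<^sub>R x))) \<partial>lborel)
      = (\<integral>\<^sup>+y. ennreal (real N * norm y ^ N / s ^ Suc N) * indicator {norm y..} s * (indicator (- {0}) y * f y) \<partial>lborel)"
    proof (cases "0 < s")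
      case True
      have pw: "s ^ N = s * s ^ (N - 1)" using N by (simp flip: power_Suc)
      have "(\<integral>\<^sup>+y. ennreal (real N * norm y ^ N / s ^ Suc N) * indicator {norm y..} s * (indicator (- {0}) y * f y) \<partial>lborel)
        = ennreal (\<bar>s\<bar> ^ N) * (\<integral>\<^sup>+x. ennreal (real N * norm (0 + s *\<^sub>R x) ^ N / s ^ Suc N) * indicator {norm (0 + s *\<^sub>R x)..} s * (indicator (- {0}) (0 + s *\<^sub>R x) * f (0 + s *\<^sub>R x)) \<partial>lborel)"
      proof (rule nn_integral_lborel_affine[where 'a = 'a, folded N_def])
        show "(\<lambda>y. ennreal (real N * norm y ^ N / s ^ Suc N) * indicator {norm y..} s * (indicator (- {0}) y * f y))
            \<in> borel_measurable borel"
          by measurable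
      qed (use True in simp)
      also have "\<dots> = (\<integral>\<^sup>+x. ennreal (\<bar>s\<bar> ^ N) * (ennreal (real N * norm (0 + s *\<^sub>R x) ^ N / s ^ Suc N) * indicator {norm (0 + s *\<^sub>R x)..} s * (indicator (- {0}) (0 + s *\<^sub>R x) * f (0 + s *\<^sub>R x))) \<partial>lborel)"
        by (rule nn_integral_cmult[symmetric]) measurable
      also have "\<dots> = (\<integral>\<^sup>+x. ?p s * (ennreal (s ^ (N - 1)) * (ennreal (real N * norm x ^ N) * ?i x * f (s *\<^sub>R x))) \<partial>lborel)"
      proof (rule nn_integral_cong)
        fix x :: 'a
        have "s ^ N * (real N * (s * norm x) ^ N / s ^ Suc N) = s ^ (N - 1) * (real N * norm x ^ N)"
          using True by (simp add: power_mult_distrib pw)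
        then have "ennreal (s ^ N) * ennreal (real N * (s * norm x) ^ N / s ^ Suc N)
            = ennreal (s ^ (N - 1)) * ennreal (real N * norm x ^ N)"
          using True by (simp add: ennreal_mult[symmetric])
        then show "ennreal (\<bar>s\<bar> ^ N) * (ennreal (real N * norm (0 + s *\<^sub>R x) ^ N / s ^ Suc N) * indicator {norm (0 + s *\<^sub>R x)..} s * (indicator (- {0}) (0 + s *\<^sub>R x) * f (0 + s *\<^sub>R x)))
          = ?p s * (ennreal (s ^ (N - 1)) * (ennreal (real N * norm x ^ N) * ?i x * f (s *\<^sub>R x)))"
          using True by (cases "x = 0"; cases "norm x \<le> 1") (auto simp: mult.assoc[symmetric] indicator_def)
      qed
      finally show ?thesis ..
    next
      case False
      then have "ennreal (real N * norm y ^ N / s ^ Suc N) * indicator {norm y..} s * (indicator (- {0}) y * f y) = 0" for y :: 'a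
      proof (cases "y = 0")
        case False
        then have "\<not> norm y \<le> s"
          using \<open>\<not> 0 < s\<close> zero_less_norm_iff[of y] by linarith
        then show ?thesis by (simp add: indicator_def)
      qed simp
      then have "(\<integral>\<^sup>+y. ennreal (real N * norm y ^ N / s ^ Suc N) * indicator {norm y..} s * (indicator (- {0}) y * f y) \<partial>lborel)
          = (\<integral>\<^sup>+y. 0 \<partial>(lborel :: 'a measure))"
        by (intro nn_integral_cong)
      then show ?thesis using False by simp
    qed
  qed
  also have "\<dots> = (\<integral>\<^sup>+y. (\<integral>\<^sup>+s. ennreal (real N * norm y ^ N / s ^ Suc N) * indicator {norm y..} s * (indicator (- {0}) y * f y) \<partial>lborel) \<partial>lborel)"
  proof (rule lborel_pair.Fubini')
    have [measurable]: "(\<lambda>x. indicator {norm (fst x)..} (snd x) :: ennreal) \<in> borel_measurable ((lborel :: 'a measure) \<Otimes>\<^sub>M (lborel :: real measure))"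
      unfolding indicator_def atLeast_iff by measurable
    have "(\<lambda>y. indicator (- {0}) y * f y) \<in> borel_measurable lborel"
      by (intro borel_measurable_times_ennreal) auto
    from measurable_compose[OF measurable_fst this]
    have [measurable]: "(\<lambda>x. indicator (- {0}) (fst x) * f (fst x)) \<in> borel_measurable (lborel \<Otimes>\<^sub>M (lborel :: real measure))" .
    show "(\<lambda>(y, s). ennreal (real N * norm y ^ N / s ^ Suc N) * indicator {norm y..} s * (indicator (- {0}) y * f y))
        \<in> borel_measurable ((lborel :: 'a measure) \<Otimes>\<^sub>M (lborel :: real measure))"
      unfolding case_prod_beta by measurable
  qed
  also have "\<dots> = (\<integral>\<^sup>+y. indicator (- {0}) y * f y \<partial>lborel)"
  proof (rule nn_integral_cong)
    fix y :: 'a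
    show "(\<integral>\<^sup>+s. ennreal (real N * norm y ^ N / s ^ Suc N) * indicator {norm y..} s * (indicator (- {0}) y * f y) \<partial>lborel)
      = indicator (- {0}) y * f y"
      using N by (cases "y = 0") (auto simp: nn_integral_multc nn_integral_inverse_power simp del: power_Suc)
  qed
  also have "\<dots> = (\<integral>\<^sup>+y. f y \<partial>lborel)"
  proof (rule nn_integral_cong_AE)
    have "AE y in lborel. y \<notin> {0::'a}"
      by (rule AE_not_in) (auto intro: countable_imp_null_set_lborel)
    then show "AE y in lborel. indicator (- {0}) y * f y = f y"
      by eventually_elim simp
  qed
  finally show ?thesis by (simp add: N_def)
qed

section \<open>Gnomonic projection\<close>

text \<open>The slice of a pyramid at height \<open>t\<close> is its base scaled by
  \<open>t\<close>; this supplies the factor \<open>t ^ (N - 1)\<close> in its volume.\<close>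

lemma nn_integral_PiM_lborel_scale:
  fixes f :: "('i \<Rightarrow> real) \<Rightarrow> ennreal"
  assumes "finite I" "f \<in> borel_measurable (\<Pi>\<^sub>M i\<in>I. lborel)" "0 < c"
  shows "(\<integral>\<^sup>+x. f x \<partial>(\<Pi>\<^sub>M i\<in>I. lborel)) = ennreal (c ^ card I) * (\<integral>\<^sup>+x. f (\<lambda>i\<in>I. c * x i) \<partial>(\<Pi>\<^sub>M i\<in>I. lborel))"
  using assms(1,2)
proof (induction I arbitrary: f rule: finite_induct)
  case empty
  show ?case by (simp add: PiM_empty nn_integral_count_space_finite restrict_def)
next
  case (insert i I)
  interpret product_sigma_finite "\<lambda>_. lborel :: real measure" by standard
  interpret I: finite_product_sigma_finite "\<lambda>_. lborel :: real measure" I by standard (rule insert.hyps)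
  note [measurable] = insert.prems(1)
  have scale: "(\<lambda>x. \<lambda>i\<in>J. c * x i) \<in> (\<Pi>\<^sub>M i\<in>J. lborel) \<rightarrow>\<^sub>M (\<Pi>\<^sub>M i\<in>J. lborel)" for J :: "'i set"
    by measurable
  note [measurable] = scale[of I] scale[of "insert i I"]
  have m1: "(\<lambda>(t, x). f (x(i := t))) \<in> borel_measurable (lborel \<Otimes>\<^sub>M (\<Pi>\<^sub>M i\<in>I. lborel))"
    by measurable
  have m2: "(\<lambda>x. f (x(i := t))) \<in> borel_measurable (\<Pi>\<^sub>M i\<in>I. lborel)" for t
    by measurable
  have m3: "(\<lambda>t. \<integral>\<^sup>+x. f (x(i := t)) \<partial>(\<Pi>\<^sub>M i\<in>I. lborel)) \<in> borel_measurable borel"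
    using I.borel_measurable_nn_integral[OF m1] by simp
  have m4: "(\<lambda>(t, x). f ((\<lambda>j\<in>I. c * x j)(i := c * t))) \<in> borel_measurable (lborel \<Otimes>\<^sub>M (\<Pi>\<^sub>M i\<in>I. lborel))"
    by measurable
  have m5: "(\<lambda>t. \<integral>\<^sup>+x. f ((\<lambda>j\<in>I. c * x j)(i := c * t)) \<partial>(\<Pi>\<^sub>M i\<in>I. lborel)) \<in> borel_measurable lborel"
    using I.borel_measurable_nn_integral[OF m4] by simp
  have "(\<integral>\<^sup>+x. f x \<partial>(\<Pi>\<^sub>M i\<in>insert i I. lborel)) = (\<integral>\<^sup>+t. \<integral>\<^sup>+x. f (x(i := t)) \<partial>(\<Pi>\<^sub>M i\<in>I. lborel) \<partial>lborel)"
    using insert by (intro product_nn_integral_insert_rev) auto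
  also have "\<dots> = ennreal \<bar>c\<bar> * (\<integral>\<^sup>+t. \<integral>\<^sup>+x. f (x(i := 0 + c * t)) \<partial>(\<Pi>\<^sub>M i\<in>I. lborel) \<partial>lborel)"
    using m3 \<open>0 < c\<close> by (intro nn_integral_real_affine) auto
  also have "\<dots> = ennreal \<bar>c\<bar> * (\<integral>\<^sup>+t. ennreal (c ^ card I) * (\<integral>\<^sup>+x. f ((\<lambda>j\<in>I. c * x j)(i := c * t)) \<partial>(\<Pi>\<^sub>M i\<in>I. lborel)) \<partial>lborel)"
    using m2 by (subst insert.IH) auto
  also have "\<dots> = ennreal \<bar>c\<bar> * (ennreal (c ^ card I) * (\<integral>\<^sup>+t. \<integral>\<^sup>+x. f ((\<lambda>j\<in>I. c * x j)(i := c * t)) \<partial>(\<Pi>\<^sub>M i\<in>I. lborel) \<partial>lborel))"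
    using m5 by (subst nn_integral_cmult) auto
  also have "(\<integral>\<^sup>+t. \<integral>\<^sup>+x. f ((\<lambda>j\<in>I. c * x j)(i := c * t)) \<partial>(\<Pi>\<^sub>M i\<in>I. lborel) \<partial>lborel)
      = (\<integral>\<^sup>+t. \<integral>\<^sup>+x. f (\<lambda>j\<in>insert i I. c * (x(i := t)) j) \<partial>(\<Pi>\<^sub>M i\<in>I. lborel) \<partial>lborel)"
  proof -
    have "(\<lambda>j\<in>I. c * x j)(i := c * t) = (\<lambda>j\<in>insert i I. c * (x(i := t)) j)" for x t
      using insert.hyps by (auto simp: fun_eq_iff restrict_def)
    then show ?thesis by simp
  qed
  also have "\<dots> = (\<integral>\<^sup>+x. f (\<lambda>j\<in>insert i I. c * x j) \<partial>(\<Pi>\<^sub>M i\<in>insert i I. lborel))"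
    using insert by (intro product_nn_integral_insert_rev[symmetric]) auto
  finally have eq: "(\<integral>\<^sup>+x. f x \<partial>(\<Pi>\<^sub>M i\<in>insert i I. lborel)) = ennreal c * (ennreal (c ^ card I) *
      (\<integral>\<^sup>+x. f (\<lambda>j\<in>insert i I. c * x j) \<partial>(\<Pi>\<^sub>M i\<in>insert i I. lborel)))"
    using \<open>0 < c\<close> by (simp only: abs_of_pos)
  have "ennreal (c ^ card (insert i I)) = ennreal c * ennreal (c ^ card I)"
    using insert.hyps \<open>0 < c\<close> by (simp add: ennreal_mult)
  then show ?case unfolding eq by (simp only: mult.assoc)
qed

text \<open>Central projection from the tangent hyperplane at \<open>e\<close>, whose points are given by their coordinates
  in the remaining basis directions.  It turns cones into pyramids, whose volume is exactly computable.\<close>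

definition gnomonic :: "'a::euclidean_space \<Rightarrow> ('a \<Rightarrow> real) \<Rightarrow> 'a" where
  "gnomonic e y = e + (\<Sum>i\<in>Basis - {e}. y i *\<^sub>R i)"

lemma gnomonic_measurable [measurable]:
  "gnomonic e \<in> (\<Pi>\<^sub>M i\<in>Basis - {e}. lborel) \<rightarrow>\<^sub>M (borel :: 'a::euclidean_space measure)"
  unfolding gnomonic_def[abs_def] by measurable

lemma gnomonic_inner:
  assumes "e \<in> Basis" shows "gnomonic e y \<bullet> e = 1"
  using assms by (auto simp: gnomonic_def inner_add_left inner_sum_left inner_Basis intro!: sum.neutral)

lemma norm_gnomonic_diff:
  assumes "e \<in> Basis"
  shows "(norm (gnomonic e y - gnomonic e z))\<^sup>2 = (\<Sum>i\<in>Basis - {e}. (y i - z i)\<^sup>2)"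
proof -
  have "gnomonic e y - gnomonic e z = (\<Sum>i\<in>Basis - {e}. (y i - z i) *\<^sub>R i)"
    by (simp add: gnomonic_def scaleR_diff_left sum_subtractf)
  also have "(norm \<dots>)\<^sup>2 = (\<Sum>i\<in>Basis - {e}. (norm ((y i - z i) *\<^sub>R i))\<^sup>2)"
    by (rule norm_sum_Pythagorean) (auto simp: pairwise_def orthogonal_def inner_Basis)
  also have "\<dots> = (\<Sum>i\<in>Basis - {e}. (y i - z i)\<^sup>2)"
    by (intro sum.cong) auto
  finally show ?thesis .
qed

lemma norm_gnomonic_ge_1: "e \<in> Basis \<Longrightarrow> 1 \<le> norm (gnomonic e y)"
  using Basis_le_norm[of e "gnomonic e y"] by (simp add: gnomonic_inner)

text \<open>Cavalieri's principle along \<open>e\<close>: the slices contribute the integral of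
  \<open>t ^ (N - 1)\<close> up to \<open>\<tau>\<close>, which is \<open>\<tau> ^ N / N\<close>,
  and the factor \<open>N\<close> in the cone measure cancels the denominator.\<close>

lemma emeasure_pyramid:
  fixes e :: "'a::euclidean_space"
  assumes e: "e \<in> Basis" and [measurable]: "A \<in> sets borel" and \<tau>: "0 \<le> \<tau>"
  shows "ennreal (real DIM('a)) * emeasure lborel {x. 0 < x \<bullet> e \<and> x \<bullet> e \<le> \<tau> \<and> sgn x \<in> A}
    = ennreal (\<tau> ^ DIM('a)) * emeasure (\<Pi>\<^sub>M i\<in>Basis - {e}. lborel)
        {y \<in> space (\<Pi>\<^sub>M i\<in>Basis - {e}. lborel). sgn (gnomonic e y) \<in> A}"
proof -
  interpret product_sigma_finite "\<lambda>_. lborel :: real measure" by standard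
  define I where "I = Basis - {e}"
  have I: "finite I" "e \<notin> I" "insert e I = Basis" "card I = DIM('a) - 1"
    using e by (auto simp: I_def)
  define N where "N = DIM('a)"
  have N: "0 < N" by (simp add: N_def)
  define Q where "Q = {y \<in> space (\<Pi>\<^sub>M i\<in>I. lborel). sgn (gnomonic e y) \<in> A}"
  have [measurable]: "gnomonic e \<in> (\<Pi>\<^sub>M i\<in>I. lborel) \<rightarrow>\<^sub>M borel"
    unfolding I_def by measurable
  have Q[measurable]: "Q \<in> sets (\<Pi>\<^sub>M i\<in>I. lborel)" unfolding Q_def by measurable
  define P where "P = {x. 0 < x \<bullet> e \<and> x \<bullet> e \<le> \<tau> \<and> sgn x \<in> A}"
  have P[measurable]: "P \<in> sets borel" unfolding P_def by measurable
  have slice: "(\<integral>\<^sup>+x. indicator P (\<Sum>b\<in>Basis. (x(e := t)) b *\<^sub>R b) \<partial>(\<Pi>\<^sub>M i\<in>I. lborel))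
      = ennreal (t ^ (N - 1)) * emeasure (\<Pi>\<^sub>M i\<in>I. lborel) Q * indicator {0<..\<tau>} t" for t
  proof (cases "0 < t \<and> t \<le> \<tau>")
    case True
    have *: "indicator P (\<Sum>b\<in>Basis. ((\<lambda>i\<in>I. t * y i)(e := t)) b *\<^sub>R b) = (indicator Q y :: ennreal)"
      if y: "y \<in> space (\<Pi>\<^sub>M i\<in>I. lborel)" for y
    proof -
      have "(\<Sum>b\<in>Basis. ((\<lambda>i\<in>I. t * y i)(e := t)) b *\<^sub>R b) = t *\<^sub>R e + (\<Sum>b\<in>I. ((\<lambda>i\<in>I. t * y i)(e := t)) b *\<^sub>R b)"
        using sum.insert[OF I(1,2), of "\<lambda>b. ((\<lambda>i\<in>I. t * y i)(e := t)) b *\<^sub>R b"]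
        unfolding I(3) by (simp only: fun_upd_same)
      also have "(\<Sum>b\<in>I. ((\<lambda>i\<in>I. t * y i)(e := t)) b *\<^sub>R b) = (\<Sum>b\<in>I. t *\<^sub>R y b *\<^sub>R b)"
        using I by (intro sum.cong) auto
      also have "t *\<^sub>R e + \<dots> = t *\<^sub>R gnomonic e y"
        by (simp add: gnomonic_def I_def scaleR_add_right scaleR_sum_right)
      finally have eq: "(\<Sum>b\<in>Basis. ((\<lambda>i\<in>I. t * y i)(e := t)) b *\<^sub>R b) = t *\<^sub>R gnomonic e y" .
      show ?thesis
        unfolding eq using True y e by (simp add: P_def Q_def indicator_def gnomonic_inner sgn_scaleR)
    qed
    have mf: "(\<lambda>x. indicator P (\<Sum>b\<in>Basis. (x(e := t)) b *\<^sub>R b) :: ennreal) \<in> borel_measurable (\<Pi>\<^sub>M i\<in>I. lborel)"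
    proof -
      have "(\<lambda>x. (x(e := t)) b) \<in> borel_measurable (\<Pi>\<^sub>M i\<in>I. lborel)" if "b \<in> Basis" for b
        using that I by (cases "b = e") (auto intro!: measurable_component_singleton[of b I "\<lambda>_. lborel", simplified])
      then have [measurable]: "(\<lambda>x. (\<Sum>b\<in>Basis. (x(e := t)) b *\<^sub>R b) :: 'a) \<in> borel_measurable (\<Pi>\<^sub>M i\<in>I. lborel)"
        by (intro borel_measurable_sum borel_measurable_scaleR) auto
      show ?thesis by measurable
    qed
    have "(\<integral>\<^sup>+x. indicator P (\<Sum>b\<in>Basis. (x(e := t)) b *\<^sub>R b) \<partial>(\<Pi>\<^sub>M i\<in>I. lborel))
      = ennreal (t ^ card I) * (\<integral>\<^sup>+y. indicator P (\<Sum>b\<in>Basis. ((\<lambda>i\<in>I. t * y i)(e := t)) b *\<^sub>R b) \<partial>(\<Pi>\<^sub>M i\<in>I. lborel))"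
      using True by (intro nn_integral_PiM_lborel_scale I mf) auto
    also have "(\<integral>\<^sup>+y. indicator P (\<Sum>b\<in>Basis. ((\<lambda>i\<in>I. t * y i)(e := t)) b *\<^sub>R b) \<partial>(\<Pi>\<^sub>M i\<in>I. lborel))
      = (\<integral>\<^sup>+y. indicator Q y \<partial>(\<Pi>\<^sub>M i\<in>I. lborel))"
      by (rule nn_integral_cong) (rule *)
    finally show ?thesis using True I by (simp add: N_def)
  next
    case False
    have "(\<Sum>b\<in>Basis. (x(e := t)) b *\<^sub>R b) \<bullet> e = t" for x
      using e by simp
    then show ?thesis using False by (auto simp: P_def indicator_def)
  qed
  have "emeasure lborel P = (\<integral>\<^sup>+x. indicator P (\<Sum>b\<in>Basis. x b *\<^sub>R b) \<partial>(\<Pi>\<^sub>M i\<in>Basis. lborel))"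
  proof -
    have "emeasure lborel P = (\<integral>\<^sup>+x. indicator P x \<partial>distr (\<Pi>\<^sub>M b\<in>Basis. lborel) borel (\<lambda>f. \<Sum>b\<in>Basis. f b *\<^sub>R b))"
      by (simp flip: lborel_eq)
    then show ?thesis by (subst (asm) nn_integral_distr) auto
  qed
  also have "\<dots> = (\<integral>\<^sup>+t. (\<integral>\<^sup>+x. indicator P (\<Sum>b\<in>Basis. (x(e := t)) b *\<^sub>R b) \<partial>(\<Pi>\<^sub>M i\<in>I. lborel)) \<partial>lborel)"
    unfolding I(3)[symmetric] using I(1,2) by (intro product_nn_integral_insert_rev) (simp_all add: I(3))
  also have "\<dots> = (\<integral>\<^sup>+t. ennreal (t ^ (N - 1)) * indicator {0<..\<tau>} t * emeasure (\<Pi>\<^sub>M i\<in>I. lborel) Q \<partial>lborel)"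
    unfolding slice by (simp add: mult_ac)
  also have "\<dots> = (\<integral>\<^sup>+t. ennreal (t ^ (N - 1)) * indicator {0<..\<tau>} t \<partial>lborel) * emeasure (\<Pi>\<^sub>M i\<in>I. lborel) Q"
    by (rule nn_integral_multc) measurable
  also have "(\<integral>\<^sup>+t. ennreal (t ^ (N - 1)) * indicator {0<..\<tau>} t \<partial>lborel)
      = (\<integral>\<^sup>+t. ennreal (t ^ (N - 1)) * indicator {0..\<tau>} t \<partial>lborel)"
  proof (rule nn_integral_cong_AE)
    have "AE t in lborel. t \<notin> {0::real}"
      by (rule AE_not_in) (auto intro: countable_imp_null_set_lborel)
    then show "AE t in lborel. ennreal (t ^ (N - 1)) * indicator {0<..\<tau>} t = ennreal (t ^ (N - 1)) * indicator {0..\<tau>} t"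
      by eventually_elim (simp add: indicator_def)
  qed
  also have "\<dots> = ennreal (\<tau> ^ N / N)"
  proof -
    have "((\<lambda>t. t ^ N / N) has_real_derivative x ^ (N - 1)) (at x)" for x :: real
      using N by (auto intro!: derivative_eq_intros)
    then have "(\<integral>\<^sup>+t. ennreal (t ^ (N - 1)) * indicator {0..\<tau>} t \<partial>lborel) = \<tau> ^ N / N - 0 ^ N / N"
      using \<tau> by (intro nn_integral_FTC_Icc) (auto intro: DERIV_subset)
    then show ?thesis using N by (simp add: zero_power)
  qed
  finally have "ennreal (real N) * emeasure lborel P
      = (ennreal (real N) * ennreal (\<tau> ^ N / N)) * emeasure (\<Pi>\<^sub>M i\<in>I. lborel) Q"
    by (simp add: mult.assoc)
  also have "ennreal (real N) * ennreal (\<tau> ^ N / N) = ennreal (\<tau> ^ N)"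
    using N \<tau> by (subst ennreal_mult[symmetric]) auto
  finally show ?thesis by (simp add: N_def P_def Q_def I_def)
qed

text \<open>The part of the unit ball on rays through \<open>A\<close> lies between the pyramids of
  heights \<open>c\<close> and 1: there \<open>x \<bullet> e \<le> norm x \<le> 1\<close>, and
  conversely \<open>norm x * c \<le> x \<bullet> e \<le> c\<close> forces
  \<open>norm x \<le> 1\<close>. The discrepancy \<open>c ^ DIM('a)\<close> tends to 1 for small
  caps around \<open>e\<close>.\<close>

lemma cone_measure_gnomonic:
  fixes e :: "'a::euclidean_space"
  assumes e: "e \<in> Basis" and [measurable]: "A \<in> sets borel"
    and c: "0 < c" and A: "\<And>a. a \<in> A \<Longrightarrow> norm a = 1 \<and> c \<le> a \<bullet> e"
  defines "Q \<equiv> {y \<in> space (\<Pi>\<^sub>M i\<in>Basis - {e}. lborel). sgn (gnomonic e y) \<in> A}"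
  shows "emeasure cone_measure A \<le> emeasure (\<Pi>\<^sub>M i\<in>Basis - {e}. lborel) Q"
    and "ennreal (c ^ DIM('a)) * emeasure (\<Pi>\<^sub>M i\<in>Basis - {e}. lborel) Q \<le> emeasure cone_measure A"
proof -
  let ?P = "\<lambda>\<tau>. {x. 0 < x \<bullet> e \<and> x \<bullet> e \<le> \<tau> \<and> sgn x \<in> A}"
  have [measurable]: "?P \<tau> \<in> sets borel" for \<tau> by measurable
  have [measurable]: "{x \<in> cball 0 1 - {0}. sgn x \<in> A} \<in> sets borel"
  proof -
    have "{x \<in> cball 0 1 - {0}. sgn x \<in> A} = (cball 0 1 - {0}) \<inter> (sgn -` A \<inter> space borel)" by auto
    also have "\<dots> \<in> sets borel" by (intro sets.Int measurable_sets[of sgn borel borel]) auto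
    finally show ?thesis .
  qed
  have inner: "norm x * c \<le> x \<bullet> e" if "sgn x \<in> A" for x
  proof -
    have "x \<noteq> 0" using A[OF that] by auto
    have "x \<bullet> e = norm x * (sgn x \<bullet> e)" using \<open>x \<noteq> 0\<close> by (simp add: sgn_div_norm)
    then show ?thesis using A[OF that] by (simp add: mult_left_mono)
  qed
  have "{x \<in> cball 0 1 - {0}. sgn x \<in> A} \<subseteq> ?P 1"
  proof safe
    fix x assume x: "x \<in> cball 0 1" "x \<noteq> 0" "sgn x \<in> A"
    have "0 < norm x * c" using c x by simp
    then show "0 < x \<bullet> e" using inner[OF x(3)] by linarith
    show "x \<bullet> e \<le> 1" using Basis_le_norm[OF e, of x] x by simp
  qed
  then have "emeasure cone_measure A \<le> ennreal (real DIM('a)) * emeasure lborel (?P 1)"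
    unfolding emeasure_cone_measure[OF assms(2)] by (intro mult_left_mono emeasure_mono) auto
  also have "\<dots> = emeasure (\<Pi>\<^sub>M i\<in>Basis - {e}. lborel) Q"
    using emeasure_pyramid[OF e assms(2), of 1] by (simp add: Q_def)
  finally show "emeasure cone_measure A \<le> emeasure (\<Pi>\<^sub>M i\<in>Basis - {e}. lborel) Q" .
  have "?P c \<subseteq> {x \<in> cball 0 1 - {0}. sgn x \<in> A}"
  proof safe
    fix x assume x: "0 < x \<bullet> e" "x \<bullet> e \<le> c" "sgn x \<in> A"
    have "norm x * c \<le> 1 * c" using inner[OF x(3)] x by linarith
    then have "norm x \<le> 1" using c by (simp only: mult_le_cancel_right_pos)
    then show "x \<in> cball 0 1" by simp
  qed auto
  then have "ennreal (real DIM('a)) * emeasure lborel (?P c) \<le> emeasure cone_measure A"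
    unfolding emeasure_cone_measure[OF assms(2)] by (intro mult_left_mono emeasure_mono) auto
  then show "ennreal (c ^ DIM('a)) * emeasure (\<Pi>\<^sub>M i\<in>Basis - {e}. lborel) Q \<le> emeasure cone_measure A"
    using emeasure_pyramid[OF e assms(2), of c] c by (simp add: Q_def)
qed

text \<open>\<open>a /\<^sub>R (a \<bullet> e)\<close> is the point of the tangent hyperplane on the
  ray through \<open>a\<close>. The difference of two such points is the tangential part of
  \<open>a - b\<close>, rescaled, plus a correction along the tangential part of \<open>b\<close>,
  whose norm is at most \<open>sqrt (1 - c\<^sup>2)\<close>. The resulting constant tends to 1 as
  \<open>c\<close> does.\<close>

lemma gnomonic_lipschitz:
  fixes a b e :: "'a::real_inner"
  assumes "norm a = 1" "norm b = 1" "norm e = 1" and c: "0 < c" "c \<le> a \<bullet> e" "c \<le> b \<bullet> e"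
  shows "norm (a /\<^sub>R (a \<bullet> e) - b /\<^sub>R (b \<bullet> e)) \<le> (1 / c + sqrt (1 - c\<^sup>2) / c\<^sup>2) * norm (a - b)"
proof -
  define s where "s = a \<bullet> e"
  define t where "t = b \<bullet> e"
  define b' where "b' = b - t *\<^sub>R e"
  have st: "0 < s" "0 < t" "c \<le> s" "c \<le> t" using c by (auto simp: s_def t_def)
  have ee: "e \<bullet> e = 1" using assms by (simp add: dot_square_norm)
  have bb: "b \<bullet> b = 1" using assms by (simp add: dot_square_norm)
  have "a /\<^sub>R s - b /\<^sub>R t = inverse s *\<^sub>R ((a - b) - (s - t) *\<^sub>R e) + ((t - s) / (s * t)) *\<^sub>R b'"
  proof -
    have "(t - s) / (s * t) = inverse s - inverse t" using st by (simp add: field_simps)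
    moreover have "inverse s *\<^sub>R ((a - b) - (s - t) *\<^sub>R e) + (inverse s - inverse t) *\<^sub>R (b - t *\<^sub>R e)
        = inverse s *\<^sub>R a - inverse t *\<^sub>R b - (inverse s * s - inverse t * t) *\<^sub>R e"
      by (simp add: algebra_simps)
    moreover have "inverse s * s - inverse t * t = 0" using st by simp
    ultimately show ?thesis by (simp add: b'_def)
  qed
  then have "norm (a /\<^sub>R s - b /\<^sub>R t) \<le> inverse s * norm ((a - b) - (s - t) *\<^sub>R e) + \<bar>t - s\<bar> / (s * t) * norm b'"
    using st by (simp add: order_trans[OF norm_triangle_ineq])
  also have "\<dots> \<le> inverse c * norm (a - b) + norm (a - b) / (c * c) * sqrt (1 - c\<^sup>2)"
  proof (intro add_mono mult_mono frac_le)
    have *: "(d - (d \<bullet> e) *\<^sub>R e) \<bullet> (d - (d \<bullet> e) *\<^sub>R e) = d \<bullet> d - (d \<bullet> e)\<^sup>2" for d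
      by (simp add: inner_diff_left inner_diff_right inner_commute ee power2_eq_square)
    have "(norm ((a - b) - (s - t) *\<^sub>R e))\<^sup>2 = (norm (a - b))\<^sup>2 - (s - t)\<^sup>2"
      using *[of "a - b"] unfolding power2_norm_eq_inner s_def t_def inner_diff_left[of a b e] .
    then show "norm ((a - b) - (s - t) *\<^sub>R e) \<le> norm (a - b)"
      by (intro power2_le_imp_le[OF _ norm_ge_zero]) simp
    have "\<bar>t - s\<bar> = \<bar>(b - a) \<bullet> e\<bar>" by (simp add: s_def t_def inner_diff_left)
    also have "\<dots> \<le> norm (b - a) * norm e" by (rule Cauchy_Schwarz_ineq2)
    finally show "\<bar>t - s\<bar> \<le> norm (a - b)" using assms by (simp add: norm_minus_commute)
    have "(norm b')\<^sup>2 = 1 - t\<^sup>2"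
      using *[of b] bb unfolding power2_norm_eq_inner b'_def t_def by simp
    also have "\<dots> \<le> 1 - c\<^sup>2" using st c by (simp add: power_mono)
    finally show "norm b' \<le> sqrt (1 - c\<^sup>2)" by (rule real_le_rsqrt)
    show "inverse s \<le> inverse c" using st c by simp
  qed (use st c in auto)
  finally show ?thesis by (simp add: s_def t_def divide_inverse algebra_simps power2_eq_square)
qed

text \<open>In the tangent hyperplane diameters exceed those on the sphere at most by the Lipschitz
  factor, and there the isodiametric inequality is available.\<close>

lemma cone_measure_isodiametric_axis:
  fixes e :: "'a::euclidean_space"
  assumes e: "e \<in> Basis" and A: "A \<in> sets borel"
    and c: "0 < c" "c \<le> 1" and An: "\<And>a. a \<in> A \<Longrightarrow> norm a = 1 \<and> c \<le> a \<bullet> e"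
    and D: "0 \<le> D" "\<And>a b. a \<in> A \<Longrightarrow> b \<in> A \<Longrightarrow> norm (a - b) \<le> D"
  shows "emeasure cone_measure A \<le> ennreal (unit_ball_vol (real (DIM('a) - 1)) *
     ((1 / c + sqrt (1 - c\<^sup>2) / c\<^sup>2) * D / 2) ^ (DIM('a) - 1))"
proof -
  let ?L = "1 / c + sqrt (1 - c\<^sup>2) / c\<^sup>2"
  define Q where "Q = {y \<in> space (\<Pi>\<^sub>M i\<in>Basis - {e}. lborel). sgn (gnomonic e y) \<in> A}"
  have c2: "c\<^sup>2 \<le> 1" using c by (simp add: power_le_one)
  have Lpos: "0 \<le> ?L" using c c2 by auto
  have sg: "gnomonic e y = sgn (gnomonic e y) /\<^sub>R (sgn (gnomonic e y) \<bullet> e)" for y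
  proof -
    have "gnomonic e y \<noteq> 0" using norm_gnomonic_ge_1[OF e, of y] by auto
    then show ?thesis by (simp add: sgn_div_norm gnomonic_inner[OF e])
  qed
  have "emeasure cone_measure A \<le> emeasure (\<Pi>\<^sub>M i\<in>Basis - {e}. lborel) Q"
    unfolding Q_def by (rule cone_measure_gnomonic[OF e A c(1) An])
  also have "\<dots> \<le> ennreal (unit_ball_vol (real (card (Basis - {e}))) * (?L * D / 2) ^ card (Basis - {e}))"
  proof (rule isodiametric_PiM)
    show "Q \<in> sets (\<Pi>\<^sub>M i\<in>Basis - {e}. lborel)"
      unfolding Q_def using A by measurable
    show "0 \<le> ?L * D" using Lpos D by simp
    fix y z assume yz: "y \<in> Q" "z \<in> Q"
    let ?a = "sgn (gnomonic e y)" and ?b = "sgn (gnomonic e z)"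
    have "norm (gnomonic e y - gnomonic e z) = norm (?a /\<^sub>R (?a \<bullet> e) - ?b /\<^sub>R (?b \<bullet> e))"
      using sg by metis
    also have "\<dots> \<le> ?L * norm (?a - ?b)"
      using yz An e c by (intro gnomonic_lipschitz) (auto simp: Q_def)
    also have "\<dots> \<le> ?L * D"
      using yz by (intro mult_left_mono D Lpos) (auto simp: Q_def)
    finally have "(norm (gnomonic e y - gnomonic e z))\<^sup>2 \<le> (?L * D)\<^sup>2" by (intro power_mono) auto
    then show "(\<Sum>i\<in>Basis - {e}. (y i - z i)\<^sup>2) \<le> (?L * D)\<^sup>2" by (simp add: norm_gnomonic_diff[OF e])
  qed auto
  finally show ?thesis using e by simp
qed

text \<open>Origin of the constant \<open>1 - r\<^sup>2 / 2\<close>: it is the least height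
  \<open>a \<bullet> e\<close> of a unit vector \<open>a\<close> within distance \<open>r\<close> of
  the pole \<open>e\<close>.\<close>

lemma norm_diff_unit:
  fixes a e :: "'a::real_inner"
  assumes "norm a = 1" "norm e = 1"
  shows "(norm (a - e))\<^sup>2 = 2 - 2 * (a \<bullet> e)"
proof -
  have "a \<bullet> a = 1" "e \<bullet> e = 1" using assms by (simp_all add: dot_square_norm)
  then show ?thesis
    unfolding power2_norm_eq_inner by (simp add: inner_diff_left inner_diff_right inner_commute)
qed

text \<open>Radial projection from the tangent hyperplane to the sphere does not increase the
  distance from \<open>e\<close>, so the flat ball of radius \<open>r\<close> projects into the cap
  of the same radius.\<close>

lemma cone_measure_cap_axis:
  fixes e :: "'a::euclidean_space"
  assumes e: "e \<in> Basis" and r: "0 < r" "r \<le> 1"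
  shows "ennreal ((1 - r\<^sup>2 / 2) ^ DIM('a)) * ennreal (unit_ball_vol (real (DIM('a) - 1)) * r ^ (DIM('a) - 1))
    \<le> emeasure cone_measure (sphere 0 1 \<inter> cball e r)"
proof -
  define A where "A = sphere 0 1 \<inter> cball e r"
  define Q where "Q = {y \<in> space (\<Pi>\<^sub>M i\<in>Basis - {e}. lborel). sgn (gnomonic e y) \<in> A}"
  have A: "A \<in> sets borel" by (auto simp: A_def)
  have r2: "r\<^sup>2 \<le> 1" using r by (simp add: power_le_one)
  have c: "0 < 1 - r\<^sup>2 / 2" using r2 by simp
  have An: "norm a = 1 \<and> 1 - r\<^sup>2 / 2 \<le> a \<bullet> e" if "a \<in> A" for a
  proof -
    have "norm a = 1" "norm (a - e) \<le> r" using that by (auto simp: A_def dist_norm norm_minus_commute)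
    moreover have "(norm (a - e))\<^sup>2 \<le> r\<^sup>2" using calculation by (intro power_mono) auto
    ultimately show ?thesis using norm_diff_unit[of a e] e by simp
  qed
  let ?B = "{f. sqrt (\<Sum>i\<in>Basis - {e}. (f i)\<^sup>2) \<le> r} \<inter> space (\<Pi>\<^sub>M i\<in>Basis - {e}. lborel)"
  have "?B \<subseteq> Q"
  proof
    fix y assume y: "y \<in> ?B"
    define s where "s = (\<Sum>i\<in>Basis - {e}. (y i)\<^sup>2)"
    have s: "0 \<le> s" "s \<le> r\<^sup>2" using y r by (auto simp: s_def sum_nonneg real_sqrt_le_iff')
    have "gnomonic e (\<lambda>_. 0) = e" by (simp add: gnomonic_def)
    then have "(norm (gnomonic e y - e))\<^sup>2 = s"
      using norm_gnomonic_diff[OF e, of y "\<lambda>_. 0"] by (simp add: s_def)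
    moreover have "(norm (gnomonic e y - e))\<^sup>2 = (norm (gnomonic e y))\<^sup>2 - 1"
      using gnomonic_inner[OF e, of y] e
      by (simp add: power2_norm_eq_inner inner_diff_left inner_diff_right inner_commute)
    ultimately have n2: "(norm (gnomonic e y))\<^sup>2 = 1 + s" by simp
    define n where "n = norm (gnomonic e y)"
    have n: "1 \<le> n" "n * n = 1 + s" using norm_gnomonic_ge_1[OF e, of y] n2 by (auto simp: n_def power2_eq_square)
    have "sgn (gnomonic e y) \<bullet> e = 1 / n"
      by (simp add: n_def sgn_div_norm gnomonic_inner[OF e] divide_inverse)
    moreover have ns: "norm (sgn (gnomonic e y)) = 1" using n by (auto simp: norm_sgn n_def)
    ultimately have "(norm (sgn (gnomonic e y) - e))\<^sup>2 = 2 - 2 / n"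
      using e by (subst norm_diff_unit) auto
    also have "\<dots> \<le> s"
    proof -
      \<comment> \<open>With \<open>s = n * n - 1\<close> the numerator
        \<open>n ^ 3 - 3 * n + 2\<close> has the factor \<open>n - 1\<close>, and the cofactor is
        nonnegative for \<open>n \<ge> 1\<close>.\<close>
      have "s - (2 - 2 / n) = (n - 1) * (n * n + n - 2) / n"
        using n by (simp add: field_simps)
      moreover have "0 \<le> n * n + n - 2" using n mult_mono[of 1 n 1 n] by simp
      ultimately have "0 \<le> s - (2 - 2 / n)" using n by simp
      then show ?thesis by simp
    qed
    finally have "(norm (sgn (gnomonic e y) - e))\<^sup>2 \<le> r\<^sup>2" using s by simp
    then have "norm (sgn (gnomonic e y) - e) \<le> r" by (rule power2_le_imp_le) (use r in simp)
    then show "y \<in> Q" using y ns by (auto simp: Q_def A_def dist_norm norm_minus_commute)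
  qed
  then have "emeasure (\<Pi>\<^sub>M i\<in>Basis - {e}. lborel) ?B \<le> emeasure (\<Pi>\<^sub>M i\<in>Basis - {e}. lborel) Q"
  proof (rule emeasure_mono)
    show "Q \<in> sets (\<Pi>\<^sub>M i\<in>Basis - {e}. lborel)"
      unfolding Q_def using A by measurable
  qed
  then have "ennreal (unit_ball_vol (real (card (Basis - {e}))) * r ^ card (Basis - {e}))
      \<le> emeasure (\<Pi>\<^sub>M i\<in>Basis - {e}. lborel) Q"
    using r by (subst (asm) emeasure_cball_aux) auto
  then have "ennreal ((1 - r\<^sup>2 / 2) ^ DIM('a)) * ennreal (unit_ball_vol (real (DIM('a) - 1)) * r ^ (DIM('a) - 1))
    \<le> ennreal ((1 - r\<^sup>2 / 2) ^ DIM('a)) * emeasure (\<Pi>\<^sub>M i\<in>Basis - {e}. lborel) Q"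
    using e by (intro mult_left_mono) auto
  also have "\<dots> \<le> emeasure cone_measure A"
    unfolding Q_def by (rule cone_measure_gnomonic[OF e A c An])
  finally show ?thesis by (simp add: A_def)
qed

section \<open>Hausdorff measure on the sphere\<close>

text \<open>The library proves this for matrices over a well-ordered index type only.  Here an open set is
  filled, up to a null set, by disjoint balls, whose volumes are visibly preserved.\<close>

lemma emeasure_lborel_orthogonal_vimage:
  fixes T :: "'a::euclidean_space \<Rightarrow> 'a"
  assumes T: "orthogonal_transformation T" and B: "B \<in> sets borel"
  shows "emeasure lborel (T -` B) = emeasure lborel B"
proof -
  have lin: "linear T" using T by (rule orthogonal_transformation_linear)
  have nT: "norm (T x) = norm x" for x using T by (rule orthogonal_transformation_norm)
  have inj: "inj T" using T by (rule orthogonal_transformation_inj)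
  have surj: "surj T" using T by (rule orthogonal_transformation_surj)
  have dT: "dist (T x) (T y) = dist x y" for x y
    using nT[of "x - y"] lin by (simp add: dist_norm linear_diff)
  have Tm[measurable]: "T \<in> borel_measurable borel"
    using lin by (intro borel_measurable_continuous_onI linear_continuous_on linear_conv_bounded_linear[THEN iffD1])
  have im: "T -` X = inv T ` X" for X
    using inj surj by (simp add: bij_vimage_eq_inv_image bij_def)
  have linI: "linear (inv T)"
    using T orthogonal_transformation_inv orthogonal_transformation_linear by blast
  have ball: "emeasure lborel (T -` cball c r) = emeasure lborel (cball c r)" if "0 \<le> r" for c r
  proof -
    obtain c' where c': "T c' = c" using surj by (metis surjD)
    have "T -` cball c r = cball c' r" using dT c' by (metis (no_types, opaque_lifting) mem_cball subsetI subset_antisym vimage_eq)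
    then show ?thesis using that by (simp add: emeasure_cball)
  qed
  have op: "emeasure lborel (T -` U) = emeasure lborel U" if U: "open U" for U
  proof -
    define K where "K = {(x, s). 0 < s \<and> cball x s \<subseteq> U}"
    obtain C where C: "countable C" "C \<subseteq> K"
      "pairwise (\<lambda>i j. disjnt (cball (fst i) (snd i)) (cball (fst j) (snd j))) C"
      "negligible (U - (\<Union>i\<in>C. cball (fst i) (snd i)))"
    proof (rule Vitali_covering_theorem_cballs[of K snd U fst])
      show "0 < snd i" if "i \<in> K" for i using that by (auto simp: K_def)
      fix x d :: real and y assume "y \<in> U" "0 < d"
      then obtain s where s: "0 < s" "cball y s \<subseteq> U" using U by (auto simp: open_contains_cball)
      have "cball y (min s (d / 2)) \<subseteq> cball y s" by auto
      then show "\<exists>i. i \<in> K \<and> y \<in> cball (fst i) (snd i) \<and> snd i < d"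
        using s \<open>0 < d\<close> by (intro exI[of _ "(y, min s (d / 2))"]) (auto simp: K_def)
    qed
    let ?W = "\<Union>i\<in>C. cball (fst i) (snd i)"
    have W: "?W \<in> sets borel" using C(1) by (intro sets.countable_UN') auto
    have "cball (fst i) (snd i) \<subseteq> U" if "i \<in> C" for i
      using subsetD[OF C(2) that] by (simp add: K_def case_prod_beta)
    then have WU: "?W \<subseteq> U" by (rule UN_least)
    have Ub: "U \<in> sets borel" using U by simp
    have null: "emeasure lborel X = 0" if "negligible X" "X \<in> sets borel" for X :: "'a set"
      using that by (simp add: negligible_iff_emeasure0)
    have TUb: "T -` X \<in> sets borel" if "X \<in> sets borel" for X
      using measurable_sets_borel[OF Tm that] by simp
    have split: "emeasure lborel X = emeasure lborel Y" if "Y \<subseteq> X" "negligible (X - Y)" "X \<in> sets borel" "Y \<in> sets borel" for X Y :: "'a set"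
    proof -
      have "emeasure lborel X = emeasure lborel Y + emeasure lborel (X - Y)"
        using that by (subst plus_emeasure) (auto intro!: arg_cong2[where f = emeasure])
      then show ?thesis using null[OF that(2)] that by simp
    qed
    have disj: "disjoint_family_on (\<lambda>i. cball (fst i) (snd i)) C"
      using C(3) unfolding disjoint_family_on_def pairwise_def disjnt_def by blast
    have "emeasure lborel (T -` U) = emeasure lborel (T -` ?W)"
    proof (rule split)
      \<comment> \<open>The part of \<open>U\<close> not filled by balls stays null, being mapped by
        the linear inverse of \<open>T\<close>.\<close>
      have "negligible (inv T ` (U - ?W))"
        using linI C(4) by (intro negligible_differentiable_image_negligible linear_imp_differentiable_on) auto
      then show "negligible (T -` U - T -` ?W)"
        by (simp add: im[symmetric] vimage_Diff)
    qed (use WU W Ub TUb in auto)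
    also have "T -` ?W = (\<Union>i\<in>C. T -` cball (fst i) (snd i))" by auto
    also have "emeasure lborel \<dots> = (\<integral>\<^sup>+i. emeasure lborel (T -` cball (fst i) (snd i)) \<partial>count_space C)"
    proof (rule emeasure_UN_countable)
      show "T -` cball (fst i) (snd i) \<in> sets lborel" for i using TUb[of "cball (fst i) (snd i)"] by simp
      show "disjoint_family_on (\<lambda>i. T -` cball (fst i) (snd i)) C"
        using disj unfolding disjoint_family_on_def by blast
    qed (rule C(1))
    also have "\<dots> = (\<integral>\<^sup>+i. emeasure lborel (cball (fst i) (snd i)) \<partial>count_space C)"
      using C(2) by (intro nn_integral_cong ball) (auto simp: K_def)
    also have "\<dots> = emeasure lborel ?W"
      using C(1) disj by (intro emeasure_UN_countable[symmetric]) auto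
    also have "\<dots> = emeasure lborel U"
      using WU W Ub C(4) by (intro split[symmetric])
    finally show ?thesis .
  qed
  \<comment> \<open>Boxes are open and the values on boxes determine \<open>lborel\<close>, so the
    case of open sets suffices.\<close>
  have "lborel = distr lborel borel T"
  proof (rule lborel_eqI)
    fix l u :: 'a assume "\<And>b. b \<in> Basis \<Longrightarrow> l \<bullet> b \<le> u \<bullet> b"
    then show "emeasure (distr lborel borel T) (box l u) = ennreal (\<Prod>b\<in>Basis. (u - l) \<bullet> b)"
      using op[OF open_box, of l u] by (simp add: emeasure_distr emeasure_lborel_box)
  qed simp
  then have "emeasure lborel B = emeasure (distr lborel borel T) B" by simp
  then show ?thesis using B by (simp add: emeasure_distr)
qed

section \<open>Arbitrary poles and uniform bounds at small scales\<close>

text \<open>\<open>T\<close> commutes with \<open>sgn\<close> and preserves the unit ball, so it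
  maps the cones that define the measure onto each other.\<close>

lemma cone_measure_orthogonal_vimage:
  fixes T :: "real ^ 'n \<Rightarrow> real ^ 'n"
  assumes T: "orthogonal_transformation T" and A: "A \<in> sets borel"
  shows "T -` A \<in> sets borel" and "emeasure cone_measure (T -` A) = emeasure cone_measure A"
proof -
  have lin: "linear T" using T by (rule orthogonal_transformation_linear)
  have "T \<in> borel_measurable borel"
    using lin by (intro borel_measurable_continuous_onI linear_continuous_on linear_conv_bounded_linear[THEN iffD1])
  from measurable_sets_borel[OF this A] show TA: "T -` A \<in> sets borel" by simp
  have nT: "norm (T x) = norm x" for x using T by (rule orthogonal_transformation_norm)
  have sT: "sgn (T x) = T (sgn x)" for x
    using lin by (simp add: sgn_div_norm nT linear_cmul)
  have z: "T x = 0 \<longleftrightarrow> x = 0" for x using nT[of x] by (metis norm_eq_zero)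
  have "{x \<in> cball 0 1 - {0}. sgn x \<in> T -` A} = T -` {x \<in> cball 0 1 - {0}. sgn x \<in> A}"
    by (auto simp: nT sT z)
  moreover have "{x \<in> cball 0 1 - {0}. sgn x \<in> A} \<in> sets borel"
  proof -
    have "{x \<in> cball 0 1 - {0}. sgn x \<in> A} = (cball 0 1 - {0}) \<inter> (sgn -` A \<inter> space borel)" by auto
    also have "\<dots> \<in> sets borel" using A by (intro sets.Int measurable_sets[of sgn borel borel]) auto
    finally show ?thesis .
  qed
  ultimately show "emeasure cone_measure (T -` A) = emeasure cone_measure A"
    unfolding emeasure_cone_measure[OF A] emeasure_cone_measure[OF TA]
    by (simp only: emeasure_lborel_orthogonal_vimage[OF T])
qed

text \<open>Carries the estimates at a basis vector, where the tangent hyperplane has coordinates,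
  to any point of the sphere.\<close>

lemma obtain_orthogonal_from_Basis:
  fixes a :: "real ^ 'n"
  assumes "norm a = 1"
  obtains e :: "real ^ 'n" and T where "e \<in> Basis" "orthogonal_transformation T" "T e = a"
proof -
  obtain e :: "real ^ 'n" where e: "e \<in> Basis" using nonempty_Basis by blast
  then obtain T where "orthogonal_transformation T" "T e = a"
    using orthogonal_transformation_exists_1[of e a] assms by auto
  then show thesis using e that by blast
qed

text \<open>Any point of \<open>A\<close> can serve as the pole: all of \<open>A\<close> lies within
  distance \<open>D\<close> of it, hence at height at least
  \<open>1 - D\<^sup>2 / 2\<close>.\<close>

lemma cone_measure_isodiametric:
  fixes A :: "(real ^ 'n) set"
  assumes A: "A \<in> sets borel" "A \<subseteq> sphere 0 1"
    and D: "0 \<le> D" "D \<le> 1" "\<And>a b. a \<in> A \<Longrightarrow> b \<in> A \<Longrightarrow> norm (a - b) \<le> D"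
    and c: "c = 1 - D\<^sup>2 / 2"
  shows "emeasure cone_measure A \<le> ennreal (unit_ball_vol (real (CARD('n) - 1)) *
     ((1 / c + sqrt (1 - c\<^sup>2) / c\<^sup>2) * D / 2) ^ (CARD('n) - 1))"
proof (cases "A = {}")
  case False
  then obtain a where a: "a \<in> A" by auto
  then have na: "norm a = 1" using A by auto
  then obtain e :: "real ^ 'n" and T where e: "e \<in> Basis" and T: "orthogonal_transformation T" and Te: "T e = a"
    by (rule obtain_orthogonal_from_Basis)
  have D2: "D\<^sup>2 \<le> 1" using D by (simp add: power_le_one)
  have nT: "norm (T x) = norm x" for x using T by (rule orthogonal_transformation_norm)
  have lin: "linear T" using T by (rule orthogonal_transformation_linear)
  have "emeasure cone_measure (T -` A) \<le> ennreal (unit_ball_vol (real (DIM(real ^ 'n) - 1)) *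
     ((1 / c + sqrt (1 - c\<^sup>2) / c\<^sup>2) * D / 2) ^ (DIM(real ^ 'n) - 1))"
  proof (rule cone_measure_isodiametric_axis[OF e])
    show "T -` A \<in> sets borel" using T A(1) by (rule cone_measure_orthogonal_vimage)
    show "0 < c" "c \<le> 1" using D2 by (auto simp: c)
    fix x assume x: "x \<in> T -` A"
    have "x \<bullet> e = T x \<bullet> a" using T Te by (auto simp: orthogonal_transformation_def)
    moreover have nTx: "norm (T x) = 1" using x A by auto
    moreover have "norm (T x - a) \<le> D" using x a D by auto
    then have "(norm (T x - a))\<^sup>2 \<le> D\<^sup>2" by (intro power_mono) auto
    ultimately show "norm x = 1 \<and> c \<le> x \<bullet> e"
      using norm_diff_unit[OF nTx na] nT[of x] by (simp add: c)
  next
    fix x y assume "x \<in> T -` A" "y \<in> T -` A"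
    then have "norm (T x - T y) \<le> D" using D by auto
    then show "norm (x - y) \<le> D" using nT[of "x - y"] lin by (simp add: linear_diff)
  qed (use D in auto)
  then show ?thesis using cone_measure_orthogonal_vimage[OF T A(1)] by simp
qed simp

lemma cone_measure_cap:
  fixes a :: "real ^ 'n"
  assumes a: "norm a = 1" and r: "0 < r" "r \<le> 1"
  shows "ennreal ((1 - r\<^sup>2 / 2) ^ CARD('n)) * ennreal (unit_ball_vol (real (CARD('n) - 1)) * r ^ (CARD('n) - 1))
    \<le> emeasure cone_measure (sphere 0 1 \<inter> cball a r)"
proof -
  obtain e :: "real ^ 'n" and T where e: "e \<in> Basis" and T: "orthogonal_transformation T" and Te: "T e = a"
    using a by (rule obtain_orthogonal_from_Basis)
  have nT: "norm (T x) = norm x" for x using T by (rule orthogonal_transformation_norm)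
  have lin: "linear T" using T by (rule orthogonal_transformation_linear)
  have "T -` (sphere 0 1 \<inter> cball a r) = sphere 0 1 \<inter> cball e r"
  proof -
    have "dist a (T x) = dist e x" for x
      using nT[of "e - x"] lin Te by (simp add: dist_norm linear_diff)
    then show ?thesis by (auto simp: nT)
  qed
  moreover have "emeasure cone_measure (T -` (sphere 0 1 \<inter> cball a r)) = emeasure cone_measure (sphere 0 1 \<inter> cball a r)"
    using T by (intro cone_measure_orthogonal_vimage) auto
  ultimately show ?thesis using cone_measure_cap_axis[OF e r] by simp
qed

text \<open>The distortion constants tend to 1 with the diameter, so below some scale
  \<open>d\<close> they cost no more than the factor \<open>k\<close>. The two conclusions compare
  cone measure and Hausdorff weight in opposite directions: for arbitrary small sets, and for
  caps.\<close>

lemma cone_measure_asymp_bounds: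
  assumes k: "0 < k" "k < (1::real)"
  obtains d where "0 < d" "d \<le> 1"
    "\<forall>(A :: (real ^ 'n) set) D. A \<in> sets borel \<and> A \<subseteq> sphere 0 1 \<and> 0 \<le> D \<and> D \<le> d \<and>
       (\<forall>a\<in>A. \<forall>b\<in>A. norm (a - b) \<le> D) \<longrightarrow>
       ennreal k * emeasure cone_measure A \<le> ennreal (unit_ball_vol (real (CARD('n) - 1)) * (D / 2) ^ (CARD('n) - 1))"
    "\<forall>(a :: real ^ 'n) r. norm a = 1 \<and> 0 < r \<and> r \<le> d \<longrightarrow>
       ennreal k * ennreal (unit_ball_vol (real (CARD('n) - 1)) * r ^ (CARD('n) - 1))
        \<le> emeasure cone_measure (sphere 0 1 \<inter> cball a r)"
proof -
  define c :: "real \<Rightarrow> real" where "c D = 1 - D\<^sup>2 / 2" for D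
  define L where "L D = 1 / c D + sqrt (1 - (c D)\<^sup>2) / (c D)\<^sup>2" for D
  define w where "w = unit_ball_vol (real (CARD('n) - 1))"
  have w: "0 \<le> w" by (simp add: w_def)
  have c0: "(c \<longlongrightarrow> 1) (at_right 0)"
    unfolding c_def by (auto intro!: tendsto_eq_intros)
  have L0: "(L \<longlongrightarrow> 1) (at_right 0)"
    unfolding L_def by (rule tendsto_eq_intros c0 refl | simp)+
  have "((\<lambda>D. k * L D ^ (CARD('n) - 1)) \<longlongrightarrow> k * 1 ^ (CARD('n) - 1)) (at_right 0)"
    by (intro tendsto_intros L0)
  then have "\<forall>\<^sub>F D in at_right 0. k * L D ^ (CARD('n) - 1) < 1"
    using k by (intro order_tendstoD) auto
  moreover have "((\<lambda>D. c D ^ CARD('n)) \<longlongrightarrow> 1 ^ CARD('n)) (at_right 0)"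
    by (intro tendsto_intros c0)
  then have "\<forall>\<^sub>F D in at_right 0. k < c D ^ CARD('n)"
    using k by (intro order_tendstoD) auto
  ultimately have "\<forall>\<^sub>F D in at_right 0. k * L D ^ (CARD('n) - 1) < 1 \<and> k < c D ^ CARD('n)"
    by (rule eventually_conj)
  then obtain b where b: "0 < b" "\<And>D. 0 < D \<Longrightarrow> D < b \<Longrightarrow> k * L D ^ (CARD('n) - 1) < 1 \<and> k < c D ^ CARD('n)"
    unfolding eventually_at_right_field by blast
  show thesis
  proof (rule that[of "min 1 (b / 2)"]; (intro allI impI)?)
    show "0 < min 1 (b / 2)" "min 1 (b / 2) \<le> 1" using b by auto
  next
    fix A :: "(real ^ 'n) set" and D
    assume "A \<in> sets borel \<and> A \<subseteq> sphere 0 1 \<and> 0 \<le> D \<and> D \<le> min 1 (b / 2) \<and>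
       (\<forall>a\<in>A. \<forall>b\<in>A. norm (a - b) \<le> D)"
    then have A: "A \<in> sets borel" "A \<subseteq> sphere 0 1" and D: "0 \<le> D" "D \<le> min 1 (b / 2)"
      and diam: "\<And>a b. a \<in> A \<Longrightarrow> b \<in> A \<Longrightarrow> norm (a - b) \<le> D" by blast+
    \<comment> \<open>The choice of \<open>b\<close> controls positive \<open>D\<close> only; at
      \<open>D = 0\<close> the factor \<open>L\<close> has the value 1.\<close>
    have kL: "k * L D ^ (CARD('n) - 1) \<le> 1"
    proof (cases "D = 0")
      case True then show ?thesis using k by (simp add: L_def c_def)
    next
      case False then show ?thesis using b D by (simp add: less_imp_le)
    qed
    have "D\<^sup>2 \<le> 1" using D by (simp add: power_le_one)
    then have c01: "0 < c D" "c D \<le> 1" by (auto simp: c_def)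
    then have L0: "0 \<le> L D" by (auto simp: L_def power_le_one)
    have "ennreal k * emeasure cone_measure A \<le> ennreal k * ennreal (w * (L D * D / 2) ^ (CARD('n) - 1))"
      unfolding w_def L_def using A D diam
      by (intro mult_left_mono cone_measure_isodiametric) (auto simp: c_def)
    also have "\<dots> = ennreal (w * (D / 2) ^ (CARD('n) - 1) * (k * L D ^ (CARD('n) - 1)))"
      using k by (simp add: ennreal_mult'[symmetric] power_mult_distrib power_divide mult_ac)
    also have "\<dots> \<le> ennreal (w * (D / 2) ^ (CARD('n) - 1))"
      using kL w D k L0 by (intro ennreal_leI mult_right_le_one_le) auto
    finally show "ennreal k * emeasure cone_measure A \<le> ennreal (unit_ball_vol (real (CARD('n) - 1)) * (D / 2) ^ (CARD('n) - 1))"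
      by (simp add: w_def)
  next
    fix a :: "real ^ 'n" and r assume "norm a = 1 \<and> 0 < r \<and> r \<le> min 1 (b / 2)"
    then have a: "norm a = 1" and r: "0 < r" "r \<le> min 1 (b / 2)" by blast+
    have "k \<le> c r ^ CARD('n)" using b(2)[of r] b(1) r by simp
    then have "ennreal k * ennreal (w * r ^ (CARD('n) - 1)) \<le> ennreal (c r ^ CARD('n)) * ennreal (w * r ^ (CARD('n) - 1))"
      by (intro mult_right_mono ennreal_leI) auto
    also have "\<dots> \<le> emeasure cone_measure (sphere 0 1 \<inter> cball a r)"
      unfolding w_def c_def using a r by (intro cone_measure_cap) auto
    finally show "ennreal k * ennreal (unit_ball_vol (real (CARD('n) - 1)) * r ^ (CARD('n) - 1))
        \<le> emeasure cone_measure (sphere 0 1 \<inter> cball a r)" by (simp add: w_def)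
  qed
qed

section \<open>Comparison of the Hausdorff measure with the cone measure\<close>

lemma ennreal_le_mult_one_interval:
  fixes x y :: ennreal
  assumes x: "x < \<infinity>" and le: "\<And>z. 0 < z \<Longrightarrow> z < 1 \<Longrightarrow> ennreal z * x \<le> y"
  shows "x \<le> y"
proof (cases y)
  case (real b)
  obtain a where a: "x = ennreal a" "0 \<le> a" using x by (cases x) auto
  have "a \<le> b"
  proof (rule field_le_mult_one_interval)
    fix z :: real assume z: "0 < z" "z < 1"
    have "ennreal (z * a) \<le> ennreal b"
      using le[OF z] z a real by (simp add: ennreal_mult)
    then show "z * a \<le> b" using real by (simp add: ennreal_le_iff)
  qed
  then show ?thesis using a real by (simp add: ennreal_leI)
qed simp

text \<open>The isodiametric bound, applied to each \<open>A \<inter> closure (C i)\<close>, shows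
  that a cover by small sets weighs at least \<open>k\<close> times the cone measure. Closures make
  the pieces Borel and leave diameters unchanged.\<close>

lemma cone_measure_le_hausdorff_outer:
  fixes A :: "(real ^ 'n) set"
  assumes A: "A \<in> sets borel" "A \<subseteq> sphere 0 1"
  shows "emeasure cone_measure A \<le> hausdorff_outer (CARD('n) - 1) A"
proof (rule ennreal_le_mult_one_interval)
  show "emeasure cone_measure A < \<infinity>" by (rule emeasure_cone_measure_finite)
  fix k :: real assume k: "0 < k" "k < 1"
  obtain d where d: "0 < d" and iso: "\<forall>(A :: (real ^ 'n) set) D. A \<in> sets borel \<and> A \<subseteq> sphere 0 1 \<and> 0 \<le> D \<and> D \<le> d \<and>
       (\<forall>a\<in>A. \<forall>b\<in>A. norm (a - b) \<le> D) \<longrightarrow>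
       ennreal k * emeasure cone_measure A \<le> ennreal (unit_ball_vol (real (CARD('n) - 1)) * (D / 2) ^ (CARD('n) - 1))"
    by (rule cone_measure_asymp_bounds[OF k, where 'n = 'n]) (rule that; assumption)
  have "ennreal k * emeasure cone_measure A \<le> hausdorff_content (CARD('n) - 1) d A"
    unfolding hausdorff_content_def
  proof (rule INF_greatest)
    fix C assume "C \<in> hausdorff_covers d A"
    then have C: "A \<subseteq> (\<Union>i. C i)" "\<And>i. bounded (C i)" "\<And>i. diameter (C i) \<le> d"
      by (auto simp: hausdorff_covers_def)
    have "A \<subseteq> (\<Union>i. A \<inter> closure (C i))"
    proof
      fix x assume x: "x \<in> A"
      then obtain i where "x \<in> C i" using C(1) by blast
      then have "x \<in> A \<inter> closure (C i)" using x closure_subset by blast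
      then show "x \<in> (\<Union>i. A \<inter> closure (C i))" by blast
    qed
    then have "emeasure cone_measure A \<le> emeasure cone_measure (\<Union>i. A \<inter> closure (C i))"
      using A by (intro emeasure_mono) auto
    also have "\<dots> \<le> (\<Sum>i. emeasure cone_measure (A \<inter> closure (C i)))"
      using A by (intro emeasure_subadditive_countably) auto
    finally have "ennreal k * emeasure cone_measure A \<le> ennreal k * (\<Sum>i. emeasure cone_measure (A \<inter> closure (C i)))"
      by (rule mult_left_mono) simp
    also have "\<dots> = (\<Sum>i. ennreal k * emeasure cone_measure (A \<inter> closure (C i)))"
      by (rule ennreal_suminf_cmult[symmetric])
    also have "\<dots> \<le> (\<Sum>i. hausdorff_weight (CARD('n) - 1) (C i))"
    proof (intro suminf_le)
      fix i
      show "ennreal k * emeasure cone_measure (A \<inter> closure (C i)) \<le> hausdorff_weight (CARD('n) - 1) (C i)"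
      proof (cases "C i = {}")
        case False
        have "ennreal k * emeasure cone_measure (A \<inter> closure (C i))
          \<le> ennreal (unit_ball_vol (real (CARD('n) - 1)) * (diameter (C i) / 2) ^ (CARD('n) - 1))"
        proof (rule iso[rule_format], intro conjI ballI)
          show "0 \<le> diameter (C i)" by (rule diameter_ge_0[OF C(2)])
          fix a b assume "a \<in> A \<inter> closure (C i)" "b \<in> A \<inter> closure (C i)"
          then have "dist a b \<le> diameter (closure (C i))"
            using C(2) by (intro diameter_bounded_bound) auto
          then show "norm (a - b) \<le> diameter (C i)" using C(2)[of i] by (simp add: diameter_closure dist_norm)
        qed (use A C in auto)
        then show ?thesis using False by (simp add: hausdorff_weight_def)
      qed simp
    qed auto
    finally show "ennreal k * emeasure cone_measure A \<le> (\<Sum>i. hausdorff_weight (CARD('n) - 1) (C i))" .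
  qed
  also have "\<dots> \<le> hausdorff_outer (CARD('n) - 1) A"
    unfolding hausdorff_outer_def using d by (intro SUP_upper) auto
  finally show "ennreal k * emeasure cone_measure A \<le> hausdorff_outer (CARD('n) - 1) A" .
qed

lemma hausdorff_content_single:
  assumes "bounded C" "diameter C \<le> \<delta>" "0 \<le> \<delta>"
  shows "hausdorff_content k \<delta> C \<le> hausdorff_weight k C"
proof -
  define D where "D i = (if i = (0::nat) then C else {})" for i
  have "(\<Union>i. D i) = C" by (auto simp: D_def split: if_splits)
  then have "D \<in> hausdorff_covers \<delta> C"
    using assms by (auto simp: hausdorff_covers_def D_def)
  then have "hausdorff_content k \<delta> C \<le> (\<Sum>i. hausdorff_weight k (D i))"
    unfolding hausdorff_content_def by (rule INF_lower)
  also have "\<dots> = (\<Sum>i\<in>{0}. hausdorff_weight k (D i))"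
    by (rule suminf_finite) (auto simp: D_def hausdorff_weight_def)
  finally show ?thesis by (simp add: D_def)
qed

text \<open>Vitali's covering lemma with centres in \<open>S\<close>, so that balls cut caps around
  their centres out of the sphere, and with balls numbered, so that finite initial segments can be
  split off.\<close>

lemma vitali_sequence:
  fixes U S :: "'a::euclidean_space set"
  assumes U: "open U" and \<rho>: "0 < \<rho>"
  obtains a :: "nat \<Rightarrow> 'a" and r :: "nat \<Rightarrow> real" and V :: "nat set" where
    "\<And>n. n \<in> V \<Longrightarrow> a n \<in> S \<and> 0 < r n \<and> r n \<le> \<rho> \<and> cball (a n) (r n) \<subseteq> U"
    "disjoint_family_on (\<lambda>n. cball (a n) (r n)) V"
    "U \<inter> S \<subseteq> (\<Union>n\<in>V. cball (a n) (5 * r n))"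
proof -
  define K where "K = {(x, s). x \<in> U \<inter> S \<and> 0 < s \<and> s \<le> \<rho> \<and> cball x s \<subseteq> U}"
  have "U \<inter> S \<subseteq> (\<Union>i\<in>K. cball (fst i) (snd i))"
  proof
    fix x assume x: "x \<in> U \<inter> S"
    then obtain s where s: "0 < s" "cball x s \<subseteq> U" using U by (auto simp: open_contains_cball)
    have "cball x (min s \<rho>) \<subseteq> cball x s" by auto
    then have "(x, min s \<rho>) \<in> K" using s x \<rho> by (auto simp: K_def)
    then show "x \<in> (\<Union>i\<in>K. cball (fst i) (snd i))"
      using s \<rho> by (intro UN_I[of "(x, min s \<rho>)"]) auto
  qed
  moreover have "0 < snd i \<and> snd i \<le> \<rho>" if "i \<in> K" for i using that by (auto simp: K_def)
  ultimately obtain C where C: "countable C" "C \<subseteq> K"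
     "pairwise (\<lambda>i j. disjnt (cball (fst i) (snd i)) (cball (fst j) (snd j))) C"
     "U \<inter> S \<subseteq> (\<Union>i\<in>C. cball (fst i) (5 * snd i))"
    by (rule Vitali_covering_lemma_cballs)
  show thesis
  proof (rule that[of "to_nat_on C ` C" "\<lambda>n. fst (from_nat_into C n)" "\<lambda>n. snd (from_nat_into C n)"])
    fix n assume "n \<in> to_nat_on C ` C"
    then obtain c where c: "c \<in> C" "n = to_nat_on C c" by auto
    then have "from_nat_into C n \<in> K" using C(1) subsetD[OF C(2)] by simp
    then show "fst (from_nat_into C n) \<in> S \<and> 0 < snd (from_nat_into C n) \<and> snd (from_nat_into C n) \<le> \<rho>
        \<and> cball (fst (from_nat_into C n)) (snd (from_nat_into C n)) \<subseteq> U"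
      by (simp add: K_def case_prod_beta)
  next
    show "disjoint_family_on (\<lambda>n. cball (fst (from_nat_into C n)) (snd (from_nat_into C n))) (to_nat_on C ` C)"
      unfolding disjoint_family_on_def
    proof safe
      fix i j x assume ij: "i \<in> C" "j \<in> C" "to_nat_on C i \<noteq> to_nat_on C j"
        and x: "x \<in> cball (fst (from_nat_into C (to_nat_on C i))) (snd (from_nat_into C (to_nat_on C i)))"
          "x \<in> cball (fst (from_nat_into C (to_nat_on C j))) (snd (from_nat_into C (to_nat_on C j)))"
      have "disjnt (cball (fst i) (snd i)) (cball (fst j) (snd j))"
        using C(3) ij unfolding pairwise_def by (cases "i = j") blast+
      then show "x \<in> {}" using x ij C(1) by (auto simp: disjnt_iff)
    qed
    show "U \<inter> S \<subseteq> (\<Union>n\<in>to_nat_on C ` C. cball (fst (from_nat_into C n)) (5 * snd (from_nat_into C n)))"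
      using C(1,4) by simp
  qed
qed

lemma hausdorff_content_Un:
  fixes A B :: "'a::metric_space set"
  assumes \<delta>: "0 < \<delta>"
  shows "hausdorff_content k \<delta> (A \<union> B) \<le> hausdorff_content k \<delta> A + hausdorff_content k \<delta> B"
proof -
  define D where "D i = (if i = 0 then A else if i = Suc 0 then B else {})" for i
  have "hausdorff_content k \<delta> (A \<union> B) \<le> hausdorff_content k \<delta> (\<Union>i. D i)"
  proof (rule hausdorff_content_mono)
    have "A = D 0" "B = D (Suc 0)" by (auto simp: D_def)
    then show "A \<union> B \<subseteq> (\<Union>i. D i)" by blast
  qed
  also have "\<dots> \<le> (\<Sum>i. hausdorff_content k \<delta> (D i))"
    by (rule hausdorff_content_subadditive)
  also have "\<dots> = (\<Sum>i\<in>{0, Suc 0}. hausdorff_content k \<delta> (D i))"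
    by (rule suminf_finite) (auto simp: D_def hausdorff_content_empty[OF \<delta>])
  finally show ?thesis by (simp add: D_def)
qed

lemma hausdorff_content_finite_UN:
  assumes "finite I" "0 < \<delta>"
  shows "hausdorff_content k \<delta> (\<Union>i\<in>I. A i) \<le> (\<Sum>i\<in>I. hausdorff_content k \<delta> (A i :: 'a::metric_space set))"
  using assms(1)
proof (induction I rule: finite_induct)
  case empty then show ?case using hausdorff_content_empty[OF assms(2)] by simp
next
  case (insert i I)
  have "hausdorff_content k \<delta> (\<Union>j\<in>insert i I. A j) \<le> hausdorff_content k \<delta> (A i) + hausdorff_content k \<delta> (\<Union>j\<in>I. A j)"
    by (simp add: hausdorff_content_Un[OF assms(2)])
  also have "\<dots> \<le> (\<Sum>j\<in>insert i I. hausdorff_content k \<delta> (A j))"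
    using insert by (simp add: add_left_mono)
  finally show ?case .
qed

text \<open>Filling part of an open set by disjoint caps improves a constant in \<open>H \<le> B * m\<close>: its excess over
  \<open>1 / k\<close> shrinks by a fixed factor, so iteration removes it.\<close>

lemma hausdorff_content_sphere_le:
  fixes k \<delta> :: real
  assumes k: "0 < k" "k < 1" and \<delta>: "0 < \<delta>"
  shows "hausdorff_content (CARD('n) - 1) \<delta> (sphere (0 :: real ^ 'n) 1)
    \<le> ennreal (1 / k) * emeasure cone_measure (UNIV :: (real ^ 'n) set)"
proof -
  let ?H = "\<lambda>U :: (real ^ 'n) set. hausdorff_content (CARD('n) - 1) \<delta> (U \<inter> sphere 0 1)"
  interpret cone: finite_measure "cone_measure :: (real ^ 'n) measure" by (rule finite_measure_cone_measure)
  define m where "m = measure (cone_measure :: (real ^ 'n) measure)"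
  have em: "emeasure cone_measure A = ennreal (m A)" for A :: "(real ^ 'n) set"
    by (simp add: m_def cone.emeasure_eq_measure)
  have m0: "0 \<le> m A" for A by (simp add: m_def)
  have mS: "m (sphere 0 1 \<inter> A) = m A" if "A \<in> sets borel" for A
    unfolding m_def using that AE_cone_measure_sphere by (intro measure_eq_AE) auto
  define w where "w = unit_ball_vol (real (CARD('n) - 1))"
  have w: "0 < w" by (simp add: w_def)
  obtain d where d: "0 < d" "d \<le> 1" and iso: "\<forall>(A :: (real ^ 'n) set) D. A \<in> sets borel \<and> A \<subseteq> sphere 0 1 \<and> 0 \<le> D \<and> D \<le> d \<and>
       (\<forall>a\<in>A. \<forall>b\<in>A. norm (a - b) \<le> D) \<longrightarrow>
       ennreal k * emeasure cone_measure A \<le> ennreal (unit_ball_vol (real (CARD('n) - 1)) * (D / 2) ^ (CARD('n) - 1))"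
    and cap: "\<forall>(a :: real ^ 'n) r. norm a = 1 \<and> 0 < r \<and> r \<le> d \<longrightarrow>
       ennreal k * ennreal (unit_ball_vol (real (CARD('n) - 1)) * r ^ (CARD('n) - 1))
        \<le> emeasure cone_measure (sphere 0 1 \<inter> cball a r)"
    by (rule cone_measure_asymp_bounds[OF k, where 'n = 'n]) (rule that; assumption)
  define P where "P = (5::real) ^ (CARD('n) - 1)"
  have P: "1 \<le> P" by (simp add: P_def)
  \<comment> \<open>Five-fold enlarged caps have diameter at most \<open>10 * \<rho>\<close>, which
    must be small both for the bounds at scale \<open>d\<close> and for covers of mesh
    \<open>\<delta>\<close>.\<close>
  define \<rho> where "\<rho> = min (d / 10) (\<delta> / 10)"
  have \<rho>: "0 < \<rho>" "10 * \<rho> \<le> d" "10 * \<rho> \<le> \<delta>" using d \<delta> by (auto simp: \<rho>_def)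
  let ?c = "\<lambda>a r. sphere 0 1 \<inter> cball (a :: real ^ 'n) r"
  have cap': "w * r ^ (CARD('n) - 1) \<le> m (?c a r) / k" if "norm a = 1" "0 < r" "r \<le> \<rho>" for a r
  proof -
    have "ennreal k * ennreal (w * r ^ (CARD('n) - 1)) \<le> ennreal (m (?c a r))"
      unfolding w_def em[symmetric] using that \<rho> by (intro cap[rule_format]) auto
    then have "k * (w * r ^ (CARD('n) - 1)) \<le> m (?c a r)"
      using k w that m0 by (simp add: ennreal_mult[symmetric] ennreal_le_iff)
    then show ?thesis using k by (simp add: field_simps)
  qed
  have pw5: "(5 * r) ^ (CARD('n) - 1) = P * r ^ (CARD('n) - 1)" for r :: real
    by (simp add: P_def power_mult_distrib)
  have cap5: "m (?c a (5 * r)) \<le> P / k\<^sup>2 * m (?c a r)" if a: "norm a = 1" and r: "0 < r" "r \<le> \<rho>" for a r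
  proof -
    have "ennreal k * ennreal (m (?c a (5 * r))) \<le> ennreal (w * (10 * r / 2) ^ (CARD('n) - 1))"
      unfolding w_def em[symmetric]
    proof (rule iso[rule_format], intro conjI ballI)
      fix x y assume "x \<in> ?c a (5 * r)" "y \<in> ?c a (5 * r)"
      then have "dist x y \<le> 10 * r" using dist_triangle3[of x y a] by auto
      then show "norm (x - y) \<le> 10 * r" by (simp add: dist_norm)
    qed (use r \<rho> in auto)
    then have "ennreal (k * m (?c a (5 * r))) \<le> ennreal (w * (10 * r / 2) ^ (CARD('n) - 1))"
      using k m0 by (simp add: ennreal_mult)
    then have "k * m (?c a (5 * r)) \<le> w * (10 * r / 2) ^ (CARD('n) - 1)"
      using w r by (subst (asm) ennreal_le_iff) auto
    also have "10 * r / 2 = 5 * r" by simp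
    also have "w * (5 * r) ^ (CARD('n) - 1) = w * (P * r ^ (CARD('n) - 1))" by (simp only: pw5)
    finally have "k * m (?c a (5 * r)) \<le> w * (P * r ^ (CARD('n) - 1))" .
    also have "\<dots> = P * (w * r ^ (CARD('n) - 1))" by simp
    also have "\<dots> \<le> P * (m (?c a r) / k)" using cap'[OF a r] P by (intro mult_left_mono) auto
    finally show ?thesis using k by (simp add: field_simps power2_eq_square)
  qed
  have Hball: "hausdorff_content (CARD('n) - 1) \<delta> (?c a r) \<le> ennreal (w * r ^ (CARD('n) - 1))" if "0 < r" "2 * r \<le> \<delta>" for a r
  proof -
    have bd: "bounded (?c a r)" by (simp add: bounded_Int)
    have dm: "diameter (?c a r) \<le> 2 * r"
    proof (rule diameter_le)
      fix x y assume "x \<in> ?c a r" "y \<in> ?c a r"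
      then have "dist x y \<le> 2 * r" using dist_triangle3[of x y a] by auto
      then show "norm (x - y) \<le> 2 * r" by (simp add: dist_norm)
    qed (use that in simp)
    have "hausdorff_content (CARD('n) - 1) \<delta> (?c a r) \<le> hausdorff_weight (CARD('n) - 1) (?c a r)"
      using bd dm that by (intro hausdorff_content_single) auto
    also have "\<dots> \<le> ennreal (w * r ^ (CARD('n) - 1))"
      using dm diameter_ge_0[OF bd] w
      by (auto simp: hausdorff_weight_def w_def intro!: ennreal_leI mult_left_mono power_mono)
    finally show ?thesis .
  qed
  \<comment> \<open>The crude constant obtained by covering with all enlarged caps: \<open>P\<close>
    is the price of enlargement and \<open>1 / k\<close> that of the cap estimate.\<close>
  define B where "B = P / k"
  have B: "1 / k \<le> B" using P k by (simp add: B_def divide_right_mono)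
  \<comment> \<open>The enlarged caps cover, so the disjoint caps carry at least the fraction
    \<open>k\<^sup>2 / P\<close> of the mass; finitely many of them still carry half of
    this.\<close>
  define \<theta> where "\<theta> = k\<^sup>2 / P / 2"
  have \<theta>: "0 < \<theta>" "\<theta> < 1"
  proof -
    have "k\<^sup>2 < 1" using k by (simp add: power_less_one_iff abs_square_less_1)
    then have "k\<^sup>2 / P < 1" using P by (simp add: divide_less_eq)
    moreover have "0 < k\<^sup>2 / P" using k P by simp
    ultimately show "0 < \<theta>" "\<theta> < 1" by (auto simp: \<theta>_def)
  qed
  \<comment> \<open>The first part starts the iteration. In the second, \<open>s\<close> is the mass
    of finitely many disjoint caps, whose content is bounded at the nearly optimal rate
    \<open>1 / k\<close>, and \<open>U'\<close> is what remains.\<close>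
  have step: "?H U \<le> ennreal (B * m U) \<and>
      (\<exists>U' s. open U' \<and> \<theta> * m U \<le> s \<and> m U' = m U - s \<and> ?H U \<le> ennreal (s / k) + ?H U')"
    if U: "open U" for U :: "(real ^ 'n) set"
  proof -
    obtain a :: "nat \<Rightarrow> real ^ 'n" and r V where V:
      "\<And>n. n \<in> V \<Longrightarrow> a n \<in> sphere 0 1 \<and> 0 < r n \<and> r n \<le> \<rho> \<and> cball (a n) (r n) \<subseteq> U"
      and disj: "disjoint_family_on (\<lambda>n. cball (a n) (r n)) V"
      and cov: "U \<inter> sphere 0 1 \<subseteq> (\<Union>n\<in>V. cball (a n) (5 * r n))"
      by (rule vitali_sequence[OF U \<rho>(1), of "sphere 0 1"]) (rule that; assumption)
    define X where "X n = (if n \<in> V then ?c (a n) (r n) else {})" for n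
    define Y where "Y n = (if n \<in> V then ?c (a n) (5 * r n) else {})" for n
    have [measurable]: "X n \<in> sets borel" "Y n \<in> sets borel" for n by (auto simp: X_def Y_def)
    have UY: "U \<inter> sphere 0 1 \<subseteq> (\<Union>n. Y n)"
    proof
      fix x assume x: "x \<in> U \<inter> sphere 0 1"
      then obtain n where "n \<in> V" "x \<in> cball (a n) (5 * r n)" using cov by blast
      then have "x \<in> Y n" using x by (simp add: Y_def)
      then show "x \<in> (\<Union>n. Y n)" by blast
    qed
    have dX: "disjoint_family X"
      using disj unfolding disjoint_family_on_def X_def by (auto; blast)
    have XU: "X n \<subseteq> U \<inter> sphere 0 1" for n using V[of n] by (auto simp: X_def)
    have Ub: "U \<in> sets borel" using U by simp
    have sumX: "(\<Sum>n. emeasure cone_measure (X n)) = emeasure cone_measure (\<Union>n. X n)"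
      using dX by (intro suminf_emeasure) auto
    have "emeasure cone_measure (\<Union>n. X n) \<le> emeasure cone_measure U"
      using XU Ub by (intro emeasure_mono) auto
    then have sumXU: "(\<Sum>n. emeasure cone_measure (X n)) \<le> ennreal (m U)"
      unfolding sumX by (simp only: em)
    have HU1: "?H U \<le> ennreal (B * m U)"
    proof -
      have "?H U \<le> hausdorff_content (CARD('n) - 1) \<delta> (\<Union>n. Y n)" by (rule hausdorff_content_mono[OF UY])
      also have "\<dots> \<le> (\<Sum>n. hausdorff_content (CARD('n) - 1) \<delta> (Y n))" by (rule hausdorff_content_subadditive)
      also have "\<dots> \<le> (\<Sum>n. ennreal B * emeasure cone_measure (X n))"
      proof (intro suminf_le)
        fix n
        show "hausdorff_content (CARD('n) - 1) \<delta> (Y n) \<le> ennreal B * emeasure cone_measure (X n)"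
        proof (cases "n \<in> V")
          case True
          then have v: "norm (a n) = 1" "0 < r n" "r n \<le> \<rho>" using V[of n] by auto
          have "hausdorff_content (CARD('n) - 1) \<delta> (Y n) \<le> ennreal (w * (5 * r n) ^ (CARD('n) - 1))"
            unfolding Y_def if_P[OF True] by (rule Hball) (use v \<rho> in auto)
          also have "\<dots> \<le> ennreal (B * m (?c (a n) (r n)))"
          proof (rule ennreal_leI)
            have "w * (5 * r n) ^ (CARD('n) - 1) = P * (w * r n ^ (CARD('n) - 1))" unfolding pw5 by simp
            also have "\<dots> \<le> P * (m (?c (a n) (r n)) / k)" using cap'[OF v] P by (intro mult_left_mono) auto
            finally show "w * (5 * r n) ^ (CARD('n) - 1) \<le> B * m (?c (a n) (r n))" by (simp add: B_def)
          qed
          also have "\<dots> = ennreal B * emeasure cone_measure (X n)"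
            using True k P m0 by (simp add: X_def em ennreal_mult[symmetric] B_def)
          finally show ?thesis .
        next
          case False
          then show ?thesis using \<delta> by (simp add: Y_def hausdorff_content_empty)
        qed
      qed auto
      also have "\<dots> = ennreal B * (\<Sum>n. emeasure cone_measure (X n))" by (rule ennreal_suminf_cmult)
      also have "\<dots> \<le> ennreal B * ennreal (m U)" using sumXU by (intro mult_left_mono) auto
      also have "\<dots> = ennreal (B * m U)" using k P m0 by (simp add: ennreal_mult[symmetric] B_def)
      finally show ?thesis .
    qed
    have "\<exists>N. \<theta> * m U \<le> (\<Sum>n<N. m (X n))"
    proof (cases "m U = 0")
      case False
      then have mU: "0 < m U" using m0[of U] by simp
      have "ennreal (m U) \<le> ennreal (P / k\<^sup>2) * (\<Sum>n. emeasure cone_measure (X n))"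
      proof -
        have "ennreal (m U) = emeasure cone_measure (sphere 0 1 \<inter> U)" using mS[OF Ub] by (simp add: em)
        also have "\<dots> \<le> emeasure cone_measure (\<Union>n. Y n)"
          using UY by (intro emeasure_mono) (auto simp: Int_commute)
        also have "\<dots> \<le> (\<Sum>n. emeasure cone_measure (Y n))"
          by (intro emeasure_subadditive_countably) auto
        also have "\<dots> \<le> (\<Sum>n. ennreal (P / k\<^sup>2) * emeasure cone_measure (X n))"
        proof (intro suminf_le)
          fix n
          show "emeasure cone_measure (Y n) \<le> ennreal (P / k\<^sup>2) * emeasure cone_measure (X n)"
          proof (cases "n \<in> V")
            case True
            then have v: "norm (a n) = 1" "0 < r n" "r n \<le> \<rho>" using V[of n] by auto
            show ?thesis using cap5[OF v] True P k m0
              by (simp add: X_def Y_def em ennreal_mult[symmetric] ennreal_leI)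
          qed (simp add: Y_def)
        qed auto
        also have "\<dots> = ennreal (P / k\<^sup>2) * (\<Sum>n. emeasure cone_measure (X n))" by (rule ennreal_suminf_cmult)
        finally show ?thesis .
      qed
      then have "ennreal (k\<^sup>2 / P) * ennreal (m U) \<le> ennreal (k\<^sup>2 / P) * (ennreal (P / k\<^sup>2) * (\<Sum>n. emeasure cone_measure (X n)))"
        by (rule mult_left_mono) simp
      also have "\<dots> = (\<Sum>n. emeasure cone_measure (X n))"
        using P k by (simp add: mult.assoc[symmetric] ennreal_mult[symmetric])
      finally have "ennreal (k\<^sup>2 / P * m U) \<le> (\<Sum>n. emeasure cone_measure (X n))"
        using P k m0 by (simp add: ennreal_mult[symmetric])
      moreover have "ennreal (\<theta> * m U) < ennreal (k\<^sup>2 / P * m U)"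
      proof (rule ennreal_lessI)
        show pos: "0 < k\<^sup>2 / P * m U" using P k mU by simp
        have "\<theta> * m U = (k\<^sup>2 / P * m U) / 2" by (simp add: \<theta>_def)
        also have "\<dots> < k\<^sup>2 / P * m U"
        proof -
          have "a / 2 < a" if "0 < a" for a :: real using that by simp
          then show ?thesis using pos by blast
        qed
        finally show "\<theta> * m U < k\<^sup>2 / P * m U" .
      qed
      ultimately have "ennreal (\<theta> * m U) < (SUP N. \<Sum>n<N. emeasure cone_measure (X n))"
        by (simp add: suminf_eq_SUP)
      then obtain N where "ennreal (\<theta> * m U) < (\<Sum>n<N. emeasure cone_measure (X n))"
        by (auto simp: less_SUP_iff)
      then have "ennreal (\<theta> * m U) < ennreal (\<Sum>n<N. m (X n))"
        using m0 by (simp add: em sum_ennreal)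
      then have "\<theta> * m U \<le> (\<Sum>n<N. m (X n))"
        using \<theta> mU by (simp add: ennreal_less_iff)
      then show ?thesis ..
    qed (auto intro: exI[of _ 0])
    then obtain N where N: "\<theta> * m U \<le> (\<Sum>n<N. m (X n))" ..
    \<comment> \<open>Only finitely many closed balls are removed, so the remainder is open and the
      step can be repeated.\<close>
    define U' where "U' = U - (\<Union>n\<in>V \<inter> {..<N}. cball (a n) (r n))"
    have "open U'" unfolding U'_def using U by (intro open_Diff closed_UN) auto
    moreover have "m U' = m U - (\<Sum>n<N. m (X n))"
    proof -
      have "sphere 0 1 \<inter> U' = sphere 0 1 \<inter> (U - (\<Union>n<N. X n))"
        by (auto simp: U'_def X_def split: if_splits)
      then have "m U' = m (U - (\<Union>n<N. X n))"
        using mS[of U'] mS[of "U - (\<Union>n<N. X n)"] Ub \<open>open U'\<close> by auto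
      also have "\<dots> = m U - m (\<Union>n<N. X n)"
        unfolding m_def using XU Ub by (intro cone.finite_measure_Diff) auto
      also have "m (\<Union>n<N. X n) = (\<Sum>n<N. m (X n))"
        unfolding m_def using dX
        by (intro cone.finite_measure_finite_Union) (auto simp: disjoint_family_on_def)
      finally show ?thesis .
    qed
    moreover have "?H U \<le> ennreal ((\<Sum>n<N. m (X n)) / k) + ?H U'"
    proof -
      have "?H U \<le> hausdorff_content (CARD('n) - 1) \<delta> ((\<Union>n<N. X n) \<union> (U' \<inter> sphere 0 1))"
        by (rule hausdorff_content_mono) (auto simp: U'_def X_def)
      also have "\<dots> \<le> hausdorff_content (CARD('n) - 1) \<delta> (\<Union>n<N. X n) + ?H U'"
        by (rule hausdorff_content_Un[OF \<delta>])
      also have "hausdorff_content (CARD('n) - 1) \<delta> (\<Union>n<N. X n) \<le> (\<Sum>n<N. hausdorff_content (CARD('n) - 1) \<delta> (X n))"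
        using \<delta> by (intro hausdorff_content_finite_UN) auto
      also have "\<dots> \<le> (\<Sum>n<N. ennreal (m (X n) / k))"
      proof (rule sum_mono)
        fix n
        show "hausdorff_content (CARD('n) - 1) \<delta> (X n) \<le> ennreal (m (X n) / k)"
        proof (cases "n \<in> V")
          case True
          then have v: "norm (a n) = 1" "0 < r n" "r n \<le> \<rho>" using V[of n] by auto
          have "hausdorff_content (CARD('n) - 1) \<delta> (X n) \<le> ennreal (w * r n ^ (CARD('n) - 1))"
            unfolding X_def if_P[OF True] by (rule Hball) (use v \<rho> in auto)
          also have "\<dots> \<le> ennreal (m (X n) / k)"
            using cap'[OF v] True by (intro ennreal_leI) (simp add: X_def)
          finally show ?thesis .
        next
          case False
          then show ?thesis using \<delta> by (simp add: X_def hausdorff_content_empty)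
        qed
      qed
      also have "\<dots> = ennreal ((\<Sum>n<N. m (X n)) / k)"
        using m0 k by (subst sum_ennreal) (auto simp: sum_divide_distrib)
      finally show ?thesis by (simp add: add_right_mono)
    qed
    ultimately show ?thesis using HU1 N by blast
  qed
  have main: "?H U \<le> ennreal ((1 / k + (B - 1 / k) * (1 - \<theta>) ^ j) * m U)" if "open U" for U j
    using that
  proof (induction j arbitrary: U)
    case 0
    then show ?case using step[OF 0] by simp
  next
    case (Suc j)
    define M where "M = 1 / k + (B - 1 / k) * (1 - \<theta>) ^ j"
    have M: "1 / k \<le> M" using B \<theta> by (simp add: M_def)
    obtain U' s where U': "open U'" "\<theta> * m U \<le> s" "m U' = m U - s" "?H U \<le> ennreal (s / k) + ?H U'"
      using step[OF Suc.prems] by blast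
    have s0: "0 \<le> s" using U'(2) \<theta> m0[of U] by (smt (verit) mult_nonneg_nonneg)
    have "?H U \<le> ennreal (s / k) + ennreal (M * m U')"
      using U'(4) Suc.IH[OF U'(1)] unfolding M_def by (meson add_left_mono order_trans)
    also have "\<dots> = ennreal (s / k + M * m U')"
    proof (rule ennreal_plus[symmetric])
      have "0 \<le> M" using M k by (auto intro: order_trans[of 0 "1 / k"])
      then show "0 \<le> M * m U'" using m0 by simp
    qed (use s0 k in simp)
    also have "\<dots> \<le> ennreal ((1 / k + (B - 1 / k) * (1 - \<theta>) ^ Suc j) * m U)"
    proof (rule ennreal_leI)
      have "s / k + M * m U' = M * m U - (M - 1 / k) * s" by (simp add: U'(3) algebra_simps)
      also have "\<dots> \<le> M * m U - (M - 1 / k) * (\<theta> * m U)"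
        using U'(2) M by (intro diff_left_mono mult_left_mono) auto
      also have "\<dots> = (1 / k + (B - 1 / k) * (1 - \<theta>) ^ Suc j) * m U"
        by (simp add: M_def algebra_simps)
      finally show "s / k + M * m U' \<le> (1 / k + (B - 1 / k) * (1 - \<theta>) ^ Suc j) * m U" .
    qed
    finally show ?case .
  qed
  have "(\<lambda>j. ennreal ((1 / k + (B - 1 / k) * (1 - \<theta>) ^ j) * m UNIV)) \<longlonglongrightarrow> ennreal ((1 / k + (B - 1 / k) * 0) * m UNIV)"
    using \<theta> by (intro tendsto_ennrealI tendsto_intros LIMSEQ_realpow_zero) auto
  then have "?H UNIV \<le> ennreal ((1 / k + (B - 1 / k) * 0) * m UNIV)"
    by (rule LIMSEQ_le_const) (use main[of UNIV] in auto)
  then show ?thesis using k m0 by (simp add: em ennreal_mult[symmetric])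
qed

text \<open>The lower bound is known for every Borel subset, the upper bound only for the whole
  sphere. Since both measures are additive and the total is finite, lower bounds for
  \<open>A\<close> and for its complement together with the upper bound for their union leave no
  room for a strict inequality.\<close>

lemma hausdorff_outer_eq_cone_measure:
  fixes A :: "(real ^ 'n) set"
  assumes A: "A \<in> sets borel" "A \<subseteq> sphere 0 1"
  shows "hausdorff_outer (CARD('n) - 1) A = emeasure cone_measure A"
proof -
  let ?H = "hausdorff_outer (CARD('n) - 1) :: (real ^ 'n) set \<Rightarrow> ennreal"
  let ?S = "sphere (0 :: real ^ 'n) 1"
  have SA: "?S - A \<in> sets borel" using A by auto
  have "?H ?S \<le> emeasure cone_measure (UNIV :: (real ^ 'n) set)"
    unfolding hausdorff_outer_def
  proof (rule SUP_least)
    fix \<delta> :: real assume \<delta>: "\<delta> \<in> {0<..}"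
    have top: "hausdorff_content (CARD('n) - 1) \<delta> ?S \<le> ennreal (1 / k) * emeasure cone_measure (UNIV :: (real ^ 'n) set)"
      if "0 < k" "k < 1" for k
      using hausdorff_content_sphere_le[OF that, where 'n = 'n] \<delta> by simp
    show "hausdorff_content (CARD('n) - 1) \<delta> ?S \<le> emeasure cone_measure (UNIV :: (real ^ 'n) set)"
    proof (rule ennreal_le_mult_one_interval)
      show "hausdorff_content (CARD('n) - 1) \<delta> ?S < \<infinity>"
      proof (rule le_less_trans[OF top[of "1/2"]])
        show "ennreal (1 / (1 / 2)) * emeasure cone_measure (UNIV :: (real ^ 'n) set) < \<infinity>"
          using emeasure_cone_measure_finite[of "UNIV :: (real ^ 'n) set"] by (simp add: ennreal_mult_less_top)
      qed auto
      fix z :: real assume z: "0 < z" "z < 1"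
      have "ennreal z * hausdorff_content (CARD('n) - 1) \<delta> ?S
          \<le> ennreal z * (ennreal (1 / z) * emeasure cone_measure (UNIV :: (real ^ 'n) set))"
        by (intro mult_left_mono top z) auto
      also have "\<dots> = emeasure cone_measure (UNIV :: (real ^ 'n) set)"
        using z by (simp add: mult.assoc[symmetric] ennreal_mult[symmetric])
      finally show "ennreal z * hausdorff_content (CARD('n) - 1) \<delta> ?S \<le> emeasure cone_measure (UNIV :: (real ^ 'n) set)" .
    qed
  qed
  also have "\<dots> = emeasure cone_measure ?S"
    using AE_cone_measure_sphere by (intro emeasure_eq_AE) auto
  also have "\<dots> = emeasure cone_measure A + emeasure cone_measure (?S - A)"
  proof -
    have "A \<union> (?S - A) = ?S" using A by blast
    then show ?thesis using A SA plus_emeasure[of A cone_measure "?S - A"] by simp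
  qed
  finally have 1: "?H ?S \<le> emeasure cone_measure A + emeasure cone_measure (?S - A)" .
  have "A \<in> lambda_system UNIV UNIV ?H"
    using sets_borel_subset_hausdorff_measure A by (auto simp: sets_hausdorff_measure)
  then have "?H (A \<inter> ?S) + ?H ((UNIV - A) \<inter> ?S) = ?H ?S" by (auto simp: lambda_system_def)
  moreover have "A \<inter> ?S = A" "(UNIV - A) \<inter> ?S = ?S - A" using A by auto
  ultimately have 2: "?H A + ?H (?S - A) \<le> emeasure cone_measure A + emeasure cone_measure (?S - A)"
    using 1 by simp
  have 3: "emeasure cone_measure A \<le> ?H A" "emeasure cone_measure (?S - A) \<le> ?H (?S - A)"
    by (rule cone_measure_le_hausdorff_outer[OF A], rule cone_measure_le_hausdorff_outer[OF SA Diff_subset])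
  have "?H A + emeasure cone_measure (?S - A) \<le> ?H A + ?H (?S - A)"
    by (rule add_left_mono[OF 3(2)])
  also note 2
  finally have "?H A \<le> emeasure cone_measure A"
    using emeasure_cone_measure_finite[of "?S - A"] by (auto simp: ennreal_add_left_cancel_le add.commute[of _ "emeasure cone_measure (?S - A)"])
  then show ?thesis using 3 by (intro antisym)
qed

text \<open>The Caratheodory measurable sets form a larger sigma-algebra than the Borel sets, so the
  restriction to the sphere is pushed to \<open>borel\<close> by the identity before the measures
  are compared.\<close>

lemma nn_integral_hausdorff_sphere:
  fixes f :: "real ^ 'n \<Rightarrow> ennreal"
  assumes f: "f \<in> borel_measurable borel"
  shows "(\<integral>\<^sup>+n\<in>sphere 0 1. f n \<partial>hausdorff_measure (CARD('n) - 1)) = (\<integral>\<^sup>+n. f n \<partial>cone_measure)"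
proof -
  let ?H = "hausdorff_measure (CARD('n) - 1) :: (real ^ 'n) measure"
  let ?D = "density ?H (indicator (sphere 0 1))"
  have sub: "A \<in> sets ?H" if "A \<in> sets borel" for A :: "(real ^ 'n) set"
    using that sets_borel_subset_hausdorff_measure by blast
  have m: "g \<in> borel_measurable ?H" if "g \<in> borel_measurable borel" for g :: "real ^ 'n \<Rightarrow> 'b::topological_space"
    using that sub by (auto simp: measurable_def)
  have idm: "(\<lambda>x. x) \<in> measurable ?D borel" using sub by (auto simp: measurable_def)
  have "distr ?D borel (\<lambda>x. x) = cone_measure"
  proof (rule measure_eqI)
    fix A :: "(real ^ 'n) set" assume "A \<in> sets (distr ?D borel (\<lambda>x. x))"
    then have A: "A \<in> sets borel" by simp
    have "emeasure (distr ?D borel (\<lambda>x. x)) A = emeasure ?D A"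
      using emeasure_distr[OF idm A] by simp
    also have "\<dots> = emeasure ?H (sphere 0 1 \<inter> A)"
      using sub[OF A] sub[of "sphere 0 1"]
      by (simp add: emeasure_density indicator_inter_arith[symmetric])
    also have "\<dots> = hausdorff_outer (CARD('n) - 1) (sphere 0 1 \<inter> A)"
      using A by (intro emeasure_hausdorff_measure sub) auto
    also have "\<dots> = emeasure cone_measure (sphere 0 1 \<inter> A)"
      using A by (intro hausdorff_outer_eq_cone_measure) auto
    also have "\<dots> = emeasure cone_measure A"
      using A AE_cone_measure_sphere by (intro emeasure_eq_AE) auto
    finally show "emeasure (distr ?D borel (\<lambda>x. x)) A = emeasure cone_measure A" .
  qed simp
  then have "(\<integral>\<^sup>+n. f n \<partial>cone_measure) = (\<integral>\<^sup>+n. f n \<partial>distr ?D borel (\<lambda>x. x))" by simp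
  also have "\<dots> = (\<integral>\<^sup>+n. f n \<partial>?D)" using idm f by (simp add: nn_integral_distr)
  also have "\<dots> = (\<integral>\<^sup>+n. indicator (sphere 0 1) n * f n \<partial>?H)"
    using m[OF f] sub[of "sphere 0 1"] by (intro nn_integral_density) auto
  finally show ?thesis by (simp add: mult.commute)
qed

section \<open>Translations of Sobolev functions\<close>

text \<open>A family closed under differentiation, so that the flatness of
  \<open>exp (- (1 / t))\<close> at 0 has to be checked only once to yield derivatives of all
  orders.\<close>

definition bump_poly :: "real poly \<Rightarrow> real \<Rightarrow> real" where
  "bump_poly p t = (if 0 < t then poly p (1 / t) * exp (- (1 / t)) else 0)"

lemma tendsto_poly_exp_neg: "((\<lambda>x::real. poly p x * exp (- x)) \<longlongrightarrow> 0) at_top"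
proof -
  have "((\<lambda>x. \<Sum>i\<le>degree p. coeff p i * (x ^ i / exp x)) \<longlongrightarrow> (\<Sum>i\<le>degree p. coeff p i * 0)) at_top"
    by (intro tendsto_sum tendsto_mult tendsto_const tendsto_power_div_exp_0)
  then show ?thesis
    by (simp add: poly_altdef exp_minus sum_distrib_left divide_inverse mult_ac)
qed

lemma tendsto_bump_poly_0: "((\<lambda>t. bump_poly p t) \<longlongrightarrow> 0) (at 0)"
proof (rule filterlim_split_at)
  have "\<forall>\<^sub>F t in at_left 0. bump_poly p t = 0"
    by (rule eventually_at_leftI[of "-1"]) (auto simp: bump_poly_def)
  then show "((\<lambda>t. bump_poly p t) \<longlongrightarrow> 0) (at_left 0)"
    by (rule tendsto_eventually)
  have "((\<lambda>t. poly p (inverse t) * exp (- inverse t)) \<longlongrightarrow> 0) (at_right 0)"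
    by (rule filterlim_compose[OF tendsto_poly_exp_neg filterlim_inverse_at_top_right])
  moreover have "\<forall>\<^sub>F t in at_right 0. poly p (inverse t) * exp (- inverse t) = bump_poly p t"
    by (rule eventually_at_rightI[of 0 1]) (auto simp: bump_poly_def inverse_eq_divide)
  ultimately show "((\<lambda>t. bump_poly p t) \<longlongrightarrow> 0) (at_right 0)"
    by (rule Lim_transform_eventually)
qed

text \<open>In terms of \<open>y = 1 / t\<close> the chain rule gives
  \<open>y\<^sup>2 * (p y - p' y) * exp (- y)\<close>, which accounts for the polynomial.\<close>

lemma bump_poly_has_derivative:
  "(bump_poly p has_real_derivative bump_poly ([:0, 0, 1:] * (p - pderiv p)) t) (at t)"
proof -
  consider "0 < t" | "t < 0" | "t = 0" by linarith
  then show ?thesis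
  proof cases
    case 1
    have "((\<lambda>t. poly p (1 / t) * exp (- (1 / t))) has_real_derivative
        bump_poly ([:0, 0, 1:] * (p - pderiv p)) t) (at t)"
      using 1 by (auto intro!: derivative_eq_intros simp: bump_poly_def field_simps power2_eq_square)
    moreover have "\<forall>\<^sub>F x in nhds t. bump_poly p x = poly p (1 / x) * exp (- (1 / x))"
      using eventually_nhds_in_open[of "{0<..}" t] 1
      by (auto elim!: eventually_mono simp: bump_poly_def)
    ultimately show ?thesis by (subst DERIV_cong_ev[OF refl _ refl])
  next
    case 2
    have "\<forall>\<^sub>F x in nhds t. bump_poly p x = 0"
      using eventually_nhds_in_open[of "{..<0}" t] 2
      by (auto elim!: eventually_mono simp: bump_poly_def)
    moreover have "((\<lambda>_. 0) has_real_derivative bump_poly ([:0, 0, 1:] * (p - pderiv p)) t) (at t)"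
      using 2 by (auto simp: bump_poly_def)
    ultimately show ?thesis by (subst DERIV_cong_ev[OF refl _ refl])
  next
    case 3
    \<comment> \<open>The difference quotient at 0 again belongs to the family: dividing by
      \<open>y\<close> multiplies the polynomial by its variable.\<close>
    have "(bump_poly p y - bump_poly p 0) / (y - 0) = bump_poly (pCons 0 p) y" for y
      by (auto simp: bump_poly_def)
    then have "(bump_poly p has_real_derivative 0) (at 0)"
      unfolding has_field_derivative_iff using tendsto_bump_poly_0[of "pCons 0 p"] by simp
    then show ?thesis using 3 by (simp add: bump_poly_def)
  qed
qed

text \<open>An algebra of functions that is closed under partial derivatives, which gives all orders of
  smoothness at once.\<close>

inductive bump_algebra :: "real \<Rightarrow> 'a::euclidean_space \<Rightarrow> ('a \<Rightarrow> real) \<Rightarrow> bool" for s c where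
  base: "bump_algebra s c (\<lambda>x. bump_poly p (s\<^sup>2 - (norm (x - c))\<^sup>2))"
| coord: "bump_algebra s c (\<lambda>x. (x - c) \<bullet> v)"
| const: "bump_algebra s c (\<lambda>x. k)"
| add: "bump_algebra s c f \<Longrightarrow> bump_algebra s c g \<Longrightarrow> bump_algebra s c (\<lambda>x. f x + g x)"
| mult: "bump_algebra s c f \<Longrightarrow> bump_algebra s c g \<Longrightarrow> bump_algebra s c (\<lambda>x. f x * g x)"

lemma bump_poly_norm_has_derivative:
  fixes c x :: "'a::euclidean_space"
  shows "((\<lambda>x. bump_poly p (s\<^sup>2 - (norm (x - c))\<^sup>2)) has_derivative
    (\<lambda>v. bump_poly ([:0, 0, 1:] * (p - pderiv p)) (s\<^sup>2 - (norm (x - c))\<^sup>2) * (- 2 * ((x - c) \<bullet> v)))) (at x)"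
proof -
  have "((\<lambda>x. s\<^sup>2 - (x - c) \<bullet> (x - c)) has_derivative (\<lambda>v. - 2 * ((x - c) \<bullet> v))) (at x)"
    by (auto intro!: derivative_eq_intros simp: inner_commute)
  then have "((\<lambda>x. bump_poly p (s\<^sup>2 - (x - c) \<bullet> (x - c))) has_derivative
    (\<lambda>v. (- 2 * ((x - c) \<bullet> v)) * bump_poly ([:0, 0, 1:] * (p - pderiv p)) (s\<^sup>2 - (x - c) \<bullet> (x - c)))) (at x)"
    by (rule DERIV_compose_FDERIV[OF bump_poly_has_derivative])
  then show ?thesis by (simp add: power2_norm_eq_inner mult.commute)
qed

lemma bump_algebra_derivative:
  assumes "bump_algebra s c f"
  shows "\<exists>f'. (\<forall>x. (f has_derivative f' x) (at x)) \<and> (\<forall>v. bump_algebra s c (\<lambda>x. f' x v))"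
  using assms
proof induction
  case (base p)
  let ?q = "[:0, 0, 1:] * (p - pderiv p)"
  show ?case
  proof (intro exI conjI allI)
    fix v
    show "bump_algebra s c (\<lambda>x. bump_poly ?q (s\<^sup>2 - (norm (x - c))\<^sup>2) * (- 2 * ((x - c) \<bullet> v)))"
      by (intro bump_algebra.intros)
  qed (rule bump_poly_norm_has_derivative)
next
  case (coord w)
  show ?case
    by (intro exI[of _ "\<lambda>x v. v \<bullet> w"] conjI allI)
      (auto intro!: derivative_eq_intros bump_algebra.const)
next
  case (const k)
  show ?case
    by (intro exI[of _ "\<lambda>x v. 0"] conjI allI)
      (auto intro!: derivative_eq_intros bump_algebra.const)
next
  case (add f g)
  then obtain f' g' where
    "\<And>x. (f has_derivative f' x) (at x)" "\<And>v. bump_algebra s c (\<lambda>x. f' x v)"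
    "\<And>x. (g has_derivative g' x) (at x)" "\<And>v. bump_algebra s c (\<lambda>x. g' x v)" by blast
  then show ?case
    by (intro exI[of _ "\<lambda>x v. f' x v + g' x v"] conjI allI has_derivative_add bump_algebra.add)
next
  case (mult f g)
  then obtain f' g' where
    "\<And>x. (f has_derivative f' x) (at x)" "\<And>v. bump_algebra s c (\<lambda>x. f' x v)"
    "\<And>x. (g has_derivative g' x) (at x)" "\<And>v. bump_algebra s c (\<lambda>x. g' x v)" by blast
  with mult.hyps show ?case
    by (intro exI[of _ "\<lambda>x v. f x * g' x v + f' x v * g x"] conjI allI has_derivative_mult
        bump_algebra.add bump_algebra.mult)
qed

lemma bump_algebra_C_k: "bump_algebra s c f \<Longrightarrow> C_k k f"
proof (induction k arbitrary: f)
  case 0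
  then obtain f' where "\<And>x. (f has_derivative f' x) (at x)" using bump_algebra_derivative by blast
  then show ?case
    by (auto intro!: continuous_at_imp_continuous_on has_derivative_continuous)
next
  case (Suc k)
  then obtain f' where f': "\<And>x. (f has_derivative f' x) (at x)" "\<And>v. bump_algebra s c (\<lambda>x. f' x v)"
    using bump_algebra_derivative by blast
  have "frechet_derivative f (at x) = f' x" for x
    using frechet_derivative_at[OF f'(1)] by simp
  then show ?case using f' Suc.IH by (auto simp: differentiable_def)
qed

text \<open>The classical bump \<open>exp (- 1 / (s\<^sup>2 - (norm z)\<^sup>2))\<close> inside the
  ball of radius \<open>s\<close>, without normalisation of its mass.\<close>

definition bump :: "real \<Rightarrow> 'a::euclidean_space \<Rightarrow> real" where
  "bump s z = bump_poly 1 (s\<^sup>2 - (norm z)\<^sup>2)"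

text \<open>The derivative at \<open>z\<close> in direction \<open>v\<close>;
  \<open>[:0, 0, 1:]\<close> is the polynomial that differentiation produces from the constant
  1.\<close>

definition bump_deriv :: "real \<Rightarrow> 'a::euclidean_space \<Rightarrow> 'a \<Rightarrow> real" where
  "bump_deriv s z v = bump_poly [:0, 0, 1:] (s\<^sup>2 - (norm z)\<^sup>2) * (- 2 * (z \<bullet> v))"

lemma bump_has_derivative:
  "((\<lambda>x. bump s (x - c)) has_derivative bump_deriv s (x - c)) (at x)"
  using bump_poly_norm_has_derivative[of 1 s c x] by (simp add: bump_def bump_deriv_def[abs_def] pderiv_1)

lemma bump_nonneg: "0 \<le> bump s z" and bump_le_1: "bump s z \<le> 1"
  by (auto simp: bump_def bump_poly_def)

lemma abs_bump [simp]: "\<bar>bump s z\<bar> = bump s z"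
  using bump_nonneg[of s z] by simp

lemma bump_pos_iff: "0 < s \<Longrightarrow> 0 < bump s z \<longleftrightarrow> norm z < s"
  by (auto simp: bump_def bump_poly_def abs_square_less_1 power2_less_imp_less intro: power_strict_mono)

lemma bump_eq_0: "0 < s \<Longrightarrow> s \<le> norm z \<Longrightarrow> bump s z = 0"
  using bump_pos_iff[of s z] bump_nonneg[of s z] by linarith

lemma bump_deriv_eq_0: "0 < s \<Longrightarrow> s \<le> norm z \<Longrightarrow> bump_deriv s z v = 0"
proof -
  assume "0 < s" "s \<le> norm z"
  then have "s\<^sup>2 \<le> (norm z)\<^sup>2" by (intro power_mono) auto
  then have "\<not> 0 < s\<^sup>2 - (norm z)\<^sup>2" by linarith
  then show ?thesis by (simp only: bump_deriv_def bump_poly_def if_False mult_zero_left)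
qed

lemma continuous_bump_poly [continuous_intros]: "continuous_on A f \<Longrightarrow> continuous_on A (\<lambda>x. bump_poly p (f x))"
proof (rule continuous_on_compose2[of UNIV "bump_poly p"])
  show "continuous_on UNIV (bump_poly p)"
    using bump_poly_has_derivative DERIV_isCont continuous_at_imp_continuous_on by blast
qed auto

lemma continuous_bump: "continuous_on UNIV (bump s)"
  unfolding bump_def[abs_def] by (intro continuous_intros)

lemma continuous_bump_deriv: "continuous_on UNIV (\<lambda>z. bump_deriv s z v)"
  unfolding bump_deriv_def[abs_def] by (intro continuous_intros)

lemma borel_measurable_bump [measurable]: "bump s \<in> borel_measurable borel"
  by (rule borel_measurable_continuous_onI[OF continuous_bump])

lemma borel_measurable_bump_deriv [measurable]: "(\<lambda>z. bump_deriv s z v) \<in> borel_measurable borel"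
  by (rule borel_measurable_continuous_onI[OF continuous_bump_deriv])

lemma bump_deriv_bounded:
  assumes "0 < s"
  obtains C where "0 \<le> C" "\<And>z. \<bar>bump_deriv s z v\<bar> \<le> C"
proof -
  have "compact ((\<lambda>z. bump_deriv s z v) ` cball (0 :: 'a) s)"
    by (intro compact_continuous_image continuous_on_subset[OF continuous_bump_deriv]) auto
  then have "bounded ((\<lambda>z. bump_deriv s z v) ` cball (0 :: 'a) s)" by (rule compact_imp_bounded)
  then obtain C where "\<forall>d\<in>(\<lambda>z. bump_deriv s z v) ` cball (0 :: 'a) s. norm d \<le> C"
    unfolding bounded_iff by blast
  then have C: "\<And>z. z \<in> cball (0::'a) s \<Longrightarrow> \<bar>bump_deriv s z v\<bar> \<le> C" by simp
  show thesis
  proof (rule that[of "max C 0"])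
    fix z
    show "\<bar>bump_deriv s z v\<bar> \<le> max C 0"
      using C[of z] bump_deriv_eq_0[OF assms, of z v] by (cases "norm z \<le> s") auto
  qed simp
qed

text \<open>Weak gradients are tested on translated bumps only; the translation estimate then
  follows by averaging.\<close>

lemma test_function_bump:
  fixes c :: "'a::euclidean_space"
  assumes "0 < s" shows "test_function (\<lambda>x. bump s (x - c))"
  unfolding test_function_def
proof (intro conjI allI)
  show "C_k k (\<lambda>x. bump s (x - c))" for k
    unfolding bump_def by (rule bump_algebra_C_k[of s c, OF bump_algebra.base])
  have "{x. bump s (x - c) \<noteq> 0} \<subseteq> cball c s"
    using bump_eq_0[OF assms] by (force simp: dist_norm norm_minus_commute)
  then show "compact (closure {x. bump s (x - c) \<noteq> 0})"
    using bounded_subset[OF bounded_cball] by (simp add: compact_closure)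
qed

section \<open>Averages against bumps and the translation estimate\<close>

lemma integrable_lborel_pairI:
  fixes F :: "'a::euclidean_space \<times> 'b::euclidean_space \<Rightarrow> real"
  assumes F: "F \<in> borel_measurable (lborel \<Otimes>\<^sub>M lborel)"
    and fin: "(\<integral>\<^sup>+x. \<integral>\<^sup>+y. ennreal \<bar>F (x, y)\<bar> \<partial>lborel \<partial>lborel) < \<infinity>"
  shows "integrable (lborel \<Otimes>\<^sub>M lborel) F"
proof (rule integrableI_bounded[OF F])
  have "(\<lambda>z. ennreal (norm (F z))) \<in> borel_measurable (lborel \<Otimes>\<^sub>M lborel)" using F by measurable
  from lborel.nn_integral_fst[OF this]
  show "(\<integral>\<^sup>+z. ennreal (norm (F z)) \<partial>(lborel \<Otimes>\<^sub>M lborel)) < \<infinity>" using fin by simp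
qed

lemma nn_integral_lborel_translate:
  fixes f :: "'a::euclidean_space \<Rightarrow> ennreal"
  assumes [measurable]: "f \<in> borel_measurable borel"
  shows "(\<integral>\<^sup>+x. f (x + a) \<partial>lborel) = (\<integral>\<^sup>+x. f x \<partial>lborel)"
    and "(\<integral>\<^sup>+x. f (a - x) \<partial>lborel) = (\<integral>\<^sup>+x. f x \<partial>lborel)"
  using nn_integral_lborel_affine[OF assms, of 1 a] nn_integral_lborel_affine[OF assms, of "-1" a]
  by (simp_all add: add.commute)

lemma nn_integral_bump:
  assumes "0 < s"
  shows "0 < (\<integral>\<^sup>+z. ennreal (bump s (z::'a::euclidean_space)) \<partial>lborel)"
    "(\<integral>\<^sup>+z. ennreal (bump s (z::'a)) \<partial>lborel) < \<infinity>"
proof -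
  have "\<not> (\<integral>\<^sup>+z. ennreal (bump s (z::'a)) \<partial>lborel) = 0"
  proof
    assume "(\<integral>\<^sup>+z. ennreal (bump s (z::'a)) \<partial>lborel) = 0"
    then have "AE z in lborel. bump s (z::'a) = 0"
    proof (subst (asm) nn_integral_0_iff_AE)
      assume "AE z in lborel. ennreal (bump s (z::'a)) = 0"
      then show "AE z in lborel. bump s (z::'a) = 0"
        by eventually_elim (simp add: ennreal_eq_0_iff antisym bump_nonneg)
    qed measurable
    then have "AE z in lborel. z \<notin> ball (0::'a) s"
      by eventually_elim (use bump_pos_iff[OF assms] in force)
    then have "emeasure lborel (ball (0::'a) s) = 0"
      by (subst (asm) AE_iff_null_sets[symmetric]) auto
    then show False using assms unit_ball_vol_pos[of "real DIM('a)"] by (auto simp: emeasure_ball)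
  qed
  then show "0 < (\<integral>\<^sup>+z. ennreal (bump s (z::'a)) \<partial>lborel)" by (simp add: zero_less_iff_neq_zero)
  have "(\<integral>\<^sup>+z. ennreal (bump s (z::'a)) \<partial>lborel) \<le> (\<integral>\<^sup>+z. indicator (cball (0::'a) s) z \<partial>lborel)"
  proof (rule nn_integral_mono)
    fix z :: 'a
    show "ennreal (bump s z) \<le> indicator (cball 0 s) z"
      using bump_eq_0[OF assms, of z] bump_le_1[of s z] ennreal_leI[of "bump s z" 1]
      by (cases "norm z \<le> s") auto
  qed
  also have "\<dots> < \<infinity>" using emeasure_bounded_finite[of "cball (0::'a) s"] by simp
  finally show "(\<integral>\<^sup>+z. ennreal (bump s (z::'a)) \<partial>lborel) < \<infinity>" .
qed

lemma bump_difference_FTC: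
  fixes z h :: "'a::euclidean_space"
  shows "integrable lborel (\<lambda>t. indicator {0..1} t * bump_deriv s (z - t *\<^sub>R h) h)"
    and "(LINT t|lborel. indicator {0..1} t * bump_deriv s (z - t *\<^sub>R h) h) = bump s z - bump s (z - h)"
proof -
  have c: "continuous_on A (\<lambda>t. bump_deriv s (z - t *\<^sub>R h) h)" for A
    by (intro continuous_on_compose2[OF continuous_bump_deriv] continuous_intros) auto
  have *: "((\<lambda>t. - bump s (z - t *\<^sub>R h)) has_vector_derivative bump_deriv s (z - t *\<^sub>R h) h) (at t within A)" for t A
  proof -
    have "((\<lambda>x. bump s (x - 0)) has_derivative bump_deriv s ((z - t *\<^sub>R h) - 0)) (at (z - t *\<^sub>R h))"
      by (rule bump_has_derivative)
    moreover have "((\<lambda>t. z - t *\<^sub>R h) has_derivative (\<lambda>d. - d *\<^sub>R h)) (at t within A)"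
      by (auto intro!: derivative_eq_intros)
    ultimately have "((\<lambda>t. bump s (z - t *\<^sub>R h)) has_derivative (\<lambda>d. bump_deriv s (z - t *\<^sub>R h) (- d *\<^sub>R h))) (at t within A)"
      using has_derivative_compose by fastforce
    then have "((\<lambda>t. - bump s (z - t *\<^sub>R h)) has_derivative (\<lambda>d. - bump_deriv s (z - t *\<^sub>R h) (- d *\<^sub>R h))) (at t within A)"
      by (rule has_derivative_minus)
    then show ?thesis by (simp add: has_vector_derivative_def bump_deriv_def mult_ac)
  qed
  have "set_integrable lborel {0..1} (\<lambda>t. bump_deriv s (z - t *\<^sub>R h) h)"
    by (intro borel_integrable_atLeastAtMost' c)
  then show "integrable lborel (\<lambda>t. indicator {0..1} t * bump_deriv s (z - t *\<^sub>R h) h)"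
    by (simp add: set_integrable_def)
  have "(LINT t|lborel. indicator {0..1} t *\<^sub>R bump_deriv s (z - t *\<^sub>R h) h) = - bump s (z - 1 *\<^sub>R h) - - bump s (z - 0 *\<^sub>R h)"
    by (intro integral_FTC_Icc c *) simp
  then show "(LINT t|lborel. indicator {0..1} t * bump_deriv s (z - t *\<^sub>R h) h) = bump s z - bump s (z - h)"
    by simp
qed

text \<open>The difference of bumps is the integral of a directional derivative over a segment, so
  after Fubini the hypothesis trades \<open>\<eta>\<close> for \<open>g\<close> at each point of the
  segment. The mass of the bump enters only as a factor and drops out on normalising, which makes
  the estimate uniform in \<open>s\<close>.\<close>

lemma nn_integral_bump_convolution_difference:
  fixes \<eta> :: "'a::euclidean_space \<Rightarrow> real" and g :: "'a \<Rightarrow> 'a"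
  assumes \<eta>: "integrable lborel \<eta>" and g: "integrable lborel g" and s: "0 < s"
    and hyp: "\<And>x. (LINT y|lborel. \<eta> y * bump_deriv s (y - x) h) = - (LINT y|lborel. (g y \<bullet> h) * bump s (y - x))"
  shows "(\<integral>\<^sup>+x. ennreal \<bar>LINT y|lborel. \<eta> y * (bump s (y - x) - bump s (y - x - h))\<bar> \<partial>lborel)
    \<le> ennreal (norm h) * (\<integral>\<^sup>+y. ennreal (norm (g y)) \<partial>lborel) * (\<integral>\<^sup>+z. ennreal (bump s (z::'a)) \<partial>lborel)"
proof -
  have [measurable]: "\<eta> \<in> borel_measurable borel" "g \<in> borel_measurable borel" using \<eta> g by auto
  obtain C where C: "0 \<le> C" "\<And>z. \<bar>bump_deriv s (z::'a) h\<bar> \<le> C" using bump_deriv_bounded[OF s] by blast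
  let ?i = "indicator {0..1} :: real \<Rightarrow> real"
  have bnd: "ennreal \<bar>LINT y|lborel. \<eta> y * (bump s (y - x) - bump s (y - x - h))\<bar>
      \<le> (\<integral>\<^sup>+t. indicator {0..1} t * (\<integral>\<^sup>+y. ennreal (norm h * norm (g y) * bump s (y - x - t *\<^sub>R h)) \<partial>lborel) \<partial>lborel)" for x
  proof -
    let ?F = "\<lambda>y t. ?i t * (\<eta> y * bump_deriv s (y - x - t *\<^sub>R h) h)"
    have "integrable (lborel \<Otimes>\<^sub>M lborel) (\<lambda>z. ?F (fst z) (snd z))"
    proof (rule integrable_lborel_pairI)
      show "(\<lambda>z. ?F (fst z) (snd z)) \<in> borel_measurable (lborel \<Otimes>\<^sub>M lborel)" by measurable
      have "(\<integral>\<^sup>+y. \<integral>\<^sup>+t. ennreal \<bar>?F y t\<bar> \<partial>lborel \<partial>lborel)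
        \<le> (\<integral>\<^sup>+y. \<integral>\<^sup>+t. ennreal (C * \<bar>\<eta> y\<bar>) * indicator {0..1::real} t \<partial>lborel \<partial>lborel)"
      proof (intro nn_integral_mono)
        fix y :: 'a and t :: real
        have "\<bar>\<eta> y * bump_deriv s (y - x - t *\<^sub>R h) h\<bar> \<le> C * \<bar>\<eta> y\<bar>"
          using mult_right_mono[OF C(2)[of "y - x - t *\<^sub>R h"], of "\<bar>\<eta> y\<bar>"] by (simp add: abs_mult mult.commute)
        then show "ennreal \<bar>?F y t\<bar> \<le> ennreal (C * \<bar>\<eta> y\<bar>) * indicator {0..1} t"
          by (auto simp: indicator_def intro: ennreal_leI)
      qed
      also have "\<dots> = (\<integral>\<^sup>+y. ennreal (C * \<bar>\<eta> y\<bar>) \<partial>lborel)"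
        by (simp add: nn_integral_cmult)
      also have "\<dots> < \<infinity>"
        using \<eta> C(1)
        by (simp add: integrable_iff_bounded ennreal_mult nn_integral_cmult ennreal_mult_less_top)
      finally show "(\<integral>\<^sup>+y. \<integral>\<^sup>+t. ennreal \<bar>?F (fst (y, t)) (snd (y, t))\<bar> \<partial>lborel \<partial>lborel) < \<infinity>" by simp
    qed
    then have int: "integrable (lborel \<Otimes>\<^sub>M lborel) (case_prod ?F)" by (simp add: case_prod_beta')
    have "(LINT y|lborel. \<eta> y * (bump s (y - x) - bump s (y - x - h))) = (LINT y|lborel. LINT t|lborel. ?F y t)"
    proof (intro Bochner_Integration.integral_cong refl)
      fix y :: 'a
      have "(LINT t|lborel. ?F y t) = (LINT t|lborel. \<eta> y * (?i t * bump_deriv s ((y - x) - t *\<^sub>R h) h))"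
        by (simp add: mult_ac)
      also have "\<dots> = \<eta> y * (bump s (y - x) - bump s (y - x - h))"
        by (simp add: bump_difference_FTC)
      finally show "\<eta> y * (bump s (y - x) - bump s (y - x - h)) = (LINT t|lborel. ?F y t)" ..
    qed
    also have "\<dots> = (LINT t|lborel. LINT y|lborel. ?F y t)"
      by (rule lborel_pair.Fubini_integral[OF int, symmetric])
    also have "\<dots> = (LINT t|lborel. ?i t * - (LINT y|lborel. (g y \<bullet> h) * bump s (y - (x + t *\<^sub>R h))))"
      by (simp add: hyp[symmetric] diff_diff_eq)
    finally have eq: "(LINT y|lborel. \<eta> y * (bump s (y - x) - bump s (y - x - h)))
        = (LINT t|lborel. ?i t * - (LINT y|lborel. (g y \<bullet> h) * bump s (y - (x + t *\<^sub>R h))))" .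
    \<comment> \<open>If the integrand is not integrable, the Bochner integral has the value 0 and
      the inequality is trivial.\<close>
    have "ennreal \<bar>LINT y|lborel. \<eta> y * (bump s (y - x) - bump s (y - x - h))\<bar>
        \<le> (\<integral>\<^sup>+t. ennreal \<bar>?i t * - (LINT y|lborel. (g y \<bullet> h) * bump s (y - (x + t *\<^sub>R h)))\<bar> \<partial>lborel)"
      unfolding eq
      using integral_norm_bound_ennreal[of lborel "\<lambda>t. ?i t * - (LINT y|lborel. (g y \<bullet> h) * bump s (y - (x + t *\<^sub>R h)))"]
      by (cases "integrable lborel (\<lambda>t. ?i t * - (LINT y|lborel. (g y \<bullet> h) * bump s (y - (x + t *\<^sub>R h))))")
        (auto simp: not_integrable_integral_eq)
    also have "\<dots> \<le> (\<integral>\<^sup>+t. indicator {0..1} t * (\<integral>\<^sup>+y. ennreal (norm h * norm (g y) * bump s (y - x - t *\<^sub>R h)) \<partial>lborel) \<partial>lborel)"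
    proof (rule nn_integral_mono)
      fix t :: real
      let ?G = "\<lambda>y. (g y \<bullet> h) * bump s (y - (x + t *\<^sub>R h))"
      have "ennreal \<bar>LINT y|lborel. ?G y\<bar> \<le> (\<integral>\<^sup>+y. ennreal \<bar>?G y\<bar> \<partial>lborel)"
        using integral_norm_bound_ennreal[of lborel ?G]
        by (cases "integrable lborel ?G") (auto simp: not_integrable_integral_eq)
      also have "\<dots> \<le> (\<integral>\<^sup>+y. ennreal (norm h * norm (g y) * bump s (y - x - t *\<^sub>R h)) \<partial>lborel)"
      proof (intro nn_integral_mono ennreal_leI)
        fix y
        have "\<bar>g y \<bullet> h\<bar> \<le> norm h * norm (g y)"
          using Cauchy_Schwarz_ineq2[of "g y" h] by (simp add: mult.commute)
        then show "\<bar>?G y\<bar> \<le> norm h * norm (g y) * bump s (y - x - t *\<^sub>R h)"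
          using bump_nonneg[of s "y - (x + t *\<^sub>R h)"] by (simp add: abs_mult mult_right_mono diff_diff_eq)
      qed
      finally show "ennreal \<bar>?i t * - (LINT y|lborel. ?G y)\<bar>
         \<le> indicator {0..1} t * (\<integral>\<^sup>+y. ennreal (norm h * norm (g y) * bump s (y - x - t *\<^sub>R h)) \<partial>lborel)"
        by (simp add: indicator_def)
    qed
    finally show ?thesis .
  qed
  let ?I = "\<integral>\<^sup>+z. ennreal (bump s (z::'a)) \<partial>lborel"
  have "(\<integral>\<^sup>+x. ennreal \<bar>LINT y|lborel. \<eta> y * (bump s (y - x) - bump s (y - x - h))\<bar> \<partial>lborel)
      \<le> (\<integral>\<^sup>+x. (\<integral>\<^sup>+t. indicator {0..1} t * (\<integral>\<^sup>+y. ennreal (norm h * norm (g y) * bump s (y - x - t *\<^sub>R h)) \<partial>lborel) \<partial>(lborel :: real measure)) \<partial>lborel)"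
    by (rule nn_integral_mono) (rule bnd)
  also have "\<dots> = (\<integral>\<^sup>+t. (\<integral>\<^sup>+x. indicator {0..1} t * (\<integral>\<^sup>+y. ennreal (norm h * norm (g y) * bump s (y - x - t *\<^sub>R h)) \<partial>lborel) \<partial>lborel) \<partial>(lborel :: real measure))"
    by (rule lborel_pair.Fubini') measurable
  also have "\<dots> = (\<integral>\<^sup>+t. indicator {0..1} t * (ennreal (norm h) * (\<integral>\<^sup>+y. ennreal (norm (g y)) \<partial>lborel) * ?I) \<partial>(lborel :: real measure))"
  proof (rule nn_integral_cong)
    fix t :: real
    have "(\<integral>\<^sup>+x. indicator {0..1} t * (\<integral>\<^sup>+y. ennreal (norm h * norm (g y) * bump s (y - x - t *\<^sub>R h)) \<partial>lborel) \<partial>lborel)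
      = indicator {0..1} t * (\<integral>\<^sup>+x. (\<integral>\<^sup>+y. ennreal (norm h * norm (g y) * bump s (y - x - t *\<^sub>R h)) \<partial>lborel) \<partial>lborel)"
      by (rule nn_integral_cmult) measurable
    also have "(\<integral>\<^sup>+x. (\<integral>\<^sup>+y. ennreal (norm h * norm (g y) * bump s (y - x - t *\<^sub>R h)) \<partial>lborel) \<partial>lborel)
       = (\<integral>\<^sup>+y. (\<integral>\<^sup>+x. ennreal (norm h * norm (g y) * bump s (y - x - t *\<^sub>R h)) \<partial>lborel) \<partial>lborel)"
      by (rule lborel_pair.Fubini') measurable
    also have "\<dots> = (\<integral>\<^sup>+y. ennreal (norm h) * ennreal (norm (g y)) * ?I \<partial>lborel)"
    proof (rule nn_integral_cong)
      fix y :: 'a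
      have "(\<integral>\<^sup>+x. ennreal (norm h * norm (g y) * bump s (y - x - t *\<^sub>R h)) \<partial>lborel)
        = (\<integral>\<^sup>+x. ennreal (norm h) * ennreal (norm (g y)) * ennreal (bump s ((y - t *\<^sub>R h) - x)) \<partial>lborel)"
        by (simp add: ennreal_mult bump_nonneg algebra_simps)
      also have "\<dots> = ennreal (norm h) * ennreal (norm (g y)) * (\<integral>\<^sup>+x. ennreal (bump s ((y - t *\<^sub>R h) - x)) \<partial>lborel)"
        by (rule nn_integral_cmult) measurable
      also have "(\<integral>\<^sup>+x. ennreal (bump s ((y - t *\<^sub>R h) - x)) \<partial>lborel) = ?I"
        by (rule nn_integral_lborel_translate(2)[where f = "\<lambda>z. ennreal (bump s z)"]) measurable
      finally show "(\<integral>\<^sup>+x. ennreal (norm h * norm (g y) * bump s (y - x - t *\<^sub>R h)) \<partial>lborel)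
        = ennreal (norm h) * ennreal (norm (g y)) * ?I" .
    qed
    also have "\<dots> = ennreal (norm h) * (\<integral>\<^sup>+y. ennreal (norm (g y)) \<partial>lborel) * ?I"
      by (simp add: nn_integral_cmult nn_integral_multc)
    finally show "(\<integral>\<^sup>+x. indicator {0..1} t * (\<integral>\<^sup>+y. ennreal (norm h * norm (g y) * bump s (y - x - t *\<^sub>R h)) \<partial>lborel) \<partial>lborel)
      = indicator {0..1} t * (ennreal (norm h) * (\<integral>\<^sup>+y. ennreal (norm (g y)) \<partial>lborel) * ?I)" .
  qed
  also have "\<dots> = ennreal (norm h) * (\<integral>\<^sup>+y. ennreal (norm (g y)) \<partial>lborel) * ?I"
    by (subst nn_integral_multc) auto
  finally show ?thesis .
qed

lemma integral_lborel_translate: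
  fixes f :: "'a::euclidean_space \<Rightarrow> 'b::euclidean_space"
  assumes [measurable]: "f \<in> borel_measurable borel"
  shows "(LINT x|lborel. f (x + a)) = (LINT x|lborel. f x)"
proof -
  have "(LINT x|lborel. f x) = (LINT x|distr lborel borel (\<lambda>x. a + x). f x)"
    by (simp add: lborel_distr_plus)
  also have "\<dots> = (LINT x|lborel. f (a + x))" by (rule integral_distr) auto
  finally show ?thesis by (simp add: add.commute)
qed

lemma integrable_lborel_translate:
  fixes f :: "'a::euclidean_space \<Rightarrow> 'b::euclidean_space"
  assumes f: "integrable lborel f"
  shows "integrable lborel (\<lambda>x. f (x + a))"
proof -
  have [measurable]: "f \<in> borel_measurable borel" using f by auto
  show ?thesis
    using f nn_integral_lborel_translate(1)[of "\<lambda>x. ennreal (norm (f x))" a]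
    by (simp add: integrable_iff_bounded)
qed

text \<open>Bumps divided by their mass form an approximate identity: near \<open>y\<close>
  continuity bounds the oscillation of \<open>\<sigma>\<close>, and farther away the bump
  vanishes.\<close>

lemma bump_average_tendsto:
  fixes \<sigma> :: "'a::euclidean_space \<Rightarrow> real"
  assumes c: "continuous_on UNIV \<sigma>" and b: "\<And>x. \<bar>\<sigma> x\<bar> \<le> 1"
  shows "(\<lambda>n. (LINT x|lborel. \<sigma> x * bump (1 / Suc n) (y - x)) / (LINT x|lborel. bump (1 / Suc n) (x::'a))) \<longlonglongrightarrow> \<sigma> y"
proof (rule LIMSEQ_I)
  fix e :: real assume e: "0 < e"
  have [measurable]: "\<sigma> \<in> borel_measurable borel" using c by (rule borel_measurable_continuous_onI)
  obtain d where d: "0 < d" "\<And>x. dist x y < d \<Longrightarrow> dist (\<sigma> x) (\<sigma> y) < e / 2"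
    using c e unfolding continuous_on_iff by (metis UNIV_I half_gt_zero)
  obtain N where N: "1 / real (Suc N) < d" using d(1) nat_approx_posE by blast
  have "norm ((LINT x|lborel. \<sigma> x * bump (1 / Suc n) (y - x)) / (LINT x|lborel. bump (1 / Suc n) (x::'a)) - \<sigma> y) < e"
    if n: "N \<le> n" for n
  proof -
    define s where "s = 1 / real (Suc n)"
    have s: "0 < s" "s \<le> 1 / real (Suc N)" using n by (auto simp: s_def intro: divide_left_mono)
    define I where "I = (LINT x|lborel. bump s (x::'a))"
    have "integrable lborel (bump s :: 'a \<Rightarrow> real)"
      using nn_integral_bump(2)[OF s(1), where 'a = 'a] bump_nonneg by (simp add: integrable_iff_bounded)
    note ib = this
    have I: "ennreal I = (\<integral>\<^sup>+z. ennreal (bump s (z::'a)) \<partial>lborel)"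
      unfolding I_def using ib bump_nonneg by (intro nn_integral_eq_integral[symmetric]) auto
    then have I0: "0 < I" using nn_integral_bump(1)[OF s(1), where 'a = 'a] by (simp add: ennreal_less_zero_iff flip: I)
    have sym: "bump s (y - x) = bump s (x + (- y))" for x
      by (simp add: bump_def norm_minus_commute)
    have iy: "integrable lborel (\<lambda>x. bump s (y - x))"
      unfolding sym by (rule integrable_lborel_translate[OF ib])
    have Iy: "(LINT x|lborel. bump s (y - x)) = I"
      unfolding sym I_def by (rule integral_lborel_translate) measurable
    have i\<sigma>: "integrable lborel (\<lambda>x. \<sigma> x * bump s (y - x))"
      by (rule Bochner_Integration.integrable_bound[OF iy])
        (use b bump_nonneg in \<open>auto simp: abs_mult intro!: AE_I2 mult_left_le_one_le\<close>)
    have "(LINT x|lborel. \<sigma> x * bump s (y - x)) - \<sigma> y * I = (LINT x|lborel. (\<sigma> x - \<sigma> y) * bump s (y - x))"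
      using i\<sigma> iy by (simp add: left_diff_distrib Iy)
    also have "\<bar>\<dots>\<bar> \<le> (LINT x|lborel. e / 2 * bump s (y - x))"
    proof (rule integral_abs_bound[THEN order_trans], rule integral_mono)
      show "integrable lborel (\<lambda>x. \<bar>(\<sigma> x - \<sigma> y) * bump s (y - x)\<bar>)"
        using i\<sigma> iy by (intro integrable_abs) (simp add: left_diff_distrib)
      show "integrable lborel (\<lambda>x. e / 2 * bump s (y - x))" using iy by simp
      fix x
      show "\<bar>(\<sigma> x - \<sigma> y) * bump s (y - x)\<bar> \<le> e / 2 * bump s (y - x)"
      proof (cases "norm (y - x) < s")
        case True
        then have "dist x y < d" using s N by (simp add: dist_norm norm_minus_commute)
        then have "\<bar>\<sigma> x - \<sigma> y\<bar> \<le> e / 2" using d(2)[of x] by (simp add: dist_real_def)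
        from mult_right_mono[OF this bump_nonneg[of s "y - x"]] show ?thesis by (simp only: abs_mult abs_bump)
      next
        case False
        then show ?thesis using bump_eq_0[OF s(1), of "y - x"] by simp
      qed
    qed
    also have "\<dots> = e / 2 * I" by (simp add: Iy)
    finally have "\<bar>(LINT x|lborel. \<sigma> x * bump s (y - x)) - \<sigma> y * I\<bar> \<le> e / 2 * I" .
    moreover have "(LINT x|lborel. \<sigma> x * bump s (y - x)) / I - \<sigma> y = ((LINT x|lborel. \<sigma> x * bump s (y - x)) - \<sigma> y * I) / I"
      using I0 by (simp add: field_simps)
    ultimately have "\<bar>(LINT x|lborel. \<sigma> x * bump s (y - x)) / I - \<sigma> y\<bar> \<le> e / 2"
      using I0 by (simp add: abs_divide pos_divide_le_eq)
    then show ?thesis using e by (simp add: s_def I_def)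
  qed
  then show "\<exists>N. \<forall>n\<ge>N. norm ((LINT x|lborel. \<sigma> x * bump (1 / Suc n) (y - x)) / (LINT x|lborel. bump (1 / Suc n) (x::'a)) - \<sigma> y) < e"
    by blast
qed

text \<open>The sign of \<open>f\<close> is an almost everywhere limit of continuous functions.\<close>

lemma L1_norm_le_of_continuous_pairing:
  fixes f :: "'a::euclidean_space \<Rightarrow> real"
  assumes f: "integrable lborel f"
    and bound: "\<And>\<sigma>. continuous_on UNIV \<sigma> \<Longrightarrow> (\<And>x. \<bar>\<sigma> x\<bar> \<le> 1) \<Longrightarrow> (LINT x|lborel. f x * \<sigma> x) \<le> K"
  shows "(LINT x|lborel. \<bar>f x\<bar>) \<le> K"
proof -
  have [measurable]: "f \<in> borel_measurable borel" using f by auto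
  have "(\<lambda>x. sgn (f x)) \<in> borel_measurable lebesgue"
    by (intro measurable_completion) measurable
  then have "(\<lambda>x. sgn (f x)) measurable_on UNIV" by (simp add: measurable_on_iff_borel_measurable lebesgue_on_UNIV_eq)
  then obtain N \<sigma> where N: "negligible N" and \<sigma>: "\<And>n. continuous_on UNIV (\<sigma> n)"
    and lim: "\<And>x. x \<notin> N \<Longrightarrow> (\<lambda>n. \<sigma> n x) \<longlonglongrightarrow> sgn (f x)"
    unfolding measurable_on_def by auto
  \<comment> \<open>Truncation to \<open>[-1, 1]\<close> keeps continuity and does not disturb the
    limit, which is a sign.\<close>
  define \<tau> where "\<tau> n x = max (-1) (min 1 (\<sigma> n x))" for n :: nat and x
  have c: "continuous_on UNIV (\<tau> n)" for n
    unfolding \<tau>_def[abs_def] using \<sigma> by (intro continuous_intros)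
  have [measurable]: "\<tau> n \<in> borel_measurable borel" for n using c by (rule borel_measurable_continuous_onI)
  have b: "\<bar>\<tau> n x\<bar> \<le> 1" for n x by (auto simp: \<tau>_def)
  have "(\<lambda>n. LINT x|lborel. f x * \<tau> n x) \<longlonglongrightarrow> (LINT x|lborel. \<bar>f x\<bar>)"
  proof (rule integral_dominated_convergence)
    show "integrable lborel (\<lambda>x. \<bar>f x\<bar>)" using f by simp
    have "AE x in lebesgue. x \<notin> N" using N by (simp add: negligible_iff_null_sets AE_not_in)
    then have "AE x in lborel. x \<notin> N" by (simp add: AE_completion_iff)
    then show "AE x in lborel. (\<lambda>n. f x * \<tau> n x) \<longlonglongrightarrow> \<bar>f x\<bar>"
    proof eventually_elim
      case (elim x)
      have "(\<lambda>n. \<tau> n x) \<longlonglongrightarrow> max (-1) (min 1 (sgn (f x)))"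
        unfolding \<tau>_def by (intro tendsto_intros lim elim)
      then have "(\<lambda>n. f x * \<tau> n x) \<longlonglongrightarrow> f x * max (-1) (min 1 (sgn (f x)))"
        by (intro tendsto_intros)
      also have "f x * max (-1) (min 1 (sgn (f x))) = \<bar>f x\<bar>" by (auto simp: sgn_if)
      finally show ?case .
    qed
    show "AE x in lborel. norm (f x * \<tau> n x) \<le> \<bar>f x\<bar>" for n
      using b by (auto simp: abs_mult intro!: AE_I2 mult_right_le_one_le)
  qed measurable
  then show ?thesis
    by (rule LIMSEQ_le_const2) (use bound[OF c b] in auto)
qed

text \<open>By duality it suffices to pair the difference with continuous \<open>\<sigma>\<close>
  bounded by 1. Replacing \<open>\<sigma>\<close> by its bump averages and moving the average onto
  the difference reduces to the mollified estimate, in which the radius then tends to 0.\<close>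

lemma translation_L1_bound_borel:
  fixes \<eta> :: "'a::euclidean_space \<Rightarrow> real" and g :: "'a \<Rightarrow> 'a"
  assumes \<eta>: "integrable lborel \<eta>" and g: "integrable lborel g"
    and hyp: "\<And>s x. 0 < s \<Longrightarrow> (LINT y|lborel. \<eta> y * bump_deriv s (y - x) h) = - (LINT y|lborel. (g y \<bullet> h) * bump s (y - x))"
  shows "(LINT x|lborel. \<bar>\<eta> (x + h) - \<eta> x\<bar>) \<le> norm h * (LINT x|lborel. norm (g x))"
proof -
  have [measurable]: "\<eta> \<in> borel_measurable borel" "g \<in> borel_measurable borel" using \<eta> g by auto
  define f where "f y = \<eta> (y + h) - \<eta> y" for y
  have f: "integrable lborel f"
    unfolding f_def[abs_def] using \<eta> by (intro Bochner_Integration.integrable_diff integrable_lborel_translate)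
  have [measurable]: "f \<in> borel_measurable borel" using f by auto
  define G where "G = (LINT x|lborel. norm (g x))"
  have G: "ennreal G = (\<integral>\<^sup>+x. ennreal (norm (g x)) \<partial>lborel)"
    unfolding G_def using g by (intro nn_integral_eq_integral[symmetric]) auto
  have G0: "0 \<le> G" by (simp add: G_def)
  have "(LINT x|lborel. \<bar>f x\<bar>) \<le> norm h * G"
  proof (rule L1_norm_le_of_continuous_pairing[OF f])
    fix \<sigma> :: "'a \<Rightarrow> real" assume c: "continuous_on UNIV \<sigma>" and b: "\<And>x. \<bar>\<sigma> x\<bar> \<le> 1"
    have [measurable]: "\<sigma> \<in> borel_measurable borel" using c by (rule borel_measurable_continuous_onI)
    define I where "I s = (LINT x|lborel. bump s (x::'a))" for s
    define \<sigma>s where "\<sigma>s s y = (LINT x|lborel. \<sigma> x * bump s (y - x)) / I s" for s y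
    have ib: "integrable lborel (bump s :: 'a \<Rightarrow> real)" if "0 < s" for s
      using nn_integral_bump(2)[OF that, where 'a = 'a] bump_nonneg by (simp add: integrable_iff_bounded)
    have I: "ennreal (I s) = (\<integral>\<^sup>+z. ennreal (bump s (z::'a)) \<partial>lborel)" if "0 < s" for s
      unfolding I_def using ib[OF that] bump_nonneg by (intro nn_integral_eq_integral[symmetric]) auto
    have I0: "0 < I s" if "0 < s" for s
      using nn_integral_bump(1)[OF that, where 'a = 'a] by (simp add: ennreal_less_zero_iff flip: I[OF that])
    have sym: "bump s (y - x) = bump s (x + (- y))" for s and x y :: 'a
      by (simp add: bump_def norm_minus_commute)
    have Iy: "(LINT x|lborel. bump s (y - x)) = I s" for s and y :: 'a
      unfolding sym I_def by (rule integral_lborel_translate) measurable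
    have iy: "integrable lborel (\<lambda>x. bump s (y - x))" if "0 < s" for s and y :: 'a
      unfolding sym by (rule integrable_lborel_translate[OF ib[OF that]])
    have i\<sigma>: "integrable lborel (\<lambda>x. \<sigma> x * bump s (y - x))" if "0 < s" for s y
      by (rule Bochner_Integration.integrable_bound[OF iy[OF that, of y]])
        (use b bump_nonneg in \<open>auto simp: abs_mult intro!: AE_I2 mult_left_le_one_le\<close>)
    have \<sigma>s1: "\<bar>\<sigma>s s y\<bar> \<le> 1" if s: "0 < s" for s y
    proof -
      have "\<bar>LINT x|lborel. \<sigma> x * bump s (y - x)\<bar> \<le> (LINT x|lborel. bump s (y - x))"
      proof (rule integral_abs_bound[THEN order_trans], rule integral_mono)
        fix x
        show "\<bar>\<sigma> x * bump s (y - x)\<bar> \<le> bump s (y - x)"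
          using b[of x] bump_nonneg[of s "y - x"] by (simp add: abs_mult mult_left_le_one_le)
      qed (use i\<sigma>[OF s] iy[OF s] in auto)
      then show ?thesis using I0[OF s] by (simp add: \<sigma>s_def Iy)
    qed
    have le: "(LINT y|lborel. f y * \<sigma>s s y) \<le> norm h * G" if s: "0 < s" for s
    proof -
      let ?F = "\<lambda>y x. f y * (\<sigma> x * bump s (y - x))"
      have "integrable (lborel \<Otimes>\<^sub>M lborel) (\<lambda>z. ?F (fst z) (snd z))"
      proof (rule integrable_lborel_pairI)
        show "(\<lambda>z. ?F (fst z) (snd z)) \<in> borel_measurable (lborel \<Otimes>\<^sub>M lborel)" by measurable
        have "(\<integral>\<^sup>+y. \<integral>\<^sup>+x. ennreal \<bar>?F y x\<bar> \<partial>lborel \<partial>lborel)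
          \<le> (\<integral>\<^sup>+y. \<integral>\<^sup>+x. ennreal \<bar>f y\<bar> * ennreal (bump s (y - x)) \<partial>lborel \<partial>lborel)"
        proof (intro nn_integral_mono)
          fix x y :: 'a
          have "\<bar>\<sigma> x\<bar> * bump s (y - x) \<le> 1 * bump s (y - x)"
            by (rule mult_right_mono[OF b bump_nonneg])
          then show "ennreal \<bar>?F y x\<bar> \<le> ennreal \<bar>f y\<bar> * ennreal (bump s (y - x))"
            using bump_nonneg[of s "y - x"]
            by (auto simp: abs_mult ennreal_mult[symmetric] intro!: ennreal_leI mult_left_mono)
        qed
        also have "\<dots> = (\<integral>\<^sup>+y. ennreal \<bar>f y\<bar> * ennreal (I s) \<partial>lborel)"
        proof (rule nn_integral_cong)
          fix y :: 'a
          have "(\<integral>\<^sup>+x. ennreal \<bar>f y\<bar> * ennreal (bump s (y - x)) \<partial>lborel)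
              = ennreal \<bar>f y\<bar> * (\<integral>\<^sup>+x. ennreal (bump s (y - x)) \<partial>lborel)"
            by (rule nn_integral_cmult) measurable
          also have "(\<integral>\<^sup>+x. ennreal (bump s (y - x)) \<partial>lborel) = ennreal (I s)"
            unfolding I[OF s] by (rule nn_integral_lborel_translate(2)[where f = "\<lambda>z. ennreal (bump s z)"]) measurable
          finally show "(\<integral>\<^sup>+x. ennreal \<bar>f y\<bar> * ennreal (bump s (y - x)) \<partial>lborel) = ennreal \<bar>f y\<bar> * ennreal (I s)" .
        qed
        also have "\<dots> = (\<integral>\<^sup>+y. ennreal \<bar>f y\<bar> \<partial>lborel) * ennreal (I s)" by (rule nn_integral_multc) measurable
        also have "\<dots> < \<infinity>" using f by (simp add: integrable_iff_bounded ennreal_mult_less_top)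
        finally show "(\<integral>\<^sup>+y. \<integral>\<^sup>+x. ennreal \<bar>?F (fst (y, x)) (snd (y, x))\<bar> \<partial>lborel \<partial>lborel) < \<infinity>" by simp
      qed
      then have int: "integrable (lborel \<Otimes>\<^sub>M lborel) (case_prod ?F)" by (simp add: case_prod_beta')
      \<comment> \<open>A change of variables moves the shift by \<open>h\<close> from
        \<open>\<eta>\<close> to the bump.\<close>
      have F: "(LINT y|lborel. f y * bump s (y - x)) = - (LINT y|lborel. \<eta> y * (bump s (y - x) - bump s (y - x - h)))" for x
      proof -
        have bb: "integrable lborel (\<lambda>y. \<eta>' y * bump s (y - z))" if "integrable lborel \<eta>'" for \<eta>' :: "'a \<Rightarrow> real" and z
          by (rule Bochner_Integration.integrable_bound[OF that])
            (use that bump_nonneg bump_le_1 in \<open>auto simp: abs_mult intro!: AE_I2 mult_right_le_one_le\<close>)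
        have "(LINT y|lborel. f y * bump s (y - x)) = (LINT y|lborel. \<eta> (y + h) * bump s (y - x)) - (LINT y|lborel. \<eta> y * bump s (y - x))"
          unfolding f_def left_diff_distrib
          by (intro Bochner_Integration.integral_diff bb \<eta> integrable_lborel_translate)
        also have "(LINT y|lborel. \<eta> (y + h) * bump s (y - x)) = (LINT y|lborel. \<eta> y * bump s (y - (x + h)))"
          using integral_lborel_translate[of "\<lambda>y. \<eta> y * bump s (y - (x + h))" h] by simp
        also have "\<dots> - (LINT y|lborel. \<eta> y * bump s (y - x)) = (LINT y|lborel. \<eta> y * bump s (y - (x + h)) - \<eta> y * bump s (y - x))"
          by (intro Bochner_Integration.integral_diff[symmetric] bb \<eta>)
        also have "\<dots> = - (LINT y|lborel. \<eta> y * (bump s (y - x) - bump s (y - x - h)))"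
          by (subst integral_minus[symmetric]) (simp add: algebra_simps)
        finally show ?thesis .
      qed
      have "I s * (LINT y|lborel. f y * \<sigma>s s y) = (LINT y|lborel. LINT x|lborel. ?F y x)"
      proof -
        have "(LINT y|lborel. f y * \<sigma>s s y) = (LINT y|lborel. (LINT x|lborel. ?F y x) / I s)"
          by (simp add: \<sigma>s_def)
        also have "\<dots> = (LINT y|lborel. LINT x|lborel. ?F y x) / I s" by (rule integral_divide_zero)
        finally show ?thesis using I0[OF s] by simp
      qed
      also have "\<dots> = (LINT x|lborel. LINT y|lborel. ?F y x)"
        by (rule lborel_pair.Fubini_integral[OF int, symmetric])
      also have "\<dots> = (LINT x|lborel. \<sigma> x * (LINT y|lborel. f y * bump s (y - x)))"
        by (simp add: mult_ac flip: integral_mult_right_zero)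
      finally have eq: "I s * (LINT y|lborel. f y * \<sigma>s s y) = (LINT x|lborel. \<sigma> x * (LINT y|lborel. f y * bump s (y - x)))" .
      let ?R = "\<lambda>x. \<sigma> x * (LINT y|lborel. f y * bump s (y - x))"
      have "ennreal \<bar>LINT x|lborel. ?R x\<bar> \<le> (\<integral>\<^sup>+x. ennreal \<bar>?R x\<bar> \<partial>lborel)"
        using integral_norm_bound_ennreal[of lborel ?R]
        by (cases "integrable lborel ?R") (auto simp: not_integrable_integral_eq)
      also have "\<dots> \<le> (\<integral>\<^sup>+x. ennreal \<bar>LINT y|lborel. \<eta> y * (bump s (y - x) - bump s (y - x - h))\<bar> \<partial>lborel)"
        using b by (intro nn_integral_mono ennreal_leI) (auto simp: F abs_mult intro!: mult_left_le_one_le)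
      also have "\<dots> \<le> ennreal (norm h) * (\<integral>\<^sup>+y. ennreal (norm (g y)) \<partial>lborel) * (\<integral>\<^sup>+z. ennreal (bump s (z::'a)) \<partial>lborel)"
        using hyp[OF s] by (intro nn_integral_bump_convolution_difference \<eta> g s)
      also have "\<dots> = ennreal (norm h * G * I s)"
        using G0 I0[OF s] by (simp add: G[symmetric] I[OF s, symmetric] ennreal_mult)
      finally have "\<bar>I s * (LINT y|lborel. f y * \<sigma>s s y)\<bar> \<le> norm h * G * I s"
        unfolding eq using G0 I0[OF s] by (subst (asm) ennreal_le_iff) auto
      then have "I s * (LINT y|lborel. f y * \<sigma>s s y) \<le> I s * (norm h * G)" by (simp add: mult_ac)
      then show ?thesis using I0[OF s] by simp
    qed
    have "(\<lambda>n. LINT y|lborel. f y * \<sigma>s (1 / Suc n) y) \<longlonglongrightarrow> (LINT y|lborel. f y * \<sigma> y)"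
    proof (rule integral_dominated_convergence)
      show "integrable lborel (\<lambda>x. \<bar>f x\<bar>)" using f by simp
      show "(\<lambda>y. f y * \<sigma>s (1 / Suc n) y) \<in> borel_measurable lborel" for n
        unfolding \<sigma>s_def by measurable
      show "AE y in lborel. (\<lambda>n. f y * \<sigma>s (1 / Suc n) y) \<longlonglongrightarrow> f y * \<sigma> y"
        unfolding \<sigma>s_def I_def by (intro AE_I2 tendsto_mult tendsto_const bump_average_tendsto c b)
      show "AE y in lborel. norm (f y * \<sigma>s (1 / Suc n) y) \<le> \<bar>f y\<bar>" for n
        using \<sigma>s1[of "1 / Suc n"] by (auto simp: abs_mult intro!: AE_I2 mult_right_le_one_le)
    qed measurable
    then show "(LINT x|lborel. f x * \<sigma> x) \<le> norm h * G"
      by (rule LIMSEQ_le_const2) (use le in auto)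
  qed
  then show ?thesis by (simp add: f_def G_def)
qed

section \<open>Difference energies\<close>

text \<open>Used pointwise in place of Minkowski's inequality.\<close>

lemma powr_add_le:
  fixes \<delta> q :: real
  assumes q: "1 \<le> q" and \<delta>: "0 < \<delta>"
  obtains C where "0 \<le> C"
    "\<And>x y :: 'b::real_normed_vector. norm (x + y) powr q \<le> (1 + \<delta>) * norm x powr q + C * norm y powr q"
proof -
  have "((\<lambda>t::real. (1 + t) powr q) \<longlongrightarrow> (1 + 0) powr q) (at_right 0)"
    by (intro tendsto_intros) auto
  then have "\<forall>\<^sub>F t in at_right 0. (1 + t) powr q < 1 + \<delta>"
    using \<delta> by (intro order_tendstoD) auto
  then obtain b where b: "0 < b" "\<And>t. 0 < t \<Longrightarrow> t < b \<Longrightarrow> (1 + t) powr q < 1 + \<delta>"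
    unfolding eventually_at_right_field by blast
  define t where "t = b / 2"
  have t: "0 < t" "(1 + t) powr q \<le> 1 + \<delta>" using b by (auto simp: t_def less_imp_le)
  show thesis
  proof (rule that[of "(1 + 1 / t) powr q"])
    fix x y :: 'b
    \<comment> \<open>If \<open>y\<close> is small relative to \<open>x\<close>, the triangle
      inequality costs only \<open>(1 + t) powr q\<close>; otherwise \<open>x\<close> is controlled
      by \<open>y / t\<close>.\<close>
    show "norm (x + y) powr q \<le> (1 + \<delta>) * norm x powr q + (1 + 1 / t) powr q * norm y powr q"
    proof (cases "norm y \<le> t * norm x")
      case True
      have "norm (x + y) \<le> (1 + t) * norm x"
        using norm_triangle_ineq[of x y] True by (simp add: algebra_simps)
      then have "norm (x + y) powr q \<le> ((1 + t) * norm x) powr q" using q by (intro powr_mono2) auto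
      also have "\<dots> = (1 + t) powr q * norm x powr q" using t by (simp add: powr_mult)
      also have "\<dots> \<le> (1 + \<delta>) * norm x powr q" using t by (intro mult_right_mono) auto
      finally show ?thesis by (simp add: add_increasing2)
    next
      case False
      then have "norm x \<le> norm y / t" using t by (simp add: field_simps)
      then have "norm (x + y) \<le> (1 + 1 / t) * norm y"
        using norm_triangle_ineq[of x y] by (simp add: algebra_simps)
      then have "norm (x + y) powr q \<le> ((1 + 1 / t) * norm y) powr q" using q by (intro powr_mono2) auto
      also have "\<dots> = (1 + 1 / t) powr q * norm y powr q" using t by (simp add: powr_mult)
      finally show ?thesis using \<delta> by (simp add: add_increasing)
    qed
  qed simp
qed

section \<open>Jensen and Minkowski inequalities for integrals with a kernel\<close>

text \<open>Young's inequality with exponents \<open>q\<close> and \<open>q / (q - 1)\<close>,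
  rearranged: a convex power lies above its tangent at \<open>a\<close>. The cases in which
  \<open>powr\<close> degenerates are split off; there \<open>0 powr 0 = 0\<close> matters.\<close>

lemma powr_tangent:
  fixes a t q :: real
  assumes "1 \<le> q" "0 \<le> a" "0 \<le> t"
  shows "a powr q + q * a powr (q - 1) * (t - a) \<le> t powr q"
proof (cases "a = 0 \<or> t = 0 \<or> q = 1")
  case True
  then consider "a = 0" | "a > 0" "t = 0" | "a > 0" "q = 1" using assms by force
  then show ?thesis
  proof cases
    case 2
    have "a powr (q - 1) * a = a powr q" using 2 by (simp add: powr_diff)
    then show ?thesis using 2 assms by (simp add: mult.assoc)
  qed (use assms in auto)
next
  case False
  then have pos: "0 < a" "0 < t" "1 < q" using assms by auto
  have "t * a powr (q - 1) \<le> t powr q / q + (a powr (q - 1)) powr (q / (q - 1)) / (q / (q - 1))"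
    using pos by (intro Youngs_inequality) (auto simp: field_simps)
  also have "(a powr (q - 1)) powr (q / (q - 1)) = a powr q"
    using pos by (simp add: powr_powr)
  finally have "q * (t * a powr (q - 1)) \<le> q * (t powr q / q + a powr q / (q / (q - 1)))"
    using pos by (intro mult_left_mono) auto
  also have "\<dots> = t powr q + (q - 1) * a powr q" using pos by (simp add: field_simps)
  finally have 1: "q * (t * a powr (q - 1)) \<le> t powr q + (q - 1) * a powr q" .
  have "a powr (q - 1) * a = a powr q" using pos by (simp add: powr_diff)
  then have "a powr q + q * a powr (q - 1) * (t - a) = q * (t * a powr (q - 1)) - (q - 1) * a powr q"
    by (simp add: algebra_simps)
  then show ?thesis using 1 by linarith
qed

text \<open>As \<open>q \<ge> 1\<close>, the norm of \<open>w\<close> is at most 1 plus its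
  \<open>q\<close>-th power, and \<open>f\<close> itself is integrable.\<close>

lemma integrable_weighted_of_powr:
  fixes f :: "'a::euclidean_space \<Rightarrow> real" and w :: "'a \<Rightarrow> 'b::euclidean_space"
  assumes q: "1 \<le> q" and f: "integrable lborel f" and w[measurable]: "w \<in> borel_measurable borel"
    and fin: "(\<integral>\<^sup>+z. ennreal (\<bar>f z\<bar> * norm (w z) powr q) \<partial>lborel) < \<infinity>"
  shows "integrable lborel (\<lambda>z. f z *\<^sub>R w z)" "integrable lborel (\<lambda>z. \<bar>f z\<bar> * norm (w z) powr q)"
proof -
  have [measurable]: "f \<in> borel_measurable borel" using f by auto
  show i: "integrable lborel (\<lambda>z. \<bar>f z\<bar> * norm (w z) powr q)"
    using fin by (intro integrableI_bounded) auto
  have i2: "integrable lborel (\<lambda>z. \<bar>f z\<bar> + \<bar>f z\<bar> * norm (w z) powr q)" using f i by simp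
  show "integrable lborel (\<lambda>z. f z *\<^sub>R w z)"
  proof (rule Bochner_Integration.integrable_bound[OF i2])
    show "AE z in lborel. norm (f z *\<^sub>R w z) \<le> norm (\<bar>f z\<bar> + \<bar>f z\<bar> * norm (w z) powr q)"
    proof (rule AE_I2)
      fix z
      have "norm (w z) \<le> 1 + norm (w z) powr q"
      proof (cases "norm (w z) \<le> 1")
        case False
        then have "norm (w z) powr 1 \<le> norm (w z) powr q" using q by (intro powr_mono) auto
        then show ?thesis using False by simp
      qed (simp add: add_increasing2)
      then have "\<bar>f z\<bar> * norm (w z) \<le> \<bar>f z\<bar> * (1 + norm (w z) powr q)" by (intro mult_left_mono) auto
      then show "norm (f z *\<^sub>R w z) \<le> norm (\<bar>f z\<bar> + \<bar>f z\<bar> * norm (w z) powr q)"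
        by (simp add: distrib_left)
    qed
  qed measurable
qed

text \<open>Jensen's inequality for the probability density \<open>\<bar>f\<bar> / F\<close>. When
  the right side is infinite or \<open>F = 0\<close> it holds trivially, the latter because the
  integrand vanishes almost everywhere.\<close>

lemma powr_norm_integral_le:
  fixes f :: "'a::euclidean_space \<Rightarrow> real" and w :: "'a \<Rightarrow> 'b::euclidean_space"
  assumes q: "1 \<le> q" and f: "integrable lborel f" and w[measurable]: "w \<in> borel_measurable borel"
  defines "F \<equiv> LINT z|lborel. \<bar>f z\<bar>"
  shows "ennreal (norm (LINT z|lborel. f z *\<^sub>R w z) powr q)
    \<le> ennreal (F powr (q - 1)) * (\<integral>\<^sup>+z. ennreal (\<bar>f z\<bar> * norm (w z) powr q) \<partial>lborel)"
proof -
  have [measurable]: "f \<in> borel_measurable borel" using f by auto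
  have F0: "0 \<le> F" by (simp add: F_def)
  show ?thesis
  proof (cases "F = 0")
    case True
    then have "AE z in lborel. \<bar>f z\<bar> = 0"
      using f by (subst integral_nonneg_eq_0_iff_AE[symmetric]) (auto simp: F_def)
    then have "AE z in lborel. f z *\<^sub>R w z = 0" by eventually_elim simp
    then have "(LINT z|lborel. f z *\<^sub>R w z) = 0" by (rule integral_eq_zero_AE)
    then show ?thesis by simp
  next
    case False
    then have F: "0 < F" using F0 by simp
    show ?thesis
    proof (cases "(\<integral>\<^sup>+z. ennreal (\<bar>f z\<bar> * norm (w z) powr q) \<partial>lborel) < \<infinity>")
      case True
      note i = integrable_weighted_of_powr[OF q f w True]
      define A where "A = (LINT z|lborel. \<bar>f z\<bar> * norm (w z) powr q)"
      define B where "B = (LINT z|lborel. \<bar>f z\<bar> * norm (w z))"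
      have iB: "integrable lborel (\<lambda>z. \<bar>f z\<bar> * norm (w z))"
        using integrable_norm[OF i(1)] by simp
      have A0: "0 \<le> A" and B0: "0 \<le> B" by (auto simp: A_def B_def)
      \<comment> \<open>The mean of \<open>norm (w z)\<close> under that density; with the tangent
        taken at this point the linear term integrates to 0.\<close>
      define a where "a = B / F"
      have a: "0 \<le> a" "a * F = B" using F B0 by (auto simp: a_def)
      have "(LINT z|lborel. a powr q * \<bar>f z\<bar> + q * a powr (q - 1) * (\<bar>f z\<bar> * norm (w z) - a * \<bar>f z\<bar>))
          \<le> (LINT z|lborel. \<bar>f z\<bar> * norm (w z) powr q)"
      proof (rule integral_mono)
        fix z
        have "\<bar>f z\<bar> * (a powr q + q * a powr (q - 1) * (norm (w z) - a)) \<le> \<bar>f z\<bar> * norm (w z) powr q"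
          using powr_tangent[OF q a(1), of "norm (w z)"] by (intro mult_left_mono) auto
        then show "a powr q * \<bar>f z\<bar> + q * a powr (q - 1) * (\<bar>f z\<bar> * norm (w z) - a * \<bar>f z\<bar>)
            \<le> \<bar>f z\<bar> * norm (w z) powr q"
          by (simp add: algebra_simps)
      qed (use i iB f in auto)
      also have "(LINT z|lborel. a powr q * \<bar>f z\<bar> + q * a powr (q - 1) * (\<bar>f z\<bar> * norm (w z) - a * \<bar>f z\<bar>))
          = a powr q * F + q * a powr (q - 1) * (B - a * F)"
        using f iB by (simp add: F_def B_def)
      finally have "a powr q * F \<le> A" using a by (simp add: A_def)
      moreover have "B powr q = F powr (q - 1) * (a powr q * F)"
        using a F by (simp add: a(2)[symmetric] powr_mult powr_diff)
      ultimately have "B powr q \<le> F powr (q - 1) * A" by (simp add: mult_left_mono)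
      moreover have "norm (LINT z|lborel. f z *\<^sub>R w z) \<le> B"
        unfolding B_def using integral_norm_bound[of lborel "\<lambda>z. f z *\<^sub>R w z"] by simp
      then have "norm (LINT z|lborel. f z *\<^sub>R w z) powr q \<le> B powr q" using q by (intro powr_mono2) auto
      ultimately have "ennreal (norm (LINT z|lborel. f z *\<^sub>R w z) powr q) \<le> ennreal (F powr (q - 1) * A)"
        by (intro ennreal_leI) simp
      also have "\<dots> = ennreal (F powr (q - 1)) * ennreal A" using A0 by (simp add: ennreal_mult)
      also have "ennreal A = (\<integral>\<^sup>+z. ennreal (\<bar>f z\<bar> * norm (w z) powr q) \<partial>lborel)"
        unfolding A_def using i(2) by (intro nn_integral_eq_integral[symmetric]) auto
      finally show ?thesis .
    next
      case False
      then have "(\<integral>\<^sup>+z. ennreal (\<bar>f z\<bar> * norm (w z) powr q) \<partial>lborel) = \<infinity>" by (simp add: less_top[symmetric])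
      moreover have "0 < F powr (q - 1)" using F by simp
      ultimately show ?thesis by (simp add: ennreal_mult_top)
    qed
  qed
qed

text \<open>Minkowski's integral inequality, by integrating Jensen's inequality in \<open>x\<close>
  and exchanging the integrals. The bound on \<open>w\<close> is asked only where
  \<open>f z \<noteq> 0\<close>, so that the support of a kernel can be exploited.\<close>

lemma Lq_bound_parameter_integral:
  fixes f :: "'a::euclidean_space \<Rightarrow> real" and w :: "'c::euclidean_space \<Rightarrow> 'a \<Rightarrow> 'b::euclidean_space"
  assumes q: "1 \<le> q" and f: "integrable lborel f"
    and w[measurable]: "(\<lambda>(x, z). w x z) \<in> borel_measurable (borel \<Otimes>\<^sub>M borel)"
    and A: "0 \<le> A" "\<And>z. f z \<noteq> 0 \<Longrightarrow> (\<integral>\<^sup>+x. ennreal (norm (w x z) powr q) \<partial>lborel) \<le> ennreal A"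
    and F: "(LINT z|lborel. \<bar>f z\<bar>) \<le> F"
  shows "(\<integral>\<^sup>+x. ennreal (norm (LINT z|lborel. f z *\<^sub>R w x z) powr q) \<partial>lborel) \<le> ennreal (F powr q * A)"
    and "AE x in lborel. integrable lborel (\<lambda>z. f z *\<^sub>R w x z)"
proof -
  have [measurable]: "f \<in> borel_measurable borel" using f by auto
  have wx: "w x \<in> borel_measurable borel" for x by measurable
  define F' where "F' = (LINT z|lborel. \<bar>f z\<bar>)"
  have F'0: "0 \<le> F'" by (simp add: F'_def)
  have F': "ennreal F' = (\<integral>\<^sup>+z. ennreal \<bar>f z\<bar> \<partial>lborel)"
    unfolding F'_def using f by (intro nn_integral_eq_integral[symmetric]) auto
  have "(\<integral>\<^sup>+x. (\<integral>\<^sup>+z. ennreal (\<bar>f z\<bar> * norm (w x z) powr q) \<partial>lborel) \<partial>lborel)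
     = (\<integral>\<^sup>+z. (\<integral>\<^sup>+x. ennreal (\<bar>f z\<bar> * norm (w x z) powr q) \<partial>lborel) \<partial>lborel)"
    by (rule lborel_pair.Fubini') measurable
  also have "\<dots> \<le> (\<integral>\<^sup>+z. ennreal \<bar>f z\<bar> * ennreal A \<partial>lborel)"
  proof (rule nn_integral_mono)
    fix z
    have "(\<integral>\<^sup>+x. ennreal (\<bar>f z\<bar> * norm (w x z) powr q) \<partial>lborel)
       = (\<integral>\<^sup>+x. ennreal \<bar>f z\<bar> * ennreal (norm (w x z) powr q) \<partial>lborel)" by (simp add: ennreal_mult)
    also have "\<dots> = ennreal \<bar>f z\<bar> * (\<integral>\<^sup>+x. ennreal (norm (w x z) powr q) \<partial>lborel)"
      by (rule nn_integral_cmult) measurable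
    also have "\<dots> \<le> ennreal \<bar>f z\<bar> * ennreal A"
      using A(2)[of z] by (cases "f z = 0") (auto intro!: mult_left_mono)
    finally show "(\<integral>\<^sup>+x. ennreal (\<bar>f z\<bar> * norm (w x z) powr q) \<partial>lborel) \<le> ennreal \<bar>f z\<bar> * ennreal A" .
  qed
  also have "\<dots> = (\<integral>\<^sup>+z. ennreal \<bar>f z\<bar> \<partial>lborel) * ennreal A" by (rule nn_integral_multc) measurable
  also have "\<dots> = ennreal (F' * A)" using F'0 A(1) by (simp add: F'[symmetric] ennreal_mult)
  finally have main: "(\<integral>\<^sup>+x. (\<integral>\<^sup>+z. ennreal (\<bar>f z\<bar> * norm (w x z) powr q) \<partial>lborel) \<partial>lborel) \<le> ennreal (F' * A)" .
  have [measurable]: "(\<lambda>x. \<integral>\<^sup>+z. ennreal (\<bar>f z\<bar> * norm (w x z) powr q) \<partial>lborel) \<in> borel_measurable lborel"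
    by measurable
  have "AE x in lborel. (\<integral>\<^sup>+z. ennreal (\<bar>f z\<bar> * norm (w x z) powr q) \<partial>lborel) \<noteq> \<infinity>"
    using main by (intro nn_integral_PInf_AE) (auto simp: top_unique)
  then show "AE x in lborel. integrable lborel (\<lambda>z. f z *\<^sub>R w x z)"
    by eventually_elim (intro integrable_weighted_of_powr(1)[OF q f wx], simp add: less_top)
  have "(\<integral>\<^sup>+x. ennreal (norm (LINT z|lborel. f z *\<^sub>R w x z) powr q) \<partial>lborel)
    \<le> (\<integral>\<^sup>+x. ennreal (F' powr (q - 1)) * (\<integral>\<^sup>+z. ennreal (\<bar>f z\<bar> * norm (w x z) powr q) \<partial>lborel) \<partial>lborel)"
    unfolding F'_def by (intro nn_integral_mono powr_norm_integral_le q f wx)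
  also have "\<dots> = ennreal (F' powr (q - 1)) * (\<integral>\<^sup>+x. (\<integral>\<^sup>+z. ennreal (\<bar>f z\<bar> * norm (w x z) powr q) \<partial>lborel) \<partial>lborel)"
    by (rule nn_integral_cmult) measurable
  also have "\<dots> \<le> ennreal (F' powr (q - 1)) * ennreal (F' * A)" using main by (rule mult_left_mono) simp
  also have "\<dots> = ennreal (F' powr q * A)"
    using F'0 A(1) by (cases "F' = 0") (auto simp: ennreal_mult[symmetric] powr_diff)
  also have "\<dots> \<le> ennreal (F powr q * A)"
    using F F'0 A(1) q unfolding F'_def[symmetric] by (intro ennreal_leI mult_right_mono powr_mono2) auto
  finally show "(\<integral>\<^sup>+x. ennreal (norm (LINT z|lborel. f z *\<^sub>R w x z) powr q) \<partial>lborel) \<le> ennreal (F powr q * A)" .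
qed

section \<open>Energies of increments\<close>

text \<open>The part of the Gagliardo double integral that belongs to one increment
  \<open>h\<close>, without the weight.\<close>

definition diff_energy :: "real \<Rightarrow> 'a::euclidean_space set \<Rightarrow> ('a \<Rightarrow> 'b::euclidean_space) \<Rightarrow> 'a \<Rightarrow> ennreal" where
  "diff_energy q E v h =
    (\<integral>\<^sup>+x. indicator E x * indicator E (x + h) * ennreal (norm (v (x + h) - v x) powr q) \<partial>lborel)"

lemma diff_energy_measurable [measurable]:
  assumes [measurable]: "E \<in> sets borel" "v \<in> borel_measurable borel"
  shows "diff_energy q E v \<in> borel_measurable borel"
proof -
  have "(\<lambda>h. \<integral>\<^sup>+x. indicator E x * indicator E (x + h) * ennreal (norm (v (x + h) - v x) powr q) \<partial>lborel) \<in> borel_measurable lborel"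
    by measurable
  then show ?thesis by (simp add: diff_energy_def[abs_def])
qed

lemma diff_energy_mono_set:
  "diff_energy q E v h \<le> (\<integral>\<^sup>+x. ennreal (norm (v (x + h) - v x) powr q) \<partial>lborel)"
  unfolding diff_energy_def by (intro nn_integral_mono) (auto simp: indicator_def)

lemma AE_lborel_translate:
  fixes P :: "'a::euclidean_space \<Rightarrow> bool"
  assumes "AE x in lborel. P x" shows "AE x in lborel. P (x + h)"
  using AE_lborel_affine[OF assms, of 1 h] by (simp add: add.commute)

lemma diff_energy_cong_AE:
  assumes "AE x in lborel. v x = w x"
  shows "diff_energy q E v h = diff_energy q E w h"
  unfolding diff_energy_def
proof (rule nn_integral_cong_AE)
  show "AE x in lborel. indicator E x * indicator E (x + h) * ennreal (norm (v (x + h) - v x) powr q)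
      = indicator E x * indicator E (x + h) * ennreal (norm (w (x + h) - w x) powr q)"
    using assms AE_lborel_translate[OF assms, of h] by eventually_elim simp
qed

lemma diff_energy_scaleR:
  assumes [measurable]: "E \<in> sets borel" "v \<in> borel_measurable borel"
  shows "diff_energy q E (\<lambda>x. a *\<^sub>R v x) h = ennreal (\<bar>a\<bar> powr q) * diff_energy q E v h"
proof -
  have "diff_energy q E (\<lambda>x. a *\<^sub>R v x) h
    = (\<integral>\<^sup>+x. ennreal (\<bar>a\<bar> powr q) * (indicator E x * indicator E (x + h) * ennreal (norm (v (x + h) - v x) powr q)) \<partial>lborel)"
    unfolding diff_energy_def
    by (intro nn_integral_cong) (simp add: scaleR_diff_right[symmetric] powr_mult ennreal_mult mult_ac)
  also have "\<dots> = ennreal (\<bar>a\<bar> powr q) * diff_energy q E v h"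
    unfolding diff_energy_def by (rule nn_integral_cmult) measurable
  finally show ?thesis .
qed

lemma diff_energy_add:
  fixes v w :: "'a::euclidean_space \<Rightarrow> 'b::euclidean_space"
  assumes [measurable]: "E \<in> sets borel" "v \<in> borel_measurable borel" "w \<in> borel_measurable borel"
    and C: "0 \<le> B" "0 \<le> C" "\<And>x y :: 'b. norm (x + y) powr q \<le> B * norm x powr q + C * norm y powr q"
  shows "diff_energy q E (\<lambda>x. v x + w x) h \<le> ennreal B * diff_energy q E v h + ennreal C * diff_energy q E w h"
proof -
  have "diff_energy q E (\<lambda>x. v x + w x) h \<le>
     (\<integral>\<^sup>+x. ennreal B * (indicator E x * indicator E (x + h) * ennreal (norm (v (x + h) - v x) powr q))
       + ennreal C * (indicator E x * indicator E (x + h) * ennreal (norm (w (x + h) - w x) powr q)) \<partial>lborel)"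
    unfolding diff_energy_def
  proof (rule nn_integral_mono)
    fix x
    have "(v (x + h) + w (x + h)) - (v x + w x) = (v (x + h) - v x) + (w (x + h) - w x)" by simp
    then have "ennreal (norm ((v (x + h) + w (x + h)) - (v x + w x)) powr q)
       \<le> ennreal (B * norm (v (x + h) - v x) powr q + C * norm (w (x + h) - w x) powr q)"
      using C(3) by (simp only: ennreal_leI)
    then show "indicator E x * indicator E (x + h) * ennreal (norm ((v (x + h) + w (x + h)) - (v x + w x)) powr q)
      \<le> ennreal B * (indicator E x * indicator E (x + h) * ennreal (norm (v (x + h) - v x) powr q))
       + ennreal C * (indicator E x * indicator E (x + h) * ennreal (norm (w (x + h) - w x) powr q))"
      using C(1,2) by (auto simp: indicator_def ennreal_plus ennreal_mult)
  qed
  also have "\<dots> = ennreal B * diff_energy q E v h + ennreal C * diff_energy q E w h"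
    unfolding diff_energy_def by (subst nn_integral_add) (auto simp: nn_integral_cmult)
  finally show ?thesis .
qed

text \<open>The \<open>q\<close>-th power of the seminorm with increments restricted to
  \<open>W\<close>. Without the root it is additive in \<open>W\<close>, which permits the treatment
  scale by scale.\<close>

definition gagliardo_on :: "real \<Rightarrow> real \<Rightarrow> 'a::euclidean_space set \<Rightarrow> 'a set \<Rightarrow> ('a \<Rightarrow> 'b::euclidean_space) \<Rightarrow> ennreal" where
  "gagliardo_on r q W E v = (\<integral>\<^sup>+h. indicator W h *
     (ennreal (1 / norm h powr (real DIM('a) + r * q)) * diff_energy q E v h) \<partial>lborel)"

lemma gagliardo_on_cong_AE:
  "AE x in lborel. v x = w x \<Longrightarrow> gagliardo_on r q W E v = gagliardo_on r q W E w"
  unfolding gagliardo_on_def using diff_energy_cong_AE[of v w] by simp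

lemma gagliardo_on_scaleR:
  assumes [measurable]: "E \<in> sets borel" "v \<in> borel_measurable borel" "W \<in> sets borel"
  shows "gagliardo_on r q W E (\<lambda>x. a *\<^sub>R v x) = ennreal (\<bar>a\<bar> powr q) * gagliardo_on r q W E v"
proof -
  have "gagliardo_on r q W E (\<lambda>x. a *\<^sub>R v x) = (\<integral>\<^sup>+h. ennreal (\<bar>a\<bar> powr q) * (indicator W h *
     (ennreal (1 / norm h powr (real DIM('a) + r * q)) * diff_energy q E v h)) \<partial>lborel)"
    unfolding gagliardo_on_def diff_energy_scaleR[OF assms(1,2)] by (simp add: mult_ac)
  also have "\<dots> = ennreal (\<bar>a\<bar> powr q) * gagliardo_on r q W E v"
    unfolding gagliardo_on_def by (rule nn_integral_cmult) measurable
  finally show ?thesis .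
qed

lemma gagliardo_on_add:
  fixes v w :: "'a::euclidean_space \<Rightarrow> 'b::euclidean_space"
  assumes [measurable]: "E \<in> sets borel" "v \<in> borel_measurable borel" "w \<in> borel_measurable borel" "W \<in> sets borel"
    and C: "0 \<le> B" "0 \<le> C" "\<And>x y :: 'b. norm (x + y) powr q \<le> B * norm x powr q + C * norm y powr q"
  shows "gagliardo_on r q W E (\<lambda>x. v x + w x) \<le> ennreal B * gagliardo_on r q W E v + ennreal C * gagliardo_on r q W E w"
proof -
  have "gagliardo_on r q W E (\<lambda>x. v x + w x) \<le> (\<integral>\<^sup>+h.
      ennreal B * (indicator W h * (ennreal (1 / norm h powr (real DIM('a) + r * q)) * diff_energy q E v h))
    + ennreal C * (indicator W h * (ennreal (1 / norm h powr (real DIM('a) + r * q)) * diff_energy q E w h)) \<partial>lborel)"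
    unfolding gagliardo_on_def
  proof (rule nn_integral_mono)
    fix h :: 'a
    let ?k = "ennreal (1 / norm h powr (real DIM('a) + r * q))"
    have "indicator W h * (?k * diff_energy q E (\<lambda>x. v x + w x) h)
      \<le> indicator W h * (?k * (ennreal B * diff_energy q E v h + ennreal C * diff_energy q E w h))"
      using C by (intro mult_left_mono diff_energy_add) auto
    also have "\<dots> = ennreal B * (indicator W h * (?k * diff_energy q E v h)) + ennreal C * (indicator W h * (?k * diff_energy q E w h))"
      by (simp add: distrib_left mult_ac)
    finally show "indicator W h * (?k * diff_energy q E (\<lambda>x. v x + w x) h) \<le> \<dots>" .
  qed
  also have "\<dots> = ennreal B * gagliardo_on r q W E v + ennreal C * gagliardo_on r q W E w"
    unfolding gagliardo_on_def by (subst nn_integral_add) (auto simp: nn_integral_cmult)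
  finally show ?thesis .
qed

lemma gagliardo_on_disjoint_Un:
  assumes [measurable]: "E \<in> sets borel" "v \<in> borel_measurable borel" "V \<in> sets borel" "W \<in> sets borel"
    and disj: "V \<inter> W = {}"
  shows "gagliardo_on r q (V \<union> W) E v = gagliardo_on r q V E v + gagliardo_on r q W E v"
  unfolding gagliardo_on_def
  by (subst nn_integral_add[symmetric]) (use disj in \<open>auto intro!: nn_integral_cong simp: indicator_def\<close>)

lemma gagliardo_on_mono: "V \<subseteq> W \<Longrightarrow> gagliardo_on r q V E v \<le> gagliardo_on r q W E v"
  unfolding gagliardo_on_def by (intro nn_integral_mono) (auto simp: indicator_def)

section \<open>Mollified Besov functions\<close>

lemma nn_integral_powr_from_0:
  assumes "0 < e" "0 \<le> a"
  shows "(\<integral>\<^sup>+\<rho>. indicator {0<..a} \<rho> * ennreal (\<rho> powr (e - 1)) \<partial>lborel) = ennreal (a powr e / e)"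
proof -
  have "((\<lambda>x. x powr (e - 1)) has_integral (a powr (e - 1 + 1) / (e - 1 + 1))) {0..a}"
    using assms by (intro has_integral_powr_from_0) auto
  from nn_integral_has_integral_lebesgue'[OF _ this]
  have "(\<integral>\<^sup>+\<rho>. ennreal (\<rho> powr (e - 1)) * indicator {0..a} \<rho> \<partial>lborel) = ennreal (a powr e / e)" by simp
  also have "(\<integral>\<^sup>+\<rho>. ennreal (\<rho> powr (e - 1)) * indicator {0..a} \<rho> \<partial>lborel)
      = (\<integral>\<^sup>+\<rho>. indicator {0<..a} \<rho> * ennreal (\<rho> powr (e - 1)) \<partial>lborel)"
    by (intro nn_integral_cong) (auto simp: indicator_def)
  finally show ?thesis .
qed

lemma nn_integral_powr_to_inf_le:
  assumes "0 < e" "0 < a"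
  shows "(\<integral>\<^sup>+\<rho>. indicator {a<..} \<rho> * ennreal (\<rho> powr (- e - 1)) \<partial>lborel) \<le> ennreal (a powr (- e) / e)"
proof -
  have "((\<lambda>x. x powr (- e - 1)) has_integral (- (a powr (- e - 1 + 1)) / (- e - 1 + 1))) {a..}"
    using assms by (intro has_integral_powr_to_inf) auto
  from nn_integral_has_integral_lebesgue'[OF _ this]
  have "(\<integral>\<^sup>+\<rho>. ennreal (\<rho> powr (- e - 1)) * indicator {a..} \<rho> \<partial>lborel) = ennreal (a powr (- e) / e)" by simp
  moreover have "(\<integral>\<^sup>+\<rho>. indicator {a<..} \<rho> * ennreal (\<rho> powr (- e - 1)) \<partial>lborel)
     \<le> (\<integral>\<^sup>+\<rho>. ennreal (\<rho> powr (- e - 1)) * indicator {a..} \<rho> \<partial>lborel)"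
    by (intro nn_integral_mono) (auto simp: indicator_def)
  ultimately show ?thesis by simp
qed

lemma nn_integral_inverse:
  fixes a b :: real
  assumes "0 < a" "a \<le> b"
  shows "(\<integral>\<^sup>+\<rho>. indicator {a<..b} \<rho> * ennreal (1 / \<rho>) \<partial>lborel) = ennreal (ln (b / a))"
proof -
  have "(\<integral>\<^sup>+\<rho>. ennreal (1 / \<rho>) * indicator {a..b} \<rho> \<partial>lborel) = ln b - ln a"
    using assms by (intro nn_integral_FTC_Icc) (auto intro!: derivative_eq_intros)
  also have "(\<integral>\<^sup>+\<rho>. ennreal (1 / \<rho>) * indicator {a..b} \<rho> \<partial>lborel)
      = (\<integral>\<^sup>+\<rho>. indicator {a<..b} \<rho> * ennreal (1 / \<rho>) \<partial>lborel)"
  proof (rule nn_integral_cong_AE)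
    have "AE t in lborel. t \<notin> {a}"
      by (rule AE_not_in) (auto intro: countable_imp_null_set_lborel)
    then show "AE \<rho> in lborel. ennreal (1 / \<rho>) * indicator {a..b} \<rho> = indicator {a<..b} \<rho> * ennreal (1 / \<rho>)"
      by eventually_elim (auto simp: indicator_def)
  qed
  finally show ?thesis using assms by (simp add: ln_div)
qed

text \<open>Of the weight, the factor \<open>\<rho> powr N\<close> meets the Jacobian
  \<open>\<rho> ^ (N - 1)\<close> and leaves \<open>1 / \<rho>\<close>; the factor
  \<open>\<rho> powr (r * q)\<close> normalises the sphere difference at scale
  \<open>\<rho>\<close>.\<close>

lemma gagliardo_on_polar:
  fixes v :: "'a::euclidean_space \<Rightarrow> 'b::euclidean_space"
  assumes [measurable]: "E \<in> sets borel" "v \<in> borel_measurable borel" "T \<in> sets borel"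
  shows "gagliardo_on r q {h. norm h \<in> T} E v = (\<integral>\<^sup>+\<rho>. indicator (T \<inter> {0<..}) \<rho> *
    (ennreal (1 / \<rho>) * (\<integral>\<^sup>+n. ennreal (1 / \<rho> powr (r * q)) * diff_energy q E v (\<rho> *\<^sub>R n) \<partial>cone_measure)) \<partial>lborel)"
proof -
  define N where "N = DIM('a)"
  have N: "0 < N" by (simp add: N_def)
  let ?g = "\<lambda>h :: 'a. indicator {h. norm h \<in> T} h * (ennreal (1 / norm h powr (real N + r * q)) * diff_energy q E v h)"
  have [measurable]: "?g \<in> borel_measurable borel" by measurable
  have "gagliardo_on r q {h. norm h \<in> T} E v = (\<integral>\<^sup>+\<rho>. indicator {0<..} \<rho> * (ennreal (\<rho> ^ (N - 1)) *
      (\<integral>\<^sup>+n. ?g (\<rho> *\<^sub>R n) \<partial>cone_measure)) \<partial>lborel)"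
    unfolding gagliardo_on_def N_def[symmetric] unfolding N_def by (subst nn_integral_polar) auto
  also have "\<dots> = (\<integral>\<^sup>+\<rho>. indicator (T \<inter> {0<..}) \<rho> *
    (ennreal (1 / \<rho>) * (\<integral>\<^sup>+n. ennreal (1 / \<rho> powr (r * q)) * diff_energy q E v (\<rho> *\<^sub>R n) \<partial>cone_measure)) \<partial>lborel)"
  proof (rule nn_integral_cong)
    fix \<rho> :: real
    show "indicator {0<..} \<rho> * (ennreal (\<rho> ^ (N - 1)) * (\<integral>\<^sup>+n. ?g (\<rho> *\<^sub>R n) \<partial>cone_measure))
      = indicator (T \<inter> {0<..}) \<rho> * (ennreal (1 / \<rho>) * (\<integral>\<^sup>+n. ennreal (1 / \<rho> powr (r * q)) * diff_energy q E v (\<rho> *\<^sub>R n) \<partial>cone_measure))"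
    proof (cases "0 < \<rho>")
      case True
      have "(\<integral>\<^sup>+n. ?g (\<rho> *\<^sub>R n) \<partial>cone_measure)
        = (\<integral>\<^sup>+n. indicator T \<rho> * ennreal (1 / \<rho> powr real N) * (ennreal (1 / \<rho> powr (r * q)) * diff_energy q E v (\<rho> *\<^sub>R n)) \<partial>cone_measure)"
      proof (rule nn_integral_cong_AE)
        show "AE n in cone_measure. ?g (\<rho> *\<^sub>R n) = indicator T \<rho> * ennreal (1 / \<rho> powr real N) * (ennreal (1 / \<rho> powr (r * q)) * diff_energy q E v (\<rho> *\<^sub>R n))"
          using AE_cone_measure_sphere
        proof eventually_elim
          case (elim n)
          then have n: "norm (\<rho> *\<^sub>R n) = \<rho>" using True by simp
          have "ennreal (1 / \<rho> powr (real N + r * q)) = ennreal (1 / \<rho> powr real N) * ennreal (1 / \<rho> powr (r * q))"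
            using True by (simp add: powr_add ennreal_mult[symmetric])
          moreover have "indicator {h. norm h \<in> T} (\<rho> *\<^sub>R n) = (indicator T \<rho> :: ennreal)"
            by (simp only: indicator_def mem_Collect_eq n)
          ultimately show ?case unfolding n by (simp add: mult.assoc)
        qed
      qed
      also have "\<dots> = indicator T \<rho> * ennreal (1 / \<rho> powr real N) * (\<integral>\<^sup>+n. ennreal (1 / \<rho> powr (r * q)) * diff_energy q E v (\<rho> *\<^sub>R n) \<partial>cone_measure)"
        by (rule nn_integral_cmult) measurable
      finally have *: "(\<integral>\<^sup>+n. ?g (\<rho> *\<^sub>R n) \<partial>cone_measure) = \<dots>" .
      have "\<rho> ^ (N - 1) * (1 / \<rho> powr real N) = 1 / \<rho>"
      proof -
        have "\<rho> ^ N = \<rho> * \<rho> ^ (N - 1)" using N by (simp flip: power_Suc)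
        then show ?thesis using True by (simp add: powr_realpow)
      qed
      then have "ennreal (\<rho> ^ (N - 1)) * ennreal (1 / \<rho> powr real N) = ennreal (1 / \<rho>)"
        using True by (simp add: ennreal_mult[symmetric])
      then show ?thesis unfolding * using True
        by (simp add: indicator_def mult.assoc[symmetric])
    qed simp
  qed
  finally show ?thesis .
qed

text \<open>Common source of the three estimates that follow: the radial exponent
  \<open>p - r * q - 1\<close> is integrable at 0 for \<open>p > r * q\<close>, integrable at
  infinity for \<open>p = 0\<close>, and gives a logarithm for \<open>p = r * q\<close>.\<close>

lemma gagliardo_on_le_radial:
  fixes v :: "'a::euclidean_space \<Rightarrow> 'b::euclidean_space"
  assumes [measurable]: "E \<in> sets borel" "v \<in> borel_measurable borel" "T \<in> sets borel"
    and A: "0 \<le> A"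
    and bound: "\<And>h. norm h \<in> T \<Longrightarrow> h \<noteq> 0 \<Longrightarrow> diff_energy q E v h \<le> ennreal (A * norm h powr p)"
  shows "gagliardo_on r q {h. norm h \<in> T} E v
    \<le> ennreal (A * measure (cone_measure :: 'a measure) UNIV) * (\<integral>\<^sup>+\<rho>. indicator (T \<inter> {0<..}) \<rho> * ennreal (\<rho> powr (p - r * q - 1)) \<partial>lborel)"
proof -
  interpret cone: finite_measure "cone_measure :: 'a measure" by (rule finite_measure_cone_measure)
  define s where "s = measure (cone_measure :: 'a measure) UNIV"
  have s: "emeasure (cone_measure :: 'a measure) UNIV = ennreal s" "0 \<le> s"
    by (auto simp: s_def cone.emeasure_eq_measure)
  have "gagliardo_on r q {h. norm h \<in> T} E v \<le> (\<integral>\<^sup>+\<rho>. ennreal (A * s) * (indicator (T \<inter> {0<..}) \<rho> * ennreal (\<rho> powr (p - r * q - 1))) \<partial>lborel)"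
    unfolding gagliardo_on_polar[OF assms(1-3)]
  proof (rule nn_integral_mono)
    fix \<rho> :: real
    show "indicator (T \<inter> {0<..}) \<rho> * (ennreal (1 / \<rho>) * (\<integral>\<^sup>+n. ennreal (1 / \<rho> powr (r * q)) * diff_energy q E v (\<rho> *\<^sub>R n) \<partial>cone_measure))
      \<le> ennreal (A * s) * (indicator (T \<inter> {0<..}) \<rho> * ennreal (\<rho> powr (p - r * q - 1)))"
    proof (cases "\<rho> \<in> T \<inter> {0<..}")
      case True
      then have \<rho>: "0 < \<rho>" by simp
      have "(\<integral>\<^sup>+n. ennreal (1 / \<rho> powr (r * q)) * diff_energy q E v (\<rho> *\<^sub>R n) \<partial>cone_measure)
        \<le> (\<integral>\<^sup>+n. ennreal (1 / \<rho> powr (r * q)) * ennreal (A * \<rho> powr p) \<partial>(cone_measure :: 'a measure))"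
      proof (rule nn_integral_mono_AE)
        show "AE n in cone_measure. ennreal (1 / \<rho> powr (r * q)) * diff_energy q E v (\<rho> *\<^sub>R n) \<le> ennreal (1 / \<rho> powr (r * q)) * ennreal (A * \<rho> powr p)"
          using AE_cone_measure_sphere
        proof eventually_elim
          case (elim n)
          then have "norm (\<rho> *\<^sub>R n) = \<rho>" "\<rho> *\<^sub>R n \<noteq> 0" using \<rho> by auto
          then show ?case using bound[of "\<rho> *\<^sub>R n"] True by (intro mult_left_mono) auto
        qed
      qed
      also have "\<dots> = ennreal (1 / \<rho> powr (r * q) * (A * \<rho> powr p) * s)"
        using A s by (simp add: ennreal_mult[symmetric])
      finally have "ennreal (1 / \<rho>) * (\<integral>\<^sup>+n. ennreal (1 / \<rho> powr (r * q)) * diff_energy q E v (\<rho> *\<^sub>R n) \<partial>cone_measure)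
        \<le> ennreal (1 / \<rho>) * ennreal (1 / \<rho> powr (r * q) * (A * \<rho> powr p) * s)" by (rule mult_left_mono) simp
      also have "\<dots> = ennreal (A * s * \<rho> powr (p - r * q - 1))"
        using \<rho> A s by (subst ennreal_mult[symmetric]) (auto simp: powr_diff mult_ac)
      finally show ?thesis using True A s by (simp add: ennreal_mult)
    qed simp
  qed
  also have "\<dots> = ennreal (A * s) * (\<integral>\<^sup>+\<rho>. indicator (T \<inter> {0<..}) \<rho> * ennreal (\<rho> powr (p - r * q - 1)) \<partial>lborel)"
    by (rule nn_integral_cmult) measurable
  finally show ?thesis by (simp add: s_def)
qed

lemma gagliardo_on_small_le:
  fixes v :: "'a::euclidean_space \<Rightarrow> 'b::euclidean_space"
  assumes "E \<in> sets borel" "v \<in> borel_measurable borel"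
    and A: "0 \<le> A" and a: "0 \<le> a" and p: "r * q < p"
    and bound: "\<And>h. norm h \<le> a \<Longrightarrow> h \<noteq> 0 \<Longrightarrow> diff_energy q E v h \<le> ennreal (A * norm h powr p)"
  shows "gagliardo_on r q {h. norm h \<in> {..a}} E v
    \<le> ennreal (A * measure (cone_measure :: 'a measure) UNIV * a powr (p - r * q) / (p - r * q))"
proof -
  have "gagliardo_on r q {h. norm h \<in> {..a}} E v
    \<le> ennreal (A * measure (cone_measure :: 'a measure) UNIV) * (\<integral>\<^sup>+\<rho>. indicator ({..a} \<inter> {0<..}) \<rho> * ennreal (\<rho> powr (p - r * q - 1)) \<partial>lborel)"
    using assms by (intro gagliardo_on_le_radial) auto
  also have "{..a} \<inter> {0<..} = {0<..a}" by auto
  also have "(\<integral>\<^sup>+\<rho>. indicator {0<..a} \<rho> * ennreal (\<rho> powr (p - r * q - 1)) \<partial>lborel) = ennreal (a powr (p - r * q) / (p - r * q))"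
    using p a by (intro nn_integral_powr_from_0) auto
  finally show ?thesis using A p by (simp add: ennreal_mult[symmetric])
qed

lemma gagliardo_on_large_le:
  fixes v :: "'a::euclidean_space \<Rightarrow> 'b::euclidean_space"
  assumes "E \<in> sets borel" "v \<in> borel_measurable borel"
    and A: "0 \<le> A" and a: "0 < a" and p: "0 < r * q"
    and bound: "\<And>h. a < norm h \<Longrightarrow> diff_energy q E v h \<le> ennreal A"
  shows "gagliardo_on r q {h. norm h \<in> {a<..}} E v
    \<le> ennreal (A * measure (cone_measure :: 'a measure) UNIV * a powr (- (r * q)) / (r * q))"
proof -
  have "gagliardo_on r q {h. norm h \<in> {a<..}} E v
    \<le> ennreal (A * measure (cone_measure :: 'a measure) UNIV) * (\<integral>\<^sup>+\<rho>. indicator ({a<..} \<inter> {0<..}) \<rho> * ennreal (\<rho> powr (0 - r * q - 1)) \<partial>lborel)"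
    using assms by (intro gagliardo_on_le_radial) auto
  also have "{a<..} \<inter> {0<..} = {a<..}" using a by auto
  also have "ennreal (A * measure (cone_measure :: 'a measure) UNIV) * (\<integral>\<^sup>+\<rho>. indicator {a<..} \<rho> * ennreal (\<rho> powr (0 - r * q - 1)) \<partial>lborel)
    \<le> ennreal (A * measure (cone_measure :: 'a measure) UNIV) * ennreal (a powr (- (r * q)) / (r * q))"
    using nn_integral_powr_to_inf_le[OF p a] by (intro mult_left_mono) auto
  finally show ?thesis using A p by (simp add: ennreal_mult[symmetric])
qed

lemma gagliardo_on_mid_le:
  fixes v :: "'a::euclidean_space \<Rightarrow> 'b::euclidean_space"
  assumes "E \<in> sets borel" "v \<in> borel_measurable borel"
    and A: "0 \<le> A" and a: "0 < a" "a \<le> b"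
    and bound: "\<And>h. a < norm h \<Longrightarrow> norm h \<le> b \<Longrightarrow> diff_energy q E v h \<le> ennreal (A * norm h powr (r * q))"
  shows "gagliardo_on r q {h. norm h \<in> {a<..b}} E v
    \<le> ennreal (A * measure (cone_measure :: 'a measure) UNIV * ln (b / a))"
proof -
  have "gagliardo_on r q {h. norm h \<in> {a<..b}} E v
    \<le> ennreal (A * measure (cone_measure :: 'a measure) UNIV) * (\<integral>\<^sup>+\<rho>. indicator ({a<..b} \<inter> {0<..}) \<rho> * ennreal (\<rho> powr (r * q - r * q - 1)) \<partial>lborel)"
    using assms by (intro gagliardo_on_le_radial) auto
  also have "{a<..b} \<inter> {0<..} = {a<..b}" using a by auto
  also have "(\<integral>\<^sup>+\<rho>. indicator {a<..b} \<rho> * ennreal (\<rho> powr (r * q - r * q - 1)) \<partial>lborel)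
      = (\<integral>\<^sup>+\<rho>. indicator {a<..b} \<rho> * ennreal (1 / \<rho>) \<partial>lborel)"
    using a by (intro nn_integral_cong) (auto simp: indicator_def powr_minus divide_inverse)
  also have "\<dots> = ennreal (ln (b / a))" by (rule nn_integral_inverse[OF a])
  finally show ?thesis using A a by (simp add: ennreal_mult[symmetric])
qed

section \<open>Convolutions with a Besov function\<close>

text \<open>Counterpart of \<open>mollify\<close> for Borel representatives; over
  \<open>lborel\<close> the integrand is jointly Borel measurable in \<open>x\<close> and
  \<open>z\<close>, as Fubini requires.\<close>

definition convolve :: "('a::euclidean_space \<Rightarrow> real) \<Rightarrow> ('a \<Rightarrow> 'b::euclidean_space) \<Rightarrow> real \<Rightarrow> 'a \<Rightarrow> 'b" where
  "convolve f u \<epsilon> x = (LINT z|lborel. f z *\<^sub>R u (x - \<epsilon> *\<^sub>R z))"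

lemma convolve_measurable [measurable]:
  assumes [measurable]: "f \<in> borel_measurable borel" "u \<in> borel_measurable borel"
  shows "convolve f u \<epsilon> \<in> borel_measurable borel"
proof -
  have "(\<lambda>x. LINT z|lborel. f z *\<^sub>R u (x - \<epsilon> *\<^sub>R z)) \<in> borel_measurable lborel"
    by (rule lborel.borel_measurable_lebesgue_integral) measurable
  then show ?thesis by (simp add: convolve_def[abs_def])
qed

text \<open>The norm of a difference is at most twice the maximum of the norms, and the power of the
  maximum is at most the sum of the powers; each of the two summands contributes
  \<open>A\<close>.\<close>

lemma diff_energy_le_Lq:
  fixes v :: "'a::euclidean_space \<Rightarrow> 'b::euclidean_space"
  assumes q: "1 \<le> q" and [measurable]: "E \<in> sets borel" "v \<in> borel_measurable borel"
    and A: "0 \<le> A" "(\<integral>\<^sup>+x. ennreal (norm (v x) powr q) \<partial>lborel) \<le> ennreal A"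
  shows "diff_energy q E v h \<le> ennreal (2 powr q * 2 * A)"
proof -
  have "diff_energy q E v h \<le> (\<integral>\<^sup>+x. ennreal (norm (v (x + h) - v x) powr q) \<partial>lborel)"
    by (rule diff_energy_mono_set)
  also have "\<dots> \<le> (\<integral>\<^sup>+x. ennreal (2 powr q) * ennreal (norm (v (x + h)) powr q) + ennreal (2 powr q) * ennreal (norm (v x) powr q) \<partial>lborel)"
  proof (rule nn_integral_mono)
    fix x
    define m where "m = max (norm (v (x + h))) (norm (v x))"
    have "norm (v (x + h) - v x) \<le> 2 * m"
      using norm_triangle_ineq4[of "v (x + h)" "v x"] by (auto simp: m_def)
    then have "norm (v (x + h) - v x) powr q \<le> (2 * m) powr q" using q by (intro powr_mono2) auto
    also have "\<dots> = 2 powr q * m powr q" by (simp add: powr_mult m_def)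
    also have "m powr q \<le> norm (v (x + h)) powr q + norm (v x) powr q"
      by (auto simp: m_def max_def)
    finally have "norm (v (x + h) - v x) powr q \<le> 2 powr q * norm (v (x + h)) powr q + 2 powr q * norm (v x) powr q"
      by (simp add: distrib_left)
    then show "ennreal (norm (v (x + h) - v x) powr q) \<le> ennreal (2 powr q) * ennreal (norm (v (x + h)) powr q) + ennreal (2 powr q) * ennreal (norm (v x) powr q)"
      by (simp add: ennreal_mult[symmetric] ennreal_plus[symmetric] ennreal_leI del: ennreal_plus)
  qed
  also have "\<dots> = ennreal (2 powr q) * (\<integral>\<^sup>+x. ennreal (norm (v (x + h)) powr q) \<partial>lborel) + ennreal (2 powr q) * (\<integral>\<^sup>+x. ennreal (norm (v x) powr q) \<partial>lborel)"
    by (subst nn_integral_add) (auto simp: nn_integral_cmult)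
  also have "(\<integral>\<^sup>+x. ennreal (norm (v (x + h)) powr q) \<partial>lborel) = (\<integral>\<^sup>+x. ennreal (norm (v x) powr q) \<partial>lborel)"
    by (rule nn_integral_lborel_translate(1)[where f = "\<lambda>x. ennreal (norm (v x) powr q)"]) measurable
  also have "ennreal (2 powr q) * (\<integral>\<^sup>+x. ennreal (norm (v x) powr q) \<partial>lborel) + ennreal (2 powr q) * (\<integral>\<^sup>+x. ennreal (norm (v x) powr q) \<partial>lborel)
     \<le> ennreal (2 powr q) * ennreal A + ennreal (2 powr q) * ennreal A"
    by (intro add_mono mult_left_mono A) auto
  also have "\<dots> = ennreal (2 powr q * 2 * A)"
    using A by (simp add: ennreal_mult[symmetric] ennreal_plus[symmetric] del: ennreal_plus)
  finally show ?thesis .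
qed

text \<open>The Besov condition with explicit constants for a Borel function. The quotient is
  multiplied out, so that \<open>h = 0\<close> is included.\<close>

locale besov_function =
  fixes q r U M :: real and u :: "'a::euclidean_space \<Rightarrow> 'b::euclidean_space"
  assumes q: "1 \<le> q" and r: "0 < r" "r < 1"
    and u [measurable]: "u \<in> borel_measurable borel"
    and U: "0 \<le> U" "(\<integral>\<^sup>+x. ennreal (norm (u x) powr q) \<partial>lborel) \<le> ennreal U"
    and M: "0 \<le> M" "\<And>h. (\<integral>\<^sup>+x. ennreal (norm (u (x + h) - u x) powr q) \<partial>lborel) \<le> ennreal (M * norm h powr (r * q))"
begin

lemma nn_integral_translate_u:
  "(\<integral>\<^sup>+x. ennreal (norm (u (x - \<epsilon> *\<^sub>R z)) powr q) \<partial>lborel) \<le> ennreal U"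
  using nn_integral_lborel_translate(1)[of "\<lambda>x. ennreal (norm (u x) powr q)" "- (\<epsilon> *\<^sub>R z)"] U by simp

lemma AE_convolve_integrable:
  assumes f: "integrable lborel f"
  shows "AE x in lborel. integrable lborel (\<lambda>z. f z *\<^sub>R u (x - \<epsilon> *\<^sub>R z))"
  by (rule Lq_bound_parameter_integral(2)[OF q f _ U(1) nn_integral_translate_u order_refl]) measurable

lemma convolve_Lq:
  assumes f: "integrable lborel f" and F: "(LINT z|lborel. \<bar>f z\<bar>) \<le> F"
  shows "(\<integral>\<^sup>+x. ennreal (norm (convolve f u \<epsilon> x) powr q) \<partial>lborel) \<le> ennreal (F powr q * U)"
  unfolding convolve_def
  by (rule Lq_bound_parameter_integral(1)[OF q f _ U(1) nn_integral_translate_u F]) measurable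

text \<open>Convolution commutes with differences, so Minkowski's inequality carries the Besov bound
  of \<open>u\<close> over, uniformly in \<open>\<epsilon>\<close>.\<close>

lemma convolve_diff_besov:
  assumes f: "integrable lborel f" and F: "(LINT z|lborel. \<bar>f z\<bar>) \<le> F"
  shows "diff_energy q E (convolve f u \<epsilon>) h \<le> ennreal (F powr q * M * norm h powr (r * q))"
proof -
  have "diff_energy q E (convolve f u \<epsilon>) h \<le> (\<integral>\<^sup>+x. ennreal (norm (convolve f u \<epsilon> (x + h) - convolve f u \<epsilon> x) powr q) \<partial>lborel)"
    by (rule diff_energy_mono_set)
  also have "\<dots> = (\<integral>\<^sup>+x. ennreal (norm (LINT z|lborel. f z *\<^sub>R (u (x + h - \<epsilon> *\<^sub>R z) - u (x - \<epsilon> *\<^sub>R z))) powr q) \<partial>lborel)"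
  proof (rule nn_integral_cong_AE)
    show "AE x in lborel. ennreal (norm (convolve f u \<epsilon> (x + h) - convolve f u \<epsilon> x) powr q)
      = ennreal (norm (LINT z|lborel. f z *\<^sub>R (u (x + h - \<epsilon> *\<^sub>R z) - u (x - \<epsilon> *\<^sub>R z))) powr q)"
      using AE_convolve_integrable[OF f, of \<epsilon>] AE_lborel_translate[OF AE_convolve_integrable[OF f, of \<epsilon>], of h]
      by eventually_elim (simp add: convolve_def scaleR_diff_right)
  qed
  also have "\<dots> \<le> ennreal (F powr q * (M * norm h powr (r * q)))"
  proof (rule Lq_bound_parameter_integral(1)[OF q f _ _ _ F])
    show "(\<lambda>(x, z). u (x + h - \<epsilon> *\<^sub>R z) - u (x - \<epsilon> *\<^sub>R z)) \<in> borel_measurable (borel \<Otimes>\<^sub>M borel)" by measurable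
    show "0 \<le> M * norm h powr (r * q)" using M by simp
    fix z
    show "(\<integral>\<^sup>+x. ennreal (norm (u (x + h - \<epsilon> *\<^sub>R z) - u (x - \<epsilon> *\<^sub>R z)) powr q) \<partial>lborel) \<le> ennreal (M * norm h powr (r * q))"
      using nn_integral_lborel_translate(1)[of "\<lambda>x. ennreal (norm (u (x + h) - u x) powr q)" "- (\<epsilon> *\<^sub>R z)"] M(2)[of h]
      by (simp add: algebra_simps)
  qed
  finally show ?thesis by (simp add: mult.assoc)
qed

text \<open>Shifting \<open>x\<close> by \<open>h\<close> amounts to shifting \<open>z\<close> by
  \<open>h /\<^sub>R \<epsilon>\<close>, so the difference can be put on the kernel instead of on
  \<open>u\<close>.\<close>

lemma AE_convolve_diff:
  assumes f: "integrable lborel f" and \<epsilon>: "0 < \<epsilon>"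
  shows "AE x in lborel. convolve f u \<epsilon> (x + h) - convolve f u \<epsilon> x
    = (LINT z|lborel. (f (z + h /\<^sub>R \<epsilon>) - f z) *\<^sub>R u (x - \<epsilon> *\<^sub>R z))
    \<and> integrable lborel (\<lambda>z. (f (z + h /\<^sub>R \<epsilon>) - f z) *\<^sub>R u (x - \<epsilon> *\<^sub>R z))"
  using AE_convolve_integrable[OF f, of \<epsilon>] AE_lborel_translate[OF AE_convolve_integrable[OF f, of \<epsilon>], of h]
proof eventually_elim
  case (elim x)
  have [measurable]: "f \<in> borel_measurable borel" using f by auto
  have eq: "f (z + h /\<^sub>R \<epsilon>) *\<^sub>R u (x + h - \<epsilon> *\<^sub>R (z + h /\<^sub>R \<epsilon>)) = f (z + h /\<^sub>R \<epsilon>) *\<^sub>R u (x - \<epsilon> *\<^sub>R z)" for z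
    using \<epsilon> by (simp add: scaleR_add_right)
  have 1: "convolve f u \<epsilon> (x + h) = (LINT z|lborel. f (z + h /\<^sub>R \<epsilon>) *\<^sub>R u (x - \<epsilon> *\<^sub>R z))"
    unfolding convolve_def
    using integral_lborel_translate[of "\<lambda>z. f z *\<^sub>R u (x + h - \<epsilon> *\<^sub>R z)" "h /\<^sub>R \<epsilon>"] by (simp only: eq) simp
  have 2: "integrable lborel (\<lambda>z. f (z + h /\<^sub>R \<epsilon>) *\<^sub>R u (x - \<epsilon> *\<^sub>R z))"
    using integrable_lborel_translate[OF elim(2), of "h /\<^sub>R \<epsilon>"] by (simp only: eq)
  show ?case
    using 2 elim(1) by (simp add: 1 convolve_def[of f u \<epsilon> x] scaleR_diff_left)
qed

text \<open>The difference falls on the kernel, at a price proportional to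
  \<open>norm h / \<epsilon>\<close>, and \<open>u\<close> enters only through its norm.\<close>

lemma convolve_diff_lipschitz:
  assumes f: "integrable lborel f" and \<epsilon>: "0 < \<epsilon>" and K: "0 \<le> K" "\<And>k. (LINT z|lborel. \<bar>f (z + k) - f z\<bar>) \<le> K * norm k"
  shows "diff_energy q E (convolve f u \<epsilon>) h \<le> ennreal ((K / \<epsilon>) powr q * U * norm h powr q)"
proof -
  have g: "integrable lborel (\<lambda>z. f (z + h /\<^sub>R \<epsilon>) - f z)"
    using f by (intro Bochner_Integration.integrable_diff integrable_lborel_translate)
  have "diff_energy q E (convolve f u \<epsilon>) h \<le> (\<integral>\<^sup>+x. ennreal (norm (convolve f u \<epsilon> (x + h) - convolve f u \<epsilon> x) powr q) \<partial>lborel)"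
    by (rule diff_energy_mono_set)
  also have "\<dots> = (\<integral>\<^sup>+x. ennreal (norm (LINT z|lborel. (f (z + h /\<^sub>R \<epsilon>) - f z) *\<^sub>R u (x - \<epsilon> *\<^sub>R z)) powr q) \<partial>lborel)"
  proof (rule nn_integral_cong_AE)
    show "AE x in lborel. ennreal (norm (convolve f u \<epsilon> (x + h) - convolve f u \<epsilon> x) powr q)
      = ennreal (norm (LINT z|lborel. (f (z + h /\<^sub>R \<epsilon>) - f z) *\<^sub>R u (x - \<epsilon> *\<^sub>R z)) powr q)"
      using AE_convolve_diff[OF f \<epsilon>, of h] by eventually_elim simp
  qed
  also have "\<dots> \<le> ennreal ((K * norm (h /\<^sub>R \<epsilon>)) powr q * U)"
    by (rule Lq_bound_parameter_integral(1)[OF q g _ U(1) nn_integral_translate_u K(2)]) measurable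
  also have "(K * norm (h /\<^sub>R \<epsilon>)) powr q * U = (K / \<epsilon>) powr q * U * norm h powr q"
  proof -
    have "K * norm (h /\<^sub>R \<epsilon>) = (K / \<epsilon>) * norm h" using \<epsilon> by (simp add: divide_inverse)
    then have "(K * norm (h /\<^sub>R \<epsilon>)) powr q = (K / \<epsilon>) powr q * norm h powr q"
      using K \<epsilon> by (simp only: powr_mult divide_nonneg_nonneg norm_ge_zero less_imp_le)
    then show ?thesis by simp
  qed
  finally show ?thesis .
qed

text \<open>The kernel difference has integral zero, so the value \<open>u x\<close> may be
  subtracted inside the integral. On its support \<open>norm z \<le> R + 1\<close>, the extra 1
  being the shift \<open>norm (h /\<^sub>R \<epsilon>)\<close>, and the Besov bound for increments
  of length \<open>\<epsilon> * (R + 1)\<close> takes the place of \<open>U\<close>.\<close>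

lemma convolve_diff_lipschitz_supported:
  assumes f: "integrable lborel f" and \<epsilon>: "0 < \<epsilon>" and K: "0 \<le> K" "\<And>k. (LINT z|lborel. \<bar>f (z + k) - f z\<bar>) \<le> K * norm k"
    and R: "0 \<le> R" "\<And>z. R < norm z \<Longrightarrow> f z = 0" and h: "norm h \<le> \<epsilon>"
  shows "diff_energy q E (convolve f u \<epsilon>) h \<le> ennreal ((K / \<epsilon>) powr q * (M * (\<epsilon> * (R + 1)) powr (r * q)) * norm h powr q)"
proof -
  let ?g = "\<lambda>z. f (z + h /\<^sub>R \<epsilon>) - f z"
  have g: "integrable lborel ?g"
    using f by (intro Bochner_Integration.integrable_diff integrable_lborel_translate)
  have [measurable]: "f \<in> borel_measurable borel" using f by auto
  have g0: "(LINT z|lborel. ?g z) = 0"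
    using f by (simp add: integrable_lborel_translate integral_lborel_translate)
  have "diff_energy q E (convolve f u \<epsilon>) h \<le> (\<integral>\<^sup>+x. ennreal (norm (convolve f u \<epsilon> (x + h) - convolve f u \<epsilon> x) powr q) \<partial>lborel)"
    by (rule diff_energy_mono_set)
  also have "\<dots> = (\<integral>\<^sup>+x. ennreal (norm (LINT z|lborel. ?g z *\<^sub>R (u (x - \<epsilon> *\<^sub>R z) - u x)) powr q) \<partial>lborel)"
  proof (rule nn_integral_cong_AE)
    show "AE x in lborel. ennreal (norm (convolve f u \<epsilon> (x + h) - convolve f u \<epsilon> x) powr q)
      = ennreal (norm (LINT z|lborel. ?g z *\<^sub>R (u (x - \<epsilon> *\<^sub>R z) - u x)) powr q)"
      using AE_convolve_diff[OF f \<epsilon>, of h]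
    proof eventually_elim
      case (elim x)
      have "(LINT z|lborel. ?g z *\<^sub>R (u (x - \<epsilon> *\<^sub>R z) - u x)) = (LINT z|lborel. ?g z *\<^sub>R u (x - \<epsilon> *\<^sub>R z)) - (LINT z|lborel. ?g z *\<^sub>R u x)"
        unfolding scaleR_diff_right using elim g by (intro Bochner_Integration.integral_diff) auto
      also have "(LINT z|lborel. ?g z *\<^sub>R u x) = (LINT z|lborel. ?g z) *\<^sub>R u x"
        using g by (intro integral_scaleR_left) auto
      finally show ?case using elim g0 by simp
    qed
  qed
  also have "\<dots> \<le> ennreal ((K * norm (h /\<^sub>R \<epsilon>)) powr q * (M * (\<epsilon> * (R + 1)) powr (r * q)))"
  proof (rule Lq_bound_parameter_integral(1)[OF q g _ _ _ K(2)])
    show "(\<lambda>(x, z). u (x - \<epsilon> *\<^sub>R z) - u x) \<in> borel_measurable (borel \<Otimes>\<^sub>M borel)" by measurable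
    show "0 \<le> M * (\<epsilon> * (R + 1)) powr (r * q)" using M by simp
    fix z assume "?g z \<noteq> 0"
    then have "norm z \<le> R \<or> norm (z + h /\<^sub>R \<epsilon>) \<le> R" using R(2)[of z] R(2)[of "z + h /\<^sub>R \<epsilon>"] by force
    moreover have "norm (h /\<^sub>R \<epsilon>) \<le> 1" using h \<epsilon> by (simp add: field_simps)
    moreover have "norm z \<le> norm (z + h /\<^sub>R \<epsilon>) + norm (h /\<^sub>R \<epsilon>)"
      using norm_triangle_ineq4[of "z + h /\<^sub>R \<epsilon>" "h /\<^sub>R \<epsilon>"] by simp
    ultimately have "norm z \<le> R + 1" by linarith
    then have "norm (- (\<epsilon> *\<^sub>R z)) powr (r * q) \<le> (\<epsilon> * (R + 1)) powr (r * q)"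
      using \<epsilon> q r by (intro powr_mono2) auto
    then have "ennreal (M * norm (- (\<epsilon> *\<^sub>R z)) powr (r * q)) \<le> ennreal (M * (\<epsilon> * (R + 1)) powr (r * q))"
      using M by (intro ennreal_leI mult_left_mono)
    then show "(\<integral>\<^sup>+x. ennreal (norm (u (x - \<epsilon> *\<^sub>R z) - u x) powr q) \<partial>lborel) \<le> ennreal (M * (\<epsilon> * (R + 1)) powr (r * q))"
      using M(2)[of "- (\<epsilon> *\<^sub>R z)"] by simp
  qed
  also have "(K * norm (h /\<^sub>R \<epsilon>)) powr q * (M * (\<epsilon> * (R + 1)) powr (r * q)) = (K / \<epsilon>) powr q * (M * (\<epsilon> * (R + 1)) powr (r * q)) * norm h powr q"
  proof -
    have "K * norm (h /\<^sub>R \<epsilon>) = (K / \<epsilon>) * norm h" using \<epsilon> by (simp add: divide_inverse)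
    then have "(K * norm (h /\<^sub>R \<epsilon>)) powr q = (K / \<epsilon>) powr q * norm h powr q" 
      using K \<epsilon> by (simp only: powr_mult divide_nonneg_nonneg norm_ge_zero less_imp_le)
    then show ?thesis by simp
  qed
  finally show ?thesis .
qed

text \<open>The difference is a weighted average of increments of \<open>u\<close> of length at most
  \<open>\<epsilon> * R\<close>.\<close>

lemma convolve_minus_Lq:
  assumes f: "integrable lborel f" and F: "(LINT z|lborel. \<bar>f z\<bar>) \<le> F" and \<epsilon>: "0 < \<epsilon>"
    and R: "0 \<le> R" "\<And>z. R < norm z \<Longrightarrow> f z = 0"
  shows "(\<integral>\<^sup>+x. ennreal (norm ((LINT z|lborel. f z) *\<^sub>R u x - convolve f u \<epsilon> x) powr q) \<partial>lborel)
    \<le> ennreal (F powr q * (M * (\<epsilon> * R) powr (r * q)))"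
proof -
  have "(\<integral>\<^sup>+x. ennreal (norm ((LINT z|lborel. f z) *\<^sub>R u x - convolve f u \<epsilon> x) powr q) \<partial>lborel)
    = (\<integral>\<^sup>+x. ennreal (norm (LINT z|lborel. f z *\<^sub>R (u (x - \<epsilon> *\<^sub>R z) - u x)) powr q) \<partial>lborel)"
  proof (rule nn_integral_cong_AE)
    show "AE x in lborel. ennreal (norm ((LINT z|lborel. f z) *\<^sub>R u x - convolve f u \<epsilon> x) powr q)
      = ennreal (norm (LINT z|lborel. f z *\<^sub>R (u (x - \<epsilon> *\<^sub>R z) - u x)) powr q)"
      using AE_convolve_integrable[OF f, of \<epsilon>]
    proof eventually_elim
      case (elim x)
      have "(LINT z|lborel. f z *\<^sub>R (u (x - \<epsilon> *\<^sub>R z) - u x)) = (LINT z|lborel. f z *\<^sub>R u (x - \<epsilon> *\<^sub>R z)) - (LINT z|lborel. f z *\<^sub>R u x)"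
        unfolding scaleR_diff_right using elim f by (intro Bochner_Integration.integral_diff) auto
      also have "(LINT z|lborel. f z *\<^sub>R u x) = (LINT z|lborel. f z) *\<^sub>R u x"
        using f by (intro integral_scaleR_left) auto
      finally show ?case by (simp add: convolve_def norm_minus_commute)
    qed
  qed
  also have "\<dots> \<le> ennreal (F powr q * (M * (\<epsilon> * R) powr (r * q)))"
  proof (rule Lq_bound_parameter_integral(1)[OF q f _ _ _ F])
    show "(\<lambda>(x, z). u (x - \<epsilon> *\<^sub>R z) - u x) \<in> borel_measurable (borel \<Otimes>\<^sub>M borel)" by measurable
    show "0 \<le> M * (\<epsilon> * R) powr (r * q)" using M by simp
    fix z assume "f z \<noteq> 0"
    then have "norm z \<le> R" using R(2)[of z] by force
    then have "norm (- (\<epsilon> *\<^sub>R z)) powr (r * q) \<le> (\<epsilon> * R) powr (r * q)"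
      using \<epsilon> q r by (intro powr_mono2) auto
    then have "ennreal (M * norm (- (\<epsilon> *\<^sub>R z)) powr (r * q)) \<le> ennreal (M * (\<epsilon> * R) powr (r * q))"
      using M by (intro ennreal_leI mult_left_mono)
    then show "(\<integral>\<^sup>+x. ennreal (norm (u (x - \<epsilon> *\<^sub>R z) - u x) powr q) \<partial>lborel) \<le> ennreal (M * (\<epsilon> * R) powr (r * q))"
      using M(2)[of "- (\<epsilon> *\<^sub>R z)"] by simp
  qed
  finally show ?thesis .
qed

end

section \<open>Energy of convolutions, scale by scale\<close>

lemma ennreal_linear_combination:
  "0 \<le> a \<Longrightarrow> 0 \<le> b \<Longrightarrow> 0 \<le> c \<Longrightarrow> 0 \<le> d \<Longrightarrow>
    ennreal a * ennreal b + ennreal c * ennreal d = ennreal (a * b + c * d)"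
  by (simp add: ennreal_mult)

context besov_function
begin

lemma exponent_bounds: "0 < r * q" "r * q < q" "q - r * q = q * (1 - r)"
  using q r by (auto simp: algebra_simps)

text \<open>Below the scale \<open>a\<close> the Lipschitz bound gives a constant. Above it the
  Besov bound gives \<open>ln (1 / a)\<close>, which is
  \<open>ln (1 / \<epsilon>) / (1 - r)\<close>; hence the factor \<open>1 / (1 - r)\<close>.\<close>

lemma gagliardo_convolve_unit_ball:
  assumes E: "E \<in> sets borel" and f: "integrable lborel f" and F: "(LINT z|lborel. \<bar>f z\<bar>) \<le> F"
    and K: "0 \<le> K" "\<And>k. (LINT z|lborel. \<bar>f (z + k) - f z\<bar>) \<le> K * norm k" and \<epsilon>: "0 < \<epsilon>" "\<epsilon> < 1"
  shows "gagliardo_on r q {h. norm h \<in> {..1}} E (convolve f u \<epsilon>)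
    \<le> ennreal (K powr q * U * measure (cone_measure :: 'a measure) UNIV / (q - r * q) + F powr q * M * measure (cone_measure :: 'a measure) UNIV / (1 - r) * ln (1 / \<epsilon>))"
proof -
  have [measurable]: "f \<in> borel_measurable borel" using f by auto
  note [measurable] = E
  \<comment> \<open>At the scale \<open>a\<close> the two available bounds for the difference energy balance up to constants.\<close>
  define a where "a = \<epsilon> powr (1 / (1 - r))"
  have a: "0 < a" "a \<le> 1" using \<epsilon> r by (auto simp: a_def intro: powr_le1)
  have "{h :: 'a. norm h \<in> {..1}} = {h. norm h \<in> {..a}} \<union> {h. norm h \<in> {a<..1}}" using a by auto
  then have "gagliardo_on r q {h. norm h \<in> {..1}} E (convolve f u \<epsilon>)
     = gagliardo_on r q {h. norm h \<in> {..a}} E (convolve f u \<epsilon>) + gagliardo_on r q {h. norm h \<in> {a<..1}} E (convolve f u \<epsilon>)"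
    by (simp only:) (rule gagliardo_on_disjoint_Un, auto)
  also have "\<dots> \<le> ennreal ((K / \<epsilon>) powr q * U * measure (cone_measure :: 'a measure) UNIV * a powr (q - r * q) / (q - r * q))
      + ennreal (F powr q * M * measure (cone_measure :: 'a measure) UNIV * ln (1 / a))"
  proof (rule add_mono)
    show "gagliardo_on r q {h. norm h \<in> {..a}} E (convolve f u \<epsilon>)
      \<le> ennreal ((K / \<epsilon>) powr q * U * measure (cone_measure :: 'a measure) UNIV * a powr (q - r * q) / (q - r * q))"
      using a U exponent_bounds by (intro gagliardo_on_small_le convolve_diff_lipschitz f K \<epsilon> E) auto
    show "gagliardo_on r q {h. norm h \<in> {a<..1}} E (convolve f u \<epsilon>) \<le> ennreal (F powr q * M * measure (cone_measure :: 'a measure) UNIV * ln (1 / a))"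
      using a M by (intro gagliardo_on_mid_le convolve_diff_besov f F E) auto
  qed
  also have "(K / \<epsilon>) powr q * U * measure (cone_measure :: 'a measure) UNIV * a powr (q - r * q) / (q - r * q) = K powr q * U * measure (cone_measure :: 'a measure) UNIV / (q - r * q)"
  proof -
    have "a powr (q - r * q) = \<epsilon> powr q"
      using r unfolding a_def powr_powr exponent_bounds(3) by simp
    then show ?thesis using \<epsilon> K by (simp add: powr_divide)
  qed
  also have "ln (1 / a) = ln (1 / \<epsilon>) / (1 - r)"
    using \<epsilon> by (simp add: a_def ln_div ln_powr)
  also have "ennreal (K powr q * U * measure (cone_measure :: 'a measure) UNIV / (q - r * q)) + ennreal (F powr q * M * measure (cone_measure :: 'a measure) UNIV * (ln (1 / \<epsilon>) / (1 - r)))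
    = ennreal (K powr q * U * measure (cone_measure :: 'a measure) UNIV / (q - r * q) + F powr q * M * measure (cone_measure :: 'a measure) UNIV / (1 - r) * ln (1 / \<epsilon>))"
    using U M exponent_bounds r \<epsilon> by (subst ennreal_plus[symmetric]) auto
  finally show ?thesis .
qed

lemma gagliardo_convolve_tail:
  assumes E: "E \<in> sets borel" and f: "integrable lborel f" and F: "(LINT z|lborel. \<bar>f z\<bar>) \<le> F"
  shows "gagliardo_on r q {h. norm h \<in> {1<..}} E (convolve f u \<epsilon>)
    \<le> ennreal (2 powr q * 2 * (F powr q * U) * measure (cone_measure :: 'a measure) UNIV / (r * q))"
proof -
  have [measurable]: "f \<in> borel_measurable borel" using f by auto
  have "gagliardo_on r q {h. norm h \<in> {1<..}} E (convolve f u \<epsilon>)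
    \<le> ennreal (2 powr q * 2 * (F powr q * U) * measure (cone_measure :: 'a measure) UNIV * 1 powr (- (r * q)) / (r * q))"
    using U exponent_bounds q by (intro gagliardo_on_large_le diff_energy_le_Lq convolve_Lq f F E) auto
  then show ?thesis by simp
qed

text \<open>The powers of \<open>\<epsilon>\<close> cancel: \<open>- q\<close> from the Lipschitz
  bound, \<open>r * q\<close> from the increments of \<open>u\<close>, and \<open>q - r * q\<close>
  from the radial integral.\<close>

lemma gagliardo_convolve_near:
  assumes E: "E \<in> sets borel" and f: "integrable lborel f"
    and K: "0 \<le> K" "\<And>k. (LINT z|lborel. \<bar>f (z + k) - f z\<bar>) \<le> K * norm k" and \<epsilon>: "0 < \<epsilon>"
    and R: "0 \<le> R" "\<And>z. R < norm z \<Longrightarrow> f z = 0"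
  shows "gagliardo_on r q {h. norm h \<in> {..\<epsilon>}} E (convolve f u \<epsilon>)
    \<le> ennreal (K powr q * (M * (R + 1) powr (r * q)) * measure (cone_measure :: 'a measure) UNIV / (q - r * q))"
proof -
  have [measurable]: "f \<in> borel_measurable borel" using f by auto
  have "gagliardo_on r q {h. norm h \<in> {..\<epsilon>}} E (convolve f u \<epsilon>)
    \<le> ennreal ((K / \<epsilon>) powr q * (M * (\<epsilon> * (R + 1)) powr (r * q)) * measure (cone_measure :: 'a measure) UNIV * \<epsilon> powr (q - r * q) / (q - r * q))"
    using M exponent_bounds \<epsilon> by (intro gagliardo_on_small_le convolve_diff_lipschitz_supported f K R E) auto
  also have "(K / \<epsilon>) powr q * (M * (\<epsilon> * (R + 1)) powr (r * q)) * measure (cone_measure :: 'a measure) UNIV * \<epsilon> powr (q - r * q) / (q - r * q)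
     = K powr q * (M * (R + 1) powr (r * q)) * measure (cone_measure :: 'a measure) UNIV / (q - r * q)"
    using \<epsilon> K R by (simp add: powr_divide powr_mult powr_diff)
  finally show ?thesis .
qed

text \<open>The power \<open>\<epsilon> powr (r * q)\<close> in the mean error cancels against the
  weight, whose integral over all increments longer than \<open>\<epsilon>\<close> is of order
  \<open>\<epsilon> powr (- (r * q))\<close>.\<close>

lemma gagliardo_convolve_minus_mid:
  assumes E: "E \<in> sets borel" and f: "integrable lborel f" and F: "(LINT z|lborel. \<bar>f z\<bar>) \<le> F"
    and \<epsilon>: "0 < \<epsilon>" and R: "0 \<le> R" "\<And>z. R < norm z \<Longrightarrow> f z = 0"
  shows "gagliardo_on r q {h. norm h \<in> {\<epsilon><..1}} E (\<lambda>x. (LINT z|lborel. f z) *\<^sub>R u x - convolve f u \<epsilon> x)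
    \<le> ennreal (2 powr q * 2 * (F powr q * (M * R powr (r * q))) * measure (cone_measure :: 'a measure) UNIV / (r * q))"
proof -
  have [measurable]: "f \<in> borel_measurable borel" using f by auto
  have "gagliardo_on r q {h. norm h \<in> {\<epsilon><..1}} E (\<lambda>x. (LINT z|lborel. f z) *\<^sub>R u x - convolve f u \<epsilon> x)
    \<le> gagliardo_on r q {h. norm h \<in> {\<epsilon><..}} E (\<lambda>x. (LINT z|lborel. f z) *\<^sub>R u x - convolve f u \<epsilon> x)"
    by (rule gagliardo_on_mono) auto
  also have "\<dots> \<le> ennreal (2 powr q * 2 * (F powr q * (M * (\<epsilon> * R) powr (r * q))) * measure (cone_measure :: 'a measure) UNIV * \<epsilon> powr (- (r * q)) / (r * q))"
    using M exponent_bounds \<epsilon> q by (intro gagliardo_on_large_le diff_energy_le_Lq convolve_minus_Lq f F R E) auto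
  also have "2 powr q * 2 * (F powr q * (M * (\<epsilon> * R) powr (r * q))) * measure (cone_measure :: 'a measure) UNIV * \<epsilon> powr (- (r * q)) / (r * q)
     = 2 powr q * 2 * (F powr q * (M * R powr (r * q))) * measure (cone_measure :: 'a measure) UNIV / (r * q)"
    using \<epsilon> R by (simp add: powr_mult powr_minus)
  finally show ?thesis .
qed

lemma gagliardo_u_mid:
  assumes E: "E \<in> sets borel" and \<epsilon>: "0 < \<epsilon>" "\<epsilon> < 1"
  shows "gagliardo_on r q {h. norm h \<in> {\<epsilon><..1}} E u \<le> ennreal (M * measure (cone_measure :: 'a measure) UNIV * ln (1 / \<epsilon>))"
  using \<epsilon> M(1) by (intro gagliardo_on_mid_le E u order_trans[OF diff_energy_mono_set M(2)]) auto

text \<open>A crude logarithmic bound. It makes the energy finite and later turns a relative error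
  into a small multiple of the logarithm.\<close>

lemma gagliardo_convolve_total:
  assumes E: "E \<in> sets borel" and f: "integrable lborel f" and F: "(LINT z|lborel. \<bar>f z\<bar>) \<le> F"
    and K: "0 \<le> K" "\<And>k. (LINT z|lborel. \<bar>f (z + k) - f z\<bar>) \<le> K * norm k" and \<epsilon>: "0 < \<epsilon>" "\<epsilon> < 1"
  shows "gagliardo_on r q UNIV E (convolve f u \<epsilon>)
    \<le> ennreal (F powr q * M * measure (cone_measure :: 'a measure) UNIV / (1 - r) * ln (1 / \<epsilon>)
        + (K powr q * U * measure (cone_measure :: 'a measure) UNIV / (q - r * q) + 2 powr q * 2 * (F powr q * U) * measure (cone_measure :: 'a measure) UNIV / (r * q)))"
proof -
  have [measurable]: "f \<in> borel_measurable borel" using f by auto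
  note [measurable] = E
  have UN: "(UNIV :: 'a set) = {h. norm h \<in> {..1}} \<union> {h. norm h \<in> {1<..}}" by auto
  have "gagliardo_on r q UNIV E (convolve f u \<epsilon>)
     = gagliardo_on r q {h. norm h \<in> {..1}} E (convolve f u \<epsilon>) + gagliardo_on r q {h. norm h \<in> {1<..}} E (convolve f u \<epsilon>)"
    by (subst UN) (rule gagliardo_on_disjoint_Un, auto)
  also have "\<dots> \<le> ennreal (K powr q * U * measure (cone_measure :: 'a measure) UNIV / (q - r * q) + F powr q * M * measure (cone_measure :: 'a measure) UNIV / (1 - r) * ln (1 / \<epsilon>))
      + ennreal (2 powr q * 2 * (F powr q * U) * measure (cone_measure :: 'a measure) UNIV / (r * q))"
    by (intro add_mono gagliardo_convolve_unit_ball gagliardo_convolve_tail E f F K \<epsilon>)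
  also have "\<dots> = ennreal (F powr q * M * measure (cone_measure :: 'a measure) UNIV / (1 - r) * ln (1 / \<epsilon>)
        + (K powr q * U * measure (cone_measure :: 'a measure) UNIV / (q - r * q) + 2 powr q * 2 * (F powr q * U) * measure (cone_measure :: 'a measure) UNIV / (r * q)))"
    using U M exponent_bounds r \<epsilon> by (subst ennreal_plus[symmetric]) (auto simp: algebra_simps)
  finally show ?thesis .
qed

text \<open>The compactly supported kernel \<open>g\<close> contributes only bounded errors; the remainder \<open>f - g\<close> is
  controlled through its \<open>L\<^sup>1\<close> norm, at the price of a logarithm.\<close>

lemma gagliardo_convolve_compare:
  assumes E: "E \<in> sets borel" and f: "integrable lborel f" and K: "0 \<le> K" "\<And>k. (LINT z|lborel. \<bar>f (z + k) - f z\<bar>) \<le> K * norm k"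
    and g: "integrable lborel g" and K': "0 \<le> K'" "\<And>k. (LINT z|lborel. \<bar>g (z + k) - g z\<bar>) \<le> K' * norm k"
    and R: "0 \<le> R" "\<And>z. R < norm z \<Longrightarrow> g z = 0"
    and F: "(LINT z|lborel. \<bar>f z - g z\<bar>) \<le> F"
    and d: "0 \<le> d" and C1: "0 \<le> C1" "\<And>x y :: 'b. norm (x + y) powr q \<le> 2 * norm x powr q + C1 * norm y powr q"
    and Cd: "0 \<le> Cd" "\<And>x y :: 'b. norm (x + y) powr q \<le> (1 + d) * norm x powr q + Cd * norm y powr q"
  shows "\<exists>C\<ge>0. \<forall>\<epsilon>. 0 < \<epsilon> \<and> \<epsilon> < 1 \<longrightarrow>
    gagliardo_on r q UNIV E (convolve f u \<epsilon>)
      \<le> ennreal (1 + d) * (ennreal (\<bar>LINT z|lborel. g z\<bar> powr q) * gagliardo_on r q {h. norm h \<in> {\<epsilon><..1}} E u)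
        + ennreal ((C1 + Cd * C1) * (F powr q * M * measure (cone_measure :: 'a measure) UNIV / (1 - r)) * ln (1 / \<epsilon>) + C) \<and>
    ennreal (\<bar>LINT z|lborel. g z\<bar> powr q) * gagliardo_on r q {h. norm h \<in> {\<epsilon><..1}} E u
      \<le> ennreal (1 + d) * gagliardo_on r q UNIV E (convolve f u \<epsilon>)
        + ennreal ((C1 + Cd * C1) * (F powr q * M * measure (cone_measure :: 'a measure) UNIV / (1 - r)) * ln (1 / \<epsilon>) + C)"
proof -
  note [measurable] = E
  have [measurable]: "f \<in> borel_measurable borel" "g \<in> borel_measurable borel" using f g by auto
  define b where "b z = f z - g z" for z
  have b: "integrable lborel b" unfolding b_def[abs_def] using f g by simp
  have [measurable]: "b \<in> borel_measurable borel" using b by auto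
  have Fb: "(LINT z|lborel. \<bar>b z\<bar>) \<le> F" using F by (simp add: b_def)
  have Kb: "(LINT z|lborel. \<bar>b (z + k) - b z\<bar>) \<le> (K + K') * norm k" for k
  proof -
    have "(LINT z|lborel. \<bar>b (z + k) - b z\<bar>) \<le> (LINT z|lborel. \<bar>f (z + k) - f z\<bar> + \<bar>g (z + k) - g z\<bar>)"
      using f g b by (intro integral_mono) (auto simp: b_def intro!: integrable_abs Bochner_Integration.integrable_diff integrable_lborel_translate Bochner_Integration.integrable_add)
    also have "\<dots> = (LINT z|lborel. \<bar>f (z + k) - f z\<bar>) + (LINT z|lborel. \<bar>g (z + k) - g z\<bar>)"
      using f g by (intro Bochner_Integration.integral_add integrable_abs Bochner_Integration.integrable_diff integrable_lborel_translate)
    also have "\<dots> \<le> (K + K') * norm k" using K(2)[of k] K'(2)[of k] by (simp add: distrib_right)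
    finally show ?thesis .
  qed
  define G where "G = (LINT z|lborel. \<bar>g z\<bar>)"
  define a where "a = (LINT z|lborel. g z)"
  define Ff where "Ff = (LINT z|lborel. \<bar>f z\<bar>)"
  define near where "near = K' powr q * (M * (R + 1) powr (r * q)) * measure (cone_measure :: 'a measure) UNIV / (q - r * q)"
  define md where "md = 2 powr q * 2 * (G powr q * (M * R powr (r * q))) * measure (cone_measure :: 'a measure) UNIV / (r * q)"
  define tail where "tail = 2 powr q * 2 * (Ff powr q * U) * measure (cone_measure :: 'a measure) UNIV / (r * q)"
  define c1 where "c1 = (K + K') powr q * U * measure (cone_measure :: 'a measure) UNIV / (q - r * q)"
  define c2 where "c2 = F powr q * M * measure (cone_measure :: 'a measure) UNIV / (1 - r)"
  have nn: "0 \<le> near" "0 \<le> md" "0 \<le> tail" "0 \<le> c1" "0 \<le> c2"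
    using U M exponent_bounds r by (auto simp: near_def md_def tail_def c1_def c2_def)
  \<comment> \<open>Everything that does not grow: the near, middle and tail errors and the bounded
    part \<open>c1\<close> of the energy of \<open>f - g\<close>. Its logarithmic part
    \<open>c2\<close> enters twice, through \<open>C1\<close> near 0 and through
    \<open>Cd * C1\<close> in the middle range.\<close>
  define C where "C = 2 * near + C1 * c1 + Cd * (2 * md + C1 * c1) + tail"
  have C0: "0 \<le> C" using nn C1(1) Cd(1) by (simp add: C_def)
  have "gagliardo_on r q UNIV E (convolve f u \<epsilon>)
      \<le> ennreal (1 + d) * (ennreal (\<bar>a\<bar> powr q) * gagliardo_on r q {h. norm h \<in> {\<epsilon><..1}} E u)
        + ennreal ((C1 + Cd * C1) * c2 * ln (1 / \<epsilon>) + C) \<and>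
    ennreal (\<bar>a\<bar> powr q) * gagliardo_on r q {h. norm h \<in> {\<epsilon><..1}} E u
      \<le> ennreal (1 + d) * gagliardo_on r q UNIV E (convolve f u \<epsilon>)
        + ennreal ((C1 + Cd * C1) * c2 * ln (1 / \<epsilon>) + C)" if \<epsilon>: "0 < \<epsilon>" "\<epsilon> < 1" for \<epsilon>
  proof -
    define L where "L = ln (1 / \<epsilon>)"
    have L: "0 \<le> L" using \<epsilon> by (simp add: L_def)
    define X where "X = c1 + c2 * L"
    have X: "0 \<le> X" using nn L by (simp add: X_def)
    let ?gag = "\<lambda>W v. gagliardo_on r q W E v"
    define W1 where "W1 = {h :: 'a. norm h \<in> {..\<epsilon>}}"
    define W2 where "W2 = {h :: 'a. norm h \<in> {\<epsilon><..1}}"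
    define W3 where "W3 = {h :: 'a. norm h \<in> {1<..}}"
    have [measurable]: "W1 \<in> sets borel" "W2 \<in> sets borel" "W3 \<in> sets borel"
      unfolding W1_def W2_def W3_def by measurable
    define v where "v = convolve f u \<epsilon>"
    define va where "va = convolve g u \<epsilon>"
    define vb where "vb = convolve b u \<epsilon>"
    have [measurable]: "v \<in> borel_measurable borel" "va \<in> borel_measurable borel" "vb \<in> borel_measurable borel"
      unfolding v_def va_def vb_def by measurable
    have vab: "AE x in lborel. v x = va x + vb x"
      using AE_convolve_integrable[OF g, of \<epsilon>] AE_convolve_integrable[OF b, of \<epsilon>]
    proof eventually_elim
      case (elim x)
      have "f z *\<^sub>R u (x - \<epsilon> *\<^sub>R z) = g z *\<^sub>R u (x - \<epsilon> *\<^sub>R z) + b z *\<^sub>R u (x - \<epsilon> *\<^sub>R z)" for z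
        by (simp add: b_def scaleR_diff_left)
      then show ?case using elim by (simp add: v_def va_def vb_def convolve_def)
    qed
    have vbX: "?gag {h. norm h \<in> {..1}} vb \<le> ennreal X"
      using gagliardo_convolve_unit_ball[OF E b Fb _ Kb \<epsilon>] K(1) K'(1)
      by (simp add: vb_def X_def c1_def c2_def L_def)
    have vb1: "?gag W1 vb \<le> ennreal X"
      by (rule order_trans[OF gagliardo_on_mono vbX]) (use \<epsilon> in \<open>auto simp: W1_def\<close>)
    have vb2: "?gag W2 vb \<le> ennreal X"
      by (rule order_trans[OF gagliardo_on_mono vbX]) (auto simp: W2_def)
    have va1: "?gag W1 va \<le> ennreal near"
      using gagliardo_convolve_near[OF E g K' \<epsilon>(1) R] by (simp add: va_def W1_def near_def)
    have G1: "?gag W1 v \<le> ennreal (2 * near + C1 * X)"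
    proof -
      have "?gag W1 v = ?gag W1 (\<lambda>x. va x + vb x)" by (rule gagliardo_on_cong_AE[OF vab])
      also have "\<dots> \<le> ennreal 2 * ?gag W1 va + ennreal C1 * ?gag W1 vb"
        using C1 by (intro gagliardo_on_add) auto
      also have "\<dots> \<le> ennreal 2 * ennreal near + ennreal C1 * ennreal X"
        by (intro add_mono mult_left_mono va1 vb1) auto
      also have "\<dots> = ennreal (2 * near + C1 * X)"
        using nn X C1 by (intro ennreal_linear_combination) auto
      finally show ?thesis .
    qed
    define y where "y x = a *\<^sub>R u x - va x" for x
    have [measurable]: "y \<in> borel_measurable borel" unfolding y_def[abs_def] by measurable
    \<comment> \<open>Almost everywhere \<open>w\<close> equals \<open>v\<close> minus
      \<open>a\<close> times \<open>u\<close>, so one bound for its energy serves the upper and the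
      lower estimate.\<close>
    define w where "w x = (-1) *\<^sub>R y x + vb x" for x
    have [measurable]: "w \<in> borel_measurable borel" unfolding w_def[abs_def] by measurable
    have G2w: "?gag W2 w \<le> ennreal (2 * md + C1 * X)"
    proof -
      have "?gag W2 w \<le> ennreal 2 * ?gag W2 (\<lambda>x. (-1) *\<^sub>R y x) + ennreal C1 * ?gag W2 vb"
        unfolding w_def[abs_def] using C1 by (intro gagliardo_on_add) auto
      also have "?gag W2 (\<lambda>x. (-1) *\<^sub>R y x) = ?gag W2 y"
        by (subst gagliardo_on_scaleR) auto
      also have "ennreal 2 * ?gag W2 y + ennreal C1 * ?gag W2 vb \<le> ennreal 2 * ennreal md + ennreal C1 * ennreal X"
        using gagliardo_convolve_minus_mid[OF E g order_refl \<epsilon>(1) R]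
        by (intro add_mono mult_left_mono vb2) (auto simp: W2_def y_def[abs_def] a_def va_def md_def G_def)
      also have "\<dots> = ennreal (2 * md + C1 * X)"
        using nn X C1 by (intro ennreal_linear_combination) auto
      finally show ?thesis .
    qed
    have Gau: "?gag W2 (\<lambda>x. a *\<^sub>R u x) = ennreal (\<bar>a\<bar> powr q) * ?gag W2 u"
      by (rule gagliardo_on_scaleR) auto
    have G2: "?gag W2 v \<le> ennreal (1 + d) * (ennreal (\<bar>a\<bar> powr q) * ?gag W2 u) + ennreal (Cd * (2 * md + C1 * X))"
    proof -
      have "AE x in lborel. v x = a *\<^sub>R u x + w x"
        using vab by eventually_elim (simp add: w_def y_def)
      then have "?gag W2 v = ?gag W2 (\<lambda>x. a *\<^sub>R u x + w x)" by (rule gagliardo_on_cong_AE)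
      also have "\<dots> \<le> ennreal (1 + d) * ?gag W2 (\<lambda>x. a *\<^sub>R u x) + ennreal Cd * ?gag W2 w"
        using Cd d by (intro gagliardo_on_add) auto
      also have "\<dots> \<le> ennreal (1 + d) * (ennreal (\<bar>a\<bar> powr q) * ?gag W2 u) + ennreal Cd * ennreal (2 * md + C1 * X)"
        unfolding Gau by (intro add_left_mono mult_left_mono G2w) auto
      also have "ennreal Cd * ennreal (2 * md + C1 * X) = ennreal (Cd * (2 * md + C1 * X))"
        using Cd nn X C1 by (simp add: ennreal_mult)
      finally show ?thesis .
    qed
    have G2': "ennreal (\<bar>a\<bar> powr q) * ?gag W2 u \<le> ennreal (1 + d) * ?gag W2 v + ennreal (Cd * (2 * md + C1 * X))"
    proof -
      have "AE x in lborel. a *\<^sub>R u x = v x + (-1) *\<^sub>R w x"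
        using vab by eventually_elim (simp add: w_def y_def)
      then have "?gag W2 (\<lambda>x. a *\<^sub>R u x) = ?gag W2 (\<lambda>x. v x + (-1) *\<^sub>R w x)" by (rule gagliardo_on_cong_AE)
      also have "\<dots> \<le> ennreal (1 + d) * ?gag W2 v + ennreal Cd * ?gag W2 (\<lambda>x. (-1) *\<^sub>R w x)"
        using Cd d by (intro gagliardo_on_add) auto
      also have "?gag W2 (\<lambda>x. (-1) *\<^sub>R w x) = ?gag W2 w"
        by (subst gagliardo_on_scaleR) auto
      also have "ennreal (1 + d) * ?gag W2 v + ennreal Cd * ?gag W2 w \<le> ennreal (1 + d) * ?gag W2 v + ennreal Cd * ennreal (2 * md + C1 * X)"
        by (intro add_left_mono mult_left_mono G2w) auto
      also have "ennreal Cd * ennreal (2 * md + C1 * X) = ennreal (Cd * (2 * md + C1 * X))"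
        using Cd nn X C1 by (simp add: ennreal_mult)
      finally show ?thesis by (simp only: Gau)
    qed
    have G3: "?gag W3 v \<le> ennreal tail"
      using gagliardo_convolve_tail[OF E f order_refl, of \<epsilon>] by (simp add: W3_def v_def tail_def Ff_def)
    have split: "?gag UNIV v = (?gag W1 v + ?gag W2 v) + ?gag W3 v"
    proof -
      have UN: "(UNIV :: 'a set) = (W1 \<union> W2) \<union> W3" using \<epsilon> by (auto simp: W1_def W2_def W3_def)
      have "?gag UNIV v = ?gag (W1 \<union> W2) v + ?gag W3 v"
        by (subst UN) (rule gagliardo_on_disjoint_Un, use \<epsilon> in \<open>auto simp: W1_def W2_def W3_def\<close>)
      also have "?gag (W1 \<union> W2) v = ?gag W1 v + ?gag W2 v"
        by (rule gagliardo_on_disjoint_Un) (auto simp: W1_def W2_def)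
      finally show ?thesis .
    qed
    have XC: "2 * near + C1 * X + Cd * (2 * md + C1 * X) + tail = (C1 + Cd * C1) * c2 * L + C"
      by (simp add: X_def C_def algebra_simps)
    have up: "?gag UNIV v \<le> ennreal (1 + d) * (ennreal (\<bar>a\<bar> powr q) * ?gag W2 u) + ennreal ((C1 + Cd * C1) * c2 * L + C)"
    proof -
      have "?gag UNIV v \<le> (ennreal (2 * near + C1 * X) + (ennreal (1 + d) * (ennreal (\<bar>a\<bar> powr q) * ?gag W2 u) + ennreal (Cd * (2 * md + C1 * X)))) + ennreal tail"
        unfolding split by (intro add_mono G1 G2 G3)
      also have "\<dots> = ennreal (1 + d) * (ennreal (\<bar>a\<bar> powr q) * ?gag W2 u) + ennreal (2 * near + C1 * X + Cd * (2 * md + C1 * X) + tail)"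
        using nn X C1(1) Cd(1) by (simp add: add_ac)
      finally show ?thesis unfolding XC .
    qed
    have low: "ennreal (\<bar>a\<bar> powr q) * ?gag W2 u \<le> ennreal (1 + d) * ?gag UNIV v + ennreal ((C1 + Cd * C1) * c2 * L + C)"
    proof -
      have "ennreal (\<bar>a\<bar> powr q) * ?gag W2 u \<le> ennreal (1 + d) * ?gag W2 v + ennreal (Cd * (2 * md + C1 * X))" by (rule G2')
      also have "\<dots> \<le> ennreal (1 + d) * ?gag UNIV v + ennreal (2 * near + C1 * X + Cd * (2 * md + C1 * X) + tail)"
        using nn X C1(1) Cd(1) by (intro add_mono mult_left_mono gagliardo_on_mono ennreal_leI) auto
      finally show ?thesis unfolding XC .
    qed
    show ?thesis using up low by (simp add: L_def v_def W2_def)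
  qed
  then show ?thesis using C0 unfolding c2_def a_def by blast
qed

end

text \<open>A cutoff of slope 1, equal to 1 on a large ball, keeps the linear translation bound: by
  the product rule it adds at most \<open>norm k\<close> times the \<open>L1\<close> norm of
  \<open>f\<close>. Dominated convergence makes the discarded part small.\<close>

lemma cutoff_approximation:
  fixes f :: "'a::euclidean_space \<Rightarrow> real"
  assumes f: "integrable lborel f" and K: "0 \<le> K" "\<And>k. (LINT z|lborel. \<bar>f (z + k) - f z\<bar>) \<le> K * norm k"
    and e: "0 < e"
  obtains g R K' where "integrable lborel g" "0 \<le> R" "\<And>z. R < norm z \<Longrightarrow> g z = 0"
    "0 \<le> K'" "\<And>k. (LINT z|lborel. \<bar>g (z + k) - g z\<bar>) \<le> K' * norm k" "(LINT z|lborel. \<bar>f z - g z\<bar>) < e"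
proof -
  have [measurable]: "f \<in> borel_measurable borel" using f by auto
  define c where "c R z = max 0 (min 1 (R + 1 - norm z))" for R and z :: 'a
  have c01: "0 \<le> c R z" "c R z \<le> 1" for R z by (auto simp: c_def)
  have cl: "\<bar>c R x - c R y\<bar> \<le> norm (x - y)" for R x y
    using norm_triangle_ineq3[of x y] unfolding c_def by (smt (verit))
  have cf: "integrable lborel (\<lambda>z. c R z * f z)" for R
    by (rule Bochner_Integration.integrable_bound[OF f])
      (use c01 in \<open>auto simp: abs_mult c_def intro!: AE_I2 mult_left_le_one_le\<close>)
  have "(\<lambda>n. LINT z|lborel. \<bar>f z - c (real n) z * f z\<bar>) \<longlonglongrightarrow> (LINT z|(lborel :: 'a measure). (0 :: real))"
  proof (rule integral_dominated_convergence)
    show "integrable lborel (\<lambda>z. \<bar>f z\<bar>)" using f by simp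
    show "AE z :: 'a in lborel. (\<lambda>n. \<bar>f z - c (real n) z * f z\<bar>) \<longlonglongrightarrow> 0"
    proof (rule AE_I2)
      fix z :: 'a
      obtain N where N: "norm z \<le> real N" using real_arch_simple by blast
      have "\<bar>f z - c (real n) z * f z\<bar> = 0" if "N \<le> n" for n
      proof -
        have "norm z \<le> real n" using N that by (meson of_nat_mono order_trans)
        then have "c (real n) z = 1" by (simp add: c_def)
        then show ?thesis by simp
      qed
      then show "(\<lambda>n. \<bar>f z - c (real n) z * f z\<bar>) \<longlonglongrightarrow> 0"
        by (intro tendsto_eventually eventually_sequentiallyI)
    qed
    show "AE z in lborel. norm \<bar>f z - c (real n) z * f z\<bar> \<le> \<bar>f z\<bar>" for n
    proof (rule AE_I2)
      fix z :: 'a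
      have "f z - c (real n) z * f z = (1 - c (real n) z) * f z" by (simp add: algebra_simps)
      then show "norm \<bar>f z - c (real n) z * f z\<bar> \<le> \<bar>f z\<bar>"
        using c01[of "real n" z] by (simp add: abs_mult mult_left_le_one_le)
    qed
    show "(\<lambda>z. \<bar>f z - c (real n) z * f z\<bar>) \<in> borel_measurable lborel" for n
      unfolding c_def by measurable
  qed simp
  then have "\<forall>\<^sub>F n in sequentially. (LINT z|lborel. \<bar>f z - c (real n) z * f z\<bar>) < e"
    using e by (intro order_tendstoD) auto
  then obtain n where n: "(LINT z|lborel. \<bar>f z - c (real n) z * f z\<bar>) < e"
    using eventually_happens trivial_limit_sequentially by blast
  show thesis
  proof (rule that[of "\<lambda>z. c (real n) z * f z" "real n + 1" "K + (LINT z|lborel. \<bar>f z\<bar>)"])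
    show "integrable lborel (\<lambda>z. c (real n) z * f z)" by (rule cf)
    show "(LINT z|lborel. \<bar>f z - c (real n) z * f z\<bar>) < e" by (rule n)
    show "c (real n) z * f z = 0" if "real n + 1 < norm z" for z using that by (simp add: c_def)
    show "0 \<le> K + (LINT z|lborel. \<bar>f z\<bar>)" using K by simp
    fix k :: 'a
    have "(LINT z|lborel. \<bar>c (real n) (z + k) * f (z + k) - c (real n) z * f z\<bar>)
        \<le> (LINT z|lborel. \<bar>f (z + k) - f z\<bar> + norm k * \<bar>f z\<bar>)"
    proof (rule integral_mono)
      show "integrable lborel (\<lambda>z. \<bar>c (real n) (z + k) * f (z + k) - c (real n) z * f z\<bar>)"
        using cf integrable_lborel_translate[OF cf] by (intro integrable_abs Bochner_Integration.integrable_diff)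
      show "integrable lborel (\<lambda>z. \<bar>f (z + k) - f z\<bar> + norm k * \<bar>f z\<bar>)"
        using f integrable_lborel_translate[OF f, of k] by simp
      fix z
      have "c (real n) (z + k) * f (z + k) - c (real n) z * f z
        = c (real n) (z + k) * (f (z + k) - f z) + (c (real n) (z + k) - c (real n) z) * f z"
        by (simp add: algebra_simps)
      then have "\<bar>c (real n) (z + k) * f (z + k) - c (real n) z * f z\<bar>
        \<le> \<bar>c (real n) (z + k) * (f (z + k) - f z)\<bar> + \<bar>(c (real n) (z + k) - c (real n) z) * f z\<bar>"
        by (metis abs_triangle_ineq)
      also have "\<dots> \<le> \<bar>f (z + k) - f z\<bar> + norm k * \<bar>f z\<bar>"
        using c01[of "real n" "z + k"] cl[of "real n" "z + k" z]
        by (intro add_mono) (auto simp: abs_mult intro!: mult_left_le_one_le mult_right_mono)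
      finally show "\<bar>c (real n) (z + k) * f (z + k) - c (real n) z * f z\<bar> \<le> \<bar>f (z + k) - f z\<bar> + norm k * \<bar>f z\<bar>" .
    qed
    also have "\<dots> = (LINT z|lborel. \<bar>f (z + k) - f z\<bar>) + norm k * (LINT z|lborel. \<bar>f z\<bar>)"
      using f integrable_lborel_translate[OF f, of k] by simp
    also have "\<dots> \<le> (K + (LINT z|lborel. \<bar>f z\<bar>)) * norm k"
      using K(2)[of k] by (simp add: algebra_simps)
    finally show "(LINT z|lborel. \<bar>c (real n) (z + k) * f (z + k) - c (real n) z * f z\<bar>)
        \<le> (K + (LINT z|lborel. \<bar>f z\<bar>)) * norm k" .
  qed auto
qed

section \<open>Logarithmic averages\<close>

lemma divide_4_mult_cancel: "0 < x \<Longrightarrow> t / (4 * x) * x = t / 4" for t x :: real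
  by simp

text \<open>The order of choices is essential: \<open>\<tau>\<close> determines \<open>d\<close>,
  \<open>d\<close> determines the possibly huge constant \<open>Cd\<close>, and only then is the
  kernel cut off, so closely that its remainder is small even after multiplication by
  \<open>D\<close>, which contains \<open>Cd\<close>. The relative error \<open>d\<close> is
  absorbed by the crude logarithmic bounds for both energies.\<close>

lemma (in besov_function) gagliardo_convolve_asymp:
  assumes E: "E \<in> sets borel" and f: "integrable lborel f" and K: "0 \<le> K" "\<And>k. (LINT z|lborel. \<bar>f (z + k) - f z\<bar>) \<le> K * norm k"
    and \<tau>: "0 < \<tau>"
  shows "\<exists>C\<ge>0. \<forall>\<epsilon>. 0 < \<epsilon> \<and> \<epsilon> < 1 \<longrightarrow>
    gagliardo_on r q UNIV E (convolve f u \<epsilon>)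
      \<le> ennreal (\<bar>LINT z|lborel. f z\<bar> powr q) * gagliardo_on r q {h. norm h \<in> {\<epsilon><..1}} E u + ennreal (\<tau> * ln (1 / \<epsilon>) + C) \<and>
    ennreal (\<bar>LINT z|lborel. f z\<bar> powr q) * gagliardo_on r q {h. norm h \<in> {\<epsilon><..1}} E u
      \<le> gagliardo_on r q UNIV E (convolve f u \<epsilon>) + ennreal (\<tau> * ln (1 / \<epsilon>) + C)"
proof -
  define s where "s = measure (cone_measure :: 'a measure) UNIV"
  have s0: "0 \<le> s" by (simp add: s_def)
  define c where "c = (LINT z|lborel. f z)"
  define Q where "Q = \<bar>c\<bar> powr q"
  define B where "B = M * s"
  define F where "F = (LINT z|lborel. \<bar>f z\<bar>)"
  define c2 where "c2 = F powr q * M * s / (1 - r)"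
  define c3 where "c3 = K powr q * U * s / (q - r * q) + 2 powr q * 2 * (F powr q * U) * s / (r * q)"
  have nn: "0 \<le> Q" "0 \<le> B" "0 \<le> c2" "0 \<le> c3"
    using M U r exponent_bounds s0 by (auto simp: Q_def B_def c2_def c3_def)
  \<comment> \<open>Chosen so that \<open>d * (Q * B)\<close> and \<open>d * c2\<close> are at most
    \<open>\<tau> / 4\<close>; the summand 1 keeps the denominator positive.\<close>
  define d where "d = \<tau> / (4 * (Q * B + c2 + 1))"
  have pos: "0 < Q * B + c2 + 1" using nn by (simp add: add_nonneg_pos)
  have d: "0 < d" using \<tau> pos by (simp add: d_def)
  have "d * (Q * B + c2 + 1) = \<tau> / 4" unfolding d_def using pos by (rule divide_4_mult_cancel)
  then have dsum: "d * (Q * B) + d * c2 + d = \<tau> / 4" by (simp add: algebra_simps)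
  have "0 \<le> d * (Q * B)" "0 \<le> d * c2" using nn d by simp_all
  with dsum d have dQ: "d * (Q * B) \<le> \<tau> / 4" and dc2: "d * c2 \<le> \<tau> / 4" by linarith+
  obtain C1 where C1: "0 \<le> C1" "\<And>x y :: 'b. norm (x + y) powr q \<le> (1 + 1) * norm x powr q + C1 * norm y powr q"
    using powr_add_le[OF q zero_less_one, where 'b = 'b] by blast
  obtain Cd where Cd: "0 \<le> Cd" "\<And>x y :: 'b. norm (x + y) powr q \<le> (1 + d) * norm x powr q + Cd * norm y powr q"
    using powr_add_le[OF q d, where 'b = 'b] by blast
  define D where "D = (C1 + Cd * C1) * (M * s / (1 - r))"
  have D: "0 \<le> D" using C1(1) Cd(1) M s0 r by (simp add: D_def)
  \<comment> \<open>Continuity lets the mean of the cut-off kernel be replaced by that of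
    \<open>f\<close>, as the two differ by less than \<open>e\<close>.\<close>
  have pw: "((\<lambda>a. \<bar>a\<bar> powr q) \<longlongrightarrow> Q) (nhds c)"
    unfolding Q_def using q by (intro tendsto_powr' tendsto_rabs filterlim_ident tendsto_const) auto
  have "((\<lambda>a. (1 + d) * \<bar>\<bar>a\<bar> powr q - Q\<bar> * B) \<longlongrightarrow> (1 + d) * \<bar>Q - Q\<bar> * B) (nhds c)"
    by (intro tendsto_mult tendsto_const tendsto_rabs tendsto_diff pw)
  then have "\<forall>\<^sub>F a in nhds c. (1 + d) * \<bar>\<bar>a\<bar> powr q - Q\<bar> * B < \<tau> / 4"
    using \<tau> by (intro order_tendstoD) auto
  then obtain e1 where e1: "0 < e1" "\<And>a. dist a c < e1 \<Longrightarrow> (1 + d) * \<bar>\<bar>a\<bar> powr q - Q\<bar> * B < \<tau> / 4"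
    unfolding eventually_nhds_metric by blast
  have "((\<lambda>t. D * t powr q) \<longlongrightarrow> D * 0 powr q) (at_right 0)"
    using q by (intro tendsto_mult tendsto_const tendsto_powr' tendsto_ident_at) (auto simp: eventually_at_right_less intro: eventually_mono[OF eventually_at_right_less])
  then have "\<forall>\<^sub>F t in at_right 0. D * t powr q < \<tau> / 2"
    using \<tau> by (intro order_tendstoD) auto
  then obtain e2 where e2: "0 < e2" "\<And>t. 0 < t \<Longrightarrow> t < e2 \<Longrightarrow> D * t powr q < \<tau> / 2"
    unfolding eventually_at_right_field by blast
  define e where "e = min e1 (e2 / 2)"
  have e: "0 < e" "e \<le> e1" "D * e powr q \<le> \<tau> / 2" using e1 e2 by (auto simp: e_def less_imp_le)
  obtain g R K' where g: "integrable lborel g" and R: "0 \<le> R" "\<And>z. R < norm z \<Longrightarrow> g z = 0"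
    and K': "0 \<le> K'" "\<And>k. (LINT z|lborel. \<bar>g (z + k) - g z\<bar>) \<le> K' * norm k"
    and fg: "(LINT z|lborel. \<bar>f z - g z\<bar>) < e"
    using cutoff_approximation[OF f K e(1)] by blast
  define A where "A = \<bar>LINT z|lborel. g z\<bar> powr q"
  have A0: "0 \<le> A" by (simp add: A_def)
  have "\<bar>c - (LINT z|lborel. g z)\<bar> \<le> (LINT z|lborel. \<bar>f z - g z\<bar>)"
    using integral_abs_bound[of lborel "\<lambda>z. f z - g z"] f g by (simp add: c_def)
  then have "dist (LINT z|lborel. g z) c < e1" using fg e by (simp add: dist_real_def abs_minus_commute)
  then have AQ: "(1 + d) * \<bar>A - Q\<bar> * B \<le> \<tau> / 4" using e1(2) by (simp add: A_def less_imp_le)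
  have "\<bar>A - Q\<bar> * B \<le> (1 + d) * (\<bar>A - Q\<bar> * B)" using d nn by (intro mult_right_mono[of 1 "1 + d", simplified]) auto
  with AQ have AQ': "\<bar>A - Q\<bar> * B \<le> \<tau> / 4" by (simp add: mult.assoc)
  obtain C where C0: "0 \<le> C" and C: "\<And>\<epsilon>. 0 < \<epsilon> \<Longrightarrow> \<epsilon> < 1 \<Longrightarrow>
    gagliardo_on r q UNIV E (convolve f u \<epsilon>)
      \<le> ennreal (1 + d) * (ennreal A * gagliardo_on r q {h. norm h \<in> {\<epsilon><..1}} E u) + ennreal (D * e powr q * ln (1 / \<epsilon>) + C) \<and>
    ennreal A * gagliardo_on r q {h. norm h \<in> {\<epsilon><..1}} E u
      \<le> ennreal (1 + d) * gagliardo_on r q UNIV E (convolve f u \<epsilon>) + ennreal (D * e powr q * ln (1 / \<epsilon>) + C)"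
  proof -
    have "(C1 + Cd * C1) * (e powr q * M * s / (1 - r)) = D * e powr q" by (simp add: D_def)
    then show thesis
      using gagliardo_convolve_compare[OF E f K g K' R less_imp_le[OF fg] less_imp_le[OF d] C1(1) _ Cd] C1(2) that
      unfolding A_def s_def by fastforce
  qed
  show ?thesis
  proof (intro exI[of _ "C + d * c3"] conjI allI impI)
    show "0 \<le> C + d * c3" using C0 d nn by simp
    fix \<epsilon> :: real assume "0 < \<epsilon> \<and> \<epsilon> < 1"
    then have \<epsilon>: "0 < \<epsilon>" "\<epsilon> < 1" by auto
    define L where "L = ln (1 / \<epsilon>)"
    have L: "0 \<le> L" using \<epsilon> by (simp add: L_def)
    let ?G = "gagliardo_on r q UNIV E (convolve f u \<epsilon>)"
    let ?J = "gagliardo_on r q {h. norm h \<in> {\<epsilon><..1}} E u"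
    have Gle: "?G \<le> ennreal (c2 * L + c3)"
      using gagliardo_convolve_total[OF E f order_refl K \<epsilon>] by (simp add: c2_def c3_def F_def L_def s_def)
    have Jle: "?J \<le> ennreal (B * L)"
      using gagliardo_u_mid[OF E \<epsilon>] by (simp add: B_def L_def s_def)
    \<comment> \<open>Both energies are finite, so the remaining bookkeeping is done with real
      numbers.\<close>
    obtain \<gamma> where \<gamma>: "?G = ennreal \<gamma>" "0 \<le> \<gamma>" using Gle by (cases ?G) (auto simp: top_unique)
    obtain j where j: "?J = ennreal j" "0 \<le> j" using Jle by (cases ?J) (auto simp: top_unique)
    have jB: "j \<le> B * L" using Jle nn L unfolding j(1) by (subst (asm) ennreal_le_iff) auto
    have \<gamma>B: "\<gamma> \<le> c2 * L + c3" using Gle nn L unfolding \<gamma>(1) by (subst (asm) ennreal_le_iff) auto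
    have DL: "D * e powr q * L \<le> \<tau> / 2 * L" using e(3) L by (rule mult_right_mono)
    have DL0: "0 \<le> D * e powr q * L + C" using D L C0 by simp
    have up: "\<gamma> \<le> (1 + d) * (A * j) + (D * e powr q * L + C)"
    proof -
      have "ennreal \<gamma> \<le> ennreal (1 + d) * (ennreal A * ennreal j) + ennreal (D * e powr q * L + C)"
        using C[OF \<epsilon>] by (simp only: \<gamma> j L_def)
      also have "\<dots> = ennreal ((1 + d) * (A * j) + (D * e powr q * L + C))"
        using A0 j d DL0 by (simp only: ennreal_mult[symmetric] ennreal_plus[symmetric] mult_nonneg_nonneg add_nonneg_nonneg less_imp_le zero_le_one)
      finally show ?thesis using A0 j d DL0 by (subst (asm) ennreal_le_iff) auto
    qed
    have low: "A * j \<le> (1 + d) * \<gamma> + (D * e powr q * L + C)"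
    proof -
      have "ennreal A * ennreal j \<le> ennreal (1 + d) * ennreal \<gamma> + ennreal (D * e powr q * L + C)"
        using C[OF \<epsilon>] by (simp only: \<gamma> j L_def)
      also have "\<dots> = ennreal ((1 + d) * \<gamma> + (D * e powr q * L + C))"
        using \<gamma> d DL0 by (simp only: ennreal_mult[symmetric] ennreal_plus[symmetric] mult_nonneg_nonneg add_nonneg_nonneg less_imp_le zero_le_one)
      finally have "ennreal (A * j) \<le> ennreal ((1 + d) * \<gamma> + (D * e powr q * L + C))"
        using A0 j by (simp add: ennreal_mult)
      then show ?thesis using \<gamma> d DL0 by (subst (asm) ennreal_le_iff) auto
    qed
    have Aj: "\<bar>A - Q\<bar> * j \<le> \<tau> / 4 * L"
    proof -
      have "\<bar>A - Q\<bar> * j \<le> \<bar>A - Q\<bar> * (B * L)" using jB by (rule mult_left_mono) simp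
      also have "\<dots> \<le> \<tau> / 4 * L" using mult_right_mono[OF AQ' L] by (simp add: mult.assoc)
      finally show ?thesis .
    qed
    have Aj': "(1 + d) * (\<bar>A - Q\<bar> * j) \<le> \<tau> / 4 * L"
    proof -
      have "(1 + d) * (\<bar>A - Q\<bar> * j) \<le> (1 + d) * (\<bar>A - Q\<bar> * (B * L))" using jB d by (intro mult_left_mono) auto
      also have "\<dots> \<le> \<tau> / 4 * L" using mult_right_mono[OF AQ L] by (simp add: mult.assoc)
      finally show ?thesis .
    qed
    have dQj: "d * (Q * j) \<le> \<tau> / 4 * L"
    proof -
      have "d * (Q * j) \<le> d * (Q * (B * L))" using jB d nn by (intro mult_left_mono) auto
      also have "\<dots> \<le> \<tau> / 4 * L" using mult_right_mono[OF dQ L] by (simp add: mult.assoc)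
      finally show ?thesis .
    qed
    have d\<gamma>: "d * \<gamma> \<le> \<tau> / 4 * L + d * c3"
    proof -
      have "d * \<gamma> \<le> d * (c2 * L + c3)" using \<gamma>B d by (intro mult_left_mono) auto
      also have "\<dots> = (d * c2) * L + d * c3" by (simp add: algebra_simps)
      also have "\<dots> \<le> \<tau> / 4 * L + d * c3" using mult_right_mono[OF dc2 L] by simp
      finally show ?thesis .
    qed
    have AQj: "A * j \<le> Q * j + \<bar>A - Q\<bar> * j" "Q * j \<le> A * j + \<bar>A - Q\<bar> * j"
      using j by (auto simp flip: distrib_right intro!: mult_right_mono)
    have dc30: "0 \<le> d * c3" using d nn by simp
    have "(1 + d) * (A * j) \<le> (1 + d) * (Q * j + \<bar>A - Q\<bar> * j)" using AQj(1) d by (intro mult_left_mono) auto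
    also have "\<dots> = Q * j + d * (Q * j) + (1 + d) * (\<bar>A - Q\<bar> * j)" by (simp add: algebra_simps)
    \<comment> \<open>Of the budget \<open>\<tau>\<close>, a quarter goes to the factor
      \<open>1 + d\<close>, a quarter to replacing \<open>A\<close> by \<open>Q\<close>, and half to
      the remainder kernel.\<close>
    finally have "\<gamma> \<le> Q * j + (\<tau> * L + (C + d * c3))"
      using up Aj' dQj DL dc30 by (simp add: field_simps)
    then have "ennreal \<gamma> \<le> ennreal (Q * j + (\<tau> * L + (C + d * c3)))" by (rule ennreal_leI)
    then show "?G \<le> ennreal (\<bar>LINT z|lborel. f z\<bar> powr q) * ?J + ennreal (\<tau> * ln (1 / \<epsilon>) + (C + d * c3))"
      using nn j \<tau> L C0 dc30 by (simp add: \<gamma> Q_def c_def L_def ennreal_mult)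
    have "(1 + d) * \<gamma> = \<gamma> + d * \<gamma>" by (simp add: algebra_simps)
    \<comment> \<open>The same division, except that the factor \<open>1 + d\<close> now stands at
      the energy of the convolution, whose bounded part contributes the constant
      \<open>d * c3\<close>.\<close>
    then have "Q * j \<le> \<gamma> + (\<tau> * L + (C + d * c3))"
      using low AQj(2) Aj d\<gamma> DL by (simp add: field_simps)
    then have "ennreal (Q * j) \<le> ennreal (\<gamma> + (\<tau> * L + (C + d * c3)))" by (rule ennreal_leI)
    then show "ennreal (\<bar>LINT z|lborel. f z\<bar> powr q) * ?J \<le> ?G + ennreal (\<tau> * ln (1 / \<epsilon>) + (C + d * c3))"
      using nn j \<gamma>(2) \<tau> L C0 dc30 by (simp add: \<gamma>(1) Q_def c_def L_def ennreal_mult)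
  qed
qed

lemma eventually_ln_inverse_large:
  fixes b C e :: real
  assumes "0 < b" "0 < e"
  shows "\<forall>\<^sub>F \<epsilon> in at_right 0. 0 < \<epsilon> \<and> \<epsilon> < b \<and> \<epsilon> < 1 \<and> 0 < ln (1 / \<epsilon>) \<and> C \<le> e * ln (1 / \<epsilon>)"
proof -
  have pos: "0 < min (min b 1) (exp (- (C / e)))" using assms by simp
  show ?thesis
  proof (rule eventually_at_rightI[OF _ pos])
    fix \<epsilon> assume "\<epsilon> \<in> {0<..<min (min b 1) (exp (- (C / e)))}"
    then have \<epsilon>: "0 < \<epsilon>" "\<epsilon> < b" "\<epsilon> < 1" "\<epsilon> < exp (- (C / e))" by auto
    have "ln \<epsilon> < ln (exp (- (C / e)))" using \<epsilon> by (subst ln_less_cancel_iff) auto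
    then have "C / e < ln (1 / \<epsilon>)" using \<epsilon> by (simp add: ln_div)
    then have "C \<le> e * ln (1 / \<epsilon>)" using assms by (simp add: pos_divide_less_eq mult.commute less_imp_le)
    then show "0 < \<epsilon> \<and> \<epsilon> < b \<and> \<epsilon> < 1 \<and> 0 < ln (1 / \<epsilon>) \<and> C \<le> e * ln (1 / \<epsilon>)"
      using \<epsilon> by simp
  qed
qed

text \<open>Up to errors, \<open>g\<close> is an average of \<open>S\<close> with weight
  \<open>1 / \<rho>\<close> of total mass \<open>ln (1 / \<epsilon>)\<close>. Scales above a fixed
  \<open>\<rho>0\<close> contribute a bounded amount, so after division only values of
  \<open>S\<close> close to its upper limit count.\<close>

lemma Limsup_logarithmic_average:
  fixes S g J :: "real \<Rightarrow> ennreal"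
  assumes B: "0 \<le> B" "\<And>\<rho>. 0 < \<rho> \<Longrightarrow> \<rho> \<le> 1 \<Longrightarrow> S \<rho> \<le> ennreal B"
    and k: "0 \<le> k"
    and J: "\<And>\<epsilon>. 0 < \<epsilon> \<Longrightarrow> \<epsilon> < 1 \<Longrightarrow> J \<epsilon> = (\<integral>\<^sup>+\<rho>. indicator {\<epsilon><..1} \<rho> * (ennreal (1 / \<rho>) * S \<rho>) \<partial>lborel)"
    and up: "\<And>\<tau>. 0 < \<tau> \<Longrightarrow> \<exists>C\<ge>0. \<forall>\<epsilon>. 0 < \<epsilon> \<and> \<epsilon> < 1 \<longrightarrow> g \<epsilon> \<le> ennreal k * J \<epsilon> + ennreal (\<tau> * ln (1 / \<epsilon>) + C)"
  shows "Limsup (at_right 0) (\<lambda>\<epsilon>. ennreal (1 / \<bar>ln \<epsilon>\<bar>) * g \<epsilon>) \<le> ennreal k * Limsup (at_right 0) S"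
proof (rule ennreal_le_epsilon)
  fix e :: real assume e: "0 < e"
  have "\<forall>\<^sub>F \<rho> in at_right 0. S \<rho> \<le> ennreal B"
    by (rule eventually_at_rightI[of 0 1]) (use B in auto)
  then have "Limsup (at_right 0) S \<le> ennreal B" by (rule Limsup_bounded)
  then obtain l where l: "Limsup (at_right 0) S = ennreal l" "0 \<le> l"
    by (cases "Limsup (at_right 0) S") (auto simp: top_unique)
  \<comment> \<open>Makes \<open>k * d\<close> at most \<open>e / 4\<close>; with
    \<open>k + 1\<close> in the denominator \<open>k = 0\<close> is included.\<close>
  define d where "d = e / (4 * (k + 1))"
  have d: "0 < d" using e k by (simp add: d_def)
  have kd: "k * d \<le> e / 4"
  proof -
    have "d * (k + 1) = e / 4" unfolding d_def by (rule divide_4_mult_cancel) (use k in simp)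
    then show ?thesis using d by (simp add: algebra_simps)
  qed
  define m where "m = l + d"
  have m: "0 \<le> m" using l d by (simp add: m_def)
  have "Limsup (at_right 0) S < ennreal m" unfolding l using l d by (simp add: m_def ennreal_lessI)
  then have "\<forall>\<^sub>F \<rho> in at_right 0. S \<rho> < ennreal m" by (rule Limsup_lessD)
  then obtain b where b: "0 < b" "\<And>\<rho>. 0 < \<rho> \<Longrightarrow> \<rho> < b \<Longrightarrow> S \<rho> < ennreal m"
    unfolding eventually_at_right_field by blast
  define \<rho>0 where "\<rho>0 = min (b / 2) 1"
  have \<rho>0: "0 < \<rho>0" "\<rho>0 < b" "\<rho>0 \<le> 1" using b by (auto simp: \<rho>0_def)
  obtain C where C: "0 \<le> C" "\<And>\<epsilon>. 0 < \<epsilon> \<Longrightarrow> \<epsilon> < 1 \<Longrightarrow> g \<epsilon> \<le> ennreal k * J \<epsilon> + ennreal (e / 4 * ln (1 / \<epsilon>) + C)"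
    using up[of "e / 4"] e by auto
  \<comment> \<open>All terms without a logarithm of \<open>\<epsilon>\<close>; for small
    \<open>\<epsilon>\<close> they are at most \<open>e / 4 * ln (1 / \<epsilon>)\<close>.\<close>
  define C' where "C' = k * (B * ln (1 / \<rho>0)) + C"
  have "\<forall>\<^sub>F \<epsilon> in at_right 0. ennreal (1 / \<bar>ln \<epsilon>\<bar>) * g \<epsilon> \<le> ennreal k * Limsup (at_right 0) S + ennreal e"
    using eventually_ln_inverse_large[OF \<rho>0(1), of "e / 4" C', OF divide_pos_pos[OF e zero_less_numeral]]
  proof eventually_elim
    case (elim \<epsilon>)
    then have \<epsilon>: "0 < \<epsilon>" "\<epsilon> < \<rho>0" "\<epsilon> < 1" and Lpos: "0 < ln (1 / \<epsilon>)" and C'L: "C' \<le> e / 4 * ln (1 / \<epsilon>)" by auto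
    define L where "L = ln (1 / \<epsilon>)"
    have L: "0 < L" "\<bar>ln \<epsilon>\<bar> = L" using Lpos \<epsilon> by (auto simp: L_def ln_div)
    have "J \<epsilon> \<le> (\<integral>\<^sup>+\<rho>. ennreal m * (indicator {\<epsilon><..\<rho>0} \<rho> * ennreal (1 / \<rho>)) + ennreal B * (indicator {\<rho>0<..1} \<rho> * ennreal (1 / \<rho>)) \<partial>lborel)"
      unfolding J[OF \<epsilon>(1,3)]
    proof (rule nn_integral_mono)
      fix \<rho> :: real
      show "indicator {\<epsilon><..1} \<rho> * (ennreal (1 / \<rho>) * S \<rho>)
        \<le> ennreal m * (indicator {\<epsilon><..\<rho>0} \<rho> * ennreal (1 / \<rho>)) + ennreal B * (indicator {\<rho>0<..1} \<rho> * ennreal (1 / \<rho>))"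
      proof (cases "\<epsilon> < \<rho> \<and> \<rho> \<le> 1")
        case True
        show ?thesis
        proof (cases "\<rho> \<le> \<rho>0")
          case le: True
          have "S \<rho> \<le> ennreal m" using b(2)[of \<rho>] True \<epsilon> le \<rho>0 by (simp add: less_imp_le)
          then show ?thesis using True le \<epsilon> by (simp add: mult.commute mult_left_mono mult_right_mono)
        next
          case False
          have "S \<rho> \<le> ennreal B" using B(2)[of \<rho>] True \<epsilon> by simp
          then show ?thesis using True False \<epsilon> by (simp add: mult.commute mult_left_mono mult_right_mono)
        qed
      qed (auto simp: indicator_def)
    qed
    also have "\<dots> = ennreal m * ennreal (ln (\<rho>0 / \<epsilon>)) + ennreal B * ennreal (ln (1 / \<rho>0))"
      using \<epsilon> \<rho>0 by (simp add: nn_integral_add nn_integral_cmult nn_integral_inverse)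
    also have "\<dots> = ennreal (m * ln (\<rho>0 / \<epsilon>) + B * ln (1 / \<rho>0))"
      using m B \<rho>0 \<epsilon> by (intro ennreal_linear_combination) auto
    also have "\<dots> \<le> ennreal (m * L + B * ln (1 / \<rho>0))"
    proof (intro ennreal_leI add_right_mono mult_left_mono m)
      show "ln (\<rho>0 / \<epsilon>) \<le> L" unfolding L_def using \<epsilon> \<rho>0 by (subst ln_le_cancel_iff) (auto intro: divide_right_mono)
    qed
    finally have JL: "J \<epsilon> \<le> ennreal (m * L + B * ln (1 / \<rho>0))" .
    have B0: "0 \<le> B * ln (1 / \<rho>0)" using B \<rho>0 by simp
    have "g \<epsilon> \<le> ennreal k * ennreal (m * L + B * ln (1 / \<rho>0)) + ennreal (e / 4 * L + C)"
      using C(2)[OF \<epsilon>(1,3)] JL unfolding L_def[symmetric] by (meson add_right_mono mult_left_mono order_trans zero_le)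
    also have "\<dots> = ennreal (k * (m * L + B * ln (1 / \<rho>0)) + (e / 4 * L + C))"
      using k m L B0 e C(1) by (simp add: ennreal_mult)
    also have "\<dots> \<le> ennreal ((k * l + e) * L)"
    proof (rule ennreal_leI)
      have "k * (m * L + B * ln (1 / \<rho>0)) + (e / 4 * L + C) = k * l * L + (k * d) * L + e / 4 * L + C'"
        by (simp add: m_def C'_def algebra_simps)
      also have "\<dots> \<le> k * l * L + e / 4 * L + e / 4 * L + e / 4 * L"
      proof -
        have "(k * d) * L \<le> e / 4 * L" using kd L(1) by (intro mult_right_mono) auto
        moreover have "C' \<le> e / 4 * L" using C'L by (simp only: L_def)
        ultimately show ?thesis by linarith
      qed
      also have "\<dots> \<le> (k * l + e) * L" using e L by (simp add: algebra_simps)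
      finally show "k * (m * L + B * ln (1 / \<rho>0)) + (e / 4 * L + C) \<le> (k * l + e) * L" .
    qed
    finally have "ennreal (1 / \<bar>ln \<epsilon>\<bar>) * g \<epsilon> \<le> ennreal (1 / L) * ennreal ((k * l + e) * L)"
      unfolding L(2) by (rule mult_left_mono) simp
    also have "\<dots> = ennreal (k * l + e)" using L k l e by (simp add: ennreal_mult[symmetric])
    also have "\<dots> = ennreal k * Limsup (at_right 0) S + ennreal e"
      using k l e by (simp add: ennreal_mult)
    finally show ?case .
  qed
  then show "Limsup (at_right 0) (\<lambda>\<epsilon>. ennreal (1 / \<bar>ln \<epsilon>\<bar>) * g \<epsilon>) \<le> ennreal k * Limsup (at_right 0) S + ennreal e"
    by (rule Limsup_bounded)
qed

text \<open>The same splitting of scales, but those above \<open>\<rho>0\<close> are simply dropped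
  from the average, as \<open>S\<close> is nonnegative.\<close>

lemma Liminf_logarithmic_average:
  fixes S g J :: "real \<Rightarrow> ennreal"
  assumes B: "0 \<le> B" "\<And>\<rho>. 0 < \<rho> \<Longrightarrow> \<rho> \<le> 1 \<Longrightarrow> S \<rho> \<le> ennreal B"
    and k: "0 \<le> k"
    and J: "\<And>\<epsilon>. 0 < \<epsilon> \<Longrightarrow> \<epsilon> < 1 \<Longrightarrow> J \<epsilon> = (\<integral>\<^sup>+\<rho>. indicator {\<epsilon><..1} \<rho> * (ennreal (1 / \<rho>) * S \<rho>) \<partial>lborel)"
    and low: "\<And>\<tau>. 0 < \<tau> \<Longrightarrow> \<exists>C\<ge>0. \<forall>\<epsilon>. 0 < \<epsilon> \<and> \<epsilon> < 1 \<longrightarrow> ennreal k * J \<epsilon> \<le> g \<epsilon> + ennreal (\<tau> * ln (1 / \<epsilon>) + C)"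
  shows "ennreal k * Liminf (at_right 0) S \<le> Liminf (at_right 0) (\<lambda>\<epsilon>. ennreal (1 / \<bar>ln \<epsilon>\<bar>) * g \<epsilon>)"
proof (rule ennreal_le_epsilon)
  fix e :: real assume e: "0 < e"
  have "\<forall>\<^sub>F \<rho> in at_right 0. S \<rho> \<le> ennreal B"
    by (rule eventually_at_rightI[of 0 1]) (use B in auto)
  then have "Limsup (at_right 0) S \<le> ennreal B" by (rule Limsup_bounded)
  moreover have "Liminf (at_right 0) S \<le> Limsup (at_right 0) S"
    by (rule Liminf_le_Limsup) simp
  ultimately have "Liminf (at_right 0) S \<le> ennreal B" by simp
  then obtain l where l: "Liminf (at_right 0) S = ennreal l" "0 \<le> l"
    by (cases "Liminf (at_right 0) S") (auto simp: top_unique)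
  define d where "d = e / (4 * (k + 1))"
  have d: "0 < d" using e k by (simp add: d_def)
  have kd: "k * d \<le> e / 4"
  proof -
    have "d * (k + 1) = e / 4" unfolding d_def by (rule divide_4_mult_cancel) (use k in simp)
    then show ?thesis using d by (simp add: algebra_simps)
  qed
  \<comment> \<open>Truncated at 0, so that it remains a lower bound for \<open>S\<close> near 0
    when \<open>l < d\<close>.\<close>
  define m where "m = max 0 (l - d)"
  have m: "0 \<le> m" "l \<le> m + d" by (auto simp: m_def)
  have "\<forall>\<^sub>F \<rho> in at_right 0. ennreal m \<le> S \<rho>"
  proof (cases "l - d \<le> 0")
    case False
    then have "ennreal m < Liminf (at_right 0) S" unfolding l using d by (simp add: m_def ennreal_lessI)
    then have "\<forall>\<^sub>F \<rho> in at_right 0. ennreal m < S \<rho>" by (rule less_LiminfD)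
    then show ?thesis by eventually_elim simp
  qed (simp add: m_def)
  then obtain b where b: "0 < b" "\<And>\<rho>. 0 < \<rho> \<Longrightarrow> \<rho> < b \<Longrightarrow> ennreal m \<le> S \<rho>"
    unfolding eventually_at_right_field by blast
  define \<rho>0 where "\<rho>0 = min (b / 2) 1"
  have \<rho>0: "0 < \<rho>0" "\<rho>0 < b" "\<rho>0 \<le> 1" using b by (auto simp: \<rho>0_def)
  obtain C where C: "0 \<le> C" "\<And>\<epsilon>. 0 < \<epsilon> \<Longrightarrow> \<epsilon> < 1 \<Longrightarrow> ennreal k * J \<epsilon> \<le> g \<epsilon> + ennreal (e / 4 * ln (1 / \<epsilon>) + C)"
    using low[of "e / 4"] e by auto
  define C' where "C' = k * m * ln (1 / \<rho>0) + C"
  \<comment> \<open>The error is subtracted on the left so that a constant is compared with the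
    lower limit; if the difference is negative, \<open>ennreal\<close> makes it 0.\<close>
  have "\<forall>\<^sub>F \<epsilon> in at_right 0. ennreal (k * m - e / 2) \<le> ennreal (1 / \<bar>ln \<epsilon>\<bar>) * g \<epsilon>"
    using eventually_ln_inverse_large[OF \<rho>0(1), of "e / 4" C', OF divide_pos_pos[OF e zero_less_numeral]]
  proof eventually_elim
    case (elim \<epsilon>)
    then have \<epsilon>: "0 < \<epsilon>" "\<epsilon> < \<rho>0" "\<epsilon> < 1" and Lpos: "0 < ln (1 / \<epsilon>)" and C'L: "C' \<le> e / 4 * ln (1 / \<epsilon>)" by auto
    define L where "L = ln (1 / \<epsilon>)"
    have L: "0 < L" "\<bar>ln \<epsilon>\<bar> = L" using Lpos \<epsilon> by (auto simp: L_def ln_div)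
    have "ennreal m * ennreal (ln (\<rho>0 / \<epsilon>)) = (\<integral>\<^sup>+\<rho>. ennreal m * (indicator {\<epsilon><..\<rho>0} \<rho> * ennreal (1 / \<rho>)) \<partial>lborel)"
      using \<epsilon> by (simp add: nn_integral_cmult nn_integral_inverse)
    also have "\<dots> \<le> J \<epsilon>"
      unfolding J[OF \<epsilon>(1,3)]
    proof (rule nn_integral_mono)
      fix \<rho> :: real
      show "ennreal m * (indicator {\<epsilon><..\<rho>0} \<rho> * ennreal (1 / \<rho>)) \<le> indicator {\<epsilon><..1} \<rho> * (ennreal (1 / \<rho>) * S \<rho>)"
      proof (cases "\<epsilon> < \<rho> \<and> \<rho> \<le> \<rho>0")
        case True
        then have "ennreal m \<le> S \<rho>" using b(2)[of \<rho>] \<epsilon> \<rho>0 by simp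
        then show ?thesis using True \<rho>0 by (simp add: mult.commute mult_left_mono mult_right_mono)
      qed (auto simp: indicator_def)
    qed
    finally have JL: "ennreal (m * ln (\<rho>0 / \<epsilon>)) \<le> J \<epsilon>" using m \<epsilon> by (simp add: ennreal_mult)
    have ln0: "0 \<le> ln (\<rho>0 / \<epsilon>)" "0 \<le> ln (1 / \<rho>0)" using \<epsilon> \<rho>0 by auto
    \<comment> \<open>The range above \<open>\<rho>0\<close> that was dropped is missing from the
      logarithm; it is added back and charged to \<open>C'\<close>.\<close>
    have Lsum: "L = ln (\<rho>0 / \<epsilon>) + ln (1 / \<rho>0)" using \<epsilon> \<rho>0 by (simp add: L_def ln_div)
    have "ennreal (k * m * L) = ennreal k * ennreal (m * ln (\<rho>0 / \<epsilon>)) + ennreal (k * m * ln (1 / \<rho>0))"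
      using k m ln0 by (simp add: Lsum ennreal_mult[symmetric] ennreal_plus[symmetric] algebra_simps del: ennreal_plus)
    also have "\<dots> \<le> (g \<epsilon> + ennreal (e / 4 * L + C)) + ennreal (k * m * ln (1 / \<rho>0))"
      using C(2)[OF \<epsilon>(1,3)] JL unfolding L_def[symmetric]
      by (intro add_right_mono) (meson mult_left_mono order_trans zero_le)
    also have "\<dots> = g \<epsilon> + ennreal (e / 4 * L + C')"
      using k m ln0 e L C(1) by (simp add: C'_def add.assoc add.commute add.left_commute)
    also have "\<dots> \<le> g \<epsilon> + ennreal (e / 2 * L)"
      using C'L by (intro add_left_mono ennreal_leI) (simp add: L_def)
    finally have "ennreal (1 / L) * ennreal (k * m * L) \<le> ennreal (1 / L) * (g \<epsilon> + ennreal (e / 2 * L))"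
      by (rule mult_left_mono) simp
    also have "\<dots> = ennreal (1 / L) * g \<epsilon> + ennreal (e / 2)"
      using L e by (simp add: distrib_left ennreal_mult[symmetric])
    also have "ennreal (1 / L) * ennreal (k * m * L) = ennreal (k * m)"
      using L k m by (simp add: ennreal_mult[symmetric])
    finally have "ennreal (k * m) \<le> ennreal (e / 2) + ennreal (1 / L) * g \<epsilon>" by (simp add: add.commute)
    then have "ennreal (k * m) - ennreal (e / 2) \<le> ennreal (1 / L) * g \<epsilon>"
      by (simp add: ennreal_minus_le_iff)
    then show ?case using e L by (simp add: ennreal_minus)
  qed
  then have "ennreal (k * m - e / 2) \<le> Liminf (at_right 0) (\<lambda>\<epsilon>. ennreal (1 / \<bar>ln \<epsilon>\<bar>) * g \<epsilon>)"
    by (rule Liminf_bounded)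
  moreover have "ennreal k * Liminf (at_right 0) S \<le> ennreal (k * m - e / 2) + ennreal e"
  proof -
    have "k * l \<le> k * m + k * d" using mult_left_mono[OF m(2) k] by (simp add: distrib_left)
    then have "k * l \<le> (k * m - e / 2) + e" using kd e by linarith
    then have "ennreal (k * l) \<le> ennreal (max 0 (k * m - e / 2) + e)" by (intro ennreal_leI) linarith
    then show ?thesis using k l e by (simp add: ennreal_mult max_def ennreal_neg split: if_splits)
  qed
  ultimately show "ennreal k * Liminf (at_right 0) S \<le> Liminf (at_right 0) (\<lambda>\<epsilon>. ennreal (1 / \<bar>ln \<epsilon>\<bar>) * g \<epsilon>) + ennreal e"
    by (meson add_right_mono order_trans)
qed

section \<open>Borel representatives and the theorem\<close>

lemma borel_representative:
  fixes f :: "'a::euclidean_space \<Rightarrow> 'b::euclidean_space"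
  assumes f: "f \<in> borel_measurable lebesgue"
  obtains f' where "f' \<in> borel_measurable borel" "AE x in lborel. f x = f' x"
proof -
  have "\<exists>g\<in>borel_measurable lborel. AE x in lborel. f x \<bullet> b = g x" for b
    using f by (intro completion_ex_borel_measurable_real) auto
  then obtain g where g: "\<And>b. g b \<in> borel_measurable lborel" "\<And>b. AE x in lborel. f x \<bullet> b = g b x" by metis
  show thesis
  proof (rule that)
    show "(\<lambda>x. \<Sum>b\<in>Basis. g b x *\<^sub>R b) \<in> borel_measurable borel"
      using g(1) by (intro borel_measurable_sum borel_measurable_scaleR) auto
    have "AE x in lborel. \<forall>b\<in>Basis. f x \<bullet> b = g b x"
      using g(2) by (intro AE_finite_allI) auto
    then show "AE x in lborel. f x = (\<Sum>b\<in>Basis. g b x *\<^sub>R b)"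
      by eventually_elim (metis (no_types, lifting) euclidean_representation sum.cong)
  qed
qed

lemma borel_set_representative:
  fixes E :: "'a::euclidean_space set"
  assumes E: "E \<in> sets lebesgue"
  obtains E' where "E' \<in> sets borel" "AE x in lborel. x \<in> E \<longleftrightarrow> x \<in> E'"
proof -
  have "main_part lborel E \<in> sets borel" using E main_part_sets[of E lborel] by simp
  moreover have "AE x in lborel. x \<in> E \<longleftrightarrow> x \<in> main_part lborel E"
    using AE_in_main_part[OF E] by (simp add: AE_completion_iff eq_commute)
  ultimately show thesis by (rule that)
qed

lemma integral_lebesgue_eq_borel:
  fixes f :: "'a::euclidean_space \<Rightarrow> 'b::euclidean_space"
  assumes f': "f' \<in> borel_measurable borel" and eq: "AE x in lborel. f x = f' x"
  shows "(LINT x|lebesgue. f x) = (LINT x|lborel. f' x)"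
    and "integrable lebesgue f \<longleftrightarrow> integrable lborel f'"
proof -
  have f'l: "f' \<in> borel_measurable lborel" using f' by simp
  then have f'L: "f' \<in> borel_measurable lebesgue" by (rule measurable_completion)
  have eq': "AE x in lebesgue. f' x = f x"
    using eq by (simp add: AE_completion_iff eq_commute)
  have fL: "f \<in> borel_measurable lebesgue"
    using f'L eq' by (rule borel_measurable_AE)
  have "(LINT x|lebesgue. f x) = (LINT x|lebesgue. f' x)"
    using fL f'L eq' by (intro integral_cong_AE) auto
  then show "(LINT x|lebesgue. f x) = (LINT x|lborel. f' x)"
    using integral_completion[OF f'l] by simp
  have "integrable lebesgue f \<longleftrightarrow> integrable lebesgue f'"
    using fL f'L eq' by (intro integrable_cong_AE) auto
  then show "integrable lebesgue f \<longleftrightarrow> integrable lborel f'"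
    using integrable_completion[OF f'l] by simp
qed

text \<open>Equality holds at every \<open>x\<close>: for fixed \<open>x\<close> the affine map
  \<open>z \<mapsto> x - \<epsilon> z\<close> pulls null sets back to null sets, so the integrands
  agree almost everywhere, and where they are not integrable both integrals are 0.\<close>

lemma mollify_eq_convolve:
  fixes u u' :: "'a::euclidean_space \<Rightarrow> 'b::euclidean_space"
  assumes [measurable]: "\<eta>' \<in> borel_measurable borel" "u' \<in> borel_measurable borel"
    and \<eta>: "AE x in lborel. \<eta> x = \<eta>' x" and u: "AE x in lborel. u x = u' x" and \<epsilon>: "\<epsilon> \<noteq> 0"
  shows "mollify \<eta> u \<epsilon> = convolve \<eta>' u' \<epsilon>"
proof
  fix x
  have "AE z in lborel. u (x + (- \<epsilon>) *\<^sub>R z) = u' (x + (- \<epsilon>) *\<^sub>R z)"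
    using \<epsilon> by (intro AE_lborel_affine[OF u]) simp
  with \<eta> have "AE z in lborel. \<eta> z *\<^sub>R u (x - \<epsilon> *\<^sub>R z) = \<eta>' z *\<^sub>R u' (x - \<epsilon> *\<^sub>R z)"
    by eventually_elim simp
  then show "mollify \<eta> u \<epsilon> x = convolve \<eta>' u' \<epsilon> x"
    unfolding mollify_def convolve_def by (intro integral_lebesgue_eq_borel(1)) measurable
qed

lemma besov_space_imp_besov_function:
  fixes u u' :: "'a::euclidean_space \<Rightarrow> 'b::euclidean_space"
  assumes q: "1 \<le> q" and r: "0 < r" "r < 1" and u: "u \<in> besov_inf_space r q"
    and u'[measurable]: "u' \<in> borel_measurable borel" and eq: "AE x in lborel. u x = u' x"
  obtains U M where "besov_function q r U M u'"
proof -
  have fin1: "(\<integral>\<^sup>+x. ennreal (norm (u x) powr q) \<partial>lborel) < \<infinity>"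
    using u by (auto simp: besov_inf_space_def Lq_space_def nn_integral_completion)
  define S where "S = (SUP h\<in>UNIV - {0}. \<integral>\<^sup>+x. ennreal (norm (u (x + h) - u x) powr q / norm h powr (r * q)) \<partial>lebesgue)"
  have S: "S < \<infinity>" using u by (simp add: besov_inf_space_def S_def)
  have 1: "(\<integral>\<^sup>+x. ennreal (norm (u' x) powr q) \<partial>lborel) = (\<integral>\<^sup>+x. ennreal (norm (u x) powr q) \<partial>lborel)"
    using eq by (intro nn_integral_cong_AE) (auto elim!: eventually_mono)
  have 2: "(\<integral>\<^sup>+x. ennreal (norm (u' (x + h) - u' x) powr q) \<partial>lborel) \<le> ennreal (enn2real S * norm h powr (r * q))" for h
  proof (cases "h = 0")
    case True then show ?thesis using q by simp
  next
    case False
    have "(\<integral>\<^sup>+x. ennreal (norm (u' (x + h) - u' x) powr q) \<partial>lborel)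
        = (\<integral>\<^sup>+x. ennreal (norm h powr (r * q)) * ennreal (norm (u' (x + h) - u' x) powr q / norm h powr (r * q)) \<partial>lborel)"
      using False by (simp add: ennreal_mult[symmetric])
    also have "\<dots> = ennreal (norm h powr (r * q)) * (\<integral>\<^sup>+x. ennreal (norm (u' (x + h) - u' x) powr q / norm h powr (r * q)) \<partial>lborel)"
      by (rule nn_integral_cmult) measurable
    also have "(\<integral>\<^sup>+x. ennreal (norm (u' (x + h) - u' x) powr q / norm h powr (r * q)) \<partial>lborel)
        = (\<integral>\<^sup>+x. ennreal (norm (u (x + h) - u x) powr q / norm h powr (r * q)) \<partial>lborel)"
    proof (rule nn_integral_cong_AE)
      show "AE x in lborel. ennreal (norm (u' (x + h) - u' x) powr q / norm h powr (r * q))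
          = ennreal (norm (u (x + h) - u x) powr q / norm h powr (r * q))"
        using eq AE_lborel_translate[OF eq, of h] by eventually_elim simp
    qed
    also have "\<dots> \<le> S"
      unfolding S_def nn_integral_completion using False by (intro SUP_upper) auto
    also have "ennreal (norm h powr (r * q)) * S = ennreal (enn2real S * norm h powr (r * q))"
      using S by (simp add: ennreal_mult mult.commute)
    finally show ?thesis by (simp add: mult_left_mono)
  qed
  show thesis
  proof (rule that)
    show "besov_function q r (enn2real (\<integral>\<^sup>+x. ennreal (norm (u x) powr q) \<partial>lborel)) (enn2real S) u'"
      by unfold_locales (use q r 1 2 fin1 in auto)
  qed
qed

text \<open>The constant \<open>K\<close> is the \<open>L1\<close> norm of the weak gradient. From
  here on this bound, together with integrability, is all that the proof uses of the Sobolev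
  property.\<close>

lemma W11_space_translation_bound:
  fixes \<eta> :: "'a::euclidean_space \<Rightarrow> real"
  assumes \<eta>: "\<eta> \<in> W11_space" and \<eta>'[measurable]: "\<eta>' \<in> borel_measurable borel" and eq: "AE x in lborel. \<eta> x = \<eta>' x"
  obtains K where "0 \<le> K" "\<And>k. (LINT z|lborel. \<bar>\<eta>' (z + k) - \<eta>' z\<bar>) \<le> K * norm k"
proof -
  obtain g where g: "integrable lebesgue g" "weak_gradient \<eta> g" and \<eta>i: "integrable lebesgue \<eta>"
    using \<eta> by (auto simp: W11_space_def)
  obtain g' where g'[measurable]: "g' \<in> borel_measurable borel" and geq: "AE x in lborel. g x = g' x"
    using borel_measurable_integrable[OF g(1)] by (rule borel_representative)
  have i: "integrable lborel \<eta>'" "integrable lborel g'"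
    using integral_lebesgue_eq_borel(2)[OF \<eta>' eq] integral_lebesgue_eq_borel(2)[OF g' geq] \<eta>i g(1) by auto
  have base: "(LINT y|lborel. \<eta>' y * bump_deriv s (y - x) b) = - (LINT y|lborel. (g' y \<bullet> b) * bump s (y - x))"
    if s: "0 < s" and b: "b \<in> Basis" for s x b
  proof -
    have fd: "frechet_derivative (\<lambda>y. bump s (y - x)) (at y) = bump_deriv s (y - x)" for y
      using frechet_derivative_at[OF bump_has_derivative] by metis
    have "(LINT y|lebesgue. \<eta> y * bump_deriv s (y - x) b) = - (LINT y|lebesgue. (g y \<bullet> b) * bump s (y - x))"
      using g(2) test_function_bump[OF s, of x] b unfolding weak_gradient_def fd[symmetric] by blast
    moreover have "(LINT y|lebesgue. \<eta> y * bump_deriv s (y - x) b) = (LINT y|lborel. \<eta>' y * bump_deriv s (y - x) b)"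
      using eq by (intro integral_lebesgue_eq_borel(1)) (auto elim!: eventually_mono)
    moreover have "(LINT y|lebesgue. (g y \<bullet> b) * bump s (y - x)) = (LINT y|lborel. (g' y \<bullet> b) * bump s (y - x))"
      using geq by (intro integral_lebesgue_eq_borel(1)) (auto elim!: eventually_mono)
    ultimately show ?thesis by simp
  qed
  \<comment> \<open>The weak gradient is tested in basis directions only; both sides are linear in
    the direction.\<close>
  have hyp: "(LINT y|lborel. \<eta>' y * bump_deriv s (y - x) h) = - (LINT y|lborel. (g' y \<bullet> h) * bump s (y - x))"
    if s: "0 < s" for s x h
  proof -
    have int1: "integrable lborel (\<lambda>y. \<eta>' y * bump_deriv s (y - x) b)" for b
    proof -
      obtain C where C: "0 \<le> C" "\<And>z. \<bar>bump_deriv s (z::'a) b\<bar> \<le> C" using bump_deriv_bounded[OF s] by blast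
      show ?thesis
      proof (rule Bochner_Integration.integrable_bound)
        show "integrable lborel (\<lambda>y. C * \<eta>' y)" using i by simp
        show "AE y in lborel. norm (\<eta>' y * bump_deriv s (y - x) b) \<le> norm (C * \<eta>' y)"
        proof (rule AE_I2)
          fix y
          show "norm (\<eta>' y * bump_deriv s (y - x) b) \<le> norm (C * \<eta>' y)"
            using mult_right_mono[OF C(2)[of "y - x"], of "\<bar>\<eta>' y\<bar>"] C(1) by (simp add: abs_mult mult.commute)
        qed
      qed measurable
    qed
    have int2: "integrable lborel (\<lambda>y. (g' y \<bullet> b) * bump s (y - x))" for b
    proof (rule Bochner_Integration.integrable_bound)
      show "integrable lborel (\<lambda>y. g' y \<bullet> b)" using i by simp
      show "AE y in lborel. norm ((g' y \<bullet> b) * bump s (y - x)) \<le> norm (g' y \<bullet> b)"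
        using bump_nonneg bump_le_1 by (auto simp: abs_mult intro!: AE_I2 mult_right_le_one_le)
    qed measurable
    have lin1: "bump_deriv s z h = (\<Sum>b\<in>Basis. (h \<bullet> b) * bump_deriv s z b)" for z :: 'a
    proof -
      have "bump_deriv s z h = (bump_poly [:0, 0, 1:] (s\<^sup>2 - (norm z)\<^sup>2) * (- 2)) * (\<Sum>b\<in>Basis. (z \<bullet> b) * (h \<bullet> b))"
        by (simp add: bump_deriv_def euclidean_inner[of z h])
      also have "\<dots> = (\<Sum>b\<in>Basis. (h \<bullet> b) * bump_deriv s z b)"
        unfolding sum_distrib_left by (intro sum.cong) (simp_all add: bump_deriv_def)
      finally show ?thesis .
    qed
    have lin2: "w \<bullet> h = (\<Sum>b\<in>Basis. (h \<bullet> b) * (w \<bullet> b))" for w :: 'a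
      by (simp add: euclidean_inner[of w h] mult_ac)
    have "(LINT y|lborel. \<eta>' y * bump_deriv s (y - x) h) = (LINT y|lborel. (\<Sum>b\<in>Basis. (h \<bullet> b) * (\<eta>' y * bump_deriv s (y - x) b)))"
      unfolding lin1 by (simp add: sum_distrib_left mult_ac)
    also have "\<dots> = (\<Sum>b\<in>Basis. (h \<bullet> b) * (LINT y|lborel. \<eta>' y * bump_deriv s (y - x) b))"
      using int1 by (subst Bochner_Integration.integral_sum) auto
    also have "\<dots> = - (\<Sum>b\<in>Basis. (h \<bullet> b) * (LINT y|lborel. (g' y \<bullet> b) * bump s (y - x)))"
      using base[OF s] by (simp add: sum_negf)
    also have "(\<Sum>b\<in>Basis. (h \<bullet> b) * (LINT y|lborel. (g' y \<bullet> b) * bump s (y - x)))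
        = (LINT y|lborel. (\<Sum>b\<in>Basis. (h \<bullet> b) * ((g' y \<bullet> b) * bump s (y - x))))"
      using int2 by (subst Bochner_Integration.integral_sum) auto
    also have "\<dots> = (LINT y|lborel. (g' y \<bullet> h) * bump s (y - x))"
      unfolding lin2 by (simp add: sum_distrib_right mult.assoc)
    finally show ?thesis .
  qed
  show thesis
  proof (rule that)
    show "0 \<le> (LINT x|lborel. norm (g' x))" by simp
    show "(LINT z|lborel. \<bar>\<eta>' (z + k) - \<eta>' z\<bar>) \<le> (LINT x|lborel. norm (g' x)) * norm k" for k
      using translation_L1_bound_borel[OF i hyp, of k] by (simp add: mult.commute)
  qed
qed

text \<open>Borel representatives are inserted in the inner integral first, which makes the
  integrand in \<open>n\<close> Borel; then the Hausdorff measure can be exchanged for the cone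
  measure.\<close>

lemma sphere_difference_eq:
  fixes u u' :: "real ^ 'n \<Rightarrow> 'b::euclidean_space"
  assumes [measurable]: "u' \<in> borel_measurable borel" "E' \<in> sets borel"
    and u: "AE x in lborel. u x = u' x" and E: "AE x in lborel. x \<in> E \<longleftrightarrow> x \<in> E'" and \<epsilon>: "0 < \<epsilon>"
  shows "sphere_difference r q E u \<epsilon>
    = (\<integral>\<^sup>+n. ennreal (1 / \<epsilon> powr (r * q)) * diff_energy q E' u' (\<epsilon> *\<^sub>R n) \<partial>cone_measure)"
proof -
  have "(\<integral>\<^sup>+x\<in>E. indicator E (x + h) * ennreal (norm (u (x + h) - u x) powr q / \<epsilon> powr (r * q)) \<partial>lebesgue)
      = ennreal (1 / \<epsilon> powr (r * q)) * diff_energy q E' u' h" for h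
  proof -
    have "(\<integral>\<^sup>+x\<in>E. indicator E (x + h) * ennreal (norm (u (x + h) - u x) powr q / \<epsilon> powr (r * q)) \<partial>lebesgue)
      = (\<integral>\<^sup>+x. ennreal (1 / \<epsilon> powr (r * q)) * (indicator E' x * indicator E' (x + h) * ennreal (norm (u' (x + h) - u' x) powr q)) \<partial>lborel)"
      unfolding nn_integral_completion
    proof (rule nn_integral_cong_AE)
      show "AE x in lborel. indicator E (x + h) * ennreal (norm (u (x + h) - u x) powr q / \<epsilon> powr (r * q)) * indicator E x
        = ennreal (1 / \<epsilon> powr (r * q)) * (indicator E' x * indicator E' (x + h) * ennreal (norm (u' (x + h) - u' x) powr q))"
        using u E AE_lborel_translate[OF u, of h] AE_lborel_translate[OF E, of h]
        by eventually_elim (auto simp: indicator_def ennreal_mult[symmetric])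
    qed
    also have "\<dots> = ennreal (1 / \<epsilon> powr (r * q)) * diff_energy q E' u' h"
      unfolding diff_energy_def by (rule nn_integral_cmult) measurable
    finally show ?thesis .
  qed
  moreover have "(\<lambda>n. ennreal (1 / \<epsilon> powr (r * q)) * diff_energy q E' u' (\<epsilon> *\<^sub>R n)) \<in> borel_measurable borel"
    by measurable
  note nn_integral_hausdorff_sphere[OF this]
  ultimately show ?thesis
    unfolding sphere_difference_def by simp
qed

lemma ennreal_powr_inverse_cancel:
  assumes "1 \<le> q" shows "ennreal_powr (ennreal_powr x (1 / q)) q = x"
  using assms by (cases x) (auto simp: ennreal_powr_def powr_powr)

text \<open>The substitution \<open>x = h + y\<close> and Fubini bring the increment to the outside.
  The root cancels against the power, also at infinity.\<close>

lemma gagliardo_seminorm_powr: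
  fixes v :: "'a::euclidean_space \<Rightarrow> 'b::euclidean_space"
  assumes q: "1 \<le> q" and [measurable]: "v \<in> borel_measurable borel" "E' \<in> sets borel"
    and E: "AE x in lborel. x \<in> E \<longleftrightarrow> x \<in> E'"
  shows "ennreal_powr (gagliardo_seminorm r q E v) q = gagliardo_on r q UNIV E' v"
proof -
  let ?k = "\<lambda>x y. ennreal (norm (v x - v y) powr q / norm (x - y) powr (real DIM('a) + r * q))"
  have "(\<integral>\<^sup>+y\<in>E. (\<integral>\<^sup>+x\<in>E. ?k x y \<partial>lebesgue) \<partial>lebesgue) = (\<integral>\<^sup>+y. (\<integral>\<^sup>+x. ?k x y * indicator E' x \<partial>lborel) * indicator E' y \<partial>lborel)"
    unfolding nn_integral_completion
  proof (rule nn_integral_cong_AE)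
    have "(\<integral>\<^sup>+x. ?k x y * indicator E x \<partial>lborel) = (\<integral>\<^sup>+x. ?k x y * indicator E' x \<partial>lborel)" for y
      using E by (intro nn_integral_cong_AE) (auto elim!: eventually_mono simp: indicator_def)
    then show "AE y in lborel. (\<integral>\<^sup>+x. ?k x y * indicator E x \<partial>lborel) * indicator E y = (\<integral>\<^sup>+x. ?k x y * indicator E' x \<partial>lborel) * indicator E' y"
      using E by (auto elim!: eventually_mono simp: indicator_def)
  qed
  also have "\<dots> = (\<integral>\<^sup>+y. (\<integral>\<^sup>+h. ?k (h + y) y * indicator E' (h + y) * indicator E' y \<partial>lborel) \<partial>lborel)"
  proof (rule nn_integral_cong)
    fix y :: 'a
    have "(\<integral>\<^sup>+x. ?k x y * indicator E' x \<partial>lborel) = (\<integral>\<^sup>+h. ?k (h + y) y * indicator E' (h + y) \<partial>lborel)"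
      by (rule nn_integral_lborel_translate(1)[symmetric, where f = "\<lambda>x. ?k x y * indicator E' x"]) measurable
    then show "(\<integral>\<^sup>+x. ?k x y * indicator E' x \<partial>lborel) * indicator E' y = (\<integral>\<^sup>+h. ?k (h + y) y * indicator E' (h + y) * indicator E' y \<partial>lborel)"
      by (simp add: nn_integral_multc)
  qed
  also have "\<dots> = (\<integral>\<^sup>+h. (\<integral>\<^sup>+y. ?k (h + y) y * indicator E' (h + y) * indicator E' y \<partial>lborel) \<partial>lborel)"
    by (rule lborel_pair.Fubini') measurable
  also have "\<dots> = gagliardo_on r q UNIV E' v"
    unfolding gagliardo_on_def
  proof (rule nn_integral_cong)
    fix h :: 'a
    have "(\<integral>\<^sup>+y. ?k (h + y) y * indicator E' (h + y) * indicator E' y \<partial>lborel)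
      = (\<integral>\<^sup>+y. ennreal (1 / norm h powr (real DIM('a) + r * q)) * (indicator E' y * indicator E' (y + h) * ennreal (norm (v (y + h) - v y) powr q)) \<partial>lborel)"
      by (intro nn_integral_cong) (auto simp: indicator_def ennreal_mult[symmetric] add.commute)
    also have "\<dots> = ennreal (1 / norm h powr (real DIM('a) + r * q)) * diff_energy q E' v h"
      unfolding diff_energy_def by (rule nn_integral_cmult) measurable
    finally show "(\<integral>\<^sup>+y. ?k (h + y) y * indicator E' (h + y) * indicator E' y \<partial>lborel)
      = indicator UNIV h * (ennreal (1 / norm h powr (real DIM('a) + r * q)) * diff_energy q E' v h)" by simp
  qed
  finally show ?thesis
    unfolding gagliardo_seminorm_def by (simp only: ennreal_powr_inverse_cancel[OF q])
qed

theorem theorem1p1: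
  fixes q r :: real
    and u :: "real ^ 'n \<Rightarrow> real ^ 'd"
    and E :: "(real ^ 'n) set"
    and \<eta> :: "real ^ 'n \<Rightarrow> real"
  assumes "1 \<le> q" and "0 < r" and "r < 1"
    and "u \<in> besov_inf_space r q"
    and "E \<in> sets lebesgue"
    and "\<eta> \<in> W11_space"
  shows "ennreal (\<bar>LINT z|lebesgue. \<eta> z\<bar> powr q)
           * Liminf (at_right 0) (\<lambda>\<epsilon>. sphere_difference r q E u \<epsilon>)
         \<le> Liminf (at_right 0) (\<lambda>\<epsilon>. ennreal (1 / \<bar>ln \<epsilon>\<bar>)
             * ennreal_powr (gagliardo_seminorm r q E (mollify \<eta> u \<epsilon>)) q)
       \<and> Liminf (at_right 0) (\<lambda>\<epsilon>. ennreal (1 / \<bar>ln \<epsilon>\<bar>)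
             * ennreal_powr (gagliardo_seminorm r q E (mollify \<eta> u \<epsilon>)) q)
         \<le> Limsup (at_right 0) (\<lambda>\<epsilon>. ennreal (1 / \<bar>ln \<epsilon>\<bar>)
             * ennreal_powr (gagliardo_seminorm r q E (mollify \<eta> u \<epsilon>)) q)
       \<and> Limsup (at_right 0) (\<lambda>\<epsilon>. ennreal (1 / \<bar>ln \<epsilon>\<bar>)
             * ennreal_powr (gagliardo_seminorm r q E (mollify \<eta> u \<epsilon>)) q)
         \<le> ennreal (\<bar>LINT z|lebesgue. \<eta> z\<bar> powr q)
           * Limsup (at_right 0) (\<lambda>\<epsilon>. sphere_difference r q E u \<epsilon>)"
proof -
  have "u \<in> borel_measurable lebesgue" using assms(4) by (simp add: besov_inf_space_def Lq_space_def)
  then obtain u' where u'[measurable]: "u' \<in> borel_measurable borel" and ueq: "AE x in lborel. u x = u' x"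
    by (rule borel_representative)
  obtain E' where E'[measurable]: "E' \<in> sets borel" and Eeq: "AE x in lborel. x \<in> E \<longleftrightarrow> x \<in> E'"
    using assms(5) by (rule borel_set_representative)
  have \<eta>i: "integrable lebesgue \<eta>" using assms(6) by (simp add: W11_space_def)
  then have "\<eta> \<in> borel_measurable lebesgue" by simp
  then obtain \<eta>' where \<eta>'[measurable]: "\<eta>' \<in> borel_measurable borel" and \<eta>eq: "AE x in lborel. \<eta> x = \<eta>' x"
    by (rule borel_representative)
  have int: "integrable lborel \<eta>'" and c: "(LINT z|lebesgue. \<eta> z) = (LINT z|lborel. \<eta>' z)"
    using integral_lebesgue_eq_borel[OF \<eta>' \<eta>eq] \<eta>i by auto
  obtain K where K: "0 \<le> K" "\<And>k. (LINT z|lborel. \<bar>\<eta>' (z + k) - \<eta>' z\<bar>) \<le> K * norm k"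
    using W11_space_translation_bound[OF assms(6) \<eta>' \<eta>eq] by blast
  obtain U M where "besov_function q r U M u'"
    using besov_space_imp_besov_function[OF assms(1-4) u' ueq] by blast
  then interpret besov_function q r U M u' .
  let ?S = "\<lambda>\<rho>. \<integral>\<^sup>+n. ennreal (1 / \<rho> powr (r * q)) * diff_energy q E' u' (\<rho> *\<^sub>R n) \<partial>cone_measure"
  let ?g = "\<lambda>\<epsilon>. gagliardo_on r q UNIV E' (convolve \<eta>' u' \<epsilon>)"
  let ?J = "\<lambda>\<epsilon>. gagliardo_on r q {h. norm h \<in> {\<epsilon><..1}} E' u'"
  define B where "B = M * measure (cone_measure :: (real ^ 'n) measure) UNIV"
  have pos: "\<forall>\<^sub>F \<epsilon> in at_right (0::real). 0 < \<epsilon>" by (rule eventually_at_right_less)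
  have SS: "\<forall>\<^sub>F \<epsilon> in at_right 0. sphere_difference r q E u \<epsilon> = ?S \<epsilon>"
    using pos by eventually_elim (rule sphere_difference_eq[OF u' E' ueq Eeq])
  have gg: "\<forall>\<^sub>F \<epsilon> in at_right 0. ennreal (1 / \<bar>ln \<epsilon>\<bar>) * ennreal_powr (gagliardo_seminorm r q E (mollify \<eta> u \<epsilon>)) q
      = ennreal (1 / \<bar>ln \<epsilon>\<bar>) * ?g \<epsilon>"
    using pos
  proof eventually_elim
    case (elim \<epsilon>)
    then have "mollify \<eta> u \<epsilon> = convolve \<eta>' u' \<epsilon>" by (intro mollify_eq_convolve \<eta>' u' \<eta>eq ueq) simp
    moreover have "ennreal_powr (gagliardo_seminorm r q E (convolve \<eta>' u' \<epsilon>)) q = ?g \<epsilon>"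
      by (rule gagliardo_seminorm_powr[OF assms(1) _ E' Eeq]) measurable
    ultimately show ?case by simp
  qed
  have B0: "0 \<le> B" using M by (simp add: B_def)
  \<comment> \<open>On the sphere the normalisation by \<open>\<rho> powr (r * q)\<close> cancels
    exactly against the Besov bound; this is the uniform bound on \<open>S\<close> that the
    averaging lemmas require.\<close>
  have SB: "?S \<rho> \<le> ennreal B" if \<rho>: "0 < \<rho>" for \<rho>
  proof -
    interpret cone: finite_measure "cone_measure :: (real ^ 'n) measure" by (rule finite_measure_cone_measure)
    have "?S \<rho> \<le> (\<integral>\<^sup>+n. ennreal M \<partial>(cone_measure :: (real ^ 'n) measure))"
    proof (rule nn_integral_mono_AE)
      show "AE n in cone_measure. ennreal (1 / \<rho> powr (r * q)) * diff_energy q E' u' (\<rho> *\<^sub>R n) \<le> ennreal M"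
        using AE_cone_measure_sphere
      proof eventually_elim
        case (elim n)
        then have n: "norm (\<rho> *\<^sub>R n) = \<rho>" using \<rho> by simp
        have "diff_energy q E' u' (\<rho> *\<^sub>R n) \<le> ennreal (M * \<rho> powr (r * q))"
          using order_trans[OF diff_energy_mono_set M(2)[of "\<rho> *\<^sub>R n"]] unfolding n .
        then have "ennreal (1 / \<rho> powr (r * q)) * diff_energy q E' u' (\<rho> *\<^sub>R n)
          \<le> ennreal (1 / \<rho> powr (r * q)) * ennreal (M * \<rho> powr (r * q))" by (rule mult_left_mono) simp
        also have "\<dots> = ennreal M" using \<rho> M by (simp add: ennreal_mult[symmetric])
        finally show ?case .
      qed
    qed
    also have "\<dots> = ennreal B" using M by (simp add: B_def cone.emeasure_eq_measure ennreal_mult)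
    finally show ?thesis .
  qed
  \<comment> \<open>Polar coordinates exhibit the energy of \<open>u'\<close> between the scales
    \<open>\<epsilon>\<close> and 1 as the logarithmic average of its sphere differences.\<close>
  have JS: "?J \<epsilon> = (\<integral>\<^sup>+\<rho>. indicator {\<epsilon><..1} \<rho> * (ennreal (1 / \<rho>) * ?S \<rho>) \<partial>lborel)" if "0 < \<epsilon>" for \<epsilon>
  proof -
    have "{\<epsilon><..1} \<inter> {0<..} = {\<epsilon><..1}" using that by auto
    then show ?thesis by (subst gagliardo_on_polar) auto
  qed
  note asymp = gagliardo_convolve_asymp[OF E' int K]
  have low: "ennreal (\<bar>LINT z|lborel. \<eta>' z\<bar> powr q) * Liminf (at_right 0) ?S
      \<le> Liminf (at_right 0) (\<lambda>\<epsilon>. ennreal (1 / \<bar>ln \<epsilon>\<bar>) * ?g \<epsilon>)"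
  proof (rule Liminf_logarithmic_average[where B = B and J = ?J])
    show "\<exists>C\<ge>0. \<forall>\<epsilon>. 0 < \<epsilon> \<and> \<epsilon> < 1 \<longrightarrow> ennreal (\<bar>LINT z|lborel. \<eta>' z\<bar> powr q) * ?J \<epsilon> \<le> ?g \<epsilon> + ennreal (\<tau> * ln (1 / \<epsilon>) + C)"
      if "0 < \<tau>" for \<tau>
      using asymp[OF that] by blast
  qed (use B0 SB JS in auto)
  have up: "Limsup (at_right 0) (\<lambda>\<epsilon>. ennreal (1 / \<bar>ln \<epsilon>\<bar>) * ?g \<epsilon>)
      \<le> ennreal (\<bar>LINT z|lborel. \<eta>' z\<bar> powr q) * Limsup (at_right 0) ?S"
  proof (rule Limsup_logarithmic_average[where B = B and J = ?J])
    show "\<exists>C\<ge>0. \<forall>\<epsilon>. 0 < \<epsilon> \<and> \<epsilon> < 1 \<longrightarrow> ?g \<epsilon> \<le> ennreal (\<bar>LINT z|lborel. \<eta>' z\<bar> powr q) * ?J \<epsilon> + ennreal (\<tau> * ln (1 / \<epsilon>) + C)"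
      if "0 < \<tau>" for \<tau>
      using asymp[OF that] by blast
  qed (use B0 SB JS in auto)
  show ?thesis
    unfolding c Liminf_eq[OF SS] Limsup_eq[OF SS] Liminf_eq[OF gg] Limsup_eq[OF gg]
    using low up Liminf_le_Limsup[of "at_right (0::real)"] by simp
qed

end
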